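(* Let $K$ be a field of characteristic zero, let $N=\mathrm{UT}(n,K)$, and let $D$ be a basic subset of $\Delta^+$. The field of invariants of the coadjoint action of $N$ on the basic cell $V_D^\circ$ (respectively, on the basic cone $V_D$), i.e. the field of $N$-invariant rational functions, is a purely transcendental extension of $K$ of degree $|C(D)|$. Moreover, one can choose a system $\{F_\xi : \xi\in C(D)\}$ of algebraically independent generators of this field of invariants over $K$ such that, for every $\xi\in D$, $F_\xi$ coincides with (the restriction of) the minor $P_\xi$.
   Context: Roots. Fix $n\ge 1$. A positive root is a pair $(i,j)$ with $n\ge i>j\ge 1$; $\Delta^+$ is the set of positive roots; $\mathrm{row}(i,j)=i$, $\mathrm{col}(i,j)=j$. For positive roots, $\gamma=\alpha+\beta$ means $\gamma=(i,k)$ and $\{\alpha,\beta\}=\{(i,j),(j,k)\}$ for some $i>j>k$. A subset $D\subset\Delta^+$ is basic if every row and every column contains at most one root of $D$. A positive root $\alpha$ is $D$-singular if there is a positive root $\beta$ with $\alpha+\beta\in D$; $S(D)$ is the set of $D$-singular roots, $R(D)=\Delta^+\setminus S(D)$, and $M(D)=R(D)\setminus D$. The permutation $w_D$. $w_D\in S_n$ is defined recursively: for $j=1,\dots,n$, $w_D(j)$ is the greatest $i\in\{1,\dots,n\}$ such that $(i,j)\notin M(D)$ and $i\notin\{w_D(1),\dots,w_D(j-1)\}$. Order and the set $C(D)$. Order $\Delta^+$ linearly by: $(k,m)\succ(i,j)$ if $m<j$, or $m=j$ and $k>i$. The diagram of $D$ is a filling of the places $(i,j)\in\Delta^+$ with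 symbols $\otimes,\bullet,+,-$ built as follows. Step 0: fill all places of $M(D)$ with $\bullet$. Step $i$ ($i\ge1$): let $\xi_i$ be the greatest (for $\succ$) place that is still empty; fill it with $\otimes$. For every decomposition $\xi_i=\alpha+\beta$ into positive roots with $\mathrm{col}(\alpha)=\mathrm{col}(\xi_i)$ and $\mathrm{row}(\beta)=\mathrm{row}(\xi_i)$: if both places $\alpha,\beta$ are empty, fill $\alpha$ with $+$ and $\beta$ with $-$; if one of them is already filled, do not fill the other. Continue until no place is empty. $C(D)=\{\xi_1\succ\xi_2\succ\dots\succ\xi_c\}$ is the set of places filled with $\otimes$. Varieties. $N=\mathrm{UT}(n,K)$ is the group of upper unitriangular $n\times n$ matrices, $\mathfrak n$ the Lie algebra of strictly upper triangular matrices, $\mathfrak n_-$ the space of strictly lower triangular matrices, identified with $\mathfrak n^*$ through the form $(A,B)=\mathrm{Tr}\,AB$. Under this identification the coadjoint action of $g\in N$ sends $X\in\mathfrak n_-$ to the strictly lower triangular part of $gXg^{-1}$, and the left-right action of $(g,h)\in N\times N$ sends $X$ to the strictly lower triangular part of $gXh^{-1}$. For a basic subset $D$ and a map $\varphi:D\to K^*$ put $X_{D,\varphi}=\sum_{\xi\in D}\varphi(\xi)E_\xi$, where $E_{(i,j)}$ is the matrix unit. The basic variety $V_{D,\varphi}$ is the $N\times N$-orbit of $X_{D,\varphi}$; the basic cell is $V_D^\circ=\bigsqcup_{\varphi}V_{D,\varphi}$, the union over all $\varphi:D\to K^*$; the basic cone $V_D$ is the Zariski closure of $V_D^\circ$ in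 $\mathfrak n_-$. All of them are invariant under the coadjoint action of $N$. Minors. For $\eta=(i,j)$ and $w=w_D$ put $J'=\{1\le b\le j-1: w(b)>i\}$, $J=J'\cup\{j\}$, $I'=w(J')$, $I=I'\cup\{i\}$. $P_\eta(X)$ is the minor of the matrix $X$ with row set $I$ and column set $J$. *)

theory Defs
  imports
    "HOL-Algebra.Generated_Fields"
    "HOL-Library.Poly_Mapping"
    "Jordan_Normal_Form.Determinant"
    "Jordan_Normal_Form.Gauss_Jordan_Elimination"
    "Jordan_Normal_Form.DL_Submatrix"
begin

section \<open>Roots\<close>

text \<open>The root \<open>(i, j)\<close> has row \<open>i\<close> and column \<open>j\<close>. Roots are numbered from 1, while matrix
  entries in \<^typ>\<open>'a mat\<close> are numbered from 0, so that \<open>(i, j)\<close> is the matrix place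
  \<open>(i - 1, j - 1)\<close>.\<close>

type_synonym root = "nat \<times> nat"

abbreviation root_row :: "root \<Rightarrow> nat" where "root_row \<equiv> fst"
abbreviation root_col :: "root \<Rightarrow> nat" where "root_col \<equiv> snd"

definition pos_roots :: "nat \<Rightarrow> root set" where
  "pos_roots n = {(i, j). n \<ge> i \<and> i > j \<and> j \<ge> 1}"

text \<open>\<open>root_sum \<gamma> \<alpha> \<beta>\<close> is the relation \<open>\<gamma> = \<alpha> + \<beta>\<close> between positive roots.\<close>

definition root_sum :: "root \<Rightarrow> root \<Rightarrow> root \<Rightarrow> bool" where
  "root_sum \<gamma> \<alpha> \<beta> \<longleftrightarrow> (\<exists>i j k. i > j \<and> j > k \<and> \<gamma> = (i, k) \<and> {\<alpha>, \<beta>} = {(i, j), (j, k)})"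

definition basic :: "nat \<Rightarrow> root set \<Rightarrow> bool" where
  "basic n D \<longleftrightarrow> D \<subseteq> pos_roots n \<and>
     (\<forall>\<alpha>\<in>D. \<forall>\<beta>\<in>D. root_row \<alpha> = root_row \<beta> \<longrightarrow> \<alpha> = \<beta>) \<and>
     (\<forall>\<alpha>\<in>D. \<forall>\<beta>\<in>D. root_col \<alpha> = root_col \<beta> \<longrightarrow> \<alpha> = \<beta>)"

definition singular_roots :: "nat \<Rightarrow> root set \<Rightarrow> root set" where
  "singular_roots n D = {\<alpha> \<in> pos_roots n. \<exists>\<beta>\<in>pos_roots n. \<exists>\<gamma>\<in>D. root_sum \<gamma> \<alpha> \<beta>}"

definition regular_roots :: "nat \<Rightarrow> root set \<Rightarrow> root set" where
  "regular_roots n D = pos_roots n - singular_roots n D"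

definition M_roots :: "nat \<Rightarrow> root set \<Rightarrow> root set" where
  "M_roots n D = regular_roots n D - D"


section \<open>The permutation \<open>w\<^sub>D\<close>\<close>

context
  notes image_cong [fundef_cong]
begin

text \<open>Only the values at \<open>j \<in> {1..n}\<close> are meaningful. For such \<open>j\<close> the set under \<^const>\<open>Max\<close> is
  nonempty: the elements of \<open>{1..j}\<close> all satisfy the first condition and at most \<open>j - 1\<close> of them
  are excluded by the second.\<close>

fun w_perm :: "nat \<Rightarrow> root set \<Rightarrow> nat \<Rightarrow> nat" where
  "w_perm n D j = Max {i \<in> {1..n}. (i, j) \<notin> M_roots n D \<and> i \<notin> w_perm n D ` {1..<j}}"

end

declare w_perm.simps [simp del]


section \<open>The diagram of \<open>D\<close> and the set \<open>C(D)\<close>\<close>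

definition root_succ :: "root \<Rightarrow> root \<Rightarrow> bool" where
  "root_succ \<alpha> \<beta> \<longleftrightarrow> root_col \<alpha> < root_col \<beta> \<or>
     (root_col \<alpha> = root_col \<beta> \<and> root_row \<alpha> > root_row \<beta>)"

definition greatest_root :: "root set \<Rightarrow> root" where
  "greatest_root E = (THE \<xi>. \<xi> \<in> E \<and> (\<forall>\<eta>\<in>E. \<eta> \<noteq> \<xi> \<longrightarrow> root_succ \<xi> \<eta>))"

datatype symbol = Otimes | Bullet | PlusSign | MinusSign

text \<open>A partially filled diagram; \<^term>\<open>None\<close> marks an empty place.\<close>

type_synonym diagram = "root \<Rightarrow> symbol option"

definition empty_places :: "nat \<Rightarrow> diagram \<Rightarrow> root set" where
  "empty_places n d = {\<eta> \<in> pos_roots n. d \<eta> = None}"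

definition initial_diagram :: "nat \<Rightarrow> root set \<Rightarrow> diagram" where
  "initial_diagram n D = (\<lambda>\<eta>. if \<eta> \<in> M_roots n D then Some Bullet else None)"

text \<open>The places occurring in the various decompositions of \<open>\<xi>\<close> are pairwise different, so all
  decompositions of \<open>\<xi>\<close> can be treated simultaneously.\<close>

definition diagram_step :: "nat \<Rightarrow> diagram \<Rightarrow> diagram" where
  "diagram_step n d =
    (if empty_places n d = {} then d
     else let \<xi> = greatest_root (empty_places n d) in
       (\<lambda>\<eta>. if \<eta> = \<xi> then Some Otimes
             else if \<exists>\<alpha>\<in>empty_places n d. \<exists>\<beta>\<in>empty_places n d. root_sum \<xi> \<alpha> \<beta> \<and>
                root_col \<alpha> = root_col \<xi> \<and> root_row \<beta> = root_row \<xi> \<and> \<eta> = \<alpha> then Some PlusSign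
             else if \<exists>\<alpha>\<in>empty_places n d. \<exists>\<beta>\<in>empty_places n d. root_sum \<xi> \<alpha> \<beta> \<and>
                root_col \<alpha> = root_col \<xi> \<and> root_row \<beta> = root_row \<xi> \<and> \<eta> = \<beta> then Some MinusSign
             else d \<eta>))"

text \<open>A filled place is never changed again and a complete diagram is a fixed point of
  \<^const>\<open>diagram_step\<close>, so the places that are \<open>\<otimes>\<close> after some number of steps are those that are
  \<open>\<otimes>\<close> in the final diagram.\<close>

definition C_set :: "nat \<Rightarrow> root set \<Rightarrow> root set" where
  "C_set n D = {\<xi> \<in> pos_roots n. \<exists>m. (diagram_step n ^^ m) (initial_diagram n D) \<xi> = Some Otimes}"


section \<open>Basic cells and basic cones\<close>

definition UT :: "nat \<Rightarrow> 'k::field mat set" where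
  "UT n = {g \<in> carrier_mat n n. upper_triangular g \<and> (\<forall>i<n. g $$ (i, i) = 1)}"

text \<open>The space \<open>\<nn>\<^sub>-\<close>.\<close>

definition strictly_lower :: "nat \<Rightarrow> 'k::field mat set" where
  "strictly_lower n = {X \<in> carrier_mat n n. \<forall>i<n. \<forall>j<n. i \<le> j \<longrightarrow> X $$ (i, j) = 0}"

definition lower_part :: "'k::field mat \<Rightarrow> 'k mat" where
  "lower_part A = mat (dim_row A) (dim_col A) (\<lambda>(i, j). if j < i then A $$ (i, j) else 0)"

definition left_right_act :: "'k::field mat \<Rightarrow> 'k mat \<Rightarrow> 'k mat \<Rightarrow> 'k mat" where
  "left_right_act g h X = lower_part (g * X * the (mat_inverse h))"

definition coadjoint_act :: "'k::field mat \<Rightarrow> 'k mat \<Rightarrow> 'k mat" where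
  "coadjoint_act g X = lower_part (g * X * the (mat_inverse g))"

text \<open>The matrix \<open>\<Sum>\<xi>\<in>D. \<phi>(\<xi>) E\<^sub>\<xi>\<close>, written entrywise.\<close>

definition X_mat :: "nat \<Rightarrow> root set \<Rightarrow> (root \<Rightarrow> 'k::field) \<Rightarrow> 'k mat" where
  "X_mat n D \<phi> = mat n n (\<lambda>(i, j). if (i + 1, j + 1) \<in> D then \<phi> (i + 1, j + 1) else 0)"

definition basic_variety :: "nat \<Rightarrow> root set \<Rightarrow> (root \<Rightarrow> 'k::field) \<Rightarrow> 'k mat set" where
  "basic_variety n D \<phi> = {left_right_act g h (X_mat n D \<phi>) | g h. g \<in> UT n \<and> h \<in> UT n}"

definition basic_cell :: "nat \<Rightarrow> root set \<Rightarrow> 'k::field mat set" where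
  "basic_cell n D = (\<Union>\<phi> \<in> {\<phi>. \<forall>\<xi>\<in>D. \<phi> \<xi> \<noteq> 0}. basic_variety n D \<phi>)"

text \<open>Polynomial functions in the coordinates of \<open>\<nn>\<^sub>-\<close>.\<close>

inductive_set poly_functions :: "nat \<Rightarrow> ('k::field mat \<Rightarrow> 'k) set" for n :: nat where
  const: "(\<lambda>X. c) \<in> poly_functions n"
| coord: "(i, j) \<in> pos_roots n \<Longrightarrow> (\<lambda>X. X $$ (i - 1, j - 1)) \<in> poly_functions n"
| add: "f \<in> poly_functions n \<Longrightarrow> g \<in> poly_functions n \<Longrightarrow> (\<lambda>X. f X + g X) \<in> poly_functions n"
| mult: "f \<in> poly_functions n \<Longrightarrow> g \<in> poly_functions n \<Longrightarrow> (\<lambda>X. f X * g X) \<in> poly_functions n"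

definition zariski_closure :: "nat \<Rightarrow> 'k::field mat set \<Rightarrow> 'k mat set" where
  "zariski_closure n S = {X \<in> strictly_lower n.
     \<forall>f\<in>poly_functions n. (\<forall>Y\<in>S. f Y = 0) \<longrightarrow> f X = 0}"

definition basic_cone :: "nat \<Rightarrow> root set \<Rightarrow> 'k::field mat set" where
  "basic_cone n D = zariski_closure n (basic_cell n D)"


section \<open>Field of fractions of an integral domain\<close>

definition fraction_rel :: "('a, 'm) ring_scheme \<Rightarrow> (('a \<times> 'a) \<times> ('a \<times> 'a)) set" where
  "fraction_rel R = {((a, b), (c, d)). a \<in> carrier R \<and> b \<in> carrier R - {\<zero>\<^bsub>R\<^esub>} \<and>
     c \<in> carrier R \<and> d \<in> carrier R - {\<zero>\<^bsub>R\<^esub>} \<and> a \<otimes>\<^bsub>R\<^esub> d = c \<otimes>\<^bsub>R\<^esub> b}"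

definition fraction :: "('a, 'm) ring_scheme \<Rightarrow> 'a \<Rightarrow> 'a \<Rightarrow> ('a \<times> 'a) set" where
  "fraction R a b = fraction_rel R `` {(a, b)}"

text \<open>The operations on classes are written as unions over representatives; all members of such
  a union coincide when \<open>R\<close> is an integral domain.\<close>

definition fraction_field :: "('a, 'm) ring_scheme \<Rightarrow> ('a \<times> 'a) set ring" where
  "fraction_field R =
    \<lparr> carrier = (carrier R \<times> (carrier R - {\<zero>\<^bsub>R\<^esub>})) // fraction_rel R,
      monoid.mult = (\<lambda>A B. \<Union>(a, b)\<in>A. \<Union>(c, d)\<in>B. fraction R (a \<otimes>\<^bsub>R\<^esub> c) (b \<otimes>\<^bsub>R\<^esub> d)),
      monoid.one = fraction R \<one>\<^bsub>R\<^esub> \<one>\<^bsub>R\<^esub>,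
      ring.zero = fraction R \<zero>\<^bsub>R\<^esub> \<one>\<^bsub>R\<^esub>,
      ring.add = (\<lambda>A B. \<Union>(a, b)\<in>A. \<Union>(c, d)\<in>B.
        fraction R ((a \<otimes>\<^bsub>R\<^esub> d) \<oplus>\<^bsub>R\<^esub> (c \<otimes>\<^bsub>R\<^esub> b)) (b \<otimes>\<^bsub>R\<^esub> d)) \<rparr>"


section \<open>Rational functions and invariants\<close>

text \<open>The ring of restrictions to \<open>V\<close> of polynomial functions. For an irreducible locally closed
  \<open>V\<close> its field of fractions is the field of rational functions on \<open>V\<close>.\<close>

definition coordinate_ring :: "nat \<Rightarrow> 'k::field mat set \<Rightarrow> ('k mat \<Rightarrow> 'k) ring" where
  "coordinate_ring n V =
    \<lparr> carrier = (\<lambda>f. restrict f V) ` poly_functions n,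
      monoid.mult = (\<lambda>f g. \<lambda>X\<in>V. f X * g X),
      monoid.one = (\<lambda>X\<in>V. 1),
      ring.zero = (\<lambda>X\<in>V. 0),
      ring.add = (\<lambda>f g. \<lambda>X\<in>V. f X + g X) \<rparr>"

type_synonym 'k ratfun = "(('k mat \<Rightarrow> 'k) \<times> ('k mat \<Rightarrow> 'k)) set"

definition rational_functions :: "nat \<Rightarrow> 'k::field mat set \<Rightarrow> 'k ratfun ring" where
  "rational_functions n V = fraction_field (coordinate_ring n V)"

text \<open>The restriction to \<open>V\<close> of a polynomial function \<open>f\<close>, as a rational function on \<open>V\<close>.\<close>

definition ratfun_of :: "nat \<Rightarrow> 'k::field mat set \<Rightarrow> ('k mat \<Rightarrow> 'k) \<Rightarrow> 'k ratfun" where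
  "ratfun_of n V f = fraction (coordinate_ring n V) (restrict f V) (\<lambda>X\<in>V. 1)"

definition ratfun_const :: "nat \<Rightarrow> 'k::field mat set \<Rightarrow> 'k \<Rightarrow> 'k ratfun" where
  "ratfun_const n V c = ratfun_of n V (\<lambda>X. c)"

definition pullback :: "'k::field mat set \<Rightarrow> 'k mat \<Rightarrow> ('k mat \<Rightarrow> 'k) \<Rightarrow> 'k mat \<Rightarrow> 'k" where
  "pullback V g f = (\<lambda>X\<in>V. f (coadjoint_act g X))"

text \<open>An element \<open>g\<close> of \<open>N\<close> acts on rational functions by substitution in numerator and
  denominator, that is, by taking the image of the class of fractions.\<close>

definition invariant_field :: "nat \<Rightarrow> 'k::field mat set \<Rightarrow> 'k ratfun set" where
  "invariant_field n V = {A \<in> carrier (rational_functions n V).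
     \<forall>g\<in>UT n. map_prod (pullback V g) (pullback V g) ` A = A}"


section \<open>Purely transcendental extensions\<close>

text \<open>Here \<open>\<iota>\<close> is the embedding of the base field \<open>'k\<close> into \<open>L\<close>, and a polynomial with
  coefficients in \<open>'k\<close> and variables indexed by \<open>'i\<close> is a finitely supported map from
  monomials to coefficients.\<close>

definition mpoly_eval ::
  "('a, 'm) ring_scheme \<Rightarrow> ('k::field \<Rightarrow> 'a) \<Rightarrow> ('i \<Rightarrow> 'a) \<Rightarrow> (('i \<Rightarrow>\<^sub>0 nat) \<Rightarrow>\<^sub>0 'k) \<Rightarrow> 'a" where
  "mpoly_eval L \<iota> F p = (\<Oplus>\<^bsub>L\<^esub>m\<in>Poly_Mapping.keys p. \<iota> (Poly_Mapping.lookup p m) \<otimes>\<^bsub>L\<^esub>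
     (\<Otimes>\<^bsub>L\<^esub>v\<in>Poly_Mapping.keys m. F v [^]\<^bsub>L\<^esub> Poly_Mapping.lookup m v))"

definition alg_independent ::
  "('a, 'm) ring_scheme \<Rightarrow> ('k::field \<Rightarrow> 'a) \<Rightarrow> 'i set \<Rightarrow> ('i \<Rightarrow> 'a) \<Rightarrow> bool" where
  "alg_independent L \<iota> S F \<longleftrightarrow>
     (\<forall>p :: ('i \<Rightarrow>\<^sub>0 nat) \<Rightarrow>\<^sub>0 'k. (\<forall>m\<in>Poly_Mapping.keys p. Poly_Mapping.keys m \<subseteq> S) \<longrightarrow>
        mpoly_eval L \<iota> F p = \<zero>\<^bsub>L\<^esub> \<longrightarrow> p = 0)"

text \<open>The family \<open>F\<close>, indexed by \<open>S\<close>, consists of elements of \<open>E\<close> that are algebraically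
  independent over \<open>'k\<close> and generate the field \<open>E\<close> over \<open>'k\<close>.\<close>

definition independent_generators ::
  "('a, 'm) ring_scheme \<Rightarrow> ('k::field \<Rightarrow> 'a) \<Rightarrow> 'a set \<Rightarrow> 'i set \<Rightarrow> ('i \<Rightarrow> 'a) \<Rightarrow> bool" where
  "independent_generators L \<iota> E S F \<longleftrightarrow>
     F ` S \<subseteq> E \<and> alg_independent L \<iota> S F \<and> generate_field L (range \<iota> \<union> F ` S) = E"

definition purely_transcendental ::
  "('a, 'm) ring_scheme \<Rightarrow> ('k::field \<Rightarrow> 'a) \<Rightarrow> 'a set \<Rightarrow> nat \<Rightarrow> bool" where
  "purely_transcendental L \<iota> E d \<longleftrightarrow>
     subfield E L \<and> range \<iota> \<subseteq> E \<and>
     (\<exists>B. finite B \<and> card B = d \<and> independent_generators L \<iota> E B (\<lambda>b. b))"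


section \<open>The minors \<open>P\<^sub>\<eta>\<close>\<close>

definition minor :: "nat set \<Rightarrow> nat set \<Rightarrow> 'k::field mat \<Rightarrow> 'k" where
  "minor I J X = det (submatrix X ((\<lambda>i. i - 1) ` I) ((\<lambda>j. j - 1) ` J))"

definition P_minor :: "nat \<Rightarrow> root set \<Rightarrow> root \<Rightarrow> 'k::field mat \<Rightarrow> 'k" where
  "P_minor n D \<eta> X =
    (let i = root_row \<eta>; j = root_col \<eta>; w = w_perm n D;
         J' = {b. 1 \<le> b \<and> b \<le> j - 1 \<and> w b > i}
     in minor (w ` J' \<union> {i}) (J' \<union> {j}) X)"

end

theory Submission
  imports Defs
begin

text \<open>
The idea is to read the invariants off an elimination process that mimics the construction of the
diagram. A matrix is treated column by column. Before column \<open>j\<close> every index \<open>m \<ge> j\<close> carries a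
label \<open>L m\<close>; initially \<open>L m = m\<close>. A place \<open>(b, c)\<close> is alive if \<open>L c < L b\<close>. Among the alive
places of column \<open>j\<close> outside \<open>M(D)\<close> the pivots are the records, read from the bottom upwards: those
whose label is greater than that of every such place below. Conjugation by a matrix whose entries
are quotients of column \<open>j\<close> by pivots lets one forget column \<open>j\<close>, at the price of lowering the
labels of the records. These labels encode exactly which places are filled with signs, and so the
records are the places with the symbol \<open>\<otimes>\<close> (\<open>C_set_eq\<close>).

Conjugate matrices stay conjugate throughout the process, by unitriangular matrices that respect
the labels (\<open>elim_col_equivariant\<close>). Hence the pivots are invariants of \<open>N\<close> on the cell, with
generically nonzero values (\<open>pivot_invariant\<close>). Elimination changes an entry only by an
amount depending on earlier places (\<open>elim_triangular\<close>). A matrix supported on \<open>C(D)\<close> is therefore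
determined by its pivots, which may be prescribed arbitrarily on the torus, and its entries are
rational functions of them (\<open>solve_rational\<close>).

There are no further invariants because a generic orbit meets the set of matrices supported on
\<open>C(D)\<close>. The tangent directions \<open>[u, X]\<close> of an orbit, projected to the places with a sign, fill up
everything when \<open>X\<close> is generic: each \<open>\<otimes>\<close> pairs the \<open>+\<close> and the \<open>-\<close> that it creates, and a matrix
with suitably scaled entries on \<open>C(D)\<close> makes the sum of these pairings nondegenerate
(\<open>sign_places_injective\<close>). Since the invariants forbid a direction to start at a pivot or at a
bullet, for every place with a sign there is one that starts precisely there, and the places with
signs can be cleared one after another (\<open>conjugate_to_pivots\<close>). An invariant fraction evaluated
at this normal form is a rational function of the pivots (\<open>invariants_in_subfield\<close>).

For \<open>\<xi> \<in> D\<close> the minor \<open>P\<^sub>\<xi>\<close> equals, up to a nonzero constant, the product of the pivots over all roots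
of \<open>D\<close> weakly to the south-west of \<open>\<xi>\<close> (\<open>P_minor_value\<close>). This is a triangular monomial
substitution, so on \<open>D\<close> the minors may replace the pivots. Algebraic independence holds because the
joint values of the generators exhaust a torus (\<open>mpoly_zero_on_torus\<close>).

The cell is the image of an open part of an affine space, hence irreducible, and a polynomial
function vanishing on the cell vanishes on the cone. All rational functions can thus be studied
through their values on large subsets of the cell, which treats the cell and the cone alike.
\<close>

section \<open>Bullets, labels and records\<close>

locale basic_roots =
  fixes n :: nat and D :: "root set"
  assumes basic: "basic n D"
begin

abbreviation "MD \<equiv> M_roots n D"

lemma D_bounds: "(b, c) \<in> D \<Longrightarrow> 1 \<le> c \<and> c < b \<and> b \<le> n"
  using basic unfolding basic_def pos_roots_def by auto

lemma D_row_unique: "(b, c) \<in> D \<Longrightarrow> (b, c') \<in> D \<Longrightarrow> c = c'"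
  using basic unfolding basic_def by force

lemma D_col_unique: "(b, c) \<in> D \<Longrightarrow> (b', c) \<in> D \<Longrightarrow> b = b'"
  using basic unfolding basic_def by force

text \<open>A root \<open>(b, c)\<close> is singular exactly if \<open>D\<close> contains a root strictly to its left in row \<open>b\<close> or
strictly below it in column \<open>c\<close>.\<close>

lemma M_roots_iff:
  assumes "1 \<le> c" "c < b" "b \<le> n"
  shows "(b, c) \<in> MD \<longleftrightarrow> (\<forall>c'\<le>c. (b, c') \<notin> D) \<and> (\<forall>b'\<ge>b. (b', c) \<notin> D)"
proof -
  have pos: "(b, c) \<in> pos_roots n" using assms by (auto simp: pos_roots_def)
  have sing: "(b, c) \<in> singular_roots n D \<longleftrightarrow> (\<exists>c'<c. (b, c') \<in> D) \<or> (\<exists>b'>b. (b', c) \<in> D)"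
    (is "?l \<longleftrightarrow> ?r")
  proof
    assume ?l
    then obtain \<beta> \<gamma> where g: "\<gamma> \<in> D" "root_sum \<gamma> (b, c) \<beta>"
      unfolding singular_roots_def by auto
    then obtain i j k where ijk: "i > j" "j > k" "\<gamma> = (i, k)" "{(b, c), \<beta>} = {(i, j), (j, k)}"
      unfolding root_sum_def by auto
    then have "(b, c) = (i, j) \<or> (b, c) = (j, k)" by (metis insertE insertI1 singletonD)
    then show ?r using g ijk by auto
  next
    assume ?r
    then show ?l
    proof
      assume "\<exists>c'<c. (b, c') \<in> D"
      then obtain c' where c': "c' < c" "(b, c') \<in> D" by auto
      have "root_sum (b, c') (b, c) (c, c')" unfolding root_sum_def using c' assms by blast
      moreover have "(c, c') \<in> pos_roots n" using c' D_bounds[OF c'(2)] assms by (auto simp: pos_roots_def)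
      ultimately show ?l unfolding singular_roots_def using pos c' by blast
    next
      assume "\<exists>b'>b. (b', c) \<in> D"
      then obtain b' where b': "b' > b" "(b', c) \<in> D" by auto
      have "{(b, c), (b', b)} = {(b', b), (b, c)}" by (rule insert_commute)
      then have "root_sum (b', c) (b, c) (b', b)" unfolding root_sum_def using b' assms by blast
      moreover have "(b', b) \<in> pos_roots n" using b' D_bounds[OF b'(2)] assms by (auto simp: pos_roots_def)
      ultimately show ?l unfolding singular_roots_def using pos b' by blast
    qed
  qed
  have "(b, c) \<in> MD \<longleftrightarrow> (b, c) \<notin> singular_roots n D \<and> (b, c) \<notin> D"
    using pos by (simp add: M_roots_def regular_roots_def)
  also have "\<dots> \<longleftrightarrow> (\<forall>c'\<le>c. (b, c') \<notin> D) \<and> (\<forall>b'\<ge>b. (b', c) \<notin> D)"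
    unfolding sing by (auto simp: le_less)
  finally show ?thesis .
qed

lemma M_roots_pos: "(b, c) \<in> MD \<Longrightarrow> 1 \<le> c \<and> c < b \<and> b \<le> n"
  unfolding M_roots_def regular_roots_def pos_roots_def by auto

text \<open>In what follows \<open>L\<close> is the labelling of the indices \<open>m \<ge> j\<close> that is in force before column \<open>j\<close> is
treated. Candidates are the rows whose place in column \<open>j\<close> is alive and carries no bullet.\<close>

definition cand :: "nat \<Rightarrow> (nat \<Rightarrow> nat) \<Rightarrow> nat set" where
  "cand j L = {m. 1 \<le> j \<and> j < m \<and> m \<le> n \<and> L j < L m \<and> (m, j) \<notin> MD}"

text \<open>Records of the candidates when the column is read from the bottom upwards. They turn out to be
the rows of the symbols \<open>\<otimes>\<close> of column \<open>j\<close>.\<close>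

definition recs :: "nat \<Rightarrow> (nat \<Rightarrow> nat) \<Rightarrow> nat set" where
  "recs j L = {k \<in> cand j L. \<forall>m\<in>cand j L. k < m \<longrightarrow> L m < L k}"

text \<open>The label of the preceding record, or that of \<open>j\<close> for the first record. Column \<open>j\<close> disappears
when it has been treated, and every record moves down to the label freed before it.\<close>

definition prv :: "nat \<Rightarrow> (nat \<Rightarrow> nat) \<Rightarrow> nat \<Rightarrow> nat" where
  "prv j L k = Max (insert (L j) (L ` {r \<in> recs j L. L r < L k}))"

definition next_ord :: "nat \<Rightarrow> (nat \<Rightarrow> nat) \<Rightarrow> nat \<Rightarrow> nat" where
  "next_ord j L m = (if m \<in> recs j L then prv j L m else L m)"

primrec col_ord :: "nat \<Rightarrow> nat \<Rightarrow> nat" where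
  "col_ord 0 = (\<lambda>m. m)"
| "col_ord (Suc j) = next_ord j (col_ord j)"

text \<open>The labels know which rows already meet \<open>D\<close>: such a row has a label less than \<open>j\<close>, and the others
are still labelled by themselves.\<close>

definition ord_inv :: "nat \<Rightarrow> (nat \<Rightarrow> nat) \<Rightarrow> bool" where
  "ord_inv j L \<longleftrightarrow> inj_on L {j..n} \<and>
     (\<forall>b. j \<le> b \<and> b \<le> n \<longrightarrow> (if \<exists>c<j. (b, c) \<in> D then L b < j else L b = b))"

end

locale column = basic_roots +
  fixes j :: nat and L :: "nat \<Rightarrow> nat"
  assumes j: "1 \<le> j" "j \<le> n" and inv: "ord_inv j L"
begin

abbreviation "Cd \<equiv> cand j L"
abbreviation "Rc \<equiv> recs j L"
abbreviation "pv \<equiv> prv j L"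
abbreviation "L' \<equiv> next_ord j L"

lemma L_inj: "inj_on L {j..n}" using inv by (simp add: ord_inv_def)

lemma L_eqD: "j \<le> a \<Longrightarrow> a \<le> n \<Longrightarrow> j \<le> b \<Longrightarrow> b \<le> n \<Longrightarrow> L a = L b \<Longrightarrow> a = b"
  using L_inj by (auto dest: inj_onD)

lemma L_used: "j \<le> b \<Longrightarrow> b \<le> n \<Longrightarrow> c < j \<Longrightarrow> (b, c) \<in> D \<Longrightarrow> L b < j"
  using inv unfolding ord_inv_def by meson

lemma L_unused: "j \<le> b \<Longrightarrow> b \<le> n \<Longrightarrow> (\<And>c. c < j \<Longrightarrow> (b, c) \<notin> D) \<Longrightarrow> L b = b"
  using inv unfolding ord_inv_def by meson

lemma L_cases: "j \<le> b \<Longrightarrow> b \<le> n \<Longrightarrow>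
    (\<exists>c<j. (b, c) \<in> D) \<and> L b < j \<or> (\<forall>c<j. (b, c) \<notin> D) \<and> L b = b"
  using L_used L_unused by blast

lemma Lj_le: "L j \<le> j" using L_cases[of j] j by auto

lemma candD: "m \<in> Cd \<Longrightarrow> j < m \<and> m \<le> n \<and> L j < L m \<and> (m, j) \<notin> MD"
  by (auto simp: cand_def)

lemma candI: "j < m \<Longrightarrow> m \<le> n \<Longrightarrow> L j < L m \<Longrightarrow> (m, j) \<notin> MD \<Longrightarrow> m \<in> Cd"
  using j by (auto simp: cand_def)

lemma finite_cand: "finite Cd" by (rule finite_subset[of _ "{..n}"]) (auto simp: cand_def)

lemma rec_cand: "r \<in> Rc \<Longrightarrow> r \<in> Cd" by (auto simp: recs_def)

lemma finite_recs: "finite Rc" by (rule finite_subset[OF _ finite_cand]) (auto dest: rec_cand)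

lemma recs_desc: "k \<in> Rc \<Longrightarrow> m \<in> Cd \<Longrightarrow> k < m \<Longrightarrow> L m < L k" by (auto simp: recs_def)

lemma M_col_iff: "j < b \<Longrightarrow> b \<le> n \<Longrightarrow>
    (b, j) \<in> MD \<longleftrightarrow> (\<forall>c\<le>j. (b, c) \<notin> D) \<and> (\<forall>b'\<ge>b. (b', j) \<notin> D)"
  using M_roots_iff j by auto

text \<open>A bullet lies in a row that \<open>D\<close> does not meet up to column \<open>j\<close>, so its label is its own index,
which exceeds the labels of all rows above it.\<close>

lemma bullet_above:
  assumes "j < b" "b \<le> n" "L j < L b" "b \<notin> Cd" "m \<in> Cd" "m < b"
  shows "L m < L b"
proof -
  have "(b, j) \<in> MD" using assms candI by blast
  then have "L b = b" using assms M_col_iff by (intro L_unused) auto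
  moreover have "L m < j \<or> L m = m" using candD[OF assms(5)] L_cases[of m] by auto
  ultimately show ?thesis using assms by auto
qed

text \<open>Among the candidates that dominate \<open>m\<close> in both position and label, one with maximal sum of position
and label is a record.\<close>

lemma rec_above: assumes "m \<in> Cd" obtains r where "r \<in> Rc" "m \<le> r" "L m \<le> L r"
proof -
  \<comment> \<open>maximizing the sum suffices, since a candidate further down with at least the same label has a greater one\<close>
  define S where "S = {r \<in> Cd. m \<le> r \<and> L m \<le> L r}"
  have fS: "finite S" "m \<in> S" using assms finite_cand by (auto simp: S_def)
  let ?f = "\<lambda>s. s + L s"
  have "Max (?f ` S) \<in> ?f ` S" using fS by (intro Max_in) auto
  then obtain r where r: "r \<in> S" "Max (?f ` S) = r + L r" by auto
  have r2: "s + L s \<le> r + L r" if "s \<in> S" for s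
  proof -
    have "?f s \<le> Max (?f ` S)" using that fS by (intro Max_ge) auto
    then show ?thesis using r(2) by simp
  qed
  have "r \<in> Rc" unfolding recs_def
  proof (safe)
    show "r \<in> Cd" using r by (auto simp: S_def)
    fix m' assume m': "m' \<in> Cd" "r < m'"
    show "L m' < L r"
    proof (rule ccontr)
      assume "\<not> L m' < L r"
      then have "m' \<in> S" using m' r by (auto simp: S_def)
      then show False using r2[of m'] m' \<open>\<not> L m' < L r\<close> by auto
    qed
  qed
  then show ?thesis using that r by (auto simp: S_def)
qed

lemma finite_prv_set: "finite (insert (L j) (L ` {r \<in> Rc. L r < L k}))" using finite_recs by auto

lemma prv_ge: "L j \<le> pv k" unfolding prv_def by (rule Max_ge[OF finite_prv_set]) auto

lemma prv_ge_rec: "r \<in> Rc \<Longrightarrow> L r < L k \<Longrightarrow> L r \<le> pv k"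
  unfolding prv_def by (rule Max_ge[OF finite_prv_set]) auto

lemma prv_cases: obtains "pv k = L j" | r where "r \<in> Rc" "L r < L k" "pv k = L r"
  using Max_in[OF finite_prv_set[of k]] unfolding prv_def by auto

lemma prv_less: "k \<in> Cd \<Longrightarrow> pv k < L k"
  by (rule prv_cases[of k]) (auto dest: candD)

lemma rec_le: "c \<in> Rc \<Longrightarrow> m \<in> Cd \<Longrightarrow> pv c < L m \<Longrightarrow> m \<le> c"
proof (rule ccontr)
  assume a: "c \<in> Rc" "m \<in> Cd" "pv c < L m" "\<not> m \<le> c"
  obtain r where r: "r \<in> Rc" "m \<le> r" "L m \<le> L r" using rec_above a by metis
  have "L r < L c" using recs_desc[of c r] r rec_cand a by auto
  then show False using prv_ge_rec[of r c] r a by auto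
qed

lemma prv_mono: "k \<in> Rc \<Longrightarrow> k' \<in> Rc \<Longrightarrow> L k < L k' \<Longrightarrow> pv k < pv k'"
  using prv_ge_rec[of k k'] prv_less[of k] rec_cand by fastforce

lemma rec_L_neq: "k \<in> Rc \<Longrightarrow> k' \<in> Rc \<Longrightarrow> k \<noteq> k' \<Longrightarrow> L k \<noteq> L k'"
  using L_eqD candD rec_cand by (meson less_imp_le)

lemma prv_neq_nonrec: "j < m \<Longrightarrow> m \<le> n \<Longrightarrow> m \<notin> Rc \<Longrightarrow> L m \<noteq> pv k"
proof (rule prv_cases[of k])
  assume "j < m" "m \<le> n" "pv k = L j" then show ?thesis using L_eqD[of m j] j by auto
next
  fix r assume "j < m" "m \<le> n" "m \<notin> Rc" "r \<in> Rc" "pv k = L r"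
  then show ?thesis using L_eqD[of m r] candD[OF rec_cand[of r]] by auto
qed

lemma next_ord_inj: "inj_on L' {Suc j..n}"
proof (rule inj_onI)
  fix a b assume ab: "a \<in> {Suc j..n}" "b \<in> {Suc j..n}" "L' a = L' b"
  consider "a \<in> Rc" "b \<in> Rc" | "a \<in> Rc" "b \<notin> Rc" | "a \<notin> Rc" "b \<in> Rc" | "a \<notin> Rc" "b \<notin> Rc" by blast
  then show "a = b"
  proof cases
    case 1
    then have "pv a = pv b" using ab by (simp add: next_ord_def)
    then have "L a = L b" using 1 prv_mono[of a b] prv_mono[of b a] by linarith
    then show ?thesis using 1 rec_L_neq[of a b] by auto
  next
    case 2 then show ?thesis using ab prv_neq_nonrec[of b a] by (auto simp: next_ord_def)
  next
    case 3 then show ?thesis using ab prv_neq_nonrec[of a b] by (auto simp: next_ord_def)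
  next
    case 4 then show ?thesis using ab L_eqD[of a b] by (auto simp: next_ord_def)
  qed
qed

text \<open>Below a root of \<open>D\<close> in column \<open>j\<close>, a place without bullet lies in a row already used, whose label
is less than \<open>j\<close>.\<close>

lemma D_in_recs: assumes "(k, j) \<in> D" shows "k \<in> Rc"
proof -
  have k: "j < k" "k \<le> n" using D_bounds[OF assms] by auto
  have Lk: "L k = k" using k D_row_unique[OF assms] by (intro L_unused) auto
  have kC: "k \<in> Cd" using k Lk Lj_le assms M_col_iff by (intro candI) auto
  moreover have "L m < L k" if m: "m \<in> Cd" "k < m" for m
  proof -
    have mb: "j < m" "m \<le> n" "(m, j) \<notin> MD" using candD[OF m(1)] by auto
    then consider c where "c \<le> j" "(m, c) \<in> D" | b' where "b' \<ge> m" "(b', j) \<in> D"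
      using M_col_iff by auto
    then show ?thesis
    proof cases
      case 1
      then have "c < j" using D_col_unique[OF assms, of m] m by (cases "c = j") auto
      then have "L m < j" using L_used 1 mb by auto
      then show ?thesis using k Lk by auto
    next
      case 2 then show ?thesis using D_col_unique[OF assms] m by auto
    qed
  qed
  ultimately show ?thesis by (auto simp: recs_def)
qed

text \<open>A row that \<open>D\<close> does not meet carries a bullet unless there is a root of \<open>D\<close> below it in column \<open>j\<close>.
That root belongs to a candidate whose label is its own index, so the row is not a record.\<close>

lemma rec_used: assumes "r \<in> Rc" shows "\<exists>c\<le>j. (r, c) \<in> D"
proof (rule ccontr)
  assume no: "\<not> ?thesis"
  have r: "j < r" "r \<le> n" "(r, j) \<notin> MD" "r \<in> Cd" using candD rec_cand assms by auto
  then obtain b' where b': "b' \<ge> r" "(b', j) \<in> D" using no M_col_iff by auto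
  then have "b' \<in> Rc" "b' \<noteq> r" using no D_in_recs by auto
  then have "L b' < L r" using recs_desc[OF assms rec_cand] b' by auto
  moreover have "L r = r" using no r by (intro L_unused) auto
  moreover have "L b' = b'" using D_row_unique[OF b'(2)] D_bounds[OF b'(2)] by (intro L_unused) auto
  ultimately show False using b' by auto
qed

lemma rec_nonbullet: assumes "r \<in> Rc" "j \<le> c" "c < r" shows "(r, c) \<notin> MD"
proof -
  obtain c' where "c' \<le> j" "(r, c') \<in> D" using rec_used[OF assms(1)] by auto
  then show ?thesis using M_roots_iff[of c r] candD[OF rec_cand[OF assms(1)]] j assms by auto
qed

lemma prv_le: assumes "k \<in> Rc" shows "pv k \<le> j"
proof (rule prv_cases[of k])
  assume "pv k = L j" then show ?thesis using Lj_le by auto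
next
  fix r assume r: "r \<in> Rc" "L r < L k" "pv k = L r"
  have rb: "j < r" "r \<le> n" using candD[OF rec_cand[OF r(1)]] by auto
  have kb: "j < k" "k \<le> n" using candD[OF rec_cand[OF assms]] by auto
  show ?thesis
  proof (cases "L r < j")
    case True then show ?thesis using r by auto
  next
    case False
    then have Lr: "L r = r" using L_cases[of r] rb by auto
    then have "L k = k" using kb L_cases[of k] r rb by auto
    then have "r < k" using Lr r by auto
    then show ?thesis using recs_desc[OF r(1) rec_cand[OF assms]] r by auto
  qed
qed

lemma next_inv: "ord_inv (Suc j) L'"
  unfolding ord_inv_def
proof (intro conjI allI impI)
  show "inj_on L' {Suc j..n}" by (rule next_ord_inj)
  fix b assume b: "Suc j \<le> b \<and> b \<le> n"
  show "if \<exists>c<Suc j. (b, c) \<in> D then L' b < Suc j else L' b = b"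
  proof (cases "b \<in> Rc")
    case True
    then show ?thesis using rec_used[OF True] prv_le[OF True] by (auto simp: next_ord_def less_Suc_eq_le)
  next
    case False
    then have nj: "(b, j) \<notin> D" using D_in_recs by auto
    have "L' b = L b" using False by (simp add: next_ord_def)
    moreover have "(\<exists>c<Suc j. (b, c) \<in> D) \<longleftrightarrow> (\<exists>c<j. (b, c) \<in> D)" using nj by (auto simp: less_Suc_eq)
    ultimately show ?thesis using L_cases[of b] b by auto
  qed
qed

lemma cand_between:
  assumes "k \<in> Rc" "j < c" "c < k" "L j < L c" "L c < L k"
  shows "c \<in> Cd"
proof (rule ccontr)
  assume "c \<notin> Cd"
  have kb: "j < k" "k \<le> n" "(k, j) \<notin> MD" using candD[OF rec_cand[OF assms(1)]] by auto
  then have cM: "(c, j) \<in> MD" using candI[of c] \<open>c \<notin> Cd\<close> assms by auto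
  then have Lc: "L c = c" using assms kb M_col_iff[of c] by (intro L_unused) auto
  have "\<forall>c<j. (k, c) \<notin> D" using L_cases[of k] Lc assms kb by auto
  then obtain b' where "b' \<ge> k" "(b', j) \<in> D" using kb M_col_iff[of k] by (auto simp: le_less)
  then show False using cM assms kb M_col_iff[of c] by auto
qed

text \<open>A place to the right of column \<open>j\<close> ceases to be alive exactly if it lies in the row of a record and
its column has a label between the old and the new label of this row. These are the places that
receive the sign \<open>-\<close>.\<close>

lemma next_ord_less_iff:
  assumes "j < c" "c < b" "b \<le> n"
  shows "L' c < L' b \<longleftrightarrow> L c < L b \<and> \<not> (b \<in> Rc \<and> pv b < L c)"
proof -
  consider "b \<in> Rc" "c \<in> Rc" | "b \<in> Rc" "c \<notin> Rc" | "b \<notin> Rc" "c \<notin> Rc"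
    | "b \<notin> Rc" "c \<in> Rc" "b \<in> Cd" | "b \<notin> Cd" "c \<in> Rc" "L j < L b" | "b \<notin> Rc" "c \<in> Rc" "\<not> L j < L b"
    by blast
  then show ?thesis
  proof cases
    case 1
    then have "L b < L c" using recs_desc[of c b] rec_cand[of b] assms by auto
    then show ?thesis using 1 prv_mono[of b c] by (auto simp: next_ord_def)
  next
    case 2
    then have "L c \<noteq> pv b" "pv b < L b" using prv_neq_nonrec[of c b] assms prv_less[OF rec_cand[of b]] by auto
    then show ?thesis using 2 by (simp add: next_ord_def) linarith
  next
    case 3 then show ?thesis by (auto simp: next_ord_def)
  next
    case 4 then show ?thesis using rec_le[of c b] prv_less[OF rec_cand[of c]] assms
      by (auto simp: next_ord_def)
  next
    case 5 then show ?thesis using bullet_above[of b c] assms rec_cand prv_less[OF rec_cand[of c]]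
      by (auto simp: next_ord_def)
  next
    case 6 then show ?thesis using prv_ge[of c] prv_less[OF rec_cand[of c]]
      by (auto simp: next_ord_def)
  qed
qed

text \<open>The row of the pivot that is used to clear row \<open>m\<close>: the preceding record if \<open>m\<close> is a record, and
otherwise the record with the least label above that of \<open>m\<close>. Only the first record is not cleared.\<close>

definition pivot_row :: "nat \<Rightarrow> nat" where
  "pivot_row m = (SOME r. r \<in> Rc \<and> L r = (if m \<in> Rc then pv m else Min (L ` {r \<in> Rc. L m < L r})))"

definition cleared_rows :: "nat set" where "cleared_rows = {m \<in> Cd. m \<in> Rc \<longrightarrow> pv m \<noteq> L j}"

lemma pivot_row_rec:
  assumes "m \<in> Rc" "pv m \<noteq> L j"
  shows "pivot_row m \<in> Rc" "L (pivot_row m) = pv m" "m < pivot_row m"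
proof -
  have "\<exists>r. r \<in> Rc \<and> L r = pv m" using prv_cases[of m] assms by metis
  then have "pivot_row m \<in> Rc \<and> L (pivot_row m) = pv m" unfolding pivot_row_def using assms
    by simp (rule someI_ex, blast)
  then show k: "pivot_row m \<in> Rc" "L (pivot_row m) = pv m" by auto
  have "L (pivot_row m) < L m" using k prv_less[OF rec_cand[OF assms(1)]] by simp
  then have "\<not> pivot_row m < m" "pivot_row m \<noteq> m" using recs_desc[OF k(1) rec_cand[OF assms(1)]] by auto
  then show "m < pivot_row m" by linarith
qed

lemma pivot_row_nonrec:
  assumes "m \<in> Cd" "m \<notin> Rc"
  shows "pivot_row m \<in> Rc" "L m < L (pivot_row m)" "m < pivot_row m"
    "\<And>r. r \<in> Rc \<Longrightarrow> L m < L r \<Longrightarrow> L (pivot_row m) \<le> L r"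
proof -
  let ?S = "L ` {r \<in> Rc. L m < L r}"
  obtain r where r: "r \<in> Rc" "m \<le> r" "L m \<le> L r" using rec_above assms by metis
  then have mr: "m < r" using assms by (cases "m = r") auto
  have "L m \<noteq> L r" using L_eqD[of m r] mr candD[OF assms(1)] candD[OF rec_cand[OF r(1)]] by auto
  then have rS: "L r \<in> ?S" using r by auto
  have "Min ?S \<in> ?S" using rS finite_recs by (intro Min_in) auto
  then have "\<exists>r. r \<in> Rc \<and> L r = Min ?S" by auto
  then have k: "pivot_row m \<in> Rc \<and> L (pivot_row m) = Min ?S" unfolding pivot_row_def using assms
    by simp (rule someI_ex, blast)
  then show "pivot_row m \<in> Rc" by auto
  show "L m < L (pivot_row m)" using k \<open>Min ?S \<in> ?S\<close> by auto
  show le: "L (pivot_row m) \<le> L r" if "r \<in> Rc" "L m < L r" for r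
    using k that finite_recs by (auto intro: Min_le)
  have "L (pivot_row m) \<le> L r" using le r \<open>L m \<noteq> L r\<close> by auto
  then have "\<not> pivot_row m < r" using k recs_desc[OF _ rec_cand[OF r(1)]] by force
  then show "m < pivot_row m" using mr by auto
qed

lemma cleared_pivot_row: "m \<in> cleared_rows \<Longrightarrow> pivot_row m \<in> Rc \<and> m < pivot_row m"
  using pivot_row_rec[of m] pivot_row_nonrec[of m] by (cases "m \<in> Rc") (auto simp: cleared_rows_def)

text \<open>The column of a record \<open>c\<close> is modified by the rows with label above \<open>prv c\<close>. This set of rows contains
\<open>m\<close> if and only if it contains the row that clears \<open>m\<close>, except for \<open>m = c\<close>. This is the reason why
clearing rows and modifying columns are inverse to each other.\<close>

lemma pivot_row_thresh: assumes "m \<in> cleared_rows" "c \<in> Rc"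
  shows "pv c < L (pivot_row m) \<longleftrightarrow> pv c < L m \<and> m \<noteq> c"
proof (cases "m \<in> Rc")
  case True
  then have k: "pivot_row m \<in> Rc" "L (pivot_row m) = pv m" using pivot_row_rec assms unfolding cleared_rows_def by auto
  show ?thesis
  proof
    assume "pv c < L (pivot_row m)"
    then show "pv c < L m \<and> m \<noteq> c" using k prv_less[OF rec_cand[OF True]] by auto
  next
    assume a: "pv c < L m \<and> m \<noteq> c"
    then have "\<not> L m < L c" using prv_ge_rec[OF True, of c] by auto
    then have "L c < L m" using rec_L_neq[OF True assms(2)] a by auto
    then show "pv c < L (pivot_row m)" using k prv_mono assms True by auto
  qed
next
  case False
  then have m: "m \<in> Cd" using assms by (auto simp: cleared_rows_def)
  note k = pivot_row_nonrec[OF m False]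
  show ?thesis
  proof
    assume a: "pv c < L (pivot_row m)"
    have "pv c < L m"
    proof (rule prv_cases[of c])
      assume "pv c = L j" then show ?thesis using candD[OF m] by auto
    next
      fix r assume r: "r \<in> Rc" "L r < L c" "pv c = L r"
      show ?thesis
      proof (rule ccontr)
        assume "\<not> pv c < L m"
        then have "L m \<le> L r" using r by auto
        moreover have "L m \<noteq> L r" using prv_neq_nonrec[of m c] candD[OF m] False r by auto
        ultimately show False using k(4)[OF r(1)] a r by auto
      qed
    qed
    then show "pv c < L m \<and> m \<noteq> c" using False assms by auto
  next
    assume "pv c < L m \<and> m \<noteq> c" then show "pv c < L (pivot_row m)" using k by auto
  qed
qed

lemma first_rec_thresh: assumes "m \<in> Cd" "m \<notin> cleared_rows" "c \<in> Rc" "pv c < L m" shows "m = c"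
proof (rule ccontr)
  assume ne: "m \<noteq> c"
  have m: "m \<in> Rc" "pv m = L j" using assms by (auto simp: cleared_rows_def)
  have "\<not> L m < L c" using prv_ge_rec[OF m(1), of c] assms by auto
  then have "L c < L m" using rec_L_neq[OF m(1) assms(3) ne] by auto
  then have "L c \<le> L j" using prv_ge_rec[OF assms(3), of m] m by auto
  then show False using candD[OF rec_cand[OF assms(3)]] by auto
qed

end

section \<open>The diagram of symbols consists of records\<close>

context basic_roots begin

lemma col_ord_inv: "1 \<le> j \<Longrightarrow> j \<le> Suc n \<Longrightarrow> ord_inv j (col_ord j)"
proof (induction j rule: nat_induct_at_least)
  case base
  have "recs 0 (col_ord 0) = {}" by (auto simp: recs_def cand_def)
  then have "col_ord 1 = (\<lambda>m. m)" by (auto simp: next_ord_def fun_eq_iff)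
  then show ?case using D_bounds by (fastforce simp: ord_inv_def inj_on_def)
next
  case (Suc j)
  then interpret column n D j "col_ord j" by unfold_locales auto
  show ?case using next_inv by simp
qed

lemma column_ord: "1 \<le> j \<Longrightarrow> j \<le> n \<Longrightarrow> column n D j (col_ord j)"
  using col_ord_inv by unfold_locales auto

lemma col_ord_1: "col_ord (Suc 0) = (\<lambda>m. m)"
proof -
  have "recs 0 (col_ord 0) = {}" by (auto simp: recs_def cand_def)
  then show ?thesis by (auto simp: next_ord_def)
qed

declare col_ord.simps(2) [simp del]

abbreviation "rec_at j \<equiv> recs j (col_ord j)"
abbreviation "cand_at j \<equiv> cand j (col_ord j)"

text \<open>The empty places when, in column \<open>j\<close>, the records in \<open>P\<close> have been treated. In this column a
candidate has received the sign \<open>+\<close> as soon as it lies above a treated record with greater label.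
To the right of it, the row of a treated record has received the sign \<open>-\<close> at all columns whose
label exceeds the new label of this row.\<close>

definition vacant :: "nat \<Rightarrow> nat set \<Rightarrow> nat \<Rightarrow> nat \<Rightarrow> bool" where
  "vacant j P b c \<longleftrightarrow> (b, c) \<notin> MD \<and>
     (c = j \<and> b \<in> cand_at j \<and> b \<notin> P \<and> (\<forall>r\<in>P. b < r \<longrightarrow> col_ord j r < col_ord j b) \<or>
      c > j \<and> col_ord j c < col_ord j b \<and> \<not> (b \<in> P \<and> prv j (col_ord j) b < col_ord j c))"

definition diagram_state :: "nat \<Rightarrow> nat set \<Rightarrow> diagram \<Rightarrow> bool" where
  "diagram_state j P d \<longleftrightarrow> P \<subseteq> rec_at j \<and> (\<forall>r\<in>rec_at j. \<forall>p\<in>P. p < r \<longrightarrow> r \<in> P) \<and>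
     (\<forall>b c. 1 \<le> c \<longrightarrow> c < b \<longrightarrow> b \<le> n \<longrightarrow>
       (d (b, c) = Some Otimes \<longleftrightarrow> c < j \<and> b \<in> rec_at c \<or> c = j \<and> b \<in> P) \<and>
       (d (b, c) = None \<longleftrightarrow> vacant j P b c))"

lemma diagram_stateD:
  assumes "diagram_state j P d" "1 \<le> c" "c < b" "b \<le> n"
  shows "d (b, c) = Some Otimes \<longleftrightarrow> c < j \<and> b \<in> rec_at c \<or> c = j \<and> b \<in> P"
    and "d (b, c) = None \<longleftrightarrow> vacant j P b c"
  using assms unfolding diagram_state_def by simp_all

lemma diagram_stateI:
  assumes "P \<subseteq> rec_at j" "\<And>r p. r \<in> rec_at j \<Longrightarrow> p \<in> P \<Longrightarrow> p < r \<Longrightarrow> r \<in> P"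
    and "\<And>b c. 1 \<le> c \<Longrightarrow> c < b \<Longrightarrow> b \<le> n \<Longrightarrow>
       d (b, c) = Some Otimes \<longleftrightarrow> c < j \<and> b \<in> rec_at c \<or> c = j \<and> b \<in> P"
    and "\<And>b c. 1 \<le> c \<Longrightarrow> c < b \<Longrightarrow> b \<le> n \<Longrightarrow> d (b, c) = None \<longleftrightarrow> vacant j P b c"
  shows "diagram_state j P d"
  using assms unfolding diagram_state_def by simp

lemma diagram_step_at:
  assumes g: "greatest_root (empty_places n d) = (k, j)" and ne: "empty_places n d \<noteq> {}"
    and kj: "j < k" "k \<le> n" "1 \<le> j"
  shows "diagram_step n d (b, c) =
    (if (b, c) = (k, j) then Some Otimes
     else if c = j \<and> j < b \<and> b < k \<and> d (b, j) = None \<and> d (k, b) = None then Some PlusSign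
     else if b = k \<and> j < c \<and> c < k \<and> d (c, j) = None \<and> d (k, c) = None then Some MinusSign
     else d (b, c))"
proof -
  let ?E = "empty_places n d"
  have rs: "root_sum (k, j) \<alpha> \<beta> \<and> snd \<alpha> = j \<and> fst \<beta> = k \<longleftrightarrow>
      (\<exists>m. j < m \<and> m < k \<and> \<alpha> = (m, j) \<and> \<beta> = (k, m))" for \<alpha> \<beta>
  proof
    assume a: "root_sum (k, j) \<alpha> \<beta> \<and> snd \<alpha> = j \<and> fst \<beta> = k"
    then obtain m where m: "k > m" "m > j" "{\<alpha>, \<beta>} = {(k, m), (m, j)}"
      unfolding root_sum_def by auto
    then have "\<alpha> = (m, j) \<and> \<beta> = (k, m)" using a by (auto simp: doubleton_eq_iff)
    then show "\<exists>m. j < m \<and> m < k \<and> \<alpha> = (m, j) \<and> \<beta> = (k, m)" using m by auto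
  next
    assume "\<exists>m. j < m \<and> m < k \<and> \<alpha> = (m, j) \<and> \<beta> = (k, m)"
    then obtain m where m: "j < m" "m < k" "\<alpha> = (m, j)" "\<beta> = (k, m)" by auto
    moreover have "{\<alpha>, \<beta>} = {(k, m), (m, j)}" using m by auto
    ultimately show "root_sum (k, j) \<alpha> \<beta> \<and> snd \<alpha> = j \<and> fst \<beta> = k"
      unfolding root_sum_def by auto
  qed
  have plus: "(\<exists>\<alpha>\<in>?E. \<exists>\<beta>\<in>?E. root_sum (k, j) \<alpha> \<beta> \<and> snd \<alpha> = j \<and> fst \<beta> = k \<and> (b, c) = \<alpha>) \<longleftrightarrow>
      c = j \<and> j < b \<and> b < k \<and> d (b, j) = None \<and> d (k, b) = None" (is "?l \<longleftrightarrow> ?r")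
  proof
    assume ?l
    then obtain \<alpha> \<beta> where "\<alpha> \<in> ?E" "\<beta> \<in> ?E" "root_sum (k, j) \<alpha> \<beta> \<and> snd \<alpha> = j \<and> fst \<beta> = k" "(b, c) = \<alpha>"
      by blast
    with rs[of \<alpha> \<beta>] show ?r by (auto simp: empty_places_def)
  next
    assume r: ?r
    have "(b, j) \<in> ?E" "(k, b) \<in> ?E" using r kj by (auto simp: empty_places_def pos_roots_def)
    moreover have "root_sum (k, j) (b, j) (k, b)" using rs[of "(b, j)" "(k, b)"] r by auto
    ultimately show ?l using r by (intro bexI[of _ "(b, j)"] bexI[of _ "(k, b)"]) auto
  qed
  have minus: "(\<exists>\<alpha>\<in>?E. \<exists>\<beta>\<in>?E. root_sum (k, j) \<alpha> \<beta> \<and> snd \<alpha> = j \<and> fst \<beta> = k \<and> (b, c) = \<beta>) \<longleftrightarrow>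
      b = k \<and> j < c \<and> c < k \<and> d (c, j) = None \<and> d (k, c) = None" (is "?l \<longleftrightarrow> ?r")
  proof
    assume ?l
    then obtain \<alpha> \<beta> where "\<alpha> \<in> ?E" "\<beta> \<in> ?E" "root_sum (k, j) \<alpha> \<beta> \<and> snd \<alpha> = j \<and> fst \<beta> = k" "(b, c) = \<beta>"
      by blast
    with rs[of \<alpha> \<beta>] show ?r by (auto simp: empty_places_def)
  next
    assume r: ?r
    have "(c, j) \<in> ?E" "(k, c) \<in> ?E" using r kj by (auto simp: empty_places_def pos_roots_def)
    moreover have "root_sum (k, j) (c, j) (k, c)" using rs[of "(c, j)" "(k, c)"] r by auto
    ultimately show ?l using r by (intro bexI[of _ "(c, j)"] bexI[of _ "(k, c)"]) auto
  qed
  show ?thesis unfolding diagram_step_def Let_def g by (simp only: ne if_False fst_conv snd_conv plus minus)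
qed

lemma greatest_rootI:
  assumes "\<xi> \<in> E" "\<And>\<eta>. \<eta> \<in> E \<Longrightarrow> \<eta> \<noteq> \<xi> \<Longrightarrow> root_succ \<xi> \<eta>"
  shows "greatest_root E = \<xi>"
  unfolding greatest_root_def
proof (rule the_equality)
  show "\<xi> \<in> E \<and> (\<forall>\<eta>\<in>E. \<eta> \<noteq> \<xi> \<longrightarrow> root_succ \<xi> \<eta>)" using assms by auto
  fix x assume x: "x \<in> E \<and> (\<forall>\<eta>\<in>E. \<eta> \<noteq> x \<longrightarrow> root_succ x \<eta>)"
  show "x = \<xi>"
  proof (rule ccontr)
    assume "x \<noteq> \<xi>"
    then have "root_succ x \<xi>" "root_succ \<xi> x" using x assms by auto
    then show False unfolding root_succ_def by linarith
  qed
qed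

lemma diagram_state_init: assumes "1 \<le> n" shows "diagram_state 1 {} (initial_diagram n D)"
proof -
  have "cand_at (Suc 0) = {m. 1 < m \<and> m \<le> n \<and> (m, Suc 0) \<notin> MD}" by (auto simp: cand_def col_ord_1)
  then have cd: "b \<in> cand_at 1 \<longleftrightarrow> 1 < b \<and> b \<le> n \<and> (b, 1) \<notin> MD" for b by simp
  have ord: "col_ord 1 = (\<lambda>m. m)" using col_ord_1 by simp
  show ?thesis
  proof (rule diagram_stateI)
    fix b c assume bc: "1 \<le> c" "c < b" "b \<le> n"
    show "initial_diagram n D (b, c) = Some Otimes \<longleftrightarrow> c < 1 \<and> b \<in> rec_at c \<or> c = 1 \<and> b \<in> {}"
      using bc by (simp add: initial_diagram_def)
    show "initial_diagram n D (b, c) = None \<longleftrightarrow> vacant 1 {} b c"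
    proof (cases "c = 1")
      case True then show ?thesis using bc unfolding True vacant_def cd by (simp add: initial_diagram_def)
    next
      case False then show ?thesis using bc unfolding ord vacant_def by (simp add: initial_diagram_def)
    qed
  qed simp_all
qed

text \<open>When all records are treated, a candidate that is no record lies above a record with greater label,
so the column is full, and \<open>next_ord_less_iff\<close> turns the description of the remaining
empty places into the one for the new labels.\<close>

lemma diagram_state_next:
  assumes j: "1 \<le> j" "j \<le> n" and s: "diagram_state j (rec_at j) d"
  shows "diagram_state (Suc j) {} d"
proof -
  interpret column n D j "col_ord j" using column_ord[OF j] .
  let ?L = "col_ord j"
  have full: False if a: "b \<in> Cd" "b \<notin> Rc" "\<forall>r\<in>Rc. b < r \<longrightarrow> ?L r < ?L b" for b
  proof -
    obtain r where "r \<in> Rc" "b \<le> r" "?L b \<le> ?L r" by (rule rec_above[OF a(1)])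
    then show False using a by (cases "b = r") auto
  qed
  show ?thesis
  proof (rule diagram_stateI)
    fix b c assume bc: "1 \<le> c" "c < b" "b \<le> n"
    show "d (b, c) = Some Otimes \<longleftrightarrow> c < Suc j \<and> b \<in> rec_at c \<or> c = Suc j \<and> b \<in> {}"
      using diagram_stateD(1)[OF s bc] by (auto simp: less_Suc_eq)
    note none = diagram_stateD(2)[OF s bc, unfolded vacant_def]
    have ord: "(?L c < ?L b \<and> \<not> (b \<in> Rc \<and> pv b < ?L c)) \<longleftrightarrow> col_ord (Suc j) c < col_ord (Suc j) b" if "j < c"
      using next_ord_less_iff[of c b] that bc by (simp add: col_ord.simps(2))
    consider "c < j" | "c = j" | "c = Suc j" | "c > Suc j" by linarith
    then show "d (b, c) = None \<longleftrightarrow> vacant (Suc j) {} b c"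
    proof cases
      case 1 then show ?thesis using none by (simp add: vacant_def)
    next
      case 2 then show ?thesis using none full[of b] by (auto simp: vacant_def)
    next
      case 3 then show ?thesis using none ord bc by (auto simp: vacant_def cand_def)
    next
      case 4 then show ?thesis using none ord bc by (auto simp: vacant_def)
    qed
  qed simp_all
qed

text \<open>The greatest empty place is the lowest untreated record \<open>k\<close>: the labels of the records increase
upwards, so \<open>k\<close> has not been filled with \<open>+\<close>, while every candidate below it is a treated record or
lies above one with a greater label. The decomposition of \<open>(k, j)\<close> through \<open>m\<close> receives signs exactly if
\<open>m\<close> is a candidate with a label between that of the preceding record and that of \<open>k\<close>.\<close>

lemma diagram_state_step:
  assumes j: "1 \<le> j" "j \<le> n" and s: "diagram_state j P d" and P: "P \<noteq> rec_at j"
  defines "k \<equiv> Max (rec_at j - P)"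
  shows "diagram_state j (insert k P) (diagram_step n d)"
    and "empty_places n d \<noteq> {}" and "greatest_root (empty_places n d) = (k, j)" and "k \<in> rec_at j - P"
proof -
  interpret column n D j "col_ord j" using column_ord[OF j] .
  let ?L = "col_ord j"
  have PR: "P \<subseteq> Rc" and up: "\<And>r p. r \<in> Rc \<Longrightarrow> p \<in> P \<Longrightarrow> p < r \<Longrightarrow> r \<in> P"
    using s unfolding diagram_state_def by auto
  have ot: "d (b, c) = Some Otimes \<longleftrightarrow> c < j \<and> b \<in> rec_at c \<or> c = j \<and> b \<in> P"
    if "1 \<le> c" "c < b" "b \<le> n" for b c using diagram_stateD(1)[OF s that] .
  note none = diagram_stateD(2)[OF s, unfolded vacant_def]
  have fin: "finite (Rc - P)" using finite_recs by auto
  have "k \<in> Rc - P" unfolding k_def using PR P fin by (intro Max_in) auto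
  then show kk: "k \<in> Rc - P" .
  then have kR: "k \<in> Rc" "k \<notin> P" by auto
  have kmax: "r \<le> k \<or> r \<in> P" if "r \<in> Rc" for r
    using that fin unfolding k_def by (auto intro: Max_ge)
  have Pgt: "k < r" if "r \<in> P" for r
    using that kR up[OF kR(1) that] by (metis nat_neq_iff)
  have kC: "k \<in> Cd" and kb: "j < k" "k \<le> n" "?L j < ?L k" "(k, j) \<notin> MD" using rec_cand candD kR by auto
  have LP: "?L r < ?L k" if "r \<in> P" for r using recs_desc[OF kR(1) rec_cand[of r]] Pgt that PR by auto
  have colj: "d (b, j) = None \<longleftrightarrow> b \<in> Cd \<and> b \<notin> P \<and> (\<forall>r\<in>P. b < r \<longrightarrow> ?L r < ?L b)"
    if "j < b" "b \<le> n" for b using none[of j b] j that candD[of b] by auto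
  have kE: "d (k, j) = None" using colj[of k] kb kC kR LP by auto
  have Eb: "b < k" if b: "d (b, j) = None" "j < b" "b \<le> n" "b \<noteq> k" for b
  proof -
    have bb: "b \<in> Cd" "b \<notin> P" "\<And>r. r \<in> P \<Longrightarrow> b < r \<Longrightarrow> ?L r < ?L b" using colj b by auto
    obtain r where r: "r \<in> Rc" "b \<le> r" "?L b \<le> ?L r" by (rule rec_above[OF bb(1)])
    have "r \<notin> P"
    proof
      assume rP: "r \<in> P"
      then have "b < r" using bb r by (cases "b = r") auto
      then show False using bb(3)[OF rP] r by simp
    qed
    then show ?thesis using kmax[OF r(1)] r b by auto
  qed
  show ne: "empty_places n d \<noteq> {}" using kE kb j by (auto simp: empty_places_def pos_roots_def)
  show g: "greatest_root (empty_places n d) = (k, j)"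
  proof (rule greatest_rootI)
    show "(k, j) \<in> empty_places n d" using kE kb j by (auto simp: empty_places_def pos_roots_def)
    fix \<eta> assume eta: "\<eta> \<in> empty_places n d" "\<eta> \<noteq> (k, j)"
    obtain b c where bc: "\<eta> = (b, c)" by force
    have b: "1 \<le> c" "c < b" "b \<le> n" "d (b, c) = None" using eta bc by (auto simp: empty_places_def pos_roots_def)
    then have "c \<ge> j" using none[of c b] by auto
    then show "root_succ (k, j) \<eta>" using Eb[of b] b bc eta by (cases "c = j") (auto simp: root_succ_def)
  qed
  note step = diagram_step_at[OF g ne kb(1,2) j(1)]
  have kc: "d (k, c) = None \<longleftrightarrow> ?L c < ?L k" if "j < c" "c < k" for c
    using none[of c k] rec_nonbullet[OF kR(1), of c] that kb j kR by auto
  have cj: "d (c, j) = None \<longleftrightarrow> pv k < ?L c" if c: "j < c" "c < k" "?L c < ?L k" for c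
  proof
    assume a: "d (c, j) = None"
    then have cc: "c \<in> Cd" "\<And>r. r \<in> P \<Longrightarrow> c < r \<Longrightarrow> ?L r < ?L c" using colj[of c] c kb by auto
    show "pv k < ?L c"
    proof (rule prv_cases[of k])
      assume "pv k = ?L j" then show ?thesis using candD[OF cc(1)] by auto
    next
      fix r assume r: "r \<in> Rc" "?L r < ?L k" "pv k = ?L r"
      have "k < r" using recs_desc[OF r(1) kC] r by (metis less_asym less_irrefl nat_neq_iff)
      then have "r \<in> P" using kmax[OF r(1)] by auto
      then show ?thesis using cc \<open>k < r\<close> c r by auto
    qed
  next
    assume a: "pv k < ?L c"
    then have Ljc: "?L j < ?L c" using prv_ge[of k] by auto
    have "c \<in> Cd" using cand_between[OF kR(1)] c Ljc by auto
    moreover have "c \<notin> P" using Pgt c by force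
    moreover have "?L r < ?L c" if "r \<in> P" for r
      using prv_ge_rec[of r k] that PR LP a by fastforce
    ultimately show "d (c, j) = None" using colj[of c] c kb by auto
  qed
  have otn: "diagram_step n d (b, c) = Some Otimes \<longleftrightarrow> c < j \<and> b \<in> rec_at c \<or> c = j \<and> b \<in> insert k P"
    if "1 \<le> c" "c < b" "b \<le> n" for b c
    using step[of b c] ot[of c b] that by auto
  have nonen: "diagram_step n d (b, c) = None \<longleftrightarrow> vacant j (insert k P) b c"
    if bc: "1 \<le> c" "c < b" "b \<le> n" for b c
  proof -
    consider "c < j" | "c = j" "b = k" | "c = j" "b \<noteq> k" | "c > j" "b \<noteq> k" | "c > j" "b = k"
      using linorder_less_linear[of c j] by blast
    then have "diagram_step n d (b, c) = None \<longleftrightarrow> (b, c) \<notin> MD \<and>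
          (c = j \<and> b \<in> Cd \<and> b \<notin> insert k P \<and> (\<forall>r\<in>insert k P. b < r \<longrightarrow> ?L r < ?L b) \<or>
           c > j \<and> ?L c < ?L b \<and> \<not> (b \<in> insert k P \<and> pv b < ?L c))"
    proof cases
      case 1
      have "diagram_step n d (b, c) = d (b, c)" unfolding step using 1 bc by simp
      then show ?thesis using none[OF bc] 1 by simp
    next
      case 2 then show ?thesis using step[of b c] by auto
    next
      case 3
      have lne: "?L k \<noteq> ?L b" using L_eqD[of k b] 3 bc kb by auto
      have "diagram_step n d (b, c) = None \<longleftrightarrow> d (b, j) = None \<and> \<not> (b < k \<and> ?L b < ?L k)"
        using step[of b c] kc[of b] 3 bc by auto
      also have "\<dots> \<longleftrightarrow> b \<in> Cd \<and> b \<notin> insert k P \<and> (\<forall>r\<in>insert k P. b < r \<longrightarrow> ?L r < ?L b)"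
        using colj[of b] 3 bc lne by (auto simp: not_less le_less)
      also have "\<dots> \<longleftrightarrow> (b, c) \<notin> MD \<and>
          (c = j \<and> b \<in> Cd \<and> b \<notin> insert k P \<and> (\<forall>r\<in>insert k P. b < r \<longrightarrow> ?L r < ?L b) \<or>
           c > j \<and> ?L c < ?L b \<and> \<not> (b \<in> insert k P \<and> pv b < ?L c))"
        using 3 candD[of b] by auto
      finally show ?thesis .
    next
      case 4
      have "diagram_step n d (b, c) = d (b, c)" unfolding step using 4 by simp
      then show ?thesis using none[OF bc] 4 by simp
    next
      case 5
      have "diagram_step n d (b, c) = None \<longleftrightarrow> d (k, c) = None \<and> \<not> d (c, j) = None"
        unfolding step using 5 bc by (cases "d (k, c)") simp_all
      moreover have "(b, c) \<notin> MD" using 5 bc rec_nonbullet[OF kR(1), of c] by simp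
      ultimately show ?thesis using kc[of c] cj[of c] 5 bc by (cases "?L c < ?L k") simp_all
    qed
    then show ?thesis unfolding vacant_def .
  qed
  have up': "r \<in> insert k P" if "r \<in> Rc" "p \<in> insert k P" "p < r" for r p
    using that up kmax[of r] by auto
  show "diagram_state j (insert k P) (diagram_step n d)"
  proof (rule diagram_stateI)
    show "insert k P \<subseteq> Rc" using PR kR(1) by simp
  qed (use up' otn nonen in \<open>assumption | blast\<close>)+
qed

lemma diagram_state_finish:
  assumes j: "1 \<le> j" "j \<le> n" and s: "diagram_state j P d"
  shows "\<exists>m. diagram_state (Suc j) {} ((diagram_step n ^^ m) d)"
  using s
proof (induction "card (rec_at j - P)" arbitrary: P d rule: less_induct)
  case less
  show ?case
  proof (cases "P = rec_at j")
    case True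
    then have "diagram_state (Suc j) {} ((diagram_step n ^^ 0) d)"
      using diagram_state_next[OF j] less.prems by simp
    then show ?thesis by blast
  next
    case False
    interpret column n D j "col_ord j" using column_ord[OF j] .
    define k where "k = Max (Rc - P)"
    note st = diagram_state_step[OF j less.prems False, folded k_def]
    have "card (Rc - insert k P) < card (Rc - P)" using st(4) finite_recs
      by (intro psubset_card_mono) auto
    then obtain m where "diagram_state (Suc j) {} ((diagram_step n ^^ m) (diagram_step n d))"
      using less.hyps st(1) by blast
    then have "diagram_state (Suc j) {} ((diagram_step n ^^ Suc m) d)" by (simp add: funpow_swap1)
    then show ?thesis by blast
  qed
qed

lemma diagram_reaches:
  assumes "1 \<le> n" "1 \<le> j" "j \<le> Suc n"
  shows "\<exists>m. diagram_state j {} ((diagram_step n ^^ m) (initial_diagram n D))"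
  using assms(2,3)
proof (induction j rule: nat_induct_at_least)
  case base
  have "diagram_state 1 {} ((diagram_step n ^^ 0) (initial_diagram n D))"
    using diagram_state_init assms(1) by simp
  then show ?case by blast
next
  case (Suc j)
  then obtain m where "diagram_state j {} ((diagram_step n ^^ m) (initial_diagram n D))" by auto
  then obtain m' where "diagram_state (Suc j) {} ((diagram_step n ^^ m') ((diagram_step n ^^ m) (initial_diagram n D)))"
    using diagram_state_finish Suc by (metis Suc_le_mono)
  then show ?case by (metis comp_apply funpow_add)
qed

lemma vacant_past: assumes "diagram_state (Suc n) {} d" shows "empty_places n d = {}"
  using diagram_stateD(2)[OF assms] by (auto simp: empty_places_def pos_roots_def vacant_def)

lemma diagram_always_state:
  assumes "1 \<le> n"
  shows "\<exists>j P. 1 \<le> j \<and> j \<le> Suc n \<and> (j \<le> n \<longrightarrow> P \<noteq> rec_at j) \<and> (j = Suc n \<longrightarrow> P = {}) \<and>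
    diagram_state j P ((diagram_step n ^^ m) (initial_diagram n D))"
proof -
  have adv: "\<exists>j' P'. j \<le> j' \<and> j' \<le> Suc n \<and> (j' \<le> n \<longrightarrow> P' \<noteq> rec_at j') \<and> (j' = Suc n \<longrightarrow> P' = {}) \<and>
      diagram_state j' P' d"
    if "1 \<le> j" "j \<le> Suc n" "j = Suc n \<longrightarrow> P = {}" "diagram_state j P d" for j P d
    using that
  proof (induction "Suc n - j" arbitrary: j P)
    case 0
    then show ?case by (intro exI[of _ j] exI[of _ P]) auto
  next
    case (Suc x)
    show ?case
    proof (cases "P = rec_at j")
      case True
      then have "diagram_state (Suc j) {} d" using diagram_state_next Suc by auto
      then have "\<exists>j' P'. Suc j \<le> j' \<and> j' \<le> Suc n \<and> (j' \<le> n \<longrightarrow> P' \<noteq> rec_at j') \<and> (j' = Suc n \<longrightarrow> P' = {}) \<and>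
          diagram_state j' P' d"
        using Suc by (intro Suc.hyps(1)) auto
      then obtain j' P' where "Suc j \<le> j' \<and> j' \<le> Suc n \<and> (j' \<le> n \<longrightarrow> P' \<noteq> rec_at j') \<and> (j' = Suc n \<longrightarrow> P' = {}) \<and>
          diagram_state j' P' d" by blast
      then show ?thesis by (intro exI[of _ j'] exI[of _ P']) simp
    next
      case False
      then show ?thesis using Suc by (intro exI[of _ j] exI[of _ P]) auto
    qed
  qed
  show ?thesis
  proof (induction m)
    case 0
    have "diagram_state 1 {} ((diagram_step n ^^ 0) (initial_diagram n D))"
      using diagram_state_init assms by simp
    from adv[OF _ _ _ this] show ?case by auto
  next
    case (Suc m)
    let ?d = "(diagram_step n ^^ m) (initial_diagram n D)"
    from Suc obtain j P where jP: "1 \<le> j" "j \<le> Suc n" "j \<le> n \<longrightarrow> P \<noteq> rec_at j" "j = Suc n \<longrightarrow> P = {}"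
      "diagram_state j P ?d" by blast
    show ?case
    proof (cases "j = Suc n")
      case True
      then have "empty_places n ?d = {}" using vacant_past jP by auto
      then have "diagram_step n ?d = ?d" by (simp add: diagram_step_def)
      then show ?thesis using Suc by simp
    next
      case False
      then have jn: "j \<le> n" using jP by auto
      have "diagram_state j (insert (Max (rec_at j - P)) P) (diagram_step n ?d)"
        using diagram_state_step(1)[OF jP(1) jn jP(5)] jP(3) jn by auto
      from adv[OF jP(1,2) _ this] False jP(1) show ?thesis by (auto intro: le_trans)
    qed
  qed
qed

lemma C_set_eq: assumes "1 \<le> n" shows "C_set n D = {(k, j). 1 \<le> j \<and> j \<le> n \<and> k \<in> rec_at j}"
proof (intro equalityI subsetI)
  fix \<xi> assume "\<xi> \<in> C_set n D"
  then obtain k j m where kj: "\<xi> = (k, j)" "1 \<le> j" "j < k" "k \<le> n"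
    "(diagram_step n ^^ m) (initial_diagram n D) (k, j) = Some Otimes"
    unfolding C_set_def pos_roots_def by auto
  obtain j' P where "1 \<le> j'" "j' \<le> Suc n"
    and s: "diagram_state j' P ((diagram_step n ^^ m) (initial_diagram n D))"
    using diagram_always_state[OF assms] by blast
  then show "\<xi> \<in> {(k, j). 1 \<le> j \<and> j \<le> n \<and> k \<in> rec_at j}"
    using diagram_stateD(1)[OF s kj(2,3,4)] kj s unfolding diagram_state_def by auto
next
  fix \<xi> assume "\<xi> \<in> {(k, j). 1 \<le> j \<and> j \<le> n \<and> k \<in> rec_at j}"
  then obtain k j where kj: "\<xi> = (k, j)" "1 \<le> j" "j \<le> n" "k \<in> rec_at j" by auto
  interpret column n D j "col_ord j" using column_ord[OF kj(2,3)] .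
  have b: "j < k" "k \<le> n" using candD rec_cand kj by auto
  obtain m where s: "diagram_state (Suc j) {} ((diagram_step n ^^ m) (initial_diagram n D))"
    using diagram_reaches[OF assms, of "Suc j"] kj by auto
  then show "\<xi> \<in> C_set n D" using diagram_stateD(1)[OF s kj(2) b] kj b
    unfolding C_set_def pos_roots_def by auto
qed

lemma D_subset_C: "1 \<le> n \<Longrightarrow> D \<subseteq> C_set n D"
proof
  fix \<xi> assume n: "1 \<le> n" and "\<xi> \<in> D"
  then obtain k j where kj: "\<xi> = (k, j)" "(k, j) \<in> D" by (cases \<xi>) auto
  then have b: "1 \<le> j" "j \<le> n" using D_bounds by force+
  interpret column n D j "col_ord j" using column_ord[OF b] .
  show "\<xi> \<in> C_set n D" using D_in_recs[OF kj(2)] C_set_eq[OF n] kj b by auto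
qed

lemma C_row_used: "1 \<le> n \<Longrightarrow> (k, j) \<in> C_set n D \<Longrightarrow> \<exists>c\<le>j. (k, c) \<in> D"
proof -
  assume a: "1 \<le> n" "(k, j) \<in> C_set n D"
  then have b: "1 \<le> j" "j \<le> n" "k \<in> rec_at j" using C_set_eq by auto
  interpret column n D j "col_ord j" using column_ord[OF b(1,2)] .
  show ?thesis using rec_used b by auto
qed

end

section \<open>Elimination of one column\<close>

text \<open>Matrices are handled as functions of two indices, multiplied over an arbitrary index set, because
the index set \<open>{j..n}\<close> shrinks during the elimination.\<close>

definition mm :: "'i set \<Rightarrow> ('i \<Rightarrow> 'i \<Rightarrow> 'k::field) \<Rightarrow> ('i \<Rightarrow> 'i \<Rightarrow> 'k) \<Rightarrow> 'i \<Rightarrow> 'i \<Rightarrow> 'k" where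
  "mm S f g b c = (\<Sum>r\<in>S. f b r * g r c)"

lemma mm_assoc: "mm S (mm S f g) h = mm S f (mm S g h)"
proof (intro ext)
  fix b c
  have "mm S (mm S f g) h b c = (\<Sum>r\<in>S. \<Sum>s\<in>S. f b s * g s r * h r c)"
    by (simp add: mm_def sum_distrib_right)
  also have "\<dots> = (\<Sum>s\<in>S. \<Sum>r\<in>S. f b s * g s r * h r c)" by (rule sum.swap)
  also have "\<dots> = mm S f (mm S g h) b c" by (simp add: mm_def sum_distrib_left mult.assoc)
  finally show "mm S (mm S f g) h b c = mm S f (mm S g h) b c" .
qed

lemma mm_cong:
  "(\<And>r. r \<in> S \<Longrightarrow> f b r = f' b r) \<Longrightarrow> (\<And>r. r \<in> S \<Longrightarrow> g r c = g' r c) \<Longrightarrow> mm S f g b c = mm S f' g' b c"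
  by (simp add: mm_def)

definition enum_mat :: "nat \<Rightarrow> (nat \<Rightarrow> 'i) \<Rightarrow> ('i \<Rightarrow> 'i \<Rightarrow> 'k) \<Rightarrow> 'k mat" where
  "enum_mat k e f = mat k k (\<lambda>(i, l). f (e i) (e l))"

lemma enum_mat_carrier [simp]: "enum_mat k e f \<in> carrier_mat k k" by (simp add: enum_mat_def)

lemma enum_mat_mult:
  assumes "bij_betw e {0..<k} S"
  shows "enum_mat k e f * enum_mat k e g = enum_mat k e (mm S f g)"
proof (rule eq_matI)
  fix i l assume "i < dim_row (enum_mat k e (mm S f g))" "l < dim_col (enum_mat k e (mm S f g))"
  then have il: "i < k" "l < k" by (auto simp: enum_mat_def)
  have "(enum_mat k e f * enum_mat k e g) $$ (i, l) = (\<Sum>t\<in>{0..<k}. f (e i) (e t) * g (e t) (e l))"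
    using il by (simp add: enum_mat_def scalar_prod_def)
  also have "\<dots> = mm S f g (e i) (e l)" unfolding mm_def
    by (rule sum.reindex_bij_betw[OF assms])
  finally show "(enum_mat k e f * enum_mat k e g) $$ (i, l) = enum_mat k e (mm S f g) $$ (i, l)"
    using il by (simp add: enum_mat_def)
qed (auto simp: enum_mat_def)

lemma mm_left_right_inverse:
  assumes "finite S" and inv: "\<And>b c. b \<in> S \<Longrightarrow> c \<in> S \<Longrightarrow> mm S f g b c = (if b = c then 1 else 0)"
    and "b \<in> S" "c \<in> S"
  shows "mm S g f b c = (if b = c then 1 else (0 :: 'k :: field))"
proof -
  obtain e where e: "bij_betw e {0..<card S} S" using ex_bij_betw_nat_finite[OF assms(1)] by blast
  let ?k = "card S"
  have eS: "\<And>i. i < ?k \<Longrightarrow> e i \<in> S" using e by (auto simp: bij_betw_def)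
  have inj: "\<And>i l. i < ?k \<Longrightarrow> l < ?k \<Longrightarrow> e i = e l \<longleftrightarrow> i = l"
    using e by (auto simp: bij_betw_def inj_on_def)
  have "enum_mat ?k e f * enum_mat ?k e g = 1\<^sub>m ?k"
    unfolding enum_mat_mult[OF e] by (rule eq_matI) (auto simp: enum_mat_def inv eS inj)
  then have "enum_mat ?k e g * enum_mat ?k e f = 1\<^sub>m ?k"
    by (rule mat_mult_left_right_inverse[rotated 2]) auto
  then have one: "enum_mat ?k e (mm S g f) = 1\<^sub>m ?k" unfolding enum_mat_mult[OF e] .
  obtain i l where il: "i < ?k" "l < ?k" "b = e i" "c = e l"
  proof -
    have "b \<in> e ` {0..<?k}" "c \<in> e ` {0..<?k}" using assms(3,4) e by (simp_all add: bij_betw_def)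
    then show ?thesis using that by auto
  qed
  have "mm S g f b c = enum_mat ?k e (mm S g f) $$ (i, l)" using il by (simp add: enum_mat_def)
  then show ?thesis unfolding one using il inj by simp
qed

context basic_roots begin

text \<open>Conjugacy \<open>g x = y g\<close> required at the alive places only, by a unitriangular matrix \<open>g\<close> that is
supported on pairs respecting both the natural order and the labels.\<close>

definition conj_rel :: "nat \<Rightarrow> (nat \<Rightarrow> nat) \<Rightarrow> (nat \<Rightarrow> nat \<Rightarrow> 'k::field) \<Rightarrow> (nat \<Rightarrow> nat \<Rightarrow> 'k) \<Rightarrow> bool" where
  "conj_rel i \<omega> x y \<longleftrightarrow> (\<exists>g. (\<forall>p. g p p = 1) \<and>
     (\<forall>p q. p \<noteq> q \<longrightarrow> g p q \<noteq> 0 \<longrightarrow> i \<le> p \<and> p < q \<and> q \<le> n \<and> \<omega> p < \<omega> q) \<and>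
     (\<forall>b c. i \<le> c \<longrightarrow> c < b \<longrightarrow> b \<le> n \<longrightarrow> \<omega> c < \<omega> b \<longrightarrow> mm {i..n} g x b c = mm {i..n} y g b c))"

end

context column begin

abbreviation "S \<equiv> {Suc j..n}"

text \<open>\<open>row_mat\<close> and \<open>col_mat\<close> are inverse to each other, so that \<open>elim_col\<close> is a conjugation on the
indices greater than \<open>j\<close>. The column of a record \<open>c\<close> in \<open>col_mat\<close> is the part of column \<open>j\<close> with labels
above \<open>prv c\<close>, divided by the pivot.\<close>

definition col_mat :: "(nat \<Rightarrow> nat \<Rightarrow> 'k::field) \<Rightarrow> nat \<Rightarrow> nat \<Rightarrow> 'k" where
  "col_mat x m c = (if m = c then 1 else if c \<in> Rc \<and> m \<in> Cd \<and> pv c < L m then x m j / x c j else 0)"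

definition row_mat :: "(nat \<Rightarrow> nat \<Rightarrow> 'k::field) \<Rightarrow> nat \<Rightarrow> nat \<Rightarrow> 'k" where
  "row_mat x b r = (if b = r then 1 else if b \<in> cleared_rows \<and> r = pivot_row b then - (x b j / x r j) else 0)"

definition elim_col :: "(nat \<Rightarrow> nat \<Rightarrow> 'k::field) \<Rightarrow> nat \<Rightarrow> nat \<Rightarrow> 'k" where
  "elim_col x = mm S (mm S (row_mat x) x) (col_mat x)"

lemma candS: "m \<in> Cd \<Longrightarrow> m \<in> S" using candD[of m] by auto

lemma row_mat_sum:
  assumes "b \<in> S"
  shows "mm S (row_mat x) f b c = f b c - (if b \<in> cleared_rows then x b j / x (pivot_row b) j * f (pivot_row b) c else 0)"
proof (cases "b \<in> cleared_rows")
  case True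
  then have k: "pivot_row b \<in> S" "pivot_row b \<noteq> b" using cleared_pivot_row[OF True] rec_cand candS by auto
  have "mm S (row_mat x) f b c = (\<Sum>r\<in>{b, pivot_row b}. row_mat x b r * f r c)"
    unfolding mm_def using assms k by (intro sum.mono_neutral_right) (auto simp: row_mat_def)
  then show ?thesis using True k by (simp add: row_mat_def)
next
  case False
  have "mm S (row_mat x) f b c = (\<Sum>r\<in>{b}. row_mat x b r * f r c)"
    unfolding mm_def using assms False by (intro sum.mono_neutral_right) (auto simp: row_mat_def)
  then show ?thesis using False by (simp add: row_mat_def)
qed

lemma col_mat_nonrec: assumes "c \<in> S" "c \<notin> Rc" shows "mm S f (col_mat x) b c = f b c"
proof -
  have "mm S f (col_mat x) b c = (\<Sum>r\<in>{c}. f b r * col_mat x r c)"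
    unfolding mm_def using assms by (intro sum.mono_neutral_right) (auto simp: col_mat_def)
  then show ?thesis by (simp add: col_mat_def)
qed

lemma col_mat_rec:
  assumes "c \<in> Rc" "x c j \<noteq> 0"
  shows "col_mat x m c = (if m \<in> Cd \<and> pv c < L m then x m j / x c j else 0)"
  using assms prv_less[OF rec_cand[OF assms(1)]] rec_cand[OF assms(1)] by (simp add: col_mat_def)

lemma col_mat_le: "col_mat x m c \<noteq> 0 \<Longrightarrow> m \<le> c"
  using rec_le[of c m] by (auto simp: col_mat_def split: if_splits)

text \<open>For a record \<open>c \<noteq> b\<close> the entry \<open>(b, c)\<close> is a difference of two quotients by the pivot of \<open>c\<close>. By the
common threshold in \<open>pivot_row_thresh\<close> both terms are present or absent together, and they cancel.\<close>

lemma row_col_inverse: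
  assumes piv: "\<And>k. k \<in> Rc \<Longrightarrow> x k j \<noteq> 0" and bc: "b \<in> S" "c \<in> S"
  shows "mm S (row_mat x) (col_mat x) b c = (if b = c then 1 else 0)"
proof (cases "c \<in> Rc")
  case False
  have "col_mat x (pivot_row b) c = 0" if "b \<in> cleared_rows" using cleared_pivot_row[OF that] False by (auto simp: col_mat_def)
  moreover have "col_mat x b c = (if b = c then 1 else 0)" using False by (simp add: col_mat_def)
  ultimately show ?thesis unfolding row_mat_sum[OF bc(1)] by simp
next
  case True
  note A = col_mat_rec[of c x, OF True piv[OF True]]
  show ?thesis
  proof (cases "b \<in> cleared_rows")
    case bK: True
    then have bC: "b \<in> Cd" by (auto simp: cleared_rows_def)
    have k: "pivot_row b \<in> Rc" using cleared_pivot_row[OF bK] by auto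
    have "mm S (row_mat x) (col_mat x) b c =
      (if pv c < L b then x b j / x c j else 0) - x b j / x (pivot_row b) j * (if pv c < L b \<and> b \<noteq> c then x (pivot_row b) j / x c j else 0)"
      unfolding row_mat_sum[OF bc(1)] A using bK bC rec_cand[OF k] pivot_row_thresh[OF bK True] by simp
    also have "\<dots> = (if b = c then 1 else 0)"
      using piv[OF k] piv[OF True] prv_less[OF rec_cand[OF True]] by auto
    finally show ?thesis .
  next
    case bK: False
    have "mm S (row_mat x) (col_mat x) b c = (if b \<in> Cd \<and> pv c < L b then x b j / x c j else 0)"
      unfolding row_mat_sum[OF bc(1)] A using bK by simp
    then show ?thesis using first_rec_thresh[OF _ bK True] piv[OF True] True rec_cand[OF True]
      prv_less[OF rec_cand[OF True]] by auto
  qed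
qed

lemma elim_col_expand:
  assumes "b \<in> S" "c \<in> S"
  shows "elim_col x b c = x b c + (\<Sum>(r, p)\<in>S \<times> S - {(b, c)}. row_mat x b r * x r p * col_mat x p c)"
proof -
  have "elim_col x b c = (\<Sum>p\<in>S. \<Sum>r\<in>S. row_mat x b r * x r p * col_mat x p c)"
    by (simp add: elim_col_def mm_def sum_distrib_right)
  also have "\<dots> = (\<Sum>r\<in>S. \<Sum>p\<in>S. row_mat x b r * x r p * col_mat x p c)" by (rule sum.swap)
  also have "\<dots> = (\<Sum>(r, p)\<in>S \<times> S. row_mat x b r * x r p * col_mat x p c)"
    by (rule sum.cartesian_product)
  also have "\<dots> = row_mat x b b * x b c * col_mat x c c +
      (\<Sum>(r, p)\<in>S \<times> S - {(b, c)}. row_mat x b r * x r p * col_mat x p c)"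
    using assms by (subst sum.remove[of _ "(b, c)"]) auto
  finally show ?thesis by (simp add: row_mat_def col_mat_def)
qed

text \<open>Besides \<open>x b c\<close> itself, every summand of the entry \<open>(b, c)\<close> involves only entries in columns to the left
or below in the same column.\<close>

lemma elim_col_triangular:
  assumes bc: "j < c" "c < b" "b \<le> n"
    and agree: "\<And>r p. p < r \<Longrightarrow> r \<le> n \<Longrightarrow> j \<le> p \<Longrightarrow> p < c \<or> p = c \<and> b < r \<Longrightarrow> x r p = y r p"
  shows "elim_col x b c - x b c = elim_col y b c - y b c"
proof -
  have S: "b \<in> S" "c \<in> S" using bc by auto
  have aj: "x m j = y m j" if "m \<in> Cd" for m using agree[of j m] candD[OF that] bc by auto
  have Q: "row_mat x r p = row_mat y r p" for r p
    using aj cleared_pivot_row[of r] rec_cand by (auto simp: row_mat_def cleared_rows_def)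
  have A: "col_mat x r p = col_mat y r p" for r p using aj rec_cand by (auto simp: col_mat_def)
  have term_eq: "row_mat x b r * x r p * col_mat x p c = row_mat y b r * y r p * col_mat y p c"
    if rp: "r \<in> S" "p \<in> S" "(r, p) \<noteq> (b, c)" for r p
  proof (cases "row_mat x b r = 0 \<or> col_mat x p c = 0")
    case True then show ?thesis using Q A by auto
  next
    case False
    then have "b \<le> r" using cleared_pivot_row[of b] by (auto simp: row_mat_def split: if_splits)
    moreover have "p \<le> c" using col_mat_le False by auto
    ultimately have "x r p = y r p" using rp bc by (intro agree) (auto simp: le_less)
    then show ?thesis using Q A by simp
  qed
  have "(\<Sum>(r, p)\<in>S \<times> S - {(b, c)}. row_mat x b r * x r p * col_mat x p c) =
      (\<Sum>(r, p)\<in>S \<times> S - {(b, c)}. row_mat y b r * y r p * col_mat y p c)"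
  proof (rule sum.cong[OF refl])
    fix z assume "z \<in> S \<times> S - {(b, c)}"
    moreover obtain r p where "z = (r, p)" by force
    ultimately show "(case z of (r, p) \<Rightarrow> row_mat x b r * x r p * col_mat x p c) =
      (case z of (r, p) \<Rightarrow> row_mat y b r * y r p * col_mat y p c)" using term_eq[of r p] by simp
  qed
  then show ?thesis unfolding elim_col_expand[OF S] by simp
qed

text \<open>A row below a bullet with a greater label is not used by \<open>D\<close> either, hence carries a bullet itself.\<close>

lemma bullet_row_up:
  assumes "j < b" "(b, j) \<in> MD" "L j < L b" "b < r" "r \<le> n" "L b < L r"
  shows "r \<notin> Cd"
proof
  assume r: "r \<in> Cd"
  have no: "\<forall>c\<le>j. (b, c) \<notin> D" "\<forall>b'\<ge>b. (b', j) \<notin> D" using assms M_col_iff[of b] by auto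
  then have "L b = b" using assms by (intro L_unused) auto
  then have "\<forall>c<j. (r, c) \<notin> D" using L_cases[of r] assms by auto
  then have "\<forall>c\<le>j. (r, c) \<notin> D" using no(2) assms by (auto simp: le_less)
  moreover have "\<forall>b'\<ge>r. (b', j) \<notin> D" using no(2) assms by auto
  ultimately show False using M_col_iff[of r] assms candD[OF r] by auto
qed

text \<open>Comparing column \<open>j\<close> in \<open>g x = y g\<close> gives \<open>y b j\<close> as \<open>x b j\<close> plus multiples of the entries \<open>x r j\<close> with
\<open>r > b\<close> and a greater label. If \<open>b\<close> carries a bullet or is a record, such an \<open>r\<close> is no candidate, and
the entry vanishes. This gives the first two claims. For the third, the elimination matrices \<open>A\<close> of \<open>x\<close>
and \<open>A'\<close> of \<open>y\<close> turn \<open>g\<close> into \<open>A'\<^sup>-\<^sup>1 g A\<close>. Columns of records in \<open>g A\<close> are columns of quotients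
of \<open>y\<close> because \<open>g\<close> carries column \<open>j\<close> of \<open>x\<close> to that of \<open>y\<close>; so \<open>A'\<^sup>-\<^sup>1\<close> makes the product compatible with
the new labels.\<close>

theorem elim_col_equivariant:
  fixes x y :: "nat \<Rightarrow> nat \<Rightarrow> 'k::field"
  assumes rel: "conj_rel j L x y"
    and zero: "\<And>b. j < b \<Longrightarrow> L j < L b \<Longrightarrow> (b, j) \<in> MD \<Longrightarrow> x b j = 0"
  shows "\<And>b. j < b \<Longrightarrow> L j < L b \<Longrightarrow> (b, j) \<in> MD \<Longrightarrow> y b j = 0"
    and "\<And>k. k \<in> Rc \<Longrightarrow> y k j = x k j"
    and "(\<And>k. k \<in> Rc \<Longrightarrow> y k j \<noteq> 0) \<Longrightarrow> conj_rel (Suc j) L' (elim_col x) (elim_col y)"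
proof -
  obtain g where g1: "\<And>p. g p p = 1"
    and gpat: "\<And>p q. p \<noteq> q \<Longrightarrow> g p q \<noteq> 0 \<Longrightarrow> j \<le> p \<and> p < q \<and> q \<le> n \<and> L p < L q"
    and geq: "\<And>b c. j \<le> c \<Longrightarrow> c < b \<Longrightarrow> b \<le> n \<Longrightarrow> L c < L b \<Longrightarrow> mm {j..n} g x b c = mm {j..n} y g b c"
    using rel unfolding conj_rel_def by blast
  have Sj: "{j..n} = insert j S" "j \<notin> S" using j by auto
  have split: "mm {j..n} f h b c = f b j * h j c + mm S f h b c" for f h :: "nat \<Rightarrow> nat \<Rightarrow> 'k" and b c
    unfolding mm_def Sj(1) using Sj(2) by simp
  have gbj: "g b j = 0" if "j < b" for b using gpat[of b j] that by force
  have colj: "y b j = mm S g x b j" if "j < b" "b \<le> n" "L j < L b" for b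
  proof -
    have "mm S y g b j = 0" unfolding mm_def using gbj by (intro sum.neutral) auto
    then have "mm {j..n} y g b j = y b j" unfolding split by (simp add: g1)
    then show ?thesis using geq[of j b] that gbj[of b] unfolding split[of g x] by simp
  qed
  have xM: "x b j = 0" if "j < b" "b \<le> n" "L j < L b" "b \<notin> Cd" for b
    using zero[of b] candI[of b] that by blast
  have single: "mm S g x b j = x b j" if "j < b" "b \<le> n" "\<And>r. b < r \<Longrightarrow> r \<le> n \<Longrightarrow> L b < L r \<Longrightarrow> x r j = 0" for b
  proof -
    have "mm S g x b j = (\<Sum>r\<in>{b}. g b r * x r j)"
      unfolding mm_def
    proof (intro sum.mono_neutral_right ballI)
      fix r assume "r \<in> S - {b}"
      then show "g b r * x r j = 0" using that(3)[of r] gpat[of b r] by (cases "g b r = 0") auto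
    qed (use that in auto)
    then show ?thesis by (simp add: g1)
  qed
  show yzero: "y b j = 0" if "j < b" "L j < L b" "(b, j) \<in> MD" for b
  proof -
    have bn: "b \<le> n" using M_roots_pos[OF that(3)] by auto
    have "mm S g x b j = x b j" using that bn bullet_row_up[of b] xM by (intro single) auto
    then show ?thesis using colj[OF that(1) bn that(2)] zero[OF that] by simp
  qed
  have yM: "y b j = 0" if "j < b" "b \<le> n" "L j < L b" "b \<notin> Cd" for b
    using yzero[of b] candI[of b] that by blast
  show ypiv: "y k j = x k j" if "k \<in> Rc" for k
  proof -
    have k: "j < k" "k \<le> n" "L j < L k" using candD[OF rec_cand[OF that]] by auto
    have "x r j = 0" if "k < r" "r \<le> n" "L k < L r" for r
      using recs_desc[OF \<open>k \<in> Rc\<close>, of r] xM[of r] that k by force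
    then show ?thesis using single[of k] colj[of k] k by simp
  qed
  assume pivy: "\<And>k. k \<in> Rc \<Longrightarrow> y k j \<noteq> 0"
  have piv: "x k j \<noteq> 0" if "k \<in> Rc" for k using pivy ypiv that by simp
  define A where "A = col_mat x"
  define Q where "Q = row_mat x"
  define A' where "A' = col_mat y"
  define Q' where "Q' = row_mat y"
  define G where "G = mm S Q' (mm S g A)"
  define h where "h = (\<lambda>p c. if p = c then 1 else if p \<in> S \<and> c \<in> S then G p c else 0)"
  let ?y = "mm S g A"
  have Gsum: "G p c = ?y p c - (if p \<in> cleared_rows then y p j / y (pivot_row p) j * ?y (pivot_row p) c else 0)"
    if "p \<in> S" for p c unfolding G_def Q'_def by (rule row_mat_sum[OF that])
  have yle: "?y p c = 0" if "c < p" for p c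
    unfolding mm_def
  proof (rule sum.neutral, rule ballI)
    fix m assume "m \<in> S"
    show "g p m * A m c = 0"
      using gpat[of p m] col_mat_le[of x m c] that by (cases "p = m"; cases "g p m = 0"; cases "A m c = 0") (auto simp: A_def)
  qed
  have yd: "?y c c = 1" if "c \<in> S" for c
  proof -
    have "?y c c = (\<Sum>m\<in>{c}. g c m * A m c)"
      unfolding mm_def using that
    proof (intro sum.mono_neutral_right ballI)
      fix m assume "m \<in> S - {c}"
      then show "g c m * A m c = 0" using gpat[of c m] col_mat_le[of x m c]
        by (cases "g c m = 0"; cases "A m c = 0") (auto simp: A_def)
    qed auto
    then show ?thesis by (simp add: g1 A_def col_mat_def)
  qed
  have ynonrec: "?y p c = g p c" if "c \<in> S" "c \<notin> Rc" for p c
    unfolding A_def by (rule col_mat_nonrec[OF that])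
  \<comment> \<open>above its threshold, the column of a record in \<open>g A\<close> is column \<open>j\<close> of \<open>g x\<close> divided by the pivot\<close>
  have yrec: "?y p c = y p j / y c j" if c: "c \<in> Rc" and p: "p \<in> S" "pv c < L p" for p c
  proof -
    have "g p m * A m c = g p m * x m j / x c j" if m: "m \<in> S" for m
    proof (cases "g p m = 0")
      case False
      then have Lm: "pv c < L m" using gpat[of p m] p by (cases "p = m") auto
      have "x m j = 0" if "m \<notin> Cd" using xM[of m] m that prv_ge[of c] Lm by auto
      then show ?thesis using Lm unfolding A_def col_mat_rec[of c x, OF c piv[OF c]] by auto
    qed simp
    then have "?y p c = (\<Sum>m\<in>S. g p m * x m j / x c j)" unfolding mm_def by (intro sum.cong) auto
    also have "\<dots> = mm S g x p j / x c j" by (simp add: mm_def sum_divide_distrib)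
    also have "\<dots> = y p j / y c j" using colj[of p] p prv_ge[of c] ypiv[OF c] by auto
    finally show ?thesis .
  qed
  have Gpat: "p < c \<and> L' p < L' c" if pc: "p \<in> S" "c \<in> S" "p \<noteq> c" "G p c \<noteq> 0" for p c
  proof (rule ccontr)
    assume neg: "\<not> (p < c \<and> L' p < L' c)"
    have kS: "pivot_row p \<in> S" "p < pivot_row p" "pivot_row p \<in> Rc" if "p \<in> cleared_rows"
      using cleared_pivot_row[OF that] rec_cand candS by auto
    have "G p c = 0"
    proof (cases "c < p")
      case True
      then show ?thesis using Gsum[OF pc(1)] yle[of c p] yle[of c "pivot_row p"] kS by auto
    next
      case False
      then have "L' c < L' p" using neg pc next_ord_inj by (metis inj_onD nat_neq_iff)
      show ?thesis
      proof (cases "c \<in> Rc")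
        case cR: False
        then have Lc: "L c < L' p" using \<open>L' c < L' p\<close> by (simp add: next_ord_def)
        have "L c < L p" using Lc prv_less[OF rec_cand[of p]] by (auto simp: next_ord_def split: if_splits)
        then have "g p c = 0" using gpat[of p c] pc by auto
        moreover have "g (pivot_row p) c = 0" if pK: "p \<in> cleared_rows"
        proof -
          have "L c < L (pivot_row p)"
          proof (cases "p \<in> Rc")
            case True
            then show ?thesis using pivot_row_rec[of p] pK Lc by (auto simp: cleared_rows_def next_ord_def)
          next
            case False
            then show ?thesis using pivot_row_nonrec[of p] pK \<open>L c < L p\<close> by (auto simp: cleared_rows_def)
          qed
          moreover have "pivot_row p \<noteq> c" using kS(3)[OF pK] cR by auto
          ultimately show ?thesis using gpat[of "pivot_row p" c] by auto
        qed
        ultimately show ?thesis unfolding Gsum[OF pc(1)] ynonrec[OF pc(2) cR] by simp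
      next
        case cR: True
        then have Lc: "pv c < L' p" using \<open>L' c < L' p\<close> by (simp add: next_ord_def)
        have Lp: "pv c < L p" using Lc prv_less[OF rec_cand[of p]] by (auto simp: next_ord_def split: if_splits)
        note yp = yrec[OF cR pc(1) Lp]
        show ?thesis
        proof (cases "p \<in> cleared_rows")
          case pK: True
          have "pv c < L (pivot_row p)" using pivot_row_thresh[OF pK cR] Lp pc by auto
          then have "?y (pivot_row p) c = y (pivot_row p) j / y c j" using yrec[OF cR kS(1)[OF pK]] by simp
          then show ?thesis unfolding Gsum[OF pc(1)] yp using pK pivy[OF kS(3)[OF pK]] by simp
        next
          case pK: False
          have "p \<notin> Cd" using first_rec_thresh[of p c] pK cR Lp pc by auto
          then have "y p j = 0" using yM[of p] pc Lp prv_ge[of c] by auto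
          then show ?thesis unfolding Gsum[OF pc(1)] yp using pK by simp
        qed
      qed
    qed
    then show False using pc by simp
  qed
  have Gd: "G c c = 1" if "c \<in> S" for c
    using Gsum[OF that, of c] yd[OF that] yle[of c "pivot_row c"] cleared_pivot_row[of c] by auto
  have hG: "h p c = G p c" if "p \<in> S" "c \<in> S" for p c using that Gd by (auto simp: h_def)
  have AQ: "mm S A Q b c = (if b = c then 1 else 0)" if "b \<in> S" "c \<in> S" for b c
    unfolding A_def Q_def by (rule mm_left_right_inverse[OF _ row_col_inverse[of x, OF piv]]) (use that in auto)
  have AQ': "mm S A' Q' b c = (if b = c then 1 else 0)" if "b \<in> S" "c \<in> S" for b c
    unfolding A'_def Q'_def by (rule mm_left_right_inverse[OF _ row_col_inverse[of y, OF pivy]]) (use that in auto)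
  have one: "mm S f e b c = f b c" if "\<And>b c. b \<in> S \<Longrightarrow> c \<in> S \<Longrightarrow> e b c = (if b = c then 1 else 0)" "c \<in> S"
    for f e :: "nat \<Rightarrow> nat \<Rightarrow> 'k" and b c
  proof -
    have "mm S f e b c = (\<Sum>r\<in>S. if r = c then f b r else 0)"
      unfolding mm_def using that by (intro sum.cong) auto
    then show ?thesis using that by simp
  qed
  have main: "mm S h (elim_col x) b c = mm S (elim_col y) h b c"
    if bc: "Suc j \<le> c" "c < b" "b \<le> n" "L' c < L' b" for b c
  proof -
    have bS: "b \<in> S" "c \<in> S" using bc by auto
    have "mm S h (elim_col x) b c = mm S G (elim_col x) b c" using bS by (intro mm_cong) (auto simp: hG)
    also have "\<dots> = mm S (mm S (mm S Q' g) (mm S A Q)) (mm S x A) b c"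
      unfolding G_def elim_col_def A_def[symmetric] Q_def[symmetric] by (simp add: mm_assoc)
    also have "\<dots> = mm S (mm S Q' g) (mm S x A) b c"
      by (intro mm_cong one AQ) auto
    also have "\<dots> = mm S Q' (mm S (mm S g x) A) b c" by (simp add: mm_assoc)
    finally have lhs: "mm S h (elim_col x) b c = mm S Q' (mm S (mm S g x) A) b c" .
    have "mm S (elim_col y) h b c = mm S (elim_col y) G b c" using bS by (intro mm_cong) (auto simp: hG)
    also have "\<dots> = mm S (mm S (mm S Q' y) (mm S A' Q')) (mm S g A) b c"
      unfolding G_def elim_col_def A'_def[symmetric] Q'_def[symmetric] by (simp add: mm_assoc)
    also have "\<dots> = mm S (mm S Q' y) (mm S g A) b c"
      by (intro mm_cong one AQ') auto
    also have "\<dots> = mm S Q' (mm S (mm S y g) A) b c" by (simp add: mm_assoc)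
    finally have rhs: "mm S (elim_col y) h b c = mm S Q' (mm S (mm S y g) A) b c" .
    define \<Delta> where "\<Delta> = (\<lambda>r p. mm S g x r p - mm S y g r p)"
    have dA: "mm S \<Delta> A r p = mm S (mm S g x) A r p - mm S (mm S y g) A r p" for r p
      by (simp add: mm_def \<Delta>_def left_diff_distrib sum_subtractf)
    \<comment> \<open>the defect of the relation on the smaller index set comes from the index \<open>j\<close>; the pivot rows clear it\<close>
    have delta: "\<Delta> r p = y r j * g j p" if "p \<in> S" "p < r" "r \<le> n" "L p < L r" for r p
    proof -
      have "mm {j..n} g x r p = mm {j..n} y g r p" using that by (intro geq) auto
      then show ?thesis using gbj[of r] that unfolding split \<Delta>_def by simp
    qed
    have gj: "g j p = 0" if "p \<in> S" "L p \<le> L j" for p using gpat[of j p] that by force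
    have yb0: "y r j * g j p = 0" if "r \<notin> Cd" "p \<in> S" "p < r" "r \<le> n" "L p < L r" for r p
      using yM[of r] gj[of p] that by (cases "L j < L r") auto
    have "mm S Q' (mm S \<Delta> A) b c = 0"
    proof (cases "c \<in> Rc")
      case cR: False
      then have Lc: "L c < L' b" using bc by (simp add: next_ord_def)
      have Lb: "L c < L b" using Lc prv_less[OF rec_cand[of b]] by (auto simp: next_ord_def split: if_splits)
      have db: "mm S \<Delta> A b c = y b j * g j c"
        unfolding A_def col_mat_nonrec[OF bS(2) cR] using delta[of c b] bc Lb bS by simp
      show ?thesis
      proof (cases "b \<in> cleared_rows")
        case bK: True
        have k: "pivot_row b \<in> Rc" "b < pivot_row b" "pivot_row b \<le> n" using cleared_pivot_row[OF bK] candD[OF rec_cand, of "pivot_row b"] by auto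
        have "L c < L (pivot_row b)"
        proof (cases "b \<in> Rc")
          case True then show ?thesis using pivot_row_rec[of b] bK Lc by (auto simp: cleared_rows_def next_ord_def)
        next
          case False then show ?thesis using pivot_row_nonrec[of b] bK Lb by (auto simp: cleared_rows_def)
        qed
        then have "mm S \<Delta> A (pivot_row b) c = y (pivot_row b) j * g j c"
          unfolding A_def col_mat_nonrec[OF bS(2) cR] using delta[of c "pivot_row b"] bc bS k by simp
        then show ?thesis unfolding Q'_def row_mat_sum[OF bS(1)] db using bK pivy[OF k(1)] by simp
      next
        case bK: False
        have "y b j * g j c = 0"
        proof (cases "b \<in> Cd")
          case True
          then have "b \<in> Rc" "pv b = L j" using bK by (auto simp: cleared_rows_def)
          then show ?thesis using Lc gj[OF bS(2)] by (simp add: next_ord_def)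
        next
          case False then show ?thesis using yb0[of b c] bS bc Lb by auto
        qed
        then show ?thesis unfolding Q'_def row_mat_sum[OF bS(1)] db using bK by simp
      qed
    next
      case cR: True
      then have Lc: "pv c < L' b" using bc by (simp add: next_ord_def)
      have Lb: "pv c < L b" using Lc prv_less[OF rec_cand[of b]] by (auto simp: next_ord_def split: if_splits)
      then have bC: "b \<notin> Cd" using rec_le[OF cR, of b] bc by auto
      then have bK: "b \<notin> cleared_rows" by (auto simp: cleared_rows_def)
      have "\<Delta> b m * A m c = 0" if m: "m \<in> S" for m
      proof (cases "A m c = 0")
        case False
        then have mC: "m \<in> Cd" "m \<le> c" using col_mat_le[of x m c] unfolding A_def col_mat_rec[of c x, OF cR piv[OF cR]]
          by (auto split: if_splits)
        then have Lm: "L m < L b" using bullet_above[of b m] bc bC Lb prv_ge[of c] by auto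
        then have "\<Delta> b m = y b j * g j m" using delta[OF m] mC bc by auto
        also have "\<dots> = 0" using yb0[of b m] bC m mC bc Lm by auto
        finally show ?thesis by simp
      qed simp
      then have "mm S \<Delta> A b c = 0" unfolding mm_def by (intro sum.neutral) auto
      then show ?thesis unfolding Q'_def row_mat_sum[OF bS(1)] using bK by simp
    qed
    then have "mm S Q' (mm S (mm S g x) A) b c = mm S Q' (mm S (mm S y g) A) b c"
      unfolding mm_def[of S Q'] dA by (simp add: right_diff_distrib sum_subtractf)
    then show ?thesis using lhs rhs by simp
  qed
  show "conj_rel (Suc j) L' (elim_col x) (elim_col y)"
    unfolding conj_rel_def
  proof (intro exI[of _ h] conjI allI impI)
    show "h p p = 1" for p by (simp add: h_def)
    fix p q assume "p \<noteq> q" "h p q \<noteq> 0"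
    then show "Suc j \<le> p" "p < q" "q \<le> n" "L' p < L' q" using Gpat[of p q] by (auto simp: h_def split: if_splits)
  next
    fix b c assume "Suc j \<le> c" "c < b" "b \<le> n" "L' c < L' b"
    then show "mm S h (elim_col x) b c = mm S (elim_col y) h b c" by (rule main)
  qed
qed

end

section \<open>The coadjoint action in coordinates\<close>

abbreviation ginv :: "'k::field mat \<Rightarrow> 'k mat" where "ginv h \<equiv> the (mat_inverse h)"

lemma UT_carrier: "g \<in> UT n \<Longrightarrow> g \<in> carrier_mat n n" by (simp add: UT_def)

lemma UT_upper: "g \<in> UT n \<Longrightarrow> upper_triangular g" by (simp add: UT_def)

lemma UT_iff: "g \<in> UT n \<longleftrightarrow> g \<in> carrier_mat n n \<and>
    (\<forall>i<n. \<forall>j<n. j \<le> i \<longrightarrow> g $$ (i, j) = (if i = j then 1 else 0))"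
  by (auto simp: UT_def upper_triangular_def)

lemma mat_mult_entry:
  assumes "A \<in> carrier_mat n n" "B \<in> carrier_mat n n" "i < n" "j < n"
  shows "(A * B) $$ (i, j) = (\<Sum>k<n. A $$ (i, k) * B $$ (k, j))"
  using assms by (simp add: scalar_prod_def atLeast0LessThan)

lemma UT_one: "1\<^sub>m n \<in> UT n" by (auto simp: UT_iff)

lemma upper_triangular_mult:
  assumes "A \<in> carrier_mat n n" "B \<in> carrier_mat n n" "upper_triangular A" "upper_triangular B"
  shows "upper_triangular (A * B)"
proof (rule upper_triangularI)
  fix i j assume ij: "j < i" "i < dim_row (A * B)"
  then have n: "i < n" "j < n" using assms by auto
  have "A $$ (i, k) * B $$ (k, j) = 0" if "k < n" for k
    using assms n ij that upper_triangularD[of A k i] upper_triangularD[of B j k] by (cases "k < i") auto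
  then show "(A * B) $$ (i, j) = 0" unfolding mat_mult_entry[OF assms(1,2) n] by simp
qed

lemma UT_mult: assumes "g \<in> UT n" "h \<in> UT n" shows "g * h \<in> UT n"
proof -
  note c = assms[THEN UT_carrier]
  have "(g * h) $$ (i, i) = 1" if "i < n" for i
  proof -
    have "g $$ (i, k) * h $$ (k, i) = (if k = i then 1 else 0)" if "k < n" for k
      using assms \<open>i < n\<close> that unfolding UT_iff by (cases k i rule: linorder_cases) auto
    then show ?thesis unfolding mat_mult_entry[OF c that that] using that by simp
  qed
  moreover have "upper_triangular (g * h)" using assms c by (intro upper_triangular_mult) (auto simp: UT_def)
  ultimately show ?thesis using c by (simp add: UT_def)
qed

text \<open>A unitriangular matrix has determinant \<open>1\<close>. That its inverse is unitriangular follows by comparing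
entries of \<open>h * ginv h\<close> from the bottom row upwards.\<close>

lemma UT_ginv:
  assumes h: "h \<in> UT n"
  shows "ginv h \<in> UT n" "h * ginv h = 1\<^sub>m n" "ginv h * h = 1\<^sub>m n"
proof -
  note c = UT_carrier[OF h]
  have "det h = prod_list (diag_mat h)" using h c by (intro det_upper_triangular) (auto simp: UT_def)
  also have "diag_mat h = map (\<lambda>_. 1) [0..<n]" using h c unfolding diag_mat_def by (auto simp: UT_def)
  also have "prod_list (map (\<lambda>_. 1 :: 'a) [0..<n]) = 1" by (induction n) auto
  finally have "det h \<noteq> 0" by simp
  then have "h \<in> Units (ring_mat TYPE('a) n (0::nat))" by (rule det_non_zero_imp_unit[OF c])
  then obtain B where B: "mat_inverse h = Some B" using mat_inverse(1)[OF c, of "0::nat"]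
    by (cases "mat_inverse h") auto
  then have inv: "h * B = 1\<^sub>m n" "B * h = 1\<^sub>m n" "B \<in> carrier_mat n n" using mat_inverse(2)[OF c B] by auto
  have "\<forall>j<n. j \<le> i \<longrightarrow> B $$ (i, j) = (if i = j then 1 else 0)" if "i < n" for i
    using that
  proof (induction "n - i" arbitrary: i rule: less_induct)
    case less
    show ?case
    proof (intro allI impI)
      fix j assume j: "j < n" "j \<le> i"
      have "h $$ (i, k) * B $$ (k, j) = (if k = i then B $$ (i, j) else 0)" if "k < n" for k
      proof (cases k i rule: linorder_cases)
        case greater
        then have "B $$ (k, j) = 0" using less.hyps[of k] less.prems that j by auto
        then show ?thesis using greater by simp
      qed (use h that less.prems in \<open>auto simp: UT_iff\<close>)
      then have "(h * B) $$ (i, j) = B $$ (i, j)"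
        unfolding mat_mult_entry[OF c inv(3) less.prems j(1)] using less.prems by simp
      then show "B $$ (i, j) = (if i = j then 1 else 0)" using inv(1) less.prems j by simp
    qed
  qed
  then have "B \<in> UT n" using inv by (simp add: UT_iff)
  then show "ginv h \<in> UT n" "h * ginv h = 1\<^sub>m n" "ginv h * h = 1\<^sub>m n" using B inv by simp_all
qed

lemma ginv_unique:
  assumes "h \<in> UT n" "k \<in> carrier_mat n n" "h * k = 1\<^sub>m n" shows "k = ginv h"
proof -
  note i = UT_ginv[OF assms(1)] and c = UT_carrier[OF assms(1)] UT_carrier[OF UT_ginv(1)[OF assms(1)]]
  have "k = (ginv h * h) * k" using i assms by simp
  also have "\<dots> = ginv h * (h * k)" using c assms by (intro assoc_mult_mat) auto
  finally show ?thesis using assms c by simp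
qed

lemma ginv_mult:
  assumes g: "g \<in> UT n" and h: "h \<in> UT n" shows "ginv (g * h) = ginv h * ginv g"
proof -
  note gi = UT_ginv[OF g] and hi = UT_ginv[OF h]
  note c = UT_carrier[OF g] UT_carrier[OF h] UT_carrier[OF gi(1)] UT_carrier[OF hi(1)]
  have "(g * h) * (ginv h * ginv g) = g * (h * (ginv h * ginv g))" using c by (intro assoc_mult_mat) auto
  also have "h * (ginv h * ginv g) = (h * ginv h) * ginv g" using c by (intro assoc_mult_mat[symmetric]) auto
  also have "g * ((h * ginv h) * ginv g) = 1\<^sub>m n" using gi hi c by simp
  finally show ?thesis using ginv_unique[OF UT_mult[OF g h], of "ginv h * ginv g"] c by simp
qed

lemma ginv_ginv: assumes "g \<in> UT n" shows "ginv (ginv g) = g"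
  using ginv_unique[OF UT_ginv(1)[OF assms] UT_carrier[OF assms] UT_ginv(3)[OF assms]] by simp

lemma lower_part_entry:
  "A \<in> carrier_mat n n \<Longrightarrow> i < n \<Longrightarrow> j < n \<Longrightarrow> lower_part A $$ (i, j) = (if j < i then A $$ (i, j) else 0)"
  by (simp add: lower_part_def)

lemma lower_part_carrier [simp]: "A \<in> carrier_mat n n \<Longrightarrow> lower_part A \<in> carrier_mat n n"
  by (simp add: lower_part_def)

lemma lower_part_strict: "A \<in> carrier_mat n n \<Longrightarrow> lower_part A \<in> strictly_lower n"
  by (auto simp: strictly_lower_def lower_part_entry)

lemma strictly_lower_carrier: "X \<in> strictly_lower n \<Longrightarrow> X \<in> carrier_mat n n"
  by (simp add: strictly_lower_def)

lemma lower_part_id: "X \<in> strictly_lower n \<Longrightarrow> lower_part X = X"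
  by (rule eq_matI) (auto simp: strictly_lower_def lower_part_def)

lemma lower_part_cong:
  assumes "A \<in> carrier_mat n n" "B \<in> carrier_mat n n"
    and "\<And>i j. j < i \<Longrightarrow> i < n \<Longrightarrow> A $$ (i, j) = B $$ (i, j)"
  shows "lower_part A = lower_part B"
  using assms by (intro eq_matI) (auto simp: lower_part_def)

text \<open>Multiplying by upper triangular matrices carries the part on and above the diagonal into itself.
This makes the left-right action an action.\<close>

lemma lower_part_absorb:
  fixes W :: "'k::field mat"
  assumes "g \<in> UT n" "h \<in> UT n" "W \<in> carrier_mat n n"
  shows "lower_part (g * lower_part W * h) = lower_part (g * W * h)"
proof (rule lower_part_cong)
  note c = UT_carrier[OF assms(1)] UT_carrier[OF assms(2)]
  show "g * lower_part W * h \<in> carrier_mat n n" "g * W * h \<in> carrier_mat n n" using c assms by auto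
  fix i j assume ij: "j < i" "i < n"
  have eq: "(g * lower_part W) $$ (i, k) = (g * W) $$ (i, k)" if k: "k < i" for k
  proof -
    have "g $$ (i, l) * lower_part W $$ (l, k) = g $$ (i, l) * W $$ (l, k)" if "l < n" for l
      using assms(1) that ij k by (cases "l < i") (auto simp: UT_iff lower_part_entry[OF assms(3)])
    moreover have kn: "k < n" using k ij by simp
    ultimately show ?thesis
      unfolding mat_mult_entry[OF c(1) lower_part_carrier[OF assms(3)] ij(2) kn]
        mat_mult_entry[OF c(1) assms(3) ij(2) kn] by (intro sum.cong) auto
  qed
  have "(g * lower_part W) $$ (i, k) * h $$ (k, j) = (g * W) $$ (i, k) * h $$ (k, j)" if "k < n" for k
    using assms(2) that ij eq[of k] by (cases "k < i") (auto simp: UT_iff)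
  then have "(\<Sum>k<n. (g * lower_part W) $$ (i, k) * h $$ (k, j)) = (\<Sum>k<n. (g * W) $$ (i, k) * h $$ (k, j))"
    by (intro sum.cong) auto
  moreover have jn: "j < n" using ij by simp
  moreover have "g * lower_part W \<in> carrier_mat n n" "g * W \<in> carrier_mat n n" using c assms by auto
  ultimately show "(g * lower_part W * h) $$ (i, j) = (g * W * h) $$ (i, j)"
    using mat_mult_entry[of "g * lower_part W" n h i j, OF _ c(2) ij(2) jn]
      mat_mult_entry[of "g * W" n h i j, OF _ c(2) ij(2) jn] by simp
qed

lemma left_right_act_strict:
  assumes "g \<in> UT n" "h \<in> UT n" "X \<in> carrier_mat n n"
  shows "left_right_act g h X \<in> strictly_lower n"
  unfolding left_right_act_def
  using UT_carrier[OF assms(1)] UT_carrier[OF UT_ginv(1)[OF assms(2)]] assms(3)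
  by (intro lower_part_strict) auto

lemma left_right_act_act:
  fixes X :: "'k::field mat"
  assumes "g \<in> UT n" "h \<in> UT n" "g' \<in> UT n" "h' \<in> UT n" "X \<in> carrier_mat n n"
  shows "left_right_act g h (left_right_act g' h' X) = left_right_act (g * g') (h * h') X"
proof -
  have c5: "X \<in> carrier_mat n n" by fact
  note cc = UT_carrier[OF assms(1)] UT_carrier[OF assms(3)] UT_carrier[OF UT_ginv(1)[OF assms(2)]]
    UT_carrier[OF UT_ginv(1)[OF assms(4)]]
  have "g * (g' * X * ginv h') * ginv h = (g * g') * X * (ginv h' * ginv h)"
    using cc c5 by (simp add: assoc_mult_mat[of _ n n _ n _ n])
  moreover have "g' * X * ginv h' \<in> carrier_mat n n" using cc c5 by auto
  ultimately show ?thesis unfolding left_right_act_def ginv_mult[OF assms(2,4)]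
    using lower_part_absorb[OF assms(1) UT_ginv(1)[OF assms(2)], of "g' * X * ginv h'"] by simp
qed

lemma coadjoint_left_right: "coadjoint_act g X = left_right_act g g X"
  by (simp add: coadjoint_act_def left_right_act_def)

lemma coadjoint_act_strict:
  "g \<in> UT n \<Longrightarrow> X \<in> carrier_mat n n \<Longrightarrow> coadjoint_act g X \<in> strictly_lower n"
  unfolding coadjoint_left_right by (rule left_right_act_strict)

lemma coadjoint_act_act:
  "g \<in> UT n \<Longrightarrow> h \<in> UT n \<Longrightarrow> X \<in> carrier_mat n n \<Longrightarrow>
    coadjoint_act g (coadjoint_act h X) = coadjoint_act (g * h) X"
  unfolding coadjoint_left_right by (rule left_right_act_act)

lemma ginv_one: "ginv (1\<^sub>m n :: 'k::field mat) = 1\<^sub>m n"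
  using ginv_unique[OF UT_one[of n], of "1\<^sub>m n :: 'k mat"] by simp

lemma coadjoint_act_one: "X \<in> strictly_lower n \<Longrightarrow> coadjoint_act (1\<^sub>m n) X = X"
  unfolding coadjoint_act_def ginv_one using strictly_lower_carrier[of X n] lower_part_id by simp

lemma coadjoint_act_inverse:
  assumes "g \<in> UT n" "X \<in> strictly_lower n"
  shows "coadjoint_act (ginv g) (coadjoint_act g X) = X" "coadjoint_act g (coadjoint_act (ginv g) X) = X"
  using assms UT_ginv[OF assms(1)] coadjoint_act_act[OF _ _ strictly_lower_carrier] coadjoint_act_one by metis+

lemma X_mat_carrier: "X_mat n D \<phi> \<in> carrier_mat n n" by (simp add: X_mat_def)

lemma basic_cell_strict: "X \<in> basic_cell n D \<Longrightarrow> X \<in> strictly_lower n"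
  unfolding basic_cell_def basic_variety_def by (auto intro: left_right_act_strict X_mat_carrier)

lemma basic_variety_invariant:
  "g \<in> UT n \<Longrightarrow> X \<in> basic_variety n D \<phi> \<Longrightarrow> coadjoint_act g X \<in> basic_variety n D \<phi>"
  unfolding basic_variety_def coadjoint_left_right
  using left_right_act_act[OF _ _ _ _ X_mat_carrier] UT_mult by fastforce

lemma basic_cell_invariant: "g \<in> UT n \<Longrightarrow> X \<in> basic_cell n D \<Longrightarrow> coadjoint_act g X \<in> basic_cell n D"
  unfolding basic_cell_def using basic_variety_invariant by blast

text \<open>Entries numbered from 1, as the roots are.\<close>

definition ent :: "'k mat \<Rightarrow> nat \<Rightarrow> nat \<Rightarrow> 'k" where "ent X b c = X $$ (b - 1, c - 1)"

lemma ent_mult: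
  assumes "A \<in> carrier_mat n n" "B \<in> carrier_mat n n" "b \<in> {1..n}" "c \<in> {1..n}"
  shows "ent (A * B) b c = mm {1..n} (ent A) (ent B) b c"
proof -
  have "ent (A * B) b c = (\<Sum>k<n. A $$ (b - 1, k) * B $$ (k, c - 1))"
    unfolding ent_def using assms by (intro mat_mult_entry) auto
  also have "\<dots> = (\<Sum>k\<in>{1..n}. ent A b k * ent B k c)"
    by (rule sum.reindex_bij_witness[of _ "\<lambda>k. k - 1" Suc]) (auto simp: ent_def)
  finally show ?thesis by (simp add: mm_def)
qed

lemma ent_lower: "A \<in> carrier_mat n n \<Longrightarrow> b \<in> {1..n} \<Longrightarrow> c \<in> {1..n} \<Longrightarrow>
    ent (lower_part A) b c = (if c < b then ent A b c else 0)"
  unfolding ent_def by (subst lower_part_entry) auto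

lemma ent_UT: "g \<in> UT n \<Longrightarrow> b \<in> {1..n} \<Longrightarrow> c \<in> {1..n} \<Longrightarrow> c \<le> b \<Longrightarrow> ent g b c = (if b = c then 1 else 0)"
  unfolding UT_iff ent_def by (auto simp: le_diff_conv)

lemma ent_strict: "X \<in> strictly_lower n \<Longrightarrow> b \<in> {1..n} \<Longrightarrow> c \<in> {1..n} \<Longrightarrow> b \<le> c \<Longrightarrow> ent X b c = 0"
  unfolding strictly_lower_def ent_def by auto

lemma lower_conj_entries:
  fixes W :: "'k::field mat"
  assumes gc: "g \<in> carrier_mat n n" "upper_triangular g" and W: "W \<in> carrier_mat n n"
    and bc: "1 \<le> c" "c < b" "b \<le> n"
  shows "mm {1..n} (ent g) (ent (lower_part W)) b c = ent (g * W) b c"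
    and "mm {1..n} (ent (lower_part W)) (ent g) b c = ent (W * g) b c"
proof -
  have b: "b \<in> {1..n}" "c \<in> {1..n}" using bc by auto
  have up: "ent g p q = 0" if "p \<in> {1..n}" "q \<in> {1..n}" "q < p" for p q
    using upper_triangularD[OF gc(2), of "q - 1" "p - 1"] gc(1) that by (auto simp: ent_def)
  show "mm {1..n} (ent g) (ent (lower_part W)) b c = ent (g * W) b c"
    unfolding ent_mult[OF gc(1) W b] mm_def
  proof (rule sum.cong[OF refl])
    fix r assume "r \<in> {1..n}"
    then show "ent g b r * ent (lower_part W) r c = ent g b r * ent W r c"
      using up[OF b(1), of r] ent_lower[OF W _ b(2), of r] bc by (cases "r < b") auto
  qed
  show "mm {1..n} (ent (lower_part W)) (ent g) b c = ent (W * g) b c"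
    unfolding ent_mult[OF W gc(1) b] mm_def
  proof (rule sum.cong[OF refl])
    fix r assume "r \<in> {1..n}"
    then show "ent (lower_part W) b r * ent g r c = ent W b r * ent g r c"
      using up[OF _ b(2), of r] ent_lower[OF W b(1), of r] bc by (cases "r < b") auto
  qed
qed

context basic_roots begin

lemma conj_relI:
  fixes g :: "'k::field mat"
  assumes g: "g \<in> UT n"
    and eq: "\<And>b c. 1 \<le> c \<Longrightarrow> c < b \<Longrightarrow> b \<le> n \<Longrightarrow> mm {1..n} (ent g) x b c = mm {1..n} y (ent g) b c"
  shows "conj_rel 1 (\<lambda>m. m) x y"
proof -
  define h where "h = (\<lambda>p q. if p = q then 1 else if p \<in> {1..n} \<and> q \<in> {1..n} then ent g p q else 0)"
  have h: "h p q = ent g p q" if "p \<in> {1..n}" "q \<in> {1..n}" for p q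
    using ent_UT[OF g] that by (auto simp: h_def)
  show ?thesis unfolding conj_rel_def
  proof (intro exI[of _ h] conjI allI impI)
    show "h p p = 1" for p by (simp add: h_def)
    fix p q assume pq: "p \<noteq> q" "h p q \<noteq> 0"
    then show "1 \<le> p" "q \<le> n" by (auto simp: h_def split: if_splits)
    show "p < q" "p < q" using pq ent_UT[OF g, of p q]
      by (cases "q \<le> p"; auto simp: h_def split: if_splits)+
  next
    fix b c assume bc: "1 \<le> c" "c < b" "b \<le> n"
    have "mm {1..n} h x b c = mm {1..n} (ent g) x b c" using bc by (intro mm_cong) (auto simp: h)
    also have "\<dots> = mm {1..n} y (ent g) b c" by (rule eq[OF bc])
    also have "\<dots> = mm {1..n} y h b c" using bc by (intro mm_cong) (auto simp: h)
    finally show "mm {1..n} h x b c = mm {1..n} y h b c" .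
  qed
qed

lemma coadjoint_act_entries:
  fixes X :: "'k::field mat"
  assumes g: "g \<in> UT n" and X: "X \<in> strictly_lower n" and bc: "1 \<le> c" "c < b" "b \<le> n"
  shows "mm {1..n} (ent g) (ent X) b c = mm {1..n} (ent (coadjoint_act g X)) (ent g) b c"
proof -
  note gc = UT_carrier[OF g] and gu = UT_upper[OF g] and ic = UT_carrier[OF UT_ginv(1)[OF g]] and Xc = strictly_lower_carrier[OF X]
  have W: "g * X * ginv g \<in> carrier_mat n n" using gc ic Xc by auto
  have "mm {1..n} (ent g) (ent X) b c = ent (g * X) b c"
    using lower_conj_entries(1)[OF gc gu Xc bc] lower_part_id[OF X] by simp
  also have "g * X = g * X * ginv g * g"
    using gc ic Xc UT_ginv(3)[OF g] by (simp add: assoc_mult_mat[of _ n n _ n _ n])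
  also have "ent (g * X * ginv g * g) b c = mm {1..n} (ent (coadjoint_act g X)) (ent g) b c"
    unfolding coadjoint_act_def by (rule lower_conj_entries(2)[OF gc gu W bc, symmetric])
  finally show ?thesis .
qed

lemma conj_rel_coadjoint:
  assumes "g \<in> UT n" "X \<in> strictly_lower n"
  shows "conj_rel 1 (\<lambda>m. m) (ent X) (ent (coadjoint_act g X))"
  using assms(1) coadjoint_act_entries[OF assms] by (rule conj_relI)

text \<open>The special representatives in the cell: the nonzero rows of \<open>X_mat\<close> are only changed to the right
of the root of \<open>D\<close>.\<close>

definition row_form :: "(root \<Rightarrow> 'k::field) \<Rightarrow> 'k mat \<Rightarrow> 'k mat" where
  "row_form \<phi> h = lower_part (X_mat n D \<phi> * h)"

text \<open>Every point \<open>g X k\<^sup>-\<^sup>1\<close> is conjugate under \<open>g\<close> to \<open>X (k\<^sup>-\<^sup>1 g)\<close>, modulo upper triangular matrices.\<close>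

lemma conj_rel_row_form:
  fixes X :: "'k::field mat"
  assumes "X \<in> basic_variety n D \<phi>"
  obtains h where "h \<in> UT n" "conj_rel 1 (\<lambda>m. m) (ent (row_form \<phi> h)) (ent X)"
proof -
  obtain g k where gk: "g \<in> UT n" "k \<in> UT n" "X = left_right_act g k (X_mat n D \<phi>)"
    using assms unfolding basic_variety_def by auto
  let ?X = "X_mat n D \<phi>"
  note gc = UT_carrier[OF gk(1)] and ki = UT_ginv(1)[OF gk(2)]
  note kc = UT_carrier[OF ki] and Xc = X_mat_carrier[of n D \<phi>]
  have hU: "ginv k * g \<in> UT n" by (rule UT_mult[OF ki gk(1)])
  have "conj_rel 1 (\<lambda>m. m) (ent (row_form \<phi> (ginv k * g))) (ent X)"
  proof (rule conj_relI[OF gk(1)])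
    fix b c assume bc: "1 \<le> c" "c < b" "b \<le> n"
    have W: "?X * (ginv k * g) \<in> carrier_mat n n" "g * ?X * ginv k \<in> carrier_mat n n" using gc kc Xc by auto
    have "mm {1..n} (ent g) (ent (row_form \<phi> (ginv k * g))) b c = ent (g * (?X * (ginv k * g))) b c"
      unfolding row_form_def by (rule lower_conj_entries(1)[OF gc UT_upper[OF gk(1)] W(1) bc])
    also have "g * (?X * (ginv k * g)) = g * ?X * ginv k * g"
      using gc kc Xc by (simp add: assoc_mult_mat[of _ n n _ n _ n])
    also have "ent (g * ?X * ginv k * g) b c = mm {1..n} (ent X) (ent g) b c"
      unfolding gk(3) left_right_act_def by (rule lower_conj_entries(2)[OF gc UT_upper[OF gk(1)] W(2) bc, symmetric])
    finally show "mm {1..n} (ent g) (ent (row_form \<phi> (ginv k * g))) b c = mm {1..n} (ent X) (ent g) b c" .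
  qed
  then show ?thesis using that hU by blast
qed

lemma row_form_entry:
  assumes h: "h \<in> UT n" and bc: "1 \<le> c" "c < b" "b \<le> n"
  shows "ent (row_form \<phi> h) b c = (\<Sum>p\<in>{1..n}. (if (b, p) \<in> D then \<phi> (b, p) else 0) * ent h p c)"
proof -
  have b: "b \<in> {1..n}" "c \<in> {1..n}" using bc by auto
  have "ent (row_form \<phi> h) b c = ent (X_mat n D \<phi> * h) b c"
    unfolding row_form_def using ent_lower[OF _ b, of "X_mat n D \<phi> * h"] X_mat_carrier[of n D \<phi>] UT_carrier[OF h] bc by auto
  also have "\<dots> = (\<Sum>p\<in>{1..n}. ent (X_mat n D \<phi>) b p * ent h p c)"
    using ent_mult[OF X_mat_carrier UT_carrier[OF h] b] by (simp add: mm_def)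
  also have "\<dots> = (\<Sum>p\<in>{1..n}. (if (b, p) \<in> D then \<phi> (b, p) else 0) * ent h p c)"
    using b by (intro sum.cong) (auto simp: ent_def X_mat_def)
  finally show ?thesis .
qed

end

section \<open>The pivots\<close>

context basic_roots begin

text \<open>The matrix before column \<open>j\<close> is treated. Columns are numbered from 1, so that nothing happens
between \<open>j = 0\<close> and \<open>j = 1\<close>.\<close>

primrec elim :: "nat \<Rightarrow> (nat \<Rightarrow> nat \<Rightarrow> 'k::field) \<Rightarrow> nat \<Rightarrow> nat \<Rightarrow> 'k" where
  "elim 0 x = x"
| "elim (Suc j) x = (if j = 0 then x else column.elim_col n D j (col_ord j) (elim j x))"

lemma elim_1: "elim (Suc 0) x = x" by simp

lemma elim_Suc: "1 \<le> j \<Longrightarrow> elim (Suc j) x = column.elim_col n D j (col_ord j) (elim j x)" by simp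

declare elim.simps(2) [simp del]

definition pivots_nonzero :: "nat \<Rightarrow> (nat \<Rightarrow> nat \<Rightarrow> 'k::field) \<Rightarrow> bool" where
  "pivots_nonzero j x \<longleftrightarrow> (\<forall>c k. 1 \<le> c \<longrightarrow> c < j \<longrightarrow> k \<in> rec_at c \<longrightarrow> elim c x k c \<noteq> 0)"

text \<open>The eliminated matrix vanishes at the alive bullets, which is what \<open>elim_col_equivariant\<close> requires.\<close>

definition bullet_free :: "nat \<Rightarrow> (nat \<Rightarrow> nat \<Rightarrow> 'k::field) \<Rightarrow> bool" where
  "bullet_free j x \<longleftrightarrow> (\<forall>c b. 1 \<le> c \<longrightarrow> c < j \<longrightarrow> c < b \<longrightarrow> col_ord c c < col_ord c b \<longrightarrow> (b, c) \<in> MD \<longrightarrow> elim c x b c = 0)"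

lemma pivots_nonzero_mono: "pivots_nonzero j x \<Longrightarrow> i \<le> j \<Longrightarrow> pivots_nonzero i x" unfolding pivots_nonzero_def by auto

text \<open>Iteration of \<open>elim_col_equivariant\<close>.\<close>

lemma elim_equivariant:
  assumes "conj_rel 1 (\<lambda>m. m) x y" "1 \<le> j" "j \<le> Suc n" "pivots_nonzero j y" "bullet_free j x"
  shows "conj_rel j (col_ord j) (elim j x) (elim j y) \<and> bullet_free j y \<and>
    (\<forall>c k. 1 \<le> c \<longrightarrow> c < j \<longrightarrow> k \<in> rec_at c \<longrightarrow> elim c y k c = elim c x k c)"
  using assms(2,3,4,5)
proof (induction j rule: nat_induct_at_least)
  case base
  then show ?case using assms(1) by (auto simp: col_ord_1 elim_1 bullet_free_def)
next
  case (Suc j)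
  interpret column n D j "col_ord j" using column_ord Suc by auto
  have IH: "conj_rel j (col_ord j) (elim j x) (elim j y)" "bullet_free j y"
    "\<And>c k. 1 \<le> c \<Longrightarrow> c < j \<Longrightarrow> k \<in> rec_at c \<Longrightarrow> elim c y k c = elim c x k c"
    using Suc pivots_nonzero_mono[of "Suc j" y j] by (auto simp: bullet_free_def)
  have z: "elim j x b j = 0" if "j < b" "col_ord j j < col_ord j b" "(b, j) \<in> MD" for b
    using Suc.prems Suc.hyps that unfolding bullet_free_def by auto
  have p: "elim j y k j \<noteq> 0" if "k \<in> Rc" for k using Suc.prems Suc.hyps that unfolding pivots_nonzero_def by auto
  have eq1: "elim j y b j = 0" if "j < b" "col_ord j j < col_ord j b" "(b, j) \<in> MD" for b
    by (rule elim_col_equivariant(1)[OF IH(1)]) (use z that in blast)+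
  have eq2: "elim j y k j = elim j x k j" if "k \<in> Rc" for k
    by (rule elim_col_equivariant(2)[OF IH(1)]) (use z that in blast)+
  have eq3: "conj_rel (Suc j) L' (elim_col (elim j x)) (elim_col (elim j y))"
    by (rule elim_col_equivariant(3)[OF IH(1)]) (use z p in blast)+
  have "bullet_free (Suc j) y"
    unfolding bullet_free_def
  proof (intro allI impI)
    fix c b assume "1 \<le> c" "c < Suc j" "c < b" "col_ord c c < col_ord c b" "(b, c) \<in> MD"
    then show "elim c y b c = 0" using IH(2) eq1[of b] by (cases "c = j") (auto simp: bullet_free_def)
  qed
  moreover have "elim c y k c = elim c x k c" if "1 \<le> c" "c < Suc j" "k \<in> rec_at c" for c k
    using that IH(3) eq2[of k] by (cases "c = j") auto
  moreover have "conj_rel (Suc j) (col_ord (Suc j)) (elim (Suc j) x) (elim (Suc j) y)"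
    using eq3 Suc.hyps by (simp add: elim_Suc col_ord.simps(2))
  ultimately show ?case by blast
qed

lemma elim_triangular:
  assumes "1 \<le> j" "j \<le> Suc n" "j \<le> c" "c < b" "b \<le> n"
    and "\<And>r p. 1 \<le> p \<Longrightarrow> p < r \<Longrightarrow> r \<le> n \<Longrightarrow> p < c \<or> p = c \<and> b < r \<Longrightarrow> x r p = y r p"
  shows "elim j x b c - x b c = elim j y b c - y b c"
  using assms
proof (induction j arbitrary: b c rule: nat_induct_at_least)
  case base then show ?case by (simp add: elim_1)
next
  case (Suc j)
  interpret column n D j "col_ord j" using column_ord Suc by auto
  have "elim j x r p = elim j y r p" if "p < r" "r \<le> n" "j \<le> p" "p < c \<or> p = c \<and> b < r" for r p
  proof -
    have "x r p = y r p" using that Suc.hyps Suc.prems by auto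
    moreover have "elim j x r p - x r p = elim j y r p - y r p"
      using that Suc.prems by (intro Suc.IH) auto
    ultimately show ?thesis by simp
  qed
  then have "elim (Suc j) x b c - elim j x b c = elim (Suc j) y b c - elim j y b c"
    unfolding elim_Suc[OF Suc.hyps] using Suc.prems by (intro elim_col_triangular) auto
  moreover have "elim j x b c - x b c = elim j y b c - y b c"
    using Suc.prems by (intro Suc.IH) auto
  ultimately have "(elim (Suc j) x b c - elim j x b c) + (elim j x b c - x b c) =
      (elim (Suc j) y b c - elim j y b c) + (elim j y b c - y b c)" by simp
  then show ?case by simp
qed

text \<open>While row \<open>b\<close> vanishes to the left of column \<open>c\<close>, its multiples of pivot rows and the column
operations contribute nothing to the entry \<open>(b, c)\<close>.\<close>

lemma elim_row:
  fixes y :: "nat \<Rightarrow> nat \<Rightarrow> 'k::field"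
  assumes zero: "\<And>c'. 1 \<le> c' \<Longrightarrow> c' < c \<Longrightarrow> y b c' = 0"
    and "1 \<le> j" "j \<le> c" "c < b" "b \<le> n"
  shows "elim j y b c = y b c"
proof -
  have "elim j y b p = y b p" if "j \<le> p" "p \<le> c" for p
    using assms(2) that
  proof (induction j arbitrary: p rule: nat_induct_at_least)
    case base then show ?case by (simp add: elim_1)
  next
    case (Suc j)
    interpret column n D j "col_ord j" using column_ord Suc assms by auto
    have bS: "b \<in> S" "p \<in> S" using Suc.prems assms by auto
    have z: "elim j y b q = 0" if "j \<le> q" "q < p" for q
      using Suc.IH[of q] that Suc.prems Suc.hyps zero[of q] by auto
    have "elim (Suc j) y b p = mm S (row_mat (elim j y)) (mm S (elim j y) (col_mat (elim j y))) b p"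
      unfolding elim_Suc[OF Suc.hyps] elim_col_def by (simp add: mm_assoc)
    also have "\<dots> = mm S (elim j y) (col_mat (elim j y)) b p"
      unfolding row_mat_sum[OF bS(1)] using z[of j] Suc.prems by simp
    also have "\<dots> = (\<Sum>q\<in>{p}. elim j y b q * col_mat (elim j y) q p)"
      unfolding mm_def
    proof (intro sum.mono_neutral_right ballI)
      fix q assume q: "q \<in> S - {p}"
      show "elim j y b q * col_mat (elim j y) q p = 0"
        using z[of q] col_mat_le[of "elim j y" q p] q by (cases "q < p") auto
    qed (use bS in auto)
    also have "\<dots> = y b p" using Suc.IH[of p] Suc.prems by (simp add: col_mat_def)
    finally show ?case .
  qed
  then show ?thesis using assms by simp
qed

lemma row_form_props:
  fixes h :: "'k::field mat"
  assumes h: "h \<in> UT n"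
  shows "\<And>b c. 1 \<le> c \<Longrightarrow> c < b \<Longrightarrow> b \<le> n \<Longrightarrow> (\<And>c'. c' \<le> c \<Longrightarrow> (b, c') \<notin> D) \<Longrightarrow> ent (row_form \<phi> h) b c = 0"
    and "\<And>b c. (b, c) \<in> D \<Longrightarrow> ent (row_form \<phi> h) b c = \<phi> (b, c)"
proof -
  fix b c assume bc: "1 \<le> c" "c < b" "b \<le> n" and no: "\<And>c'. c' \<le> c \<Longrightarrow> (b, c') \<notin> D"
  have "(if (b, p) \<in> D then \<phi> (b, p) else 0) * ent h p c = 0" if "p \<in> {1..n}" for p
    using no[of p] ent_UT[OF h that, of c] bc by (cases "p \<le> c") auto
  then show "ent (row_form \<phi> h) b c = 0" unfolding row_form_entry[OF h bc] by (intro sum.neutral) auto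
next
  fix b c assume D: "(b, c) \<in> D"
  then have bc: "1 \<le> c" "c < b" "b \<le> n" using D_bounds by auto
  have "(if (b, p) \<in> D then \<phi> (b, p) else 0) * ent h p c = (if p = c then \<phi> (b, c) else 0)" if "p \<in> {1..n}" for p
  proof (cases "p = c")
    case True then show ?thesis using D ent_UT[OF h, of c c] bc by simp
  next
    case False
    then have "(b, p) \<notin> D" using D_row_unique[OF D, of p] by blast
    then show ?thesis using False by simp
  qed
  then show "ent (row_form \<phi> h) b c = \<phi> (b, c)" unfolding row_form_entry[OF h bc] using bc by simp
qed

text \<open>A row with a bullet is zero up to that place.\<close>

lemma bullet_free_row_form:
  fixes h :: "'k::field mat"
  assumes h: "h \<in> UT n" shows "bullet_free (Suc n) (ent (row_form \<phi> h))"
  unfolding bullet_free_def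
proof (intro allI impI)
  fix c b assume c: "1 \<le> c" "c < Suc n" "c < b" "(b, c) \<in> MD"
  have b: "b \<le> n" using M_roots_pos[OF c(4)] by auto
  have no: "\<And>c'. c' \<le> c \<Longrightarrow> (b, c') \<notin> D" using M_roots_iff[of c b] c b by auto
  have "elim c (ent (row_form \<phi> h)) b c = ent (row_form \<phi> h) b c"
    using no c b by (intro elim_row row_form_props(1)[OF h]) auto
  then show "elim c (ent (row_form \<phi> h)) b c = 0" using row_form_props(1)[OF h c(1) c(3) b] no by simp
qed

lemma elim_row_form_D:
  fixes h :: "'k::field mat"
  assumes h: "h \<in> UT n" and D: "(k, j) \<in> D"
  shows "elim j (ent (row_form \<phi> h)) k j = \<phi> (k, j)"
proof -
  have b: "1 \<le> j" "j < k" "k \<le> n" using D_bounds[OF D] by auto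
  have "\<And>c'. c' < j \<Longrightarrow> (k, c') \<notin> D" using D_row_unique[OF D] by (metis less_irrefl)
  then have no: "\<And>c'. c' < j \<Longrightarrow> (k, c') \<notin> D" by blast
  have "elim j (ent (row_form \<phi> h)) k j = ent (row_form \<phi> h) k j"
    using no b by (intro elim_row row_form_props(1)[OF h]) auto
  then show ?thesis using row_form_props(2)[OF h D] by simp
qed

lemma cell_bullet_free:
  fixes X :: "'k::field mat"
  assumes X: "X \<in> basic_variety n D \<phi>" and ns: "pivots_nonzero j (ent X)" and j: "1 \<le> j" "j \<le> Suc n"
  shows "bullet_free j (ent X)"
proof -
  obtain h where h: "h \<in> UT n" "conj_rel 1 (\<lambda>m. m) (ent (row_form \<phi> h)) (ent X)"
    by (rule conj_rel_row_form[OF X])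
  have bf: "bullet_free j (ent (row_form \<phi> h))"
    using bullet_free_row_form[OF h(1), of \<phi>] j unfolding bullet_free_def by auto
  note eq = elim_equivariant[OF h(2) j ns bf]
  show "bullet_free j (ent X)" using eq by blast
qed

lemma cell_elim_bullet:
  fixes X :: "'k::field mat"
  assumes X: "X \<in> basic_variety n D \<phi>" and ns: "pivots_nonzero j (ent X)" and j: "1 \<le> j" "j \<le> n"
    and b: "j < b" "col_ord j j < col_ord j b" "(b, j) \<in> MD"
  shows "elim j (ent X) b j = 0"
proof -
  interpret column n D j "col_ord j" using column_ord[OF j] .
  obtain h where h: "h \<in> UT n" "conj_rel 1 (\<lambda>m. m) (ent (row_form \<phi> h)) (ent X)"
    by (rule conj_rel_row_form[OF X])
  have bf: "bullet_free (Suc n) (ent (row_form \<phi> h))" by (rule bullet_free_row_form[OF h(1)])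
  then have bj: "bullet_free j (ent (row_form \<phi> h))" using j by (auto simp: bullet_free_def)
  have r: "conj_rel j (col_ord j) (elim j (ent (row_form \<phi> h))) (elim j (ent X))"
    using elim_equivariant[OF h(2) j(1) _ ns bj] j by auto
  have z: "elim j (ent (row_form \<phi> h)) b j = 0" if "j < b" "col_ord j j < col_ord j b" "(b, j) \<in> MD" for b
    using bf j that unfolding bullet_free_def by auto
  show ?thesis by (rule elim_col_equivariant(1)[OF r]) (use z b in blast)+
qed

lemma cell_elim_D:
  fixes X :: "'k::field mat"
  assumes X: "X \<in> basic_variety n D \<phi>" and ns: "pivots_nonzero j (ent X)" and D: "(k, j) \<in> D"
  shows "elim j (ent X) k j = \<phi> (k, j)"
proof -
  have j: "1 \<le> j" "j \<le> n" using D_bounds[OF D] by auto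
  interpret column n D j "col_ord j" using column_ord[OF j] .
  obtain h where h: "h \<in> UT n" "conj_rel 1 (\<lambda>m. m) (ent (row_form \<phi> h)) (ent X)"
    by (rule conj_rel_row_form[OF X])
  have bf: "bullet_free (Suc n) (ent (row_form \<phi> h))" by (rule bullet_free_row_form[OF h(1)])
  then have bj: "bullet_free j (ent (row_form \<phi> h))" using j by (auto simp: bullet_free_def)
  have r: "conj_rel j (col_ord j) (elim j (ent (row_form \<phi> h))) (elim j (ent X))"
    using elim_equivariant[OF h(2) j(1) _ ns bj] j by auto
  have z: "elim j (ent (row_form \<phi> h)) b j = 0" if "j < b" "col_ord j j < col_ord j b" "(b, j) \<in> MD" for b
    using bf j that unfolding bullet_free_def by auto
  have "elim j (ent X) k j = elim j (ent (row_form \<phi> h)) k j"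
    by (rule elim_col_equivariant(2)[OF r]) (use z D_in_recs[OF D] in blast)+
  then show ?thesis using elim_row_form_D[OF h(1) D, of \<phi>] by simp
qed

text \<open>On the cell the bullets vanish because they vanish on the special representatives, and then the
equivariance of the elimination applies to any two conjugate points.\<close>

lemma pivot_invariant:
  fixes X Y :: "'k::field mat"
  assumes X: "X \<in> basic_variety n D \<phi>" and rel: "conj_rel 1 (\<lambda>m. m) (ent X) (ent Y)"
    and ns: "pivots_nonzero j (ent X)" "pivots_nonzero j (ent Y)" and j: "1 \<le> j" "j \<le> n" and k: "k \<in> rec_at j"
  shows "elim j (ent Y) k j = elim j (ent X) k j"
proof -
  interpret column n D j "col_ord j" using column_ord[OF j] .
  have bj: "bullet_free j (ent X)" using cell_bullet_free[OF X ns(1)] j by auto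
  have r: "conj_rel j (col_ord j) (elim j (ent X)) (elim j (ent Y))"
    using elim_equivariant[OF rel j(1) _ ns(2) bj] j by auto
  have z: "elim j (ent X) b j = 0" if "j < b" "col_ord j j < col_ord j b" "(b, j) \<in> MD" for b
    by (rule cell_elim_bullet[OF X ns(1) j that])
  show ?thesis by (rule elim_col_equivariant(2)[OF r]) (use z k in blast)+
qed

end

section \<open>Nondegeneracy of the bracket on the places with a sign\<close>

lemma enum_mat_inverse:
  assumes S: "finite S" and e: "bij_betw e {0..<card S} S" and d: "det (enum_mat (card S) e f) \<noteq> (0::'k::field)"
  obtains g where "\<And>b c. b \<in> S \<Longrightarrow> c \<in> S \<Longrightarrow> mm S f g b c = (if b = c then 1 else 0)"
proof -
  let ?k = "card S"
  have "enum_mat ?k e f \<in> Units (ring_mat TYPE('k) ?k (0::nat))"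
    by (rule det_non_zero_imp_unit[OF _ d]) simp
  then obtain B where B: "mat_inverse (enum_mat ?k e f) = Some B"
    using mat_inverse(1)[of "enum_mat ?k e f" ?k "0::nat"] by (cases "mat_inverse (enum_mat ?k e f)") auto
  have inv: "enum_mat ?k e f * B = 1\<^sub>m ?k" "B \<in> carrier_mat ?k ?k"
    using mat_inverse(2)[OF _ B] by auto
  define i where "i = the_inv_into {0..<?k} e"
  have i: "i b < ?k" "e (i b) = b" if "b \<in> S" for b
    using e that the_inv_into_into[of e "{0..<?k}" b "{0..<?k}"] f_the_inv_into_f_bij_betw[OF e]
    unfolding i_def by (auto simp: bij_betw_def)
  have ie: "i (e t) = t" if "t < ?k" for t
    using e that unfolding i_def by (intro the_inv_into_f_f) (auto simp: bij_betw_def)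
  define g where "g = (\<lambda>b c. B $$ (i b, i c))"
  have "mm S f g b c = (if b = c then 1 else 0)" if bc: "b \<in> S" "c \<in> S" for b c
  proof -
    have "(enum_mat ?k e f * B) $$ (i b, i c) = (\<Sum>t\<in>{0..<?k}. f (e (i b)) (e t) * B $$ (t, i c))"
      using i[OF bc(1)] i[OF bc(2)] inv(2) by (simp add: enum_mat_def scalar_prod_def)
    also have "\<dots> = (\<Sum>t\<in>{0..<?k}. f b (e t) * g (e t) c)"
      using i[OF bc(1)] by (intro sum.cong) (auto simp: g_def ie)
    also have "\<dots> = mm S f g b c" unfolding mm_def by (rule sum.reindex_bij_betw[OF e])
    finally have "mm S f g b c = (1\<^sub>m ?k) $$ (i b, i c)" using inv by simp
    also have "\<dots> = (if b = c then 1 else 0)" using i[OF bc(1)] i[OF bc(2)] by (metis index_one_mat(1))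
    finally show ?thesis .
  qed
  then show ?thesis using that by blast
qed

definition injective_on :: "'i set \<Rightarrow> ('i \<Rightarrow> 'i \<Rightarrow> 'k::field) \<Rightarrow> bool" where
  "injective_on S f \<longleftrightarrow> (\<forall>u. (\<forall>a\<in>S. (\<Sum>b\<in>S. f a b * u b) = 0) \<longrightarrow> (\<forall>b\<in>S. u b = 0))"

lemma injective_on_iff_det:
  assumes S: "finite S" and e: "bij_betw e {0..<card S} S"
  shows "injective_on S f \<longleftrightarrow> det (enum_mat (card S) e f) \<noteq> (0::'k::field)"
proof
  assume inj: "injective_on S f"
  let ?k = "card S"
  have ie: "the_inv_into {0..<?k} e (e t) = t" if "t < ?k" for t
    using e that by (intro the_inv_into_f_f) (auto simp: bij_betw_def)
  show "det (enum_mat ?k e f) \<noteq> 0"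
  proof
    assume "det (enum_mat ?k e f) = 0"
    then obtain v where v: "v \<in> carrier_vec ?k" "v \<noteq> 0\<^sub>v ?k" "enum_mat ?k e f *\<^sub>v v = 0\<^sub>v ?k"
      using det_0_iff_vec_prod_zero_field[of "enum_mat ?k e f" ?k] by auto
    define u where "u = (\<lambda>b. v $ the_inv_into {0..<?k} e b)"
    have "(\<Sum>b\<in>S. f a b * u b) = 0" if "a \<in> S" for a
    proof -
      have "a \<in> e ` {0..<?k}" using that e by (simp add: bij_betw_def)
      then obtain i where i: "i < ?k" "a = e i" by auto
      have "(\<Sum>b\<in>S. f a b * u b) = (\<Sum>t\<in>{0..<?k}. f a (e t) * u (e t))"
        by (rule sum.reindex_bij_betw[OF e, symmetric])
      also have "\<dots> = (enum_mat ?k e f *\<^sub>v v) $ i"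
        using i v(1) by (auto simp: enum_mat_def scalar_prod_def u_def ie intro!: sum.cong)
      finally show ?thesis using v(3) i by simp
    qed
    then have "u b = 0" if "b \<in> S" for b using inj that unfolding injective_on_def by blast
    moreover have "v $ t = u (e t)" "e t \<in> S" if "t < ?k" for t
      using ie[OF that] e that by (auto simp: u_def bij_betw_def)
    ultimately have "v = 0\<^sub>v ?k" using v(1) by (intro eq_vecI) auto
    then show False using v(2) by simp
  qed
next
  assume "det (enum_mat (card S) e f) \<noteq> 0"
  then obtain g where g: "\<And>b c. b \<in> S \<Longrightarrow> c \<in> S \<Longrightarrow> mm S f g b c = (if b = c then 1 else 0)"
    using enum_mat_inverse[OF S e] by metis
  note gf = mm_left_right_inverse[OF S g]
  show "injective_on S f" unfolding injective_on_def
  proof (intro allI impI ballI)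
    fix u b assume u: "\<forall>a\<in>S. (\<Sum>b\<in>S. f a b * u b) = 0" and b: "b \<in> S"
    have "u b = (\<Sum>c\<in>S. if b = c then u c else 0)" using S b by simp
    also have "\<dots> = (\<Sum>c\<in>S. mm S g f b c * u c)" using gf[OF _ _ b] by (intro sum.cong) auto
    also have "\<dots> = (\<Sum>c\<in>S. \<Sum>r\<in>S. g b r * f r c * u c)" by (simp add: mm_def sum_distrib_right)
    also have "\<dots> = (\<Sum>r\<in>S. \<Sum>c\<in>S. g b r * f r c * u c)" by (rule sum.swap)
    also have "\<dots> = (\<Sum>r\<in>S. g b r * (\<Sum>c\<in>S. f r c * u c))" by (simp add: sum_distrib_left mult.assoc)
    also have "\<dots> = 0" using u by simp
    finally show "u b = 0" .
  qed
qed

text \<open>The determinant of \<open>P + r Q\<close> is a polynomial in \<open>r\<close> that does not vanish at \<open>0\<close>.\<close>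

lemma injective_on_perturb:
  fixes P Q :: "'i \<Rightarrow> 'i \<Rightarrow> 'k::field_char_0"
  assumes S: "finite S" and inj: "injective_on S P"
  obtains r where "r \<noteq> 0" "injective_on S (\<lambda>a b. P a b + r * Q a b)"
proof -
  obtain e where e: "bij_betw e {0..<card S} S" using ex_bij_betw_nat_finite[OF S] by blast
  define p where "p = det (enum_mat (card S) e (\<lambda>a b. [:P a b, Q a b:]))"
  have p: "poly p r = det (enum_mat (card S) e (\<lambda>a b. P a b + r * Q a b))" for r
  proof -
    interpret h: comm_ring_hom "\<lambda>q. poly q r" by unfold_locales auto
    have "poly p r = det (map_mat (\<lambda>q. poly q r) (enum_mat (card S) e (\<lambda>a b. [:P a b, Q a b:])))"
      unfolding p_def by (rule h.hom_det[symmetric])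
    also have "map_mat (\<lambda>q. poly q r) (enum_mat (card S) e (\<lambda>a b. [:P a b, Q a b:])) =
        enum_mat (card S) e (\<lambda>a b. P a b + r * Q a b)" by (rule eq_matI) (auto simp: enum_mat_def)
    finally show ?thesis .
  qed
  have "poly p 0 \<noteq> 0" using inj injective_on_iff_det[OF S e, where f = P] unfolding p by simp
  then have "p \<noteq> 0" by auto
  then have "finite {r. poly p r = 0}" by (rule poly_roots_finite)
  then have "finite (insert 0 {r. poly p r = 0})" by simp
  then obtain r where "r \<notin> insert 0 {r. poly p r = 0}" using infinite_UNIV_char_0 by (meson ex_new_if_finite)
  then show ?thesis using that[of r] p[of r] injective_on_iff_det[OF S e, where f = "\<lambda>a b. P a b + r * Q a b"] by auto
qed

text \<open>The coefficient of \<open>u\<^sub>\<beta>\<close> in the place \<open>\<eta>\<close> of \<open>u x - x u\<close>, where the entry of \<open>u\<close> at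
\<open>(a, b)\<close> is indexed by the root \<open>\<beta> = (b, a)\<close>.\<close>

definition bracket :: "(nat \<Rightarrow> nat \<Rightarrow> 'k::field) \<Rightarrow> root \<Rightarrow> root \<Rightarrow> 'k" where
  "bracket x \<eta> \<beta> = (if snd \<beta> = fst \<eta> then x (fst \<beta>) (snd \<eta>) else 0)
     - (if fst \<beta> = snd \<eta> then x (fst \<eta>) (snd \<beta>) else 0)"

lemma diagram_step_filled: "d \<eta> = Some s \<Longrightarrow> greatest_root (empty_places n d) \<in> empty_places n d \<Longrightarrow>
    diagram_step n d \<eta> = Some s"
  unfolding diagram_step_def Let_def by (auto simp: empty_places_def)

context basic_roots begin

definition sign_places :: "root set" where "sign_places = pos_roots n - MD - C_set n D"

declare funpow.simps(2) [simp del]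

abbreviation diag_at :: "nat \<Rightarrow> diagram" where "diag_at i \<equiv> (diagram_step n ^^ i) (initial_diagram n D)"

lemma diag_step_facts:
  assumes n: "1 \<le> n" and ne: "empty_places n (diag_at i) \<noteq> {}"
  obtains k j where "1 \<le> j" "j < k" "k \<le> n" "(k, j) \<in> empty_places n (diag_at i)" "(k, j) \<in> C_set n D"
    "greatest_root (empty_places n (diag_at i)) = (k, j)"
    "\<forall>b c. diag_at (Suc i) (b, c) = (if (b, c) = (k, j) then Some Otimes
     else if c = j \<and> j < b \<and> b < k \<and> diag_at i (b, j) = None \<and> diag_at i (k, b) = None then Some PlusSign
     else if b = k \<and> j < c \<and> c < k \<and> diag_at i (c, j) = None \<and> diag_at i (k, c) = None then Some MinusSign
     else diag_at i (b, c))"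
proof -
  obtain j P where jP: "1 \<le> j" "j \<le> Suc n" "j \<le> n \<longrightarrow> P \<noteq> rec_at j" "j = Suc n \<longrightarrow> P = {}"
    "diagram_state j P (diag_at i)" using diagram_always_state[OF n] by blast
  have jn: "j \<le> n" using vacant_past jP ne by (cases "j = Suc n") auto
  interpret column n D j "col_ord j" using column_ord[OF jP(1) jn] .
  define k where "k = Max (rec_at j - P)"
  note st = diagram_state_step[OF jP(1) jn jP(5) jP(3)[rule_format, OF jn], folded k_def]
  have k: "j < k" "k \<le> n" using candD[OF rec_cand, of k] st(4) by auto
  have kk: "(k, j) \<in> empty_places n (diag_at i)"
  proof -
    have "k \<in> Cd" "k \<notin> P" using st(4) rec_cand by auto
    moreover have "\<forall>r\<in>P. k < r \<longrightarrow> col_ord j r < col_ord j k"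
      using recs_desc[of k] st(4) jP(5) rec_cand unfolding diagram_state_def by blast
    ultimately have "vacant j P k j" using candD[of k] by (auto simp: vacant_def)
    then have "diag_at i (k, j) = None" using diagram_stateD(2)[OF jP(5) jP(1) k] by simp
    then show ?thesis using k jP(1) by (auto simp: empty_places_def pos_roots_def)
  qed
  have "diag_at (Suc i) = diagram_step n (diag_at i)" by (simp add: funpow.simps(2))
  then show ?thesis
    using that[of j k] diagram_step_at[OF st(3) st(2) k jP(1)] jP(1) k kk st(3,4) C_set_eq[OF n] jn by auto
qed

lemma diag_filled_mono:
  assumes n: "1 \<le> n" and "diag_at i \<eta> = Some s" "i \<le> i'" shows "diag_at i' \<eta> = Some s"
  using assms(3)
proof (induction i' rule: dec_induct)
  case base then show ?case using assms by simp
next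
  case (step m)
  show ?case
  proof (cases "empty_places n (diag_at m) = {}")
    case True
    then have "diagram_step n (diag_at m) = diag_at m" by (subst diagram_step_def) simp
    then show ?thesis using step by (simp add: funpow.simps(2))
  next
    case False
    obtain k j where kj: "(k, j) \<in> empty_places n (diag_at m)" "greatest_root (empty_places n (diag_at m)) = (k, j)"
      by (rule diag_step_facts[OF n False])
    show ?thesis using diagram_step_filled[of "diag_at m" \<eta> s n] kj step by (simp add: funpow.simps(2))
  qed
qed

lemma filled_not_C:
  assumes n: "1 \<le> n" and "diag_at i \<eta> = Some s" "s \<noteq> Otimes" shows "\<eta> \<notin> C_set n D"
proof
  assume "\<eta> \<in> C_set n D"
  then have "\<exists>m. diag_at m \<eta> = Some Otimes" unfolding C_set_def by blast
  then obtain m where m: "diag_at m \<eta> = Some Otimes" ..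
  have "diag_at (max m i) \<eta> = Some Otimes" by (rule diag_filled_mono[OF n m]) simp
  moreover have "diag_at (max m i) \<eta> = Some s" by (rule diag_filled_mono[OF n assms(2)]) simp
  ultimately show False using assms(3) by simp
qed

definition open_signs :: "nat \<Rightarrow> root set" where
  "open_signs i = empty_places n (diag_at i) - C_set n D"

text \<open>Let the step treat \<open>(k, j)\<close>. With only the entry at \<open>(k, j)\<close> present, the bracket pairs each new \<open>+\<close> at \<open>(m, j)\<close>
with its \<open>-\<close> at \<open>(k, m)\<close> and vanishes otherwise. Giving this entry a dominating size \<open>1 / r\<close> and multiplying the rows of
the new signs by \<open>r\<close> yields a perturbation of a block triangular form, with the pairing on the
new signs and the given bracket on the later ones.\<close>

lemma open_signs_injective_step:
  fixes t' :: "nat \<Rightarrow> nat \<Rightarrow> 'k::field_char_0"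
  assumes n: "1 \<le> n" and ne: "empty_places n (diag_at i) \<noteq> {}"
    and supp: "\<And>b c. t' b c \<noteq> 0 \<longleftrightarrow> (b, c) \<in> C_set n D \<inter> empty_places n (diag_at (Suc i))"
    and inj: "injective_on (open_signs (Suc i)) (bracket t')"
  shows "\<exists>t. (\<forall>b c. t b c \<noteq> (0::'k) \<longleftrightarrow> (b, c) \<in> C_set n D \<inter> empty_places n (diag_at i)) \<and>
     injective_on (open_signs i) (bracket t)"
proof -
  obtain k j where kj: "1 \<le> j" "j < k" "k \<le> n" "(k, j) \<in> empty_places n (diag_at i)" "(k, j) \<in> C_set n D"
    "greatest_root (empty_places n (diag_at i)) = (k, j)"
    and "\<forall>b c. diag_at (Suc i) (b, c) = (if (b, c) = (k, j) then Some Otimes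
     else if c = j \<and> j < b \<and> b < k \<and> diag_at i (b, j) = None \<and> diag_at i (k, b) = None then Some PlusSign
     else if b = k \<and> j < c \<and> c < k \<and> diag_at i (c, j) = None \<and> diag_at i (k, c) = None then Some MinusSign
     else diag_at i (b, c))"
    by (rule diag_step_facts[OF n ne])
  note step = this(7)[rule_format]
  let ?d = "diag_at i" and ?d' = "diag_at (Suc i)" and ?C = "C_set n D"
  define A where "A = open_signs i"
  define A2 where "A2 = open_signs (Suc i)"
  define A1 where "A1 = {(m, j) | m. j < m \<and> m < k \<and> ?d (m, j) = None \<and> ?d (k, m) = None} \<union>
     {(k, m) | m. j < m \<and> m < k \<and> ?d (m, j) = None \<and> ?d (k, m) = None}"
  have fin: "finite A" by (rule finite_subset[of _ "{..n} \<times> {..n}"])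
    (auto simp: A_def open_signs_def empty_places_def pos_roots_def)
  have A1_sign: "?d' \<eta> = Some PlusSign \<or> ?d' \<eta> = Some MinusSign" if "\<eta> \<in> A1" for \<eta>
  proof -
    have "\<exists>m. (\<eta> = (m, j) \<or> \<eta> = (k, m)) \<and> j < m \<and> m < k \<and> ?d (m, j) = None \<and> ?d (k, m) = None"
      using that unfolding A1_def by auto
    then obtain m where m: "\<eta> = (m, j) \<or> \<eta> = (k, m)" "j < m" "m < k" "?d (m, j) = None" "?d (k, m) = None"
      by (elim exE conjE)
    have "?d' (m, j) = Some PlusSign" unfolding step using m by simp
    moreover have "?d' (k, m) = Some MinusSign" unfolding step using m by simp
    ultimately show ?thesis using m(1) by blast
  qed
  have A1_C: "\<eta> \<notin> ?C" if "\<eta> \<in> A1" for \<eta> using A1_sign[OF that] filled_not_C[OF n, of "Suc i" \<eta>] by auto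
  have A1_A: "A1 \<subseteq> A"
    using A1_C kj by (auto simp: A_def open_signs_def A1_def empty_places_def pos_roots_def)
  have A_split: "\<eta> \<in> A \<longleftrightarrow> \<eta> \<in> A1 \<or> \<eta> \<in> A2" for \<eta>
  proof -
    obtain b c where bc: "\<eta> = (b, c)" by force
    have "?d' \<eta> = None \<longleftrightarrow> ?d \<eta> = None \<and> \<eta> \<noteq> (k, j) \<and> \<eta> \<notin> A1"
      unfolding bc step A1_def by auto
    then show ?thesis using A1_A kj(5) by (auto simp: A_def A2_def open_signs_def empty_places_def)
  qed
  have disj: "\<eta> \<notin> A2" if "\<eta> \<in> A1" for \<eta>
    using A1_sign[OF that] by (auto simp: A2_def open_signs_def empty_places_def)
  define \<delta> where "\<delta> = (\<lambda>b c. if (b, c) = (k, j) then 1 else (0::'k))"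
  have AE: "?d \<eta> = None" "fst \<eta> > snd \<eta>" if "\<eta> \<in> A" for \<eta>
    using that by (auto simp: A_def open_signs_def empty_places_def pos_roots_def)
  have \<delta>A: "bracket \<delta> \<alpha> \<beta> = (if snd \<alpha> = j \<and> \<alpha> \<in> A1 \<and> \<beta> = (k, fst \<alpha>) then 1
      else if fst \<alpha> = k \<and> \<alpha> \<in> A1 \<and> \<beta> = (snd \<alpha>, j) then - 1 else 0)" if ab: "\<alpha> \<in> A" "\<beta> \<in> A" for \<alpha> \<beta>
  proof -
    obtain p q where a: "\<alpha> = (p, q)" by force
    obtain b a where b: "\<beta> = (b, a)" by force
    have pq: "q < p" "?d (p, q) = None" "a < b" "?d (b, a) = None" using AE ab a b by auto
    have "snd \<beta> = fst \<alpha> \<and> (fst \<beta>, snd \<alpha>) = (k, j) \<longleftrightarrow> snd \<alpha> = j \<and> \<alpha> \<in> A1 \<and> \<beta> = (k, fst \<alpha>)"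
      using pq by (auto simp: a b A1_def)
    moreover have "fst \<beta> = snd \<alpha> \<and> (fst \<alpha>, snd \<beta>) = (k, j) \<longleftrightarrow> fst \<alpha> = k \<and> \<alpha> \<in> A1 \<and> \<beta> = (snd \<alpha>, j)"
      using pq by (auto simp: a b A1_def)
    moreover have "\<not> (snd \<beta> = fst \<alpha> \<and> fst \<beta> = snd \<alpha>)" using pq by (auto simp: a b)
    ultimately show ?thesis unfolding bracket_def \<delta>_def by auto
  qed
  \<comment> \<open>after multiplication of the rows in \<open>A1\<close> by \<open>r\<close>, the bracket of \<open>t' + \<delta> / r\<close> becomes \<open>P + r Q\<close>\<close>
  define P where "P = (\<lambda>\<alpha> \<beta>. if \<alpha> \<in> A1 then bracket \<delta> \<alpha> \<beta> else bracket t' \<alpha> \<beta>)"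
  define Q where "Q = (\<lambda>\<alpha> \<beta>. if \<alpha> \<in> A1 then bracket t' \<alpha> \<beta> else 0)"
  have "injective_on A P"
    unfolding injective_on_def
  proof (intro allI impI)
    fix u assume u: "\<forall>a\<in>A. (\<Sum>b\<in>A. P a b * u b) = 0"
    have u1: "u \<beta> = 0" if "\<beta> \<in> A1" for \<beta>
    proof -
      from that consider m where "\<beta> = (k, m)" "(m, j) \<in> A1" "(k, m) \<in> A1" | m where "\<beta> = (m, j)" "(m, j) \<in> A1" "(k, m) \<in> A1" "m < k"
        unfolding A1_def by auto
      then show ?thesis
      proof cases
        case 1
        have mk: "m \<noteq> k" "m \<noteq> j" using 1 unfolding A1_def by auto
        have "0 = (\<Sum>b\<in>A. P (m, j) b * u b)" using u A1_A 1 by auto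
        also have "\<dots> = (\<Sum>b\<in>A. if b = (k, m) then u b else 0)"
        proof (rule sum.cong[OF refl])
          fix b assume "b \<in> A"
          then have "bracket \<delta> (m, j) b = (if b = (k, m) then 1 else 0)" using \<delta>A[of "(m, j)" b] 1 A1_A mk by auto
          then show "P (m, j) b * u b = (if b = (k, m) then u b else 0)" using 1 by (simp add: P_def)
        qed
        also have "\<dots> = u (k, m)" using 1 A1_A fin by auto
        finally show ?thesis using 1 by simp
      next
        case 2
        have mk: "m \<noteq> j" using 2 unfolding A1_def by auto
        have "0 = (\<Sum>b\<in>A. P (k, m) b * u b)" using u A1_A 2 by auto
        also have "\<dots> = (\<Sum>b\<in>A. if b = (m, j) then - u b else 0)"
        proof (rule sum.cong[OF refl])
          fix b assume "b \<in> A"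
          then have "bracket \<delta> (k, m) b = (if b = (m, j) then - 1 else 0)" using \<delta>A[of "(k, m)" b] 2 A1_A mk by auto
          then show "P (k, m) b * u b = (if b = (m, j) then - u b else 0)" using 2 by (simp add: P_def)
        qed
        also have "\<dots> = - u (m, j)" using 2 A1_A fin by auto
        finally show ?thesis using 2 by simp
      qed
    qed
    have "(\<Sum>b\<in>A2. bracket t' a b * u b) = 0" if a: "a \<in> A2" for a
    proof -
      have "0 = (\<Sum>b\<in>A. P a b * u b)" using u A_split a by auto
      also have "\<dots> = (\<Sum>b\<in>A2. P a b * u b)"
        using fin A_split u1 by (intro sum.mono_neutral_right) auto
      also have "\<dots> = (\<Sum>b\<in>A2. bracket t' a b * u b)" using disj[of a] a by (intro sum.cong refl) (auto simp: P_def)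
      finally show ?thesis by simp
    qed
    then have "\<forall>b\<in>A2. u b = 0" using inj unfolding injective_on_def A2_def by blast
    then show "\<forall>b\<in>A. u b = 0" using u1 A_split by blast
  qed
  from fin this obtain r where r: "r \<noteq> 0" "injective_on A (\<lambda>a b. P a b + r * Q a b)"
    by (rule injective_on_perturb)
  define t where "t = (\<lambda>b c. t' b c + (1 / r) * \<delta> b c)"
  have bt: "bracket t \<alpha> \<beta> = bracket t' \<alpha> \<beta> + (1 / r) * bracket \<delta> \<alpha> \<beta>" for \<alpha> \<beta>
    by (simp add: bracket_def t_def algebra_simps)
  have "injective_on A (bracket t)"
    unfolding injective_on_def
  proof (intro allI impI)
    fix u assume u: "\<forall>a\<in>A. (\<Sum>b\<in>A. bracket t a b * u b) = 0"
    have "(\<Sum>b\<in>A. (P a b + r * Q a b) * u b) = 0" if a: "a \<in> A" for a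
    proof (cases "a \<in> A1")
      case True
      have "(P a b + r * Q a b) * u b = r * (bracket t a b * u b)" for b
        using True r by (simp add: P_def Q_def bt field_simps)
      then have "(\<Sum>b\<in>A. (P a b + r * Q a b) * u b) = (\<Sum>b\<in>A. r * (bracket t a b * u b))"
        by (intro sum.cong refl)
      also have "\<dots> = r * (\<Sum>b\<in>A. bracket t a b * u b)" by (rule sum_distrib_left[symmetric])
      finally show ?thesis using u a by simp
    next
      case False
      have "(\<Sum>b\<in>A. (P a b + r * Q a b) * u b) = (\<Sum>b\<in>A. bracket t a b * u b)"
        using False a by (intro sum.cong) (auto simp: P_def Q_def bt \<delta>A)
      then show ?thesis using u a by simp
    qed
    then show "\<forall>b\<in>A. u b = 0" using r(2) unfolding injective_on_def by blast
  qed
  moreover have "t b c \<noteq> 0 \<longleftrightarrow> (b, c) \<in> ?C \<inter> empty_places n ?d" for b c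
  proof (cases "(b, c) = (k, j)")
    case True
    have "?d' (k, j) \<noteq> None" unfolding step by simp
    then have "t' k j = 0" using supp[of k j] by (auto simp: empty_places_def)
    then show ?thesis using True kj r by (auto simp: t_def \<delta>_def)
  next
    case False
    have "(b, c) \<in> ?C \<Longrightarrow> (b, c) \<notin> A1" using A1_C by blast
    then have "(b, c) \<in> ?C \<Longrightarrow> ?d' (b, c) = ?d (b, c)" using False unfolding step A1_def by auto
    then show ?thesis using supp[of b c] False by (auto simp: t_def \<delta>_def empty_places_def)
  qed
  ultimately show ?thesis unfolding A_def by blast
qed

theorem sign_places_injective:
  assumes n: "1 \<le> n"
  obtains t :: "nat \<Rightarrow> nat \<Rightarrow> 'k::field_char_0"
  where "\<And>b c. t b c \<noteq> 0 \<longleftrightarrow> (b, c) \<in> C_set n D" "injective_on sign_places (bracket t)"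
proof -
  have "\<exists>N. diagram_state (Suc n) {} (diag_at N)" by (rule diagram_reaches[OF n]) simp_all
  then obtain N where "diagram_state (Suc n) {} (diag_at N)" ..
  then have N: "empty_places n (diag_at N) = {}" by (rule vacant_past)
  have ex: "\<exists>t::nat \<Rightarrow> nat \<Rightarrow> 'k. (\<forall>b c. t b c \<noteq> 0 \<longleftrightarrow> (b, c) \<in> C_set n D \<inter> empty_places n (diag_at i)) \<and>
      injective_on (open_signs i) (bracket t)" if "i \<le> N" for i
    using that
  proof (induction i rule: inc_induct)
    case base
    show ?case using N by (intro exI[of _ "\<lambda>b c. 0"]) (auto simp: open_signs_def injective_on_def)
  next
    case (step i)
    show ?case
    proof (cases "empty_places n (diag_at i) = {}")
      case True
      then show ?thesis by (intro exI[of _ "\<lambda>b c. 0"]) (auto simp: open_signs_def injective_on_def)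
    next
      case False
      then show ?thesis using step.IH open_signs_injective_step[OF n False] by blast
    qed
  qed
  obtain t :: "nat \<Rightarrow> nat \<Rightarrow> 'k" where t: "\<forall>b c. t b c \<noteq> 0 \<longleftrightarrow> (b, c) \<in> C_set n D \<inter> empty_places n (diag_at 0)"
    "injective_on (open_signs 0) (bracket t)" using ex[OF le0] by blast
  have e0: "empty_places n (diag_at 0) = pos_roots n - MD" by (auto simp: empty_places_def initial_diagram_def)
  have CM: "C_set n D \<subseteq> pos_roots n - MD"
  proof
    fix \<eta> assume a: "\<eta> \<in> C_set n D"
    then have "diag_at 0 \<eta> \<noteq> Some Bullet" using filled_not_C[OF n, of 0 \<eta> Bullet] by auto
    then show "\<eta> \<in> pos_roots n - MD" using a by (auto simp: initial_diagram_def C_set_def)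
  qed
  have "open_signs 0 = sign_places" unfolding open_signs_def e0 sign_places_def ..
  moreover have "C_set n D \<inter> empty_places n (diag_at 0) = C_set n D" unfolding e0 using CM by blast
  ultimately show ?thesis using that[of t] t by simp
qed

end

section \<open>Conjugation to matrices supported on the pivot places\<close>

lemma sum_root_split:
  fixes F :: "root \<Rightarrow> 'k::field"
  assumes "A \<subseteq> {1..n} \<times> {1..n}"
  shows "(\<Sum>\<beta>\<in>A. F \<beta>) = (\<Sum>b\<in>{1..n}. \<Sum>a\<in>{1..n}. if (b, a) \<in> A then F (b, a) else 0)"
proof -
  have "(\<Sum>\<beta>\<in>A. F \<beta>) = (\<Sum>\<beta>\<in>{1..n} \<times> {1..n}. if \<beta> \<in> A then F \<beta> else 0)"
    using assms by (intro sum.mono_neutral_cong_left) auto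
  also have "\<dots> = (\<Sum>b\<in>{1..n}. \<Sum>a\<in>{1..n}. if (b, a) \<in> A then F (b, a) else 0)"
    by (simp add: sum.cartesian_product split_def cong: if_cong)
  finally show ?thesis .
qed

context basic_roots begin

definition commutator :: "(nat \<Rightarrow> nat \<Rightarrow> 'k::field) \<Rightarrow> (nat \<Rightarrow> nat \<Rightarrow> 'k) \<Rightarrow> nat \<Rightarrow> nat \<Rightarrow> 'k" where
  "commutator u x b c = mm {1..n} u x b c - mm {1..n} x u b c"

definition strictly_upper :: "(nat \<Rightarrow> nat \<Rightarrow> 'k::field) \<Rightarrow> bool" where
  "strictly_upper u \<longleftrightarrow> (\<forall>a b. u a b \<noteq> 0 \<longrightarrow> 1 \<le> a \<and> a < b \<and> b \<le> n)"

text \<open>The order of the places in which the diagram is filled.\<close>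

definition before :: "nat \<Rightarrow> nat \<Rightarrow> nat \<Rightarrow> nat \<Rightarrow> bool" where
  "before b c k j \<longleftrightarrow> 1 \<le> c \<and> c < b \<and> b \<le> n \<and> (c < j \<or> c = j \<and> k < b)"

lemma comm_bracket:
  fixes w :: "root \<Rightarrow> 'k::field"
  assumes A: "A \<subseteq> pos_roots n" and pq: "p \<in> {1..n}" "q \<in> {1..n}"
  defines "u \<equiv> \<lambda>a b. if (b, a) \<in> A then w (b, a) else 0"
  shows "commutator u x p q = (\<Sum>\<beta>\<in>A. bracket x (p, q) \<beta> * w \<beta>)" and "strictly_upper u"
proof -
  have A': "A \<subseteq> {1..n} \<times> {1..n}" using A by (auto simp: pos_roots_def)
  have 1: "(\<Sum>\<beta>\<in>A. (if snd \<beta> = p then x (fst \<beta>) q else 0) * w \<beta>) = mm {1..n} u x p q"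
  proof -
    have "(\<Sum>\<beta>\<in>A. (if snd \<beta> = p then x (fst \<beta>) q else 0) * w \<beta>) =
      (\<Sum>b\<in>{1..n}. \<Sum>a\<in>{1..n}. if (b, a) \<in> A then (if a = p then x b q else 0) * w (b, a) else 0)"
      unfolding sum_root_split[OF A'] by (simp cong: if_cong)
    also have "\<dots> = (\<Sum>b\<in>{1..n}. \<Sum>a\<in>{1..n}. if a = p then u p b * x b q else 0)"
      by (intro sum.cong refl) (auto simp: u_def)
    also have "\<dots> = mm {1..n} u x p q" using pq by (simp add: mm_def)
    finally show ?thesis .
  qed
  have 2: "(\<Sum>\<beta>\<in>A. (if fst \<beta> = q then x p (snd \<beta>) else 0) * w \<beta>) = mm {1..n} x u p q"
  proof -
    have "(\<Sum>\<beta>\<in>A. (if fst \<beta> = q then x p (snd \<beta>) else 0) * w \<beta>) =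
      (\<Sum>b\<in>{1..n}. \<Sum>a\<in>{1..n}. if (b, a) \<in> A then (if b = q then x p a else 0) * w (b, a) else 0)"
      unfolding sum_root_split[OF A'] by (simp cong: if_cong)
    also have "\<dots> = (\<Sum>b\<in>{1..n}. if b = q then \<Sum>a\<in>{1..n}. x p a * u a q else 0)"
      by (intro sum.cong refl) (auto simp: u_def intro!: sum.cong sum.neutral)
    also have "\<dots> = mm {1..n} x u p q" using pq by (simp add: mm_def)
    finally show ?thesis .
  qed
  show "commutator u x p q = (\<Sum>\<beta>\<in>A. bracket x (p, q) \<beta> * w \<beta>)"
    unfolding commutator_def 1[symmetric] 2[symmetric]
    by (simp add: bracket_def left_diff_distrib sum_subtractf cong: if_cong)
  show "strictly_upper u" using A unfolding strictly_upper_def u_def pos_roots_def by auto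
qed

lemma finite_sign_places: "finite sign_places"
  by (rule finite_subset[of _ "{..n} \<times> {..n}"]) (auto simp: sign_places_def pos_roots_def)

text \<open>The direction is the column of \<open>\<xi>\<close> in the inverse of the bracket matrix.\<close>

lemma dual_direction:
  fixes x :: "nat \<Rightarrow> nat \<Rightarrow> 'k::field"
  assumes inj: "injective_on sign_places (bracket x)" and \<xi>: "\<xi> \<in> sign_places"
  shows "\<exists>u. strictly_upper u \<and> (\<forall>b c. (b, c) \<in> sign_places \<longrightarrow> commutator u x b c = (if (b, c) = \<xi> then 1 else 0))"
proof -
  obtain e where e: "bij_betw e {0..<card sign_places} sign_places" using ex_bij_betw_nat_finite[OF finite_sign_places] by blast
  have d: "det (enum_mat (card sign_places) e (bracket x)) \<noteq> 0"
    using inj injective_on_iff_det[OF finite_sign_places e, where f = "bracket x"] by simp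
  obtain g where g: "\<And>b c. b \<in> sign_places \<Longrightarrow> c \<in> sign_places \<Longrightarrow> mm sign_places (bracket x) g b c = (if b = c then 1 else 0)"
    using enum_mat_inverse[OF finite_sign_places e d] by metis
  have sub: "sign_places \<subseteq> pos_roots n" by (auto simp: sign_places_def)
  define u where "u = (\<lambda>a b. if (b, a) \<in> sign_places then g (b, a) \<xi> else 0)"
  have u: "commutator u x p q = (\<Sum>\<beta>\<in>sign_places. bracket x (p, q) \<beta> * g \<beta> \<xi>)" if "p \<in> {1..n}" "q \<in> {1..n}" for p q
    unfolding u_def by (rule comm_bracket(1)[OF sub that])
  have "commutator u x b c = (if (b, c) = \<xi> then 1 else 0)" if bc: "(b, c) \<in> sign_places" for b c
  proof -
    have "b \<in> {1..n}" "c \<in> {1..n}" using bc sub by (auto simp: pos_roots_def)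
    then have "commutator u x b c = mm sign_places (bracket x) g (b, c) \<xi>" using u by (simp add: mm_def)
    then show ?thesis using g[OF bc \<xi>] by simp
  qed
  moreover have "strictly_upper u" unfolding strictly_upper_def u_def using sub by (auto simp: pos_roots_def split: if_splits)
  ultimately show ?thesis by blast
qed

definition unipotent :: "(nat \<Rightarrow> nat \<Rightarrow> 'k::field) \<Rightarrow> 'k mat" where
  "unipotent u = mat n n (\<lambda>(i, l). (if i = l then 1 else 0) + u (Suc i) (Suc l))"

lemma strictly_upper_zero: "strictly_upper u \<Longrightarrow> q \<le> p \<Longrightarrow> u p q = 0"
  unfolding strictly_upper_def by (meson not_le)

lemma unipotent_UT: assumes "strictly_upper u" shows "unipotent u \<in> UT n"
proof -
  have "u (Suc i) (Suc l) = 0" if "l \<le> i" for i l using strictly_upper_zero[OF assms] that by simp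
  then show ?thesis unfolding UT_iff unipotent_def by simp
qed

lemma ent_unipotent: "b \<in> {1..n} \<Longrightarrow> c \<in> {1..n} \<Longrightarrow> ent (unipotent u) b c = (if b = c then 1 else 0) + u b c"
  by (auto simp: ent_def unipotent_def)

text \<open>At the first place where \<open>[u, X]\<close> does not vanish the group element \<open>1 + u\<close> acts as the Lie algebra
element \<open>u\<close> does.\<close>

lemma coadjoint_shift:
  fixes X :: "'k::field mat"
  assumes u: "strictly_upper u" and X: "X \<in> strictly_lower n" and kj: "1 \<le> j" "j < k" "k \<le> n"
    and z: "\<And>b c. before b c k j \<Longrightarrow> commutator u (ent X) b c = 0"
  defines "Y \<equiv> coadjoint_act (unipotent u) X"
  shows "\<And>b c. before b c k j \<Longrightarrow> ent Y b c = ent X b c"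
    and "ent Y k j = ent X k j + commutator u (ent X) k j"
proof -
  note up = strictly_upper_zero[OF u]
  have main: "ent Y b c = ent X b c + commutator u (ent X) b c" if "1 \<le> c" "c < b" "b \<le> n" "before b c k j \<or> (b, c) = (k, j)" for b c
    using that
  proof (induction c rule: less_induct)
    case (less c)
    have b: "b \<in> {1..n}" "c \<in> {1..n}" using less.prems by auto
    have same: "ent Y b p = ent X b p" if p: "p \<in> {1..n}" "p < c" for p
    proof -
      have "before b p k j" using less.prems p unfolding before_def by auto
      then show ?thesis using less.IH[of p] p less.prems z by auto
    qed
    have "mm {1..n} (ent (unipotent u)) (ent X) b c = (\<Sum>r\<in>{1..n}. (if b = r then ent X r c else 0) + u b r * ent X r c)"
      unfolding mm_def using b by (intro sum.cong refl) (auto simp: ent_unipotent algebra_simps)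
    also have "\<dots> = ent X b c + mm {1..n} u (ent X) b c" using b by (simp add: mm_def sum.distrib)
    finally have l: "mm {1..n} (ent (unipotent u)) (ent X) b c = ent X b c + mm {1..n} u (ent X) b c" .
    have "mm {1..n} (ent Y) (ent (unipotent u)) b c = (\<Sum>r\<in>{1..n}. (if r = c then ent Y b r else 0) + ent X b r * u r c)"
      unfolding mm_def
    proof (intro sum.cong refl)
      fix r assume r: "r \<in> {1..n}"
      show "ent Y b r * ent (unipotent u) r c = (if r = c then ent Y b r else 0) + ent X b r * u r c"
        using same[OF r] up[of c r] ent_unipotent[OF r b(2), of u] by (cases "r < c") (auto simp: algebra_simps)
    qed
    also have "\<dots> = ent Y b c + mm {1..n} (ent X) u b c" using b by (simp add: mm_def sum.distrib)
    finally have r: "mm {1..n} (ent Y) (ent (unipotent u)) b c = ent Y b c + mm {1..n} (ent X) u b c" .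
    have "mm {1..n} (ent (unipotent u)) (ent X) b c = mm {1..n} (ent Y) (ent (unipotent u)) b c"
      unfolding Y_def using less.prems by (intro coadjoint_act_entries unipotent_UT[OF u] X) auto
    then show ?case unfolding l r commutator_def by (simp add: algebra_simps)
  qed
  show "ent Y k j = ent X k j + commutator u (ent X) k j" using main kj by auto
  fix b c assume bc: "before b c k j"
  then have "1 \<le> c" "c < b" "b \<le> n" unfolding before_def by auto
  then show "ent Y b c = ent X b c" using main[of c b] z[OF bc] bc by simp
qed

lemma C_iff: "1 \<le> n \<Longrightarrow> (k, j) \<in> C_set n D \<longleftrightarrow> 1 \<le> j \<and> j \<le> n \<and> k \<in> rec_at j"
  using C_set_eq by auto

lemma C_bounds: "(k, j) \<in> C_set n D \<Longrightarrow> 1 \<le> j \<and> j < k \<and> k \<le> n"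
  unfolding C_set_def pos_roots_def by auto

lemma bullet_alive:
  assumes "(b, j) \<in> MD" shows "col_ord j j < col_ord j b"
proof -
  have b: "1 \<le> j" "j < b" "b \<le> n" using M_roots_pos[OF assms] by auto
  then interpret column n D j "col_ord j" using column_ord by auto
  have "col_ord j b = b" using assms M_col_iff[OF b(2,3)] b by (intro L_unused) auto
  then show ?thesis using Lj_le b by auto
qed

lemma elim_agree:
  fixes x y :: "nat \<Rightarrow> nat \<Rightarrow> 'k::field"
  assumes "\<And>b c. before b c k j \<Longrightarrow> x b c = y b c" and "before b c k j" "1 \<le> i" "i \<le> c"
  shows "elim i x b c = elim i y b c"
proof -
  have "elim i x b c - x b c = elim i y b c - y b c"
    using assms by (intro elim_triangular) (auto simp: before_def)
  then show ?thesis using assms(1)[OF assms(2)] by simp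
qed

lemma pivots_nonzero_agree:
  assumes n: "1 \<le> n" and "\<And>b c. before b c k j \<Longrightarrow> x b c = y b c" and j: "j \<le> Suc n" and x: "pivots_nonzero j x"
  shows "pivots_nonzero j y"
  unfolding pivots_nonzero_def
proof (intro allI impI)
  fix c r assume c: "1 \<le> c" "c < j" "r \<in> rec_at c"
  then have "(r, c) \<in> C_set n D" using C_iff[OF n] j by auto
  then have "before r c k j" using C_bounds c unfolding before_def by auto
  then have "elim c x r c = elim c y r c" using elim_agree[of k j x y r c c] assms(2) c by auto
  then show "elim c y r c \<noteq> 0" using x c unfolding pivots_nonzero_def by auto
qed

text \<open>At a pivot or a bullet, \<open>[u, X]\<close> cannot vanish before and be nonzero there: by \<open>coadjoint_shift\<close> and
\<open>elim_triangular\<close> the group element \<open>1 + u\<close> would change the eliminated entry at this place, which is an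
invariant or zero.\<close>

lemma no_jump:
  fixes X :: "'k::field mat"
  assumes n: "1 \<le> n" and X: "X \<in> basic_variety n D \<phi>" and ns: "pivots_nonzero (Suc n) (ent X)"
    and u: "strictly_upper u" and kj: "1 \<le> j" "j < k" "k \<le> n" "(k, j) \<notin> sign_places"
    and z: "\<And>b c. before b c k j \<Longrightarrow> commutator u (ent X) b c = 0"
  shows "commutator u (ent X) k j = 0"
proof -
  have Xs: "X \<in> strictly_lower n" using X left_right_act_strict X_mat_carrier unfolding basic_variety_def by blast
  define Y where "Y = coadjoint_act (unipotent u) X"
  note sh = coadjoint_shift[OF u Xs kj(1-3) z, folded Y_def]
  have Y: "Y \<in> basic_variety n D \<phi>" unfolding Y_def by (rule basic_variety_invariant[OF unipotent_UT[OF u] X])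
  have rel: "conj_rel 1 (\<lambda>m. m) (ent X) (ent Y)" unfolding Y_def by (rule conj_rel_coadjoint[OF unipotent_UT[OF u] Xs])
  have nsX: "pivots_nonzero j (ent X)" using pivots_nonzero_mono[OF ns] kj by auto
  have nsY: "pivots_nonzero j (ent Y)" using kj sh(1) by (intro pivots_nonzero_agree[OF n _ _ nsX, of k]) auto
  have eq: "elim j (ent Y) k j = elim j (ent X) k j"
  proof (cases "(k, j) \<in> C_set n D")
    case True
    then show ?thesis using C_iff[OF n] by (intro pivot_invariant[OF X rel nsX nsY]) auto
  next
    case False
    then have M: "(k, j) \<in> MD" using kj by (auto simp: sign_places_def pos_roots_def)
    have "elim j (ent X) k j = 0" using kj M by (intro cell_elim_bullet[OF X nsX] bullet_alive) auto
    moreover have "elim j (ent Y) k j = 0" using kj M by (intro cell_elim_bullet[OF Y nsY] bullet_alive) auto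
    ultimately show ?thesis by simp
  qed
  have "elim j (ent Y) k j - ent Y k j = elim j (ent X) k j - ent X k j"
    using kj sh(1) by (intro elim_triangular) (auto simp: before_def)
  then show ?thesis using eq sh(2) by simp
qed

text \<open>The direction \<open>g u g\<^sup>-\<^sup>1\<close> serves at \<open>g X g\<^sup>-\<^sup>1\<close>, because conjugation by \<open>g\<close> adds to an entry only
multiples of entries at earlier places.\<close>

lemma comm_transport:
  fixes X :: "'k::field mat"
  assumes g: "g \<in> UT n" and X: "X \<in> strictly_lower n" and u: "strictly_upper u" and kj: "1 \<le> j" "j < k" "k \<le> n"
    and z: "\<And>b c. before b c k j \<Longrightarrow> commutator u (ent X) b c = 0"
  shows "\<exists>u'. strictly_upper u' \<and> (\<forall>b c. before b c k j \<longrightarrow> commutator u' (ent (coadjoint_act g X)) b c = 0) \<and>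
    commutator u' (ent (coadjoint_act g X)) k j = commutator u (ent X) k j"
proof -
  define U where "U = mat n n (\<lambda>(i, l). u (Suc i) (Suc l))"
  define U' where "U' = g * U * ginv g"
  define Z where "Z = g * X * ginv g"
  define W where "W = U * X - X * U"
  note gc = UT_carrier[OF g] and gi = UT_ginv[OF g]
  note ic = UT_carrier[OF gi(1)] and Xc = strictly_lower_carrier[OF X]
  have Uc: "U \<in> carrier_mat n n" by (simp add: U_def)
  have Ue: "ent U p q = u p q" if "p \<in> {1..n}" "q \<in> {1..n}" for p q using that by (auto simp: U_def ent_def)
  have cc: "U' \<in> carrier_mat n n" "Z \<in> carrier_mat n n" "W \<in> carrier_mat n n"
    using gc ic Xc Uc by (auto simp: U'_def Z_def W_def)
  have "upper_triangular U" using strictly_upper_zero[OF u] by (intro upper_triangularI) (auto simp: U_def)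
  then have "upper_triangular (g * U)" using upper_triangular_mult[OF gc Uc UT_upper[OF g]] by simp
  then have U'u: "upper_triangular U'" unfolding U'_def
    by (rule upper_triangular_mult[OF mult_carrier_mat[OF gc Uc] ic _ UT_upper[OF gi(1)]])
  have gup: "ent h p q = 0" if "h \<in> UT n" "p \<in> {1..n}" "q \<in> {1..n}" "q < p" for h :: "'k mat" and p q
    using ent_UT[OF that(1,2,3)] that by auto
  have U'diag: "ent U' p p = 0" if p: "p \<in> {1..n}" for p
  proof -
    have gU: "ent (g * U) p q = 0" if q: "q \<in> {1..n}" "q \<le> p" for q
    proof -
      have "ent g p r * ent U r q = 0" if r: "r \<in> {1..n}" for r
        using gup[OF g p r] strictly_upper_zero[OF u, of q r] Ue[OF r q(1)] q by (cases "r < p") auto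
      then show ?thesis unfolding ent_mult[OF gc Uc p q(1)] mm_def by (intro sum.neutral) auto
    qed
    have "ent (g * U) p r * ent (ginv g) r p = 0" if r: "r \<in> {1..n}" for r
      using gU[OF r] gup[OF gi(1) r p] by (cases "r \<le> p") auto
    then show ?thesis unfolding U'_def ent_mult[OF mult_carrier_mat[OF gc Uc] ic p p] mm_def
      by (intro sum.neutral) auto
  qed
  define u' where "u' = (\<lambda>p q. if p \<in> {1..n} \<and> q \<in> {1..n} then ent U' p q else 0)"
  have u'n: "strictly_upper u'" unfolding strictly_upper_def
  proof (intro allI impI)
    fix a b assume ab: "u' a b \<noteq> 0"
    then have m: "a \<in> {1..n}" "b \<in> {1..n}" "ent U' a b \<noteq> 0" by (auto simp: u'_def split: if_splits)
    have "a < b"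
    proof (rule ccontr)
      assume "\<not> a < b"
      then have "ent U' a b = 0" using U'diag[OF m(1)] upper_triangularD[OF U'u, of "b - 1" "a - 1"] m cc(1)
        by (cases "a = b") (auto simp: ent_def)
      then show False using m by simp
    qed
    then show "1 \<le> a \<and> a < b \<and> b \<le> n" using m by simp
  qed
  have comm_mat: "commutator u (ent X) b c = ent W b c" if b: "b \<in> {1..n}" "c \<in> {1..n}" for b c
  proof -
    have "commutator u (ent X) b c = mm {1..n} (ent U) (ent X) b c - mm {1..n} (ent X) (ent U) b c"
      unfolding commutator_def using b Ue by (intro arg_cong2[where f = "(-)"] mm_cong) auto
    also have "\<dots> = ent (U * X) b c - ent (X * U) b c" using ent_mult Uc Xc b by metis
    also have "\<dots> = ent W b c" using b Uc Xc unfolding W_def ent_def by auto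
    finally show ?thesis .
  qed
  have sandwich: "U' * Z - Z * U' = g * W * ginv g"
  proof -
    have "U' * Z = g * U * (ginv g * g) * X * ginv g" unfolding U'_def Z_def
      using gc ic Uc Xc by (simp add: assoc_mult_mat[of _ n n _ n _ n])
    then have 1: "U' * Z = g * (U * X) * ginv g" using gi gc ic Uc Xc by (simp add: assoc_mult_mat[of _ n n _ n _ n])
    have "Z * U' = g * X * (ginv g * g) * U * ginv g" unfolding U'_def Z_def
      using gc ic Uc Xc by (simp add: assoc_mult_mat[of _ n n _ n _ n])
    then have 2: "Z * U' = g * (X * U) * ginv g" using gi gc ic Uc Xc by (simp add: assoc_mult_mat[of _ n n _ n _ n])
    have UX: "U * X \<in> carrier_mat n n" "X * U \<in> carrier_mat n n" using Uc Xc by auto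
    have "g * W * ginv g = (g * (U * X) - g * (X * U)) * ginv g" unfolding W_def
      using mult_minus_distrib_mat[OF gc UX] by simp
    also have "\<dots> = g * (U * X) * ginv g - g * (X * U) * ginv g"
      using minus_mult_distrib_mat[OF mult_carrier_mat[OF gc UX(1)] mult_carrier_mat[OF gc UX(2)] ic] .
    finally show ?thesis using 1 2 by simp
  qed
  have Wz: "ent W r p = 0" if "before r p k j" for r p
    using comm_mat[of r p] z[OF that] that unfolding before_def by auto
  have key: "commutator u' (ent (coadjoint_act g X)) b c = ent W b c"
    if bc: "before b c k j \<or> (b, c) = (k, j)" for b c
  proof -
    have b: "1 \<le> c" "c < b" "b \<le> n" using bc kj unfolding before_def by auto
    then have bn: "b \<in> {1..n}" "c \<in> {1..n}" by auto
    have "commutator u' (ent (coadjoint_act g X)) b c =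
        mm {1..n} (ent U') (ent (lower_part Z)) b c - mm {1..n} (ent (lower_part Z)) (ent U') b c"
      unfolding commutator_def coadjoint_act_def Z_def[symmetric]
      using bn by (intro arg_cong2[where f = "(-)"] mm_cong) (auto simp: u'_def)
    also have "\<dots> = ent (U' * Z) b c - ent (Z * U') b c"
      unfolding lower_conj_entries[OF cc(1) U'u cc(2) b] ..
    also have "\<dots> = ent (U' * Z - Z * U') b c" using bn cc unfolding ent_def by auto
    also have "\<dots> = (\<Sum>p\<in>{1..n}. ent (g * W) b p * ent (ginv g) p c)"
      unfolding sandwich using ent_mult[OF mult_carrier_mat[OF gc cc(3)] ic bn] by (simp add: mm_def)
    also have "\<dots> = (\<Sum>p\<in>{1..n}. if p = c then ent W b c else 0)"
    proof (rule sum.cong[OF refl])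
      fix p assume p: "p \<in> {1..n}"
      have gW: "ent (g * W) b p = ent W b p" if "p \<le> c"
      proof -
        have "ent (g * W) b p = (\<Sum>r\<in>{1..n}. ent g b r * ent W r p)"
          using ent_mult[OF gc cc(3) bn(1) p] by (simp add: mm_def)
        also have "\<dots> = (\<Sum>r\<in>{1..n}. if r = b then ent W b p else 0)"
        proof (rule sum.cong[OF refl])
          fix r assume r: "r \<in> {1..n}"
          show "ent g b r * ent W r p = (if r = b then ent W b p else 0)"
          proof (cases r b rule: linorder_cases)
            case less then show ?thesis using gup[OF g bn(1) r] by simp
          next
            case equal then show ?thesis using ent_UT[OF g bn(1) bn(1)] by simp
          next
            case greater
            then have "before r p k j" using bc b p r that kj unfolding before_def by auto
            then show ?thesis using Wz greater by simp
          qed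
        qed
        finally show ?thesis using bn by simp
      qed
      show "ent (g * W) b p * ent (ginv g) p c = (if p = c then ent W b c else 0)"
      proof (cases p c rule: linorder_cases)
        case less
        then have "before b p k j" using bc b p kj unfolding before_def by auto
        then show ?thesis using gW Wz less by simp
      next
        case equal then show ?thesis using gW ent_UT[OF gi(1) bn(2) bn(2)] by simp
      next
        case greater then show ?thesis using gup[OF gi(1) p bn(2)] by simp
      qed
    qed
    also have "\<dots> = ent W b c" using bn by simp
    finally show ?thesis .
  qed
  have "commutator u' (ent (coadjoint_act g X)) k j = commutator u (ent X) k j" using key[of k j] comm_mat[of k j] kj by auto
  moreover have "commutator u' (ent (coadjoint_act g X)) b c = 0" if "before b c k j" for b c
    using key[of b c] Wz[OF that] that by auto
  ultimately show ?thesis using u'n by blast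
qed

text \<open>Numbers the places along \<open>before\<close>: columns ascending, rows descending inside a column.\<close>

definition place_index :: "nat \<Rightarrow> nat \<Rightarrow> nat" where "place_index b c = c * Suc n + (n - b)"

lemma place_index_less:
  assumes "1 \<le> c" "c < b" "b \<le> n" "1 \<le> j" "j < k" "k \<le> n"
  shows "place_index b c < place_index k j \<longleftrightarrow> before b c k j"
proof (cases c j rule: linorder_cases)
  case less
  then have "Suc c * Suc n \<le> j * Suc n" by (intro mult_le_mono1) auto
  then show ?thesis using less assms by (simp add: place_index_def before_def)
next
  case greater
  then have "Suc j * Suc n \<le> c * Suc n" by (intro mult_le_mono1) auto
  then show ?thesis using greater assms by (simp add: place_index_def before_def)
qed (use assms in \<open>auto simp: place_index_def before_def\<close>)

lemma place_index_inj:
  assumes "1 \<le> c" "c < b" "b \<le> n" "1 \<le> j" "j < k" "k \<le> n" "place_index b c = place_index k j"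
  shows "b = k \<and> c = j"
  using place_index_less[OF assms(1-6)] place_index_less[OF assms(4-6) assms(1-3)] assms
  unfolding before_def by auto

lemma place_index_bound: "c \<le> n \<Longrightarrow> place_index b c < Suc n * Suc n"
  using mult_le_mono1[of c n "Suc n"] by (simp add: place_index_def)

lemma pivots_nonzero_invariant:
  fixes X Y :: "'k::field mat"
  assumes X: "X \<in> basic_variety n D \<phi>" and rel: "conj_rel 1 (\<lambda>m. m) (ent X) (ent Y)"
    and j: "1 \<le> j" "j \<le> Suc n" and ns: "pivots_nonzero j (ent X)"
  shows "pivots_nonzero j (ent Y)"
  using j ns
proof (induction j rule: nat_induct_at_least)
  case base
  then show ?case by (simp add: pivots_nonzero_def)
next
  case (Suc j)
  have nj: "pivots_nonzero j (ent X)" "pivots_nonzero j (ent Y)" using Suc pivots_nonzero_mono[of "Suc j" "ent X" j] by auto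
  have eq: "elim j (ent Y) k j = elim j (ent X) k j" if "k \<in> rec_at j" for k
    using Suc.hyps Suc.prems that by (intro pivot_invariant[OF X rel nj]) auto
  show ?case unfolding pivots_nonzero_def
  proof (intro allI impI)
    fix c k assume c: "1 \<le> c" "c < Suc j" "k \<in> rec_at c"
    show "elim c (ent Y) k c \<noteq> 0"
    proof (cases "c = j")
      case True
      then show ?thesis using eq[of k] c Suc.prems(2) Suc.hyps unfolding pivots_nonzero_def by auto
    next
      case False
      then show ?thesis using nj(2) c unfolding pivots_nonzero_def by auto
    qed
  qed
qed

text \<open>Choose a direction dual to the place \<open>(k, j)\<close> among the places with a sign. Before \<open>(k, j)\<close> it vanishes at these
by choice, and at the pivots and bullets by \<open>no_jump\<close>.\<close>

lemma jump_direction: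
  fixes X :: "'k::field mat"
  assumes n: "1 \<le> n" and X: "X \<in> basic_variety n D \<phi>" and ns: "pivots_nonzero (Suc n) (ent X)"
    and inj: "injective_on sign_places (bracket (ent X))" and kj: "(k, j) \<in> sign_places"
  shows "\<exists>u. strictly_upper u \<and> (\<forall>b c. before b c k j \<longrightarrow> commutator u (ent X) b c = 0) \<and> commutator u (ent X) k j = 1"
proof -
  obtain u where u: "strictly_upper u" "\<And>b c. (b, c) \<in> sign_places \<Longrightarrow> commutator u (ent X) b c = (if (b, c) = (k, j) then 1 else 0)"
    using dual_direction[OF inj kj] by blast
  have "commutator u (ent X) b c = 0" if "before b c k j" for b c
    using that
  proof (induction "place_index b c" arbitrary: b c rule: less_induct)
    case less
    have bc: "1 \<le> c" "c < b" "b \<le> n" using less.prems unfolding before_def by auto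
    show ?case
    proof (cases "(b, c) \<in> sign_places")
      case True
      then show ?thesis using u(2) less.prems unfolding before_def by auto
    next
      case False
      show ?thesis
      proof (rule no_jump[OF n X ns u(1) bc False])
        fix b' c' assume b': "before b' c' b c"
        then have "before b' c' k j" using less.prems unfolding before_def by auto
        moreover have "place_index b' c' < place_index b c"
          using place_index_less[of c' b' c b] b' bc unfolding before_def by auto
        ultimately show "commutator u (ent X) b' c' = 0" using less.hyps by blast
      qed
    qed
  qed
  moreover have "commutator u (ent X) k j = 1" using u(2)[OF kj] by simp
  ultimately show ?thesis using u(1) by blast
qed

text \<open>The places outside \<open>C(D)\<close> are cleared in the order \<open>before\<close>. At a place with a sign this is done with a
multiple of a jump direction, which leaves the earlier places alone. At a bullet the entry vanishes automatically, since
the pivots to the left of it in its row are absent and the eliminated entry is zero.\<close>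

theorem conjugate_to_pivots:
  fixes X :: "'k::field mat"
  assumes n: "1 \<le> n" and X: "X \<in> basic_variety n D \<phi>" and ns: "pivots_nonzero (Suc n) (ent X)"
    and inj: "injective_on sign_places (bracket (ent X))"
  shows "\<exists>g\<in>UT n. \<forall>b c. 1 \<le> c \<longrightarrow> c < b \<longrightarrow> b \<le> n \<longrightarrow> (b, c) \<notin> C_set n D \<longrightarrow>
    ent (coadjoint_act g X) b c = 0"
proof -
  have Xs: "X \<in> strictly_lower n" using X left_right_act_strict X_mat_carrier unfolding basic_variety_def by blast
  have "\<exists>g\<in>UT n. \<forall>b c. 1 \<le> c \<longrightarrow> c < b \<longrightarrow> b \<le> n \<longrightarrow> (b, c) \<notin> C_set n D \<longrightarrow> place_index b c < N \<longrightarrow>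
      ent (coadjoint_act g X) b c = 0" for N
  proof (induction N)
    case 0 show ?case using UT_one by auto
  next
    case (Suc N)
    then obtain g where g: "g \<in> UT n" "\<forall>b c. 1 \<le> c \<longrightarrow> c < b \<longrightarrow> b \<le> n \<longrightarrow> (b, c) \<notin> C_set n D \<longrightarrow> place_index b c < N \<longrightarrow>
      ent (coadjoint_act g X) b c = 0" by blast
    show ?case
    proof (cases "\<exists>k j. 1 \<le> j \<and> j < k \<and> k \<le> n \<and> (k, j) \<notin> C_set n D \<and> place_index k j = N")
      case False
      show ?thesis
      proof (intro bexI[OF _ g(1)] allI impI)
        fix b c assume bc: "1 \<le> c" "c < b" "b \<le> n" "(b, c) \<notin> C_set n D" "place_index b c < Suc N"
        then have "place_index b c \<noteq> N" using False by blast
        then have "place_index b c < N" using bc(5) by simp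
        then show "ent (coadjoint_act g X) b c = 0" using g(2) bc by blast
      qed
    next
      case True
      then obtain k j where kj: "1 \<le> j" "j < k" "k \<le> n" "(k, j) \<notin> C_set n D" "place_index k j = N" by blast
      define Y where "Y = coadjoint_act g X"
      have Yv: "Y \<in> basic_variety n D \<phi>" and Ys: "Y \<in> strictly_lower n" unfolding Y_def
        using basic_variety_invariant[OF g(1) X] coadjoint_act_strict[OF g(1) strictly_lower_carrier[OF Xs]] by auto
      have i_lt: "place_index b c < N \<longleftrightarrow> before b c k j" if "1 \<le> c" "c < b" "b \<le> n" for b c
        using place_index_less[OF that kj(1-3)] kj(5) by simp
      have Y0: "ent Y b c = 0" if "before b c k j" "(b, c) \<notin> C_set n D" for b c
        using g(2) that i_lt[of c b] unfolding before_def Y_def by auto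
      show ?thesis
      proof (cases "(k, j) \<in> sign_places")
        case False
        then have M: "(k, j) \<in> MD" using kj by (auto simp: sign_places_def pos_roots_def)
        have no: "(k, c) \<notin> D" if "c \<le> j" for c using M M_roots_iff[OF kj(1-3)] that by auto
        have nsY: "pivots_nonzero j (ent Y)"
          unfolding Y_def using kj
          by (intro pivots_nonzero_invariant[OF X conj_rel_coadjoint[OF g(1) Xs]] pivots_nonzero_mono[OF ns]) auto
        have "elim j (ent Y) k j = 0" using kj M by (intro cell_elim_bullet[OF Yv nsY] bullet_alive) auto
        moreover have "elim j (ent Y) k j = ent Y k j"
        proof (rule elim_row)
          fix c assume c: "1 \<le> c" "c < j"
          have "(k, c) \<notin> C_set n D" using C_row_used[OF n, of k c] no c by auto
          then show "ent Y k c = 0" using Y0[of k c] c kj unfolding before_def by auto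
        qed (use kj in auto)
        ultimately have "ent Y k j = 0" by simp
        then have z: "ent (coadjoint_act g X) k j = 0" unfolding Y_def .
        show ?thesis
        proof (intro bexI[OF _ g(1)] allI impI)
          fix b c assume bc: "1 \<le> c" "c < b" "b \<le> n" "(b, c) \<notin> C_set n D" "place_index b c < Suc N"
          show "ent (coadjoint_act g X) b c = 0"
          proof (cases "place_index b c < N")
            case True
            then show ?thesis using g(2) bc by blast
          next
            case False
            then have "place_index b c = place_index k j" using bc(5) kj(5) by simp
            then show ?thesis using place_index_inj[OF bc(1-3) kj(1-3)] z by simp
          qed
        qed
      next
        case True
        obtain u where u: "strictly_upper u" "\<And>b c. before b c k j \<Longrightarrow> commutator u (ent X) b c = 0" "commutator u (ent X) k j = 1"
          using jump_direction[OF n X ns inj True] by blast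
        obtain u' where u': "strictly_upper u'" "\<And>b c. before b c k j \<Longrightarrow> commutator u' (ent Y) b c = 0" "commutator u' (ent Y) k j = 1"
          using comm_transport[OF g(1) Xs u(1) kj(1-3) u(2)] u(3) unfolding Y_def by auto
        \<comment> \<open>the multiple of the jump direction that cancels the entry at \<open>(k, j)\<close>\<close>
        define w where "w = (\<lambda>a b. - ent Y k j * u' a b)"
        have w: "strictly_upper w" using u'(1) unfolding strictly_upper_def w_def by auto
        have cw: "commutator w (ent Y) b c = - ent Y k j * commutator u' (ent Y) b c" for b c
          unfolding commutator_def mm_def w_def by (simp add: sum_distrib_left algebra_simps sum_negf)
        define g' where "g' = unipotent w * g"
        have g': "g' \<in> UT n" unfolding g'_def by (rule UT_mult[OF unipotent_UT[OF w] g(1)])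
        have eq: "coadjoint_act g' X = coadjoint_act (unipotent w) Y"
          unfolding g'_def Y_def by (rule coadjoint_act_act[OF unipotent_UT[OF w] g(1) strictly_lower_carrier[OF Xs], symmetric])
        have cz: "commutator w (ent Y) b c = 0" if "before b c k j" for b c using cw u'(2)[OF that] by simp
        note sh = coadjoint_shift[OF w Ys kj(1-3) cz]
        have 0: "ent (coadjoint_act g' X) k j = 0" unfolding eq using sh(2) cw[of k j] u'(3) by simp
        have "ent (coadjoint_act g' X) b c = 0"
          if bc: "1 \<le> c" "c < b" "b \<le> n" "(b, c) \<notin> C_set n D" "place_index b c < Suc N" for b c
        proof (cases "place_index b c < N")
          case True
          then have "before b c k j" using i_lt bc by auto
          then show ?thesis unfolding eq using sh(1) Y0 bc by simp
        next
          case False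
          then have "place_index b c = place_index k j" using bc kj by simp
          then show ?thesis using place_index_inj[OF bc(1-3) kj(1-3)] 0 by simp
        qed
        then show ?thesis using g' by blast
      qed
    qed
  qed
  from this[of "Suc n * Suc n"] obtain g where g: "g \<in> UT n"
    "\<forall>b c. 1 \<le> c \<longrightarrow> c < b \<longrightarrow> b \<le> n \<longrightarrow> (b, c) \<notin> C_set n D \<longrightarrow> place_index b c < Suc n * Suc n \<longrightarrow>
      ent (coadjoint_act g X) b c = 0" by blast
  have "ent (coadjoint_act g X) b c = 0" if bc: "1 \<le> c" "c < b" "b \<le> n" "(b, c) \<notin> C_set n D" for b c
  proof -
    have "place_index b c < Suc n * Suc n" using bc by (intro place_index_bound) auto
    then show ?thesis using g bc by blast
  qed
  then show ?thesis using g(1) by blast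
qed

end

section \<open>Recovering a matrix from its pivots\<close>

text \<open>Closure properties of the functions on \<open>U\<close> that are given by elements of a field of rational functions
regular on \<open>U\<close>. The elimination and its inverse use no other operations.\<close>

locale rational_class =
  fixes Fp :: "('p \<Rightarrow> 'k::field) \<Rightarrow> bool" and U :: "'p set"
  assumes const: "Fp (\<lambda>p. a)"
    and add: "Fp f \<Longrightarrow> Fp g \<Longrightarrow> Fp (\<lambda>p. f p + g p)"
    and mult: "Fp f \<Longrightarrow> Fp g \<Longrightarrow> Fp (\<lambda>p. f p * g p)"
    and divide: "Fp f \<Longrightarrow> Fp g \<Longrightarrow> (\<And>p. p \<in> U \<Longrightarrow> g p \<noteq> 0) \<Longrightarrow> Fp (\<lambda>p. f p / g p)"
begin

lemma uminus: "Fp f \<Longrightarrow> Fp (\<lambda>p. - f p)"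
  using mult[OF const[of "-1"]] by simp

lemma diff: "Fp f \<Longrightarrow> Fp g \<Longrightarrow> Fp (\<lambda>p. f p - g p)"
  using add[OF _ uminus] by simp

lemma sum: "(\<And>i. i \<in> A \<Longrightarrow> Fp (f i)) \<Longrightarrow> Fp (\<lambda>p. \<Sum>i\<in>A. f i p)"
  by (induction A rule: infinite_finite_induct) (auto intro: const add)

lemma prod: "(\<And>i. i \<in> A \<Longrightarrow> Fp (f i)) \<Longrightarrow> Fp (\<lambda>p. \<Prod>i\<in>A. f i p)"
  by (induction A rule: infinite_finite_induct) (auto intro: const mult)

end

context basic_roots begin

lemma elim_rational:
  fixes x :: "'p \<Rightarrow> nat \<Rightarrow> nat \<Rightarrow> 'k::field"
  assumes F: "rational_class Fp U"
    and x: "\<And>b c. b \<in> {1..n} \<Longrightarrow> c \<in> {1..n} \<Longrightarrow> Fp (\<lambda>p. x p b c)"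
    and j: "1 \<le> j" "j \<le> Suc n" and ns: "\<And>p. p \<in> U \<Longrightarrow> pivots_nonzero j (x p)"
    and bc: "b \<in> {j..n}" "c \<in> {j..n}"
  shows "Fp (\<lambda>p. elim j (x p) b c)"
  using j ns bc
proof (induction j arbitrary: b c rule: nat_induct_at_least)
  case base
  then show ?case using x by (simp add: elim_1)
next
  case (Suc j)
  interpret F: rational_class Fp U by (rule F)
  interpret column n D j "col_ord j" using column_ord Suc.hyps Suc.prems(1) by auto
  have IH: "Fp (\<lambda>p. elim j (x p) r q)" if "r \<in> {j..n}" "q \<in> {j..n}" for r q
  proof -
    have ns: "pivots_nonzero j (x p)" if "p \<in> U" for p using pivots_nonzero_mono[OF Suc.prems(2)[OF that], of j] by simp
    have "j \<le> Suc n" using Suc.prems(1) by simp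
    from Suc.IH[OF this ns that] show ?thesis by simp
  qed
  have jS: "j \<in> {j..n}" using Suc.prems(3) by auto
  have piv: "elim j (x p) k j \<noteq> 0" if "p \<in> U" "k \<in> Rc" for p k
    using Suc.prems(2)[OF that(1)] that(2) Suc.hyps unfolding pivots_nonzero_def by auto
  have rowm: "Fp (\<lambda>p. row_mat (elim j (x p)) r q)" if "r \<in> S" "q \<in> S" for r q
  proof (cases "r = q")
    case True then show ?thesis using F.const by (simp add: row_mat_def)
  next
    case False
    show ?thesis
    proof (cases "r \<in> cleared_rows \<and> q = pivot_row r")
      case True
      then have "pivot_row r \<in> Rc" using cleared_pivot_row[of r] by auto
      then have "Fp (\<lambda>p. - (elim j (x p) r j / elim j (x p) q j))"
        using True that jS by (intro F.uminus F.divide IH piv) auto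
      then show ?thesis using True False by (simp add: row_mat_def)
    next
      case F': False
      then have "\<And>p. row_mat (elim j (x p)) r q = 0" using False by (auto simp: row_mat_def)
      then show ?thesis using F.const by simp
    qed
  qed
  have colm: "Fp (\<lambda>p. col_mat (elim j (x p)) r q)" if "r \<in> S" "q \<in> S" for r q
  proof (cases "r = q")
    case True then show ?thesis using F.const by (simp add: col_mat_def)
  next
    case False
    show ?thesis
    proof (cases "q \<in> Rc \<and> r \<in> Cd \<and> pv q < col_ord j r")
      case True
      then have "Fp (\<lambda>p. elim j (x p) r j / elim j (x p) q j)"
        using that jS by (intro F.divide IH piv) auto
      then show ?thesis using True False by (simp add: col_mat_def)
    next
      case F': False
      then have "\<And>p. col_mat (elim j (x p)) r q = 0" using False by (auto simp: col_mat_def)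
      then show ?thesis using F.const by simp
    qed
  qed
  show ?case unfolding elim_Suc[OF Suc.hyps] elim_col_def mm_def
    using Suc.prems(3,4) by (intro F.sum F.mult rowm colm IH) auto
qed

definition matrix_of :: "(nat \<Rightarrow> nat \<Rightarrow> 'k) \<Rightarrow> 'k mat" where
  "matrix_of t = mat n n (\<lambda>(i, l). t (Suc i) (Suc l))"

lemma ent_matrix_of: "b \<in> {1..n} \<Longrightarrow> c \<in> {1..n} \<Longrightarrow> ent (matrix_of t) b c = t b c"
  by (auto simp: ent_def matrix_of_def)

lemma matrix_of_strict:
  fixes t :: "nat \<Rightarrow> nat \<Rightarrow> 'k::field"
  assumes "\<And>b c. t b c \<noteq> 0 \<Longrightarrow> (b, c) \<in> C_set n D"
  shows "matrix_of t \<in> strictly_lower n"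
proof -
  have "t b c = 0" if "b \<le> c" for b c using assms[of b c] C_bounds[of b c] that by auto
  then show ?thesis unfolding strictly_lower_def matrix_of_def by auto
qed

lemma strict_eqI:
  fixes X Y :: "'k::field mat"
  assumes X: "X \<in> strictly_lower n" and Y: "Y \<in> strictly_lower n"
    and eq: "\<And>b c. 1 \<le> c \<Longrightarrow> c < b \<Longrightarrow> b \<le> n \<Longrightarrow> ent X b c = ent Y b c"
  shows "X = Y"
proof (rule eq_matI)
  note c = strictly_lower_carrier[OF X] strictly_lower_carrier[OF Y]
  show "dim_row X = dim_row Y" "dim_col X = dim_col Y" using c by auto
  fix i l assume "i < dim_row Y" "l < dim_col Y"
  then have il: "i < n" "l < n" using c by auto
  show "X $$ (i, l) = Y $$ (i, l)"
  proof (cases "l < i")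
    case True
    then show ?thesis using eq[of "Suc l" "Suc i"] il by (simp add: ent_def)
  next
    case False
    then show ?thesis using X Y il by (simp add: strictly_lower_def)
  qed
qed

text \<open>The matrix is \<open>X_mat\<close> multiplied by a unitriangular matrix whose rows are the rows of \<open>t\<close> divided by their
entries on \<open>D\<close>. This is possible because a row that meets \<open>C(D)\<close> meets \<open>D\<close>, and not later.\<close>

lemma matrix_of_in_variety:
  fixes t :: "nat \<Rightarrow> nat \<Rightarrow> 'k::field"
  assumes n: "1 \<le> n" and supp: "\<And>b c. t b c \<noteq> 0 \<Longrightarrow> (b, c) \<in> C_set n D" and D: "\<And>b c. (b, c) \<in> D \<Longrightarrow> t b c \<noteq> 0"
  shows "matrix_of t \<in> basic_variety n D (\<lambda>(b, c). t b c)"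
proof -
  let ?\<phi> = "\<lambda>(b, c). t b c"
  define r where "r = (\<lambda>c. SOME k. (k, c) \<in> D)"
  have r: "r c = k" if "(k, c) \<in> D" for k c
  proof -
    have "(r c, c) \<in> D" unfolding r_def using that by (rule someI)
    then show ?thesis using D_col_unique[OF that] by blast
  qed
  define h :: "'k mat" where "h = mat n n (\<lambda>(i, l). if i = l then 1 else
    if i < l \<and> (r (Suc i), Suc i) \<in> D then t (r (Suc i)) (Suc l) / t (r (Suc i)) (Suc i) else 0)"
  have hU: "h \<in> UT n" unfolding UT_iff h_def by simp
  have hc: "ent h p c = t k c / t k p" if "(k, p) \<in> D" "p \<le> c" "c \<le> n" for k p c
  proof -
    have "1 \<le> p" using D_bounds[OF that(1)] by auto
    moreover have "p - Suc 0 = c - Suc 0 \<Longrightarrow> p = c" using calculation that by simp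
    ultimately show ?thesis using that r[OF that(1)] D[OF that(1)] by (auto simp: ent_def h_def)
  qed
  have "matrix_of t = row_form ?\<phi> h"
  proof (rule strict_eqI[OF matrix_of_strict[OF supp]])
    show "row_form ?\<phi> h \<in> strictly_lower n" unfolding row_form_def
      by (intro lower_part_strict mult_carrier_mat[OF X_mat_carrier UT_carrier[OF hU]])
    fix b c assume bc: "1 \<le> c" "c < b" "b \<le> n"
    have e: "ent (matrix_of t) b c = t b c" using bc by (intro ent_matrix_of) auto
    show "ent (matrix_of t) b c = ent (row_form ?\<phi> h) b c"
    proof (cases "\<exists>p\<le>c. (b, p) \<in> D")
      case True
      then obtain p where p: "p \<le> c" "(b, p) \<in> D" by blast
      have pn: "p \<in> {1..n}" using D_bounds[OF p(2)] by auto
      have "(if (b, q) \<in> D then ?\<phi> (b, q) else 0) * ent h q c = (if q = p then t b c else 0)" for q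
      proof (cases "q = p")
        case True then show ?thesis using p hc[OF p(2) p(1)] bc D[OF p(2)] by simp
      next
        case False
        then have "(b, q) \<notin> D" using D_row_unique[OF p(2), of q] by blast
        then show ?thesis using False by simp
      qed
      then show ?thesis unfolding e row_form_entry[OF hU bc] using pn by simp
    next
      case False
      then have "t b c = 0" using supp[of b c] C_row_used[OF n, of b c] by blast
      then show ?thesis using row_form_props(1)[OF hU bc, of ?\<phi>] False e by auto
    qed
  qed
  also have "\<dots> = left_right_act (1\<^sub>m n) (ginv h) (X_mat n D ?\<phi>)"
    unfolding left_right_act_def row_form_def using ginv_ginv[OF hU] X_mat_carrier[of n D ?\<phi>] by simp
  finally show ?thesis unfolding basic_variety_def using UT_one UT_ginv(1)[OF hU] by blast
qed

text \<open>Pivots determine a matrix supported on \<open>C(D)\<close> along the order of the places. The entry at the place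
with number \<open>N\<close> is still \<open>0\<close> in \<open>solve_upto N y\<close>, so that \<open>elim c (solve_upto N y) b c\<close> is the correction caused by the
earlier places.\<close>

primrec solve_upto :: "nat \<Rightarrow> (root \<Rightarrow> 'k::field) \<Rightarrow> nat \<Rightarrow> nat \<Rightarrow> 'k" where
  "solve_upto 0 y = (\<lambda>b c. 0)"
| "solve_upto (Suc N) y = (\<lambda>b c. if (b, c) \<in> C_set n D \<and> place_index b c = N
     then y (b, c) - elim c (solve_upto N y) b c else solve_upto N y b c)"

definition solve :: "(root \<Rightarrow> 'k::field) \<Rightarrow> nat \<Rightarrow> nat \<Rightarrow> 'k" where
  "solve y = solve_upto (Suc n * Suc n) y"

lemma solve_upto_support: "solve_upto N y b c \<noteq> 0 \<Longrightarrow> (b, c) \<in> C_set n D \<and> place_index b c < N"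
proof (induction N)
  case (Suc N)
  then show ?case by (cases "(b, c) \<in> C_set n D \<and> place_index b c = N") auto
qed simp

lemma solve_upto_stable: "place_index b c < N \<Longrightarrow> N \<le> M \<Longrightarrow> solve_upto M y b c = solve_upto N y b c"
  by (induction M) (auto simp: le_Suc_eq)

lemma solve_upto_solve:
  assumes "c \<le> n" "place_index b c < N" "N \<le> Suc n * Suc n"
  shows "solve_upto N y b c = solve y b c"
  unfolding solve_def by (rule solve_upto_stable[OF assms(2,3), symmetric])

lemma solve_support: "solve y b c \<noteq> 0 \<Longrightarrow> (b, c) \<in> C_set n D"
  using solve_upto_support unfolding solve_def by blast

lemma solve_pivot:
  fixes y :: "root \<Rightarrow> 'k::field"
  assumes C: "(k, c) \<in> C_set n D"
  shows "elim c (solve y) k c = y (k, c)"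
proof -
  have kc: "1 \<le> c" "c < k" "k \<le> n" using C_bounds[OF C] by auto
  define N where "N = place_index k c"
  have N: "Suc N \<le> Suc n * Suc n" using place_index_bound[of c k] kc unfolding N_def by simp
  have z: "solve_upto N y k c = 0" using solve_upto_support[of N y k c] N_def by auto
  have s: "solve y k c = y (k, c) - elim c (solve_upto N y) k c"
    using solve_upto_solve[of c k "Suc N" y] N kc C unfolding N_def by simp
  have "elim c (solve y) k c - solve y k c = elim c (solve_upto N y) k c - solve_upto N y k c"
  proof (rule elim_triangular)
    fix r p assume rp: "1 \<le> p" "p < r" "r \<le> n" "p < c \<or> p = c \<and> k < r"
    then have "place_index r p < N" unfolding N_def using place_index_less[OF rp(1-3) kc] by (auto simp: before_def)
    then show "solve y r p = solve_upto N y r p" using solve_upto_solve[of p r N y] N rp by auto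
  qed (use kc in auto)
  then show ?thesis using s z by simp
qed

lemma solve_pivots_nonzero:
  fixes y :: "root \<Rightarrow> 'k::field"
  assumes n: "1 \<le> n" and y: "\<And>\<xi>. \<xi> \<in> C_set n D \<Longrightarrow> y \<xi> \<noteq> 0"
  shows "pivots_nonzero (Suc n) (solve y)"
  unfolding pivots_nonzero_def
proof (intro allI impI)
  fix c k assume "1 \<le> c" "c < Suc n" "k \<in> rec_at c"
  then have "(k, c) \<in> C_set n D" using C_iff[OF n] by auto
  then show "elim c (solve y) k c \<noteq> 0" using solve_pivot[of k c y] y by auto
qed

lemma solve_unique:
  fixes t :: "nat \<Rightarrow> nat \<Rightarrow> 'k::field"
  assumes supp: "\<And>b c. 1 \<le> c \<Longrightarrow> c < b \<Longrightarrow> b \<le> n \<Longrightarrow> (b, c) \<notin> C_set n D \<Longrightarrow> t b c = 0"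
    and piv: "\<And>k c. (k, c) \<in> C_set n D \<Longrightarrow> elim c t k c = y (k, c)"
    and bc: "1 \<le> c" "c < b" "b \<le> n"
  shows "t b c = solve y b c"
  using bc
proof (induction "place_index b c" arbitrary: b c rule: less_induct)
  case less
  show ?case
  proof (cases "(b, c) \<in> C_set n D")
    case True
    have "elim c t b c - t b c = elim c (solve y) b c - solve y b c"
    proof (rule elim_triangular)
      fix r p assume rp: "1 \<le> p" "p < r" "r \<le> n" "p < c \<or> p = c \<and> b < r"
      then have "place_index r p < place_index b c"
        using place_index_less[OF rp(1-3) less.prems] by (auto simp: before_def)
      then show "t r p = solve y r p" using less.hyps rp by blast
    qed (use less.prems in auto)
    then show ?thesis using piv[OF True] solve_pivot[OF True, of y] by simp
  next
    case False
    then show ?thesis using supp[OF less.prems False] solve_support[of y b c] by metis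
  qed
qed

text \<open>In the row of a root of \<open>D\<close> a matrix supported on \<open>C(D)\<close> vanishes to the left of this root.\<close>

lemma solve_D:
  fixes y :: "root \<Rightarrow> 'k::field"
  assumes n: "1 \<le> n" and D: "(k, c) \<in> D"
  shows "solve y k c = y (k, c)"
proof -
  have C: "(k, c) \<in> C_set n D" using D_subset_C[OF n] D by blast
  have kc: "1 \<le> c" "c < k" "k \<le> n" using C_bounds[OF C] by auto
  have "elim c (solve y) k c = solve y k c"
  proof (rule elim_row)
    fix c' assume c': "1 \<le> c'" "c' < c"
    have "(k, c') \<notin> C_set n D"
    proof
      assume "(k, c') \<in> C_set n D"
      then obtain c'' where "c'' \<le> c'" "(k, c'') \<in> D" using C_row_used[OF n] by blast
      then show False using D_row_unique[OF D, of c''] c' by auto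
    qed
    then show "solve y k c' = 0" using solve_support by blast
  qed (use kc in auto)
  then show ?thesis using solve_pivot[OF C, of y] by simp
qed

lemma solve_in_cell:
  fixes y :: "root \<Rightarrow> 'k::field"
  assumes n: "1 \<le> n" and y: "\<And>\<xi>. \<xi> \<in> C_set n D \<Longrightarrow> y \<xi> \<noteq> 0"
  shows "matrix_of (solve y) \<in> basic_cell n D"
proof -
  have "solve y b c \<noteq> 0" if "(b, c) \<in> D" for b c using solve_D[OF n that, of y] y D_subset_C[OF n] that by auto
  then have "matrix_of (solve y) \<in> basic_variety n D (\<lambda>(b, c). solve y b c)" "\<forall>\<xi>\<in>D. (case \<xi> of (b, c) \<Rightarrow> solve y b c) \<noteq> 0"
    using matrix_of_in_variety[OF n, of "solve y"] solve_support[of y] by (blast, auto)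
  then show ?thesis unfolding basic_cell_def by blast
qed

lemma elim_cong:
  fixes x y :: "nat \<Rightarrow> nat \<Rightarrow> 'k::field"
  assumes "1 \<le> j" "j \<le> Suc n" "j \<le> c" "c < b" "b \<le> n"
    and "\<And>r p. 1 \<le> p \<Longrightarrow> p < r \<Longrightarrow> r \<le> n \<Longrightarrow> x r p = y r p"
  shows "elim j x b c = elim j y b c"
proof -
  have "elim j x b c - x b c = elim j y b c - y b c" using assms by (intro elim_triangular) auto
  then show ?thesis using assms by simp
qed

lemma pivots_nonzero_cong:
  fixes x y :: "nat \<Rightarrow> nat \<Rightarrow> 'k::field"
  assumes n: "1 \<le> n" and "\<And>r p. 1 \<le> p \<Longrightarrow> p < r \<Longrightarrow> r \<le> n \<Longrightarrow> x r p = y r p"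
    and ns: "pivots_nonzero (Suc n) x"
  shows "pivots_nonzero (Suc n) y"
  unfolding pivots_nonzero_def
proof (intro allI impI)
  fix c k assume c: "1 \<le> c" "c < Suc n" "k \<in> rec_at c"
  then have "(k, c) \<in> C_set n D" using C_iff[OF n] by auto
  then have "elim c x k c = elim c y k c" using C_bounds[of k c] assms(2) by (intro elim_cong) auto
  then show "elim c y k c \<noteq> 0" using ns c unfolding pivots_nonzero_def by auto
qed

text \<open>Computing the entry of number \<open>N\<close> divides only by pivots at earlier places, which have already been
given their prescribed nonzero values.\<close>

lemma solve_rational:
  fixes y :: "'p \<Rightarrow> root \<Rightarrow> 'k::field"
  assumes n: "1 \<le> n" and F: "rational_class Fp U"
    and y: "\<And>\<xi>. \<xi> \<in> C_set n D \<Longrightarrow> Fp (\<lambda>p. y p \<xi>)" "\<And>p \<xi>. p \<in> U \<Longrightarrow> \<xi> \<in> C_set n D \<Longrightarrow> y p \<xi> \<noteq> 0"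
  shows "Fp (\<lambda>p. solve (y p) b c)"
proof -
  interpret F: rational_class Fp U by (rule F)
  have "Fp (\<lambda>p. solve_upto N (y p) b c)" if "N \<le> Suc n * Suc n" for N
    using that
  proof (induction N arbitrary: b c)
    case 0 then show ?case using F.const by simp
  next
    case (Suc N)
    show ?case
    proof (cases "(b, c) \<in> C_set n D \<and> place_index b c = N")
      case True
      then have bc: "1 \<le> c" "c < b" "b \<le> n" using C_bounds by auto
      have "pivots_nonzero c (solve_upto N (y p))" if p: "p \<in> U" for p
      proof (rule pivots_nonzero_agree[OF n])
        show "solve (y p) b' c' = solve_upto N (y p) b' c'" if "before b' c' b c" for b' c'
        proof -
          have b': "1 \<le> c'" "c' < b'" "b' \<le> n" using that unfolding before_def by auto
          then have "place_index b' c' < N" using place_index_less[OF b' bc] that True by auto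
          then show ?thesis using solve_upto_solve[of c' b' N "y p"] Suc.prems b' by auto
        qed
        show "pivots_nonzero c (solve (y p))"
          using pivots_nonzero_mono[OF solve_pivots_nonzero[OF n y(2)[OF p]]] bc by auto
      qed (use bc in auto)
      then have "Fp (\<lambda>p. elim c (solve_upto N (y p)) b c)"
        using bc Suc by (intro elim_rational[OF F]) auto
      then have "Fp (\<lambda>p. y p (b, c) - elim c (solve_upto N (y p)) b c)"
        using True by (intro F.diff y(1)) auto
      then show ?thesis using True by simp
    next
      case False
      then have "\<And>p. solve_upto (Suc N) (y p) b c = solve_upto N (y p) b c" by auto
      then show ?thesis using Suc by simp
    qed
  qed
  from this[OF order_refl] show ?thesis unfolding solve_def .
qed

end

section \<open>Polynomial functions and irreducibility of the cell\<close>

lemma poly_functions_const: "(\<lambda>X. c) \<in> poly_functions n" by (rule poly_functions.const)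

lemma poly_functions_uminus: "f \<in> poly_functions n \<Longrightarrow> (\<lambda>X. - f X) \<in> poly_functions n"
  using poly_functions.mult[OF poly_functions.const[of "-1"]] by simp

lemma poly_functions_sum: "(\<And>i. i \<in> A \<Longrightarrow> f i \<in> poly_functions n) \<Longrightarrow> (\<lambda>X. \<Sum>i\<in>A. f i X) \<in> poly_functions n"
  by (induction A rule: infinite_finite_induct) (auto intro: poly_functions.intros)

lemma poly_functions_prod: "(\<And>i. i \<in> A \<Longrightarrow> f i \<in> poly_functions n) \<Longrightarrow> (\<lambda>X. \<Prod>i\<in>A. f i X) \<in> poly_functions n"
  by (induction A rule: infinite_finite_induct) (auto intro: poly_functions.intros)

lemma poly_functions_det:
  fixes f :: "nat \<Rightarrow> nat \<Rightarrow> 'k::field mat \<Rightarrow> 'k"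
  assumes "\<And>i l. i < m \<Longrightarrow> l < m \<Longrightarrow> f i l \<in> poly_functions n"
  shows "(\<lambda>X. det (mat m m (\<lambda>(i, l). f i l X))) \<in> poly_functions n"
proof -
  have "(\<lambda>X. \<Sum>p\<in>{p. p permutes {0..<m}}. of_int (sign p) * (\<Prod>i = 0..<m. f i (p i) X)) \<in> poly_functions n"
    using assms by (intro poly_functions_sum poly_functions.mult poly_functions_const poly_functions_prod)
      (auto simp: permutes_in_image)
  moreover have "det (mat m m (\<lambda>(i, l). f i l X)) =
      (\<Sum>p\<in>{p. p permutes {0..<m}}. of_int (sign p) * (\<Prod>i = 0..<m. f i (p i) X))" for X
    unfolding det_def by (auto intro!: sum.cong prod.cong simp: permutes_in_image)
  ultimately show ?thesis by presburger
qed

text \<open>The entries on and above the diagonal are not among the coordinates, but they vanish on strictly lower matrices.\<close>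

lemma poly_function_ent:
  fixes b c n :: nat
  assumes "b \<in> {1..n}" "c \<in> {1..n}"
  shows "\<exists>f\<in>poly_functions n. \<forall>X\<in>strictly_lower n. f X = (ent X b c :: 'a::field)"
proof (cases "c < b")
  case True
  then have "(b, c) \<in> pos_roots n" using assms by (auto simp: pos_roots_def)
  then have "(\<lambda>X. X $$ (b - 1, c - 1)) \<in> poly_functions n" by (rule poly_functions.coord)
  then show ?thesis unfolding ent_def by (rule bexI[rotated]) simp
next
  case False
  then show ?thesis using ent_strict[OF _ assms, where 'a = 'a]
    by (intro bexI[of _ "\<lambda>X. 0"] poly_functions_const) auto
qed

lemma poly_functions_pullback:
  fixes f :: "'k::field mat \<Rightarrow> 'k"
  assumes "f \<in> poly_functions n" and g: "g \<in> UT n"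
  shows "\<exists>f'\<in>poly_functions n. \<forall>X\<in>strictly_lower n. f' X = f (coadjoint_act g X)"
  using assms(1)
proof induction
  case (const c) then show ?case by (intro bexI[of _ "\<lambda>X. c"] poly_functions_const) simp
next
  case (coord i j)
  then have ij: "1 \<le> j" "j < i" "i \<le> n" by (auto simp: pos_roots_def)
  note gc = UT_carrier[OF g] and ic = UT_carrier[OF UT_ginv(1)[OF g]]
  have "\<forall>b c. \<exists>f :: 'k mat \<Rightarrow> 'k. b \<in> {1..n} \<longrightarrow> c \<in> {1..n} \<longrightarrow>
      f \<in> poly_functions n \<and> (\<forall>X\<in>strictly_lower n. f X = ent X b c)"
    using poly_function_ent[where 'a = 'k] by blast
  then obtain e where e: "\<And>b c. b \<in> {1..n} \<Longrightarrow> c \<in> {1..n} \<Longrightarrow>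
      e b c \<in> poly_functions n \<and> (\<forall>X\<in>strictly_lower n. e b c X = (ent X b c :: 'k))"
    unfolding choice_iff by blast
  define f' where "f' = (\<lambda>X. \<Sum>p\<in>{1..n}. (\<Sum>q\<in>{1..n}. ent g i q * e q p X) * ent (ginv g) p j)"
  have "f' \<in> poly_functions n" unfolding f'_def
    using e by (intro poly_functions_sum poly_functions.mult poly_functions_const) auto
  moreover have "f' X = coadjoint_act g X $$ (i - 1, j - 1)" if X: "X \<in> strictly_lower n" for X
  proof -
    note Xc = strictly_lower_carrier[OF X]
    have b: "i \<in> {1..n}" "j \<in> {1..n}" using ij by auto
    have "coadjoint_act g X $$ (i - 1, j - 1) = ent (g * X * ginv g) i j"
      using ent_lower[OF mult_carrier_mat[OF mult_carrier_mat[OF gc Xc] ic] b] ij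
      by (simp only: coadjoint_act_def ent_def if_True)
    also have "\<dots> = f' X" using b X e
      unfolding f'_def ent_mult[OF mult_carrier_mat[OF gc Xc] ic b] mm_def
      by (intro sum.cong refl) (auto simp: ent_mult[OF gc Xc] mm_def)
    finally show ?thesis by simp
  qed
  ultimately show ?case by blast
next
  case (add f1 f2)
  from add.IH(1) obtain h1 where h1: "h1 \<in> poly_functions n" "\<forall>X\<in>strictly_lower n. h1 X = f1 (coadjoint_act g X)" by (rule bexE)
  from add.IH(2) obtain h2 where h2: "h2 \<in> poly_functions n" "\<forall>X\<in>strictly_lower n. h2 X = f2 (coadjoint_act g X)" by (rule bexE)
  have "(\<lambda>X. h1 X + h2 X) \<in> poly_functions n" by (rule poly_functions.add[OF h1(1) h2(1)])
  moreover have "\<forall>X\<in>strictly_lower n. h1 X + h2 X = f1 (coadjoint_act g X) + f2 (coadjoint_act g X)"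
    using h1(2) h2(2) by metis
  ultimately show ?case by (intro bexI)
next
  case (mult f1 f2)
  from mult.IH(1) obtain h1 where h1: "h1 \<in> poly_functions n" "\<forall>X\<in>strictly_lower n. h1 X = f1 (coadjoint_act g X)" by (rule bexE)
  from mult.IH(2) obtain h2 where h2: "h2 \<in> poly_functions n" "\<forall>X\<in>strictly_lower n. h2 X = f2 (coadjoint_act g X)" by (rule bexE)
  have "(\<lambda>X. h1 X * h2 X) \<in> poly_functions n" by (rule poly_functions.mult[OF h1(1) h2(1)])
  moreover have "\<forall>X\<in>strictly_lower n. h1 X * h2 X = f1 (coadjoint_act g X) * f2 (coadjoint_act g X)"
    using h1(2) h2(2) by metis
  ultimately show ?case by (intro bexI)
qed

lemma poly_functions_curve:
  fixes X :: "'k::field \<Rightarrow> 'k mat"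
  assumes "f \<in> poly_functions n"
    and ent: "\<And>b c. b \<in> {1..n} \<Longrightarrow> c \<in> {1..n} \<Longrightarrow> \<exists>p. \<forall>s. ent (X s) b c = poly p s"
  shows "\<exists>p. \<forall>s. f (X s) = poly p s"
  using assms(1)
proof induction
  case (const c) then show ?case by (intro exI[of _ "[:c:]"]) simp
next
  case (coord i j)
  then show ?case using ent[of i j] by (auto simp: pos_roots_def ent_def)
next
  case (add f1 f2)
  then obtain p q where "\<And>s. f1 (X s) = poly p s" "\<And>s. f2 (X s) = poly q s" by metis
  then show ?case by (intro exI[of _ "p + q"]) simp
next
  case (mult f1 f2)
  then obtain p q where "\<And>s. f1 (X s) = poly p s" "\<And>s. f2 (X s) = poly q s" by metis
  then show ?case by (intro exI[of _ "p * q"]) simp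
qed

definition segment :: "nat \<Rightarrow> 'k::field mat \<Rightarrow> 'k mat \<Rightarrow> 'k \<Rightarrow> 'k mat" where
  "segment n g h s = mat n n (\<lambda>(i, l). (1 - s) * g $$ (i, l) + s * h $$ (i, l))"

lemma UT_segment:
  fixes g h :: "'k::field mat"
  assumes g: "g \<in> UT n" and h: "h \<in> UT n"
  shows "segment n g h s \<in> UT n" "segment n g h 0 = g" "segment n g h 1 = h"
    and "b \<in> {1..n} \<Longrightarrow> c \<in> {1..n} \<Longrightarrow> \<exists>p. \<forall>s. ent (segment n g h s) b c = poly p s"
proof -
  show "segment n g h s \<in> UT n" using g h unfolding UT_iff segment_def by auto
  show "segment n g h 0 = g" "segment n g h 1 = h" using UT_carrier[OF g] UT_carrier[OF h] unfolding segment_def by auto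
  assume bc: "b \<in> {1..n}" "c \<in> {1..n}"
  then have "ent (segment n g h s) b c = poly ([:ent g b c:] * [:1, -1:] + [:ent h b c:] * [:0, 1:]) s" for s
    by (auto simp: segment_def ent_def algebra_simps)
  then show "\<exists>p. \<forall>s. ent (segment n g h s) b c = poly p s" by blast
qed

lemma basic_cell_parametrization:
  "X \<in> basic_cell n D \<longleftrightarrow> (\<exists>g h \<phi>. g \<in> UT n \<and> h \<in> UT n \<and> (\<forall>\<xi>\<in>D. \<phi> \<xi> \<noteq> 0) \<and> X = lower_part (g * X_mat n D \<phi> * h))"
proof
  assume "X \<in> basic_cell n D"
  then obtain g h \<phi> where "g \<in> UT n" "h \<in> UT n" "\<forall>\<xi>\<in>D. \<phi> \<xi> \<noteq> 0" "X = left_right_act g h (X_mat n D \<phi>)"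
    unfolding basic_cell_def basic_variety_def by blast
  then show "\<exists>g h \<phi>. g \<in> UT n \<and> h \<in> UT n \<and> (\<forall>\<xi>\<in>D. \<phi> \<xi> \<noteq> 0) \<and> X = lower_part (g * X_mat n D \<phi> * h)"
    unfolding left_right_act_def using UT_ginv(1) by blast
next
  assume "\<exists>g h \<phi>. g \<in> UT n \<and> h \<in> UT n \<and> (\<forall>\<xi>\<in>D. \<phi> \<xi> \<noteq> 0) \<and> X = lower_part (g * X_mat n D \<phi> * h)"
  then obtain g h \<phi> where a: "g \<in> UT n" "h \<in> UT n" "\<forall>\<xi>\<in>D. \<phi> \<xi> \<noteq> 0" "X = lower_part (g * X_mat n D \<phi> * h)" by blast
  then have "X = left_right_act g (ginv h) (X_mat n D \<phi>)"
    unfolding left_right_act_def ginv_ginv[OF a(2)] by simp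
  then show "X \<in> basic_cell n D" unfolding basic_cell_def basic_variety_def using a UT_ginv(1)[OF a(2)] by blast
qed

text \<open>Join parameters of the two points by a line. Along it both functions and the coefficients \<open>\<phi> \<xi>\<close> are nonzero
polynomials in one variable, so that they have a common non-zero.\<close>

lemma basic_cell_irreducible:
  fixes f h :: "'k::field_char_0 mat \<Rightarrow> 'k"
  assumes D: "finite D" and fh: "f \<in> poly_functions n" "h \<in> poly_functions n"
    and X: "X \<in> basic_cell n D" "f X \<noteq> 0" and Y: "Y \<in> basic_cell n D" "h Y \<noteq> 0"
  shows "\<exists>Z\<in>basic_cell n D. f Z \<noteq> 0 \<and> h Z \<noteq> 0"
proof -
  obtain g0 h0 \<phi>0 where p0: "g0 \<in> UT n" "h0 \<in> UT n" "\<forall>\<xi>\<in>D. \<phi>0 \<xi> \<noteq> 0" "X = lower_part (g0 * X_mat n D \<phi>0 * h0)"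
    using X(1) basic_cell_parametrization by blast
  obtain g1 h1 \<phi>1 where p1: "g1 \<in> UT n" "h1 \<in> UT n" "\<forall>\<xi>\<in>D. \<phi>1 \<xi> \<noteq> 0" "Y = lower_part (g1 * X_mat n D \<phi>1 * h1)"
    using Y(1) basic_cell_parametrization by blast
  define G where "G = segment n g0 g1"
  define H where "H = segment n h0 h1"
  define \<phi> where "\<phi> = (\<lambda>s \<xi>. (1 - s) * \<phi>0 \<xi> + s * \<phi>1 \<xi>)"
  define Z where "Z = (\<lambda>s. lower_part (G s * X_mat n D (\<phi> s) * H s))"
  note G = UT_segment[OF p0(1) p1(1), folded G_def] and H = UT_segment[OF p0(2) p1(2), folded H_def]
  have c: "G s \<in> carrier_mat n n" "H s \<in> carrier_mat n n" for s using G(1) H(1) UT_carrier by auto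
  have Z01: "Z 0 = X" "Z 1 = Y" unfolding Z_def p0(4) p1(4) by (simp_all add: \<phi>_def G(2,3) H(2,3))
  have cell: "Z s \<in> basic_cell n D" if "\<forall>\<xi>\<in>D. \<phi> s \<xi> \<noteq> 0" for s
    unfolding basic_cell_parametrization Z_def using that G(1) H(1) by (intro exI conjI refl) auto
  have lin: "\<phi> s \<xi> = poly [:\<phi>0 \<xi>, \<phi>1 \<xi> - \<phi>0 \<xi>:] s" for s \<xi> by (simp add: \<phi>_def algebra_simps)
  have curve: "\<exists>p. \<forall>s. ent (Z s) b c = poly p s" if bc: "b \<in> {1..n}" "c \<in> {1..n}" for b c
  proof (cases "c < b")
    case False
    have "Z s \<in> strictly_lower n" for s unfolding Z_def
      by (intro lower_part_strict mult_carrier_mat[OF mult_carrier_mat[OF c(1) X_mat_carrier] c(2)])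
    then have "ent (Z s) b c = poly 0 s" for s using ent_strict[of "Z s" n b c] bc False by simp
    then show ?thesis by blast
  next
    case True
    obtain pG where pG: "\<And>b c s. b \<in> {1..n} \<Longrightarrow> c \<in> {1..n} \<Longrightarrow> ent (G s) b c = poly (pG b c) s"
      using G(4) by metis
    obtain pH where pH: "\<And>b c s. b \<in> {1..n} \<Longrightarrow> c \<in> {1..n} \<Longrightarrow> ent (H s) b c = poly (pH b c) s"
      using H(4) by metis
    define pX where "pX = (\<lambda>q r. if (q, r) \<in> D then [:\<phi>0 (q, r), \<phi>1 (q, r) - \<phi>0 (q, r):] else 0)"
    have pX: "ent (X_mat n D (\<phi> s)) q r = poly (pX q r) s" if "q \<in> {1..n}" "r \<in> {1..n}" for q r s
      using that unfolding pX_def by (auto simp: ent_def X_mat_def lin)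
    have "ent (Z s) b c = poly (\<Sum>r\<in>{1..n}. (\<Sum>q\<in>{1..n}. pG b q * pX q r) * pH r c) s" for s
    proof -
      have "ent (Z s) b c = ent (G s * X_mat n D (\<phi> s) * H s) b c"
        using ent_lower[OF mult_carrier_mat[OF mult_carrier_mat[OF c(1) X_mat_carrier] c(2)] bc] True
        unfolding Z_def by simp
      also have "\<dots> = (\<Sum>r\<in>{1..n}. (\<Sum>q\<in>{1..n}. poly (pG b q) s * poly (pX q r) s) * poly (pH r c) s)"
        unfolding ent_mult[OF mult_carrier_mat[OF c(1) X_mat_carrier] c(2) bc] mm_def
        using bc by (intro sum.cong refl) (simp add: ent_mult[OF c(1) X_mat_carrier] mm_def pG pX pH)
      also have "\<dots> = poly (\<Sum>r\<in>{1..n}. (\<Sum>q\<in>{1..n}. pG b q * pX q r) * pH r c) s"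
        by (simp add: poly_sum)
      finally show ?thesis .
    qed
    then show ?thesis by blast
  qed
  obtain pf where pf: "\<And>s. f (Z s) = poly pf s" using poly_functions_curve[OF fh(1) curve] by blast
  obtain ph where ph: "\<And>s. h (Z s) = poly ph s" using poly_functions_curve[OF fh(2) curve] by blast
  \<comment> \<open>the last factor keeps the curve inside the cell\<close>
  define P where "P = pf * ph * (\<Prod>\<xi>\<in>D. [:\<phi>0 \<xi>, \<phi>1 \<xi> - \<phi>0 \<xi>:])"
  have "poly pf 0 \<noteq> 0" "poly ph 1 \<noteq> 0" using pf[of 0] ph[of 1] Z01 X(2) Y(2) by auto
  then have "pf \<noteq> 0" "ph \<noteq> 0" by auto
  moreover have "(\<Prod>\<xi>\<in>D. [:\<phi>0 \<xi>, \<phi>1 \<xi> - \<phi>0 \<xi>:]) \<noteq> 0" using p0(3) D by auto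
  ultimately have "P \<noteq> 0" unfolding P_def by simp
  then have "finite {s. poly P s = 0}" by (rule poly_roots_finite)
  then obtain s where s: "poly P s \<noteq> 0"
    using ex_new_if_finite[OF infinite_UNIV_char_0[where 'a = 'k]] by blast
  then have "\<forall>\<xi>\<in>D. \<phi> s \<xi> \<noteq> 0" using D unfolding P_def lin by (auto simp: poly_prod)
  then show ?thesis using cell s pf ph unfolding P_def by (intro bexI[of _ "Z s"]) auto
qed

section \<open>The field of fractions of a domain\<close>

text \<open>Evaluates the operations of the fraction field, which are unions over representatives.\<close>

lemma Union_constant:
  assumes "A \<noteq> {}" "B \<noteq> {}" "\<And>a b c d. (a, b) \<in> A \<Longrightarrow> (c, d) \<in> B \<Longrightarrow> f a b c d = K"
  shows "(\<Union>(a, b)\<in>A. \<Union>(c, d)\<in>B. f a b c d) = K"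
  using assms by fastforce

context domain begin

lemma equiv_fraction_rel: "equiv (carrier R \<times> (carrier R - {\<zero>})) (fraction_rel R)"
proof (rule equivI)
  show "refl_on (carrier R \<times> (carrier R - {\<zero>})) (fraction_rel R)"
    by (auto simp: refl_on_def fraction_rel_def)
  show "sym (fraction_rel R)" by (auto simp: sym_def fraction_rel_def)
  show "trans (fraction_rel R)" unfolding trans_def
  proof (intro allI impI)
    fix x y z assume xy: "(x, y) \<in> fraction_rel R" and yz: "(y, z) \<in> fraction_rel R"
    obtain a b c d e f where v: "x = (a, b)" "y = (c, d)" "z = (e, f)" by (metis surj_pair)
    have car: "a \<in> carrier R" "b \<in> carrier R" "c \<in> carrier R" "d \<in> carrier R" "e \<in> carrier R" "f \<in> carrier R"
      and nz: "b \<noteq> \<zero>" "d \<noteq> \<zero>" "f \<noteq> \<zero>" and eq: "a \<otimes> d = c \<otimes> b" "c \<otimes> f = e \<otimes> d"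
      using xy yz unfolding v fraction_rel_def by auto
    have "d \<otimes> (a \<otimes> f) = (a \<otimes> d) \<otimes> f" using car by (simp add: m_ac)
    also have "\<dots> = (c \<otimes> f) \<otimes> b" unfolding eq(1) using car by (simp add: m_ac)
    also have "\<dots> = d \<otimes> (e \<otimes> b)" unfolding eq(2) using car by (simp add: m_ac)
    finally have "a \<otimes> f = e \<otimes> b" using m_lcancel[OF nz(2) car(4)] car by simp
    then show "(x, z) \<in> fraction_rel R" unfolding v fraction_rel_def using car nz by simp
  qed
qed (auto simp: fraction_rel_def)

lemma fraction_eq_iff:
  assumes "a \<in> carrier R" "b \<in> carrier R - {\<zero>}" "c \<in> carrier R" "d \<in> carrier R - {\<zero>}"
  shows "fraction R a b = fraction R c d \<longleftrightarrow> a \<otimes> d = c \<otimes> b"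
  unfolding fraction_def using eq_equiv_class_iff[OF equiv_fraction_rel, of "(a, b)" "(c, d)"] assms
  by (auto simp: fraction_rel_def)

lemma fraction_mem:
  assumes "a \<in> carrier R" "b \<in> carrier R - {\<zero>}"
  shows "(c, d) \<in> fraction R a b \<longleftrightarrow> c \<in> carrier R \<and> d \<in> carrier R - {\<zero>} \<and> a \<otimes> d = c \<otimes> b"
  using assms unfolding fraction_def fraction_rel_def by auto

lemma fraction_self: "a \<in> carrier R \<Longrightarrow> b \<in> carrier R - {\<zero>} \<Longrightarrow> (a, b) \<in> fraction R a b"
  using fraction_mem by simp

abbreviation "L \<equiv> fraction_field R"

lemma fraction_carrier: "A \<in> carrier L \<longleftrightarrow> (\<exists>a b. a \<in> carrier R \<and> b \<in> carrier R - {\<zero>} \<and> A = fraction R a b)"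
  unfolding fraction_field_def quotient_def fraction_def by auto

lemma den_mult: "b \<in> carrier R - {\<zero>} \<Longrightarrow> d \<in> carrier R - {\<zero>} \<Longrightarrow> b \<otimes> d \<in> carrier R - {\<zero>}"
  using integral by auto

lemma fraction_mult:
  assumes "a \<in> carrier R" "b \<in> carrier R - {\<zero>}" "c \<in> carrier R" "d \<in> carrier R - {\<zero>}"
  shows "fraction R a b \<otimes>\<^bsub>L\<^esub> fraction R c d = fraction R (a \<otimes> c) (b \<otimes> d)"
proof -
  have "(\<Union>(a, b)\<in>fraction R a b. \<Union>(c, d)\<in>fraction R c d. fraction R (a \<otimes> c) (b \<otimes> d)) = fraction R (a \<otimes> c) (b \<otimes> d)"
  proof (rule Union_constant)
    show "fraction R a b \<noteq> {}" "fraction R c d \<noteq> {}" using fraction_self assms by blast+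
    fix a' b' c' d' assume m: "(a', b') \<in> fraction R a b" "(c', d') \<in> fraction R c d"
    have v: "a' \<in> carrier R" "b' \<in> carrier R - {\<zero>}" "a \<otimes> b' = a' \<otimes> b" "c' \<in> carrier R" "d' \<in> carrier R - {\<zero>}" "c \<otimes> d' = c' \<otimes> d"
      using m fraction_mem assms by auto
    have "(a' \<otimes> c') \<otimes> (b \<otimes> d) = (a' \<otimes> b) \<otimes> (c' \<otimes> d)" using v(1,2,4,5) assms by (simp add: m_ac)
    also have "\<dots> = (a \<otimes> b') \<otimes> (c \<otimes> d')" using v by simp
    also have "\<dots> = (a \<otimes> c) \<otimes> (b' \<otimes> d')" using v(1,2,4,5) assms by (simp add: m_ac)
    finally show "fraction R (a' \<otimes> c') (b' \<otimes> d') = fraction R (a \<otimes> c) (b \<otimes> d)"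
      using v assms by (subst fraction_eq_iff) (auto intro: den_mult simp: den_mult[simplified])
  qed
  then show ?thesis by (simp add: fraction_field_def)
qed

lemma fraction_add:
  assumes "a \<in> carrier R" "b \<in> carrier R - {\<zero>}" "c \<in> carrier R" "d \<in> carrier R - {\<zero>}"
  shows "fraction R a b \<oplus>\<^bsub>L\<^esub> fraction R c d = fraction R ((a \<otimes> d) \<oplus> (c \<otimes> b)) (b \<otimes> d)"
proof -
  have "(\<Union>(a, b)\<in>fraction R a b. \<Union>(c, d)\<in>fraction R c d. fraction R ((a \<otimes> d) \<oplus> (c \<otimes> b)) (b \<otimes> d)) =
    fraction R ((a \<otimes> d) \<oplus> (c \<otimes> b)) (b \<otimes> d)"
  proof (rule Union_constant)
    show "fraction R a b \<noteq> {}" "fraction R c d \<noteq> {}" using fraction_self assms by blast+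
    fix a' b' c' d' assume m: "(a', b') \<in> fraction R a b" "(c', d') \<in> fraction R c d"
    have v: "a' \<in> carrier R" "b' \<in> carrier R - {\<zero>}" "a \<otimes> b' = a' \<otimes> b" "c' \<in> carrier R" "d' \<in> carrier R - {\<zero>}" "c \<otimes> d' = c' \<otimes> d"
      using m fraction_mem assms by auto
    have "((a' \<otimes> d') \<oplus> (c' \<otimes> b')) \<otimes> (b \<otimes> d) = (a' \<otimes> b) \<otimes> (d' \<otimes> d) \<oplus> (c' \<otimes> d) \<otimes> (b' \<otimes> b)"
      using v(1,2,4,5) assms by (simp add: m_ac l_distr r_distr)
    also have "\<dots> = (a \<otimes> b') \<otimes> (d' \<otimes> d) \<oplus> (c \<otimes> d') \<otimes> (b' \<otimes> b)" using v by simp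
    also have "\<dots> = ((a \<otimes> d) \<oplus> (c \<otimes> b)) \<otimes> (b' \<otimes> d')" using v(1,2,4,5) assms by (simp add: m_ac l_distr r_distr)
    finally show "fraction R ((a' \<otimes> d') \<oplus> (c' \<otimes> b')) (b' \<otimes> d') = fraction R ((a \<otimes> d) \<oplus> (c \<otimes> b)) (b \<otimes> d)"
      using v assms by (subst fraction_eq_iff) (auto simp: den_mult[simplified])
  qed
  then show ?thesis by (simp add: fraction_field_def)
qed

lemma fraction_zero: "\<zero>\<^bsub>L\<^esub> = fraction R \<zero> \<one>" and fraction_one: "\<one>\<^bsub>L\<^esub> = fraction R \<one> \<one>"
  by (simp_all add: fraction_field_def)

lemma fraction_in_carrier: "a \<in> carrier R \<Longrightarrow> b \<in> carrier R - {\<zero>} \<Longrightarrow> fraction R a b \<in> carrier L"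
  using fraction_carrier by blast

lemma fraction_zero_iff: "a \<in> carrier R \<Longrightarrow> b \<in> carrier R - {\<zero>} \<Longrightarrow> fraction R a b = \<zero>\<^bsub>L\<^esub> \<longleftrightarrow> a = \<zero>"
  unfolding fraction_zero by (subst fraction_eq_iff) auto

lemma fraction_cancel:
  assumes "a \<in> carrier R" "b \<in> carrier R - {\<zero>}" "e \<in> carrier R - {\<zero>}" "c = e \<otimes> a" "d = e \<otimes> b"
  shows "fraction R c d = fraction R a b"
  using assms by (subst fraction_eq_iff) (auto simp: den_mult[simplified] m_ac)

lemma field_fraction_field: "field L"
proof -
  have ag: "abelian_group L"
  proof (rule abelian_groupI)
    fix x y z assume "x \<in> carrier L" "y \<in> carrier L" "z \<in> carrier L"
    then obtain a b c d e f where v: "a \<in> carrier R" "b \<in> carrier R - {\<zero>}" "x = fraction R a b"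
      "c \<in> carrier R" "d \<in> carrier R - {\<zero>}" "y = fraction R c d" "e \<in> carrier R" "f \<in> carrier R - {\<zero>}" "z = fraction R e f"
      unfolding fraction_carrier by blast
    have den: "b \<otimes> d \<in> carrier R - {\<zero>}" "d \<otimes> f \<in> carrier R - {\<zero>}" using v den_mult by auto
    show "x \<oplus>\<^bsub>L\<^esub> y \<oplus>\<^bsub>L\<^esub> z = x \<oplus>\<^bsub>L\<^esub> (y \<oplus>\<^bsub>L\<^esub> z)"
      using v den by (simp add: fraction_add l_distr r_distr m_ac a_ac)
  next
    fix x y assume "x \<in> carrier L" "y \<in> carrier L"
    then obtain a b c d where v: "a \<in> carrier R" "b \<in> carrier R - {\<zero>}" "x = fraction R a b"
      "c \<in> carrier R" "d \<in> carrier R - {\<zero>}" "y = fraction R c d"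
      unfolding fraction_carrier by blast
    have den: "b \<otimes> d \<in> carrier R - {\<zero>}" using v den_mult by auto
    show "x \<oplus>\<^bsub>L\<^esub> y \<in> carrier L" using v den by (simp add: fraction_add fraction_in_carrier)
    show "x \<oplus>\<^bsub>L\<^esub> y = y \<oplus>\<^bsub>L\<^esub> x" using v den by (simp add: fraction_add m_ac a_ac)
  next
    show "\<zero>\<^bsub>L\<^esub> \<in> carrier L" unfolding fraction_zero by (rule fraction_in_carrier) auto
  next
    fix x assume "x \<in> carrier L"
    then obtain a b where v: "a \<in> carrier R" "b \<in> carrier R - {\<zero>}" "x = fraction R a b"
      unfolding fraction_carrier by blast
    show "\<zero>\<^bsub>L\<^esub> \<oplus>\<^bsub>L\<^esub> x = x" unfolding fraction_zero using v by (simp add: fraction_add)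
    have "fraction R (\<ominus> a) b \<oplus>\<^bsub>L\<^esub> x = \<zero>\<^bsub>L\<^esub>"
      using v den_mult[of b b] by (simp add: fraction_add fraction_zero_iff l_minus l_neg)
    moreover have "fraction R (\<ominus> a) b \<in> carrier L" using v by (intro fraction_in_carrier) auto
    ultimately show "\<exists>y\<in>carrier L. y \<oplus>\<^bsub>L\<^esub> x = \<zero>\<^bsub>L\<^esub>" by blast
  qed
  have cm: "comm_monoid L"
  proof (rule comm_monoidI)
    fix x y z assume "x \<in> carrier L" "y \<in> carrier L" "z \<in> carrier L"
    then obtain a b c d e f where v: "a \<in> carrier R" "b \<in> carrier R - {\<zero>}" "x = fraction R a b"
      "c \<in> carrier R" "d \<in> carrier R - {\<zero>}" "y = fraction R c d" "e \<in> carrier R" "f \<in> carrier R - {\<zero>}" "z = fraction R e f"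
      unfolding fraction_carrier by blast
    have den: "b \<otimes> d \<in> carrier R - {\<zero>}" "d \<otimes> f \<in> carrier R - {\<zero>}" using v den_mult by auto
    show "x \<otimes>\<^bsub>L\<^esub> y \<otimes>\<^bsub>L\<^esub> z = x \<otimes>\<^bsub>L\<^esub> (y \<otimes>\<^bsub>L\<^esub> z)" using v den by (simp add: fraction_mult m_ac)
  next
    fix x y assume "x \<in> carrier L" "y \<in> carrier L"
    then obtain a b c d where v: "a \<in> carrier R" "b \<in> carrier R - {\<zero>}" "x = fraction R a b"
      "c \<in> carrier R" "d \<in> carrier R - {\<zero>}" "y = fraction R c d"
      unfolding fraction_carrier by blast
    have den: "b \<otimes> d \<in> carrier R - {\<zero>}" using v den_mult by auto
    show "x \<otimes>\<^bsub>L\<^esub> y \<in> carrier L" using v den by (simp add: fraction_mult fraction_in_carrier)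
    show "x \<otimes>\<^bsub>L\<^esub> y = y \<otimes>\<^bsub>L\<^esub> x" using v by (simp add: fraction_mult m_ac)
  next
    show "\<one>\<^bsub>L\<^esub> \<in> carrier L" unfolding fraction_one by (rule fraction_in_carrier) auto
  next
    fix x assume "x \<in> carrier L"
    then obtain a b where v: "a \<in> carrier R" "b \<in> carrier R - {\<zero>}" "x = fraction R a b"
      unfolding fraction_carrier by blast
    show "\<one>\<^bsub>L\<^esub> \<otimes>\<^bsub>L\<^esub> x = x" unfolding fraction_one using v by (simp add: fraction_mult)
  qed
  have distr: "(x \<oplus>\<^bsub>L\<^esub> y) \<otimes>\<^bsub>L\<^esub> z = x \<otimes>\<^bsub>L\<^esub> z \<oplus>\<^bsub>L\<^esub> y \<otimes>\<^bsub>L\<^esub> z"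
    if "x \<in> carrier L" "y \<in> carrier L" "z \<in> carrier L" for x y z
  proof -
    obtain a b c d e f where v: "a \<in> carrier R" "b \<in> carrier R - {\<zero>}" "x = fraction R a b"
      "c \<in> carrier R" "d \<in> carrier R - {\<zero>}" "y = fraction R c d" "e \<in> carrier R" "f \<in> carrier R - {\<zero>}" "z = fraction R e f"
      using \<open>x \<in> carrier L\<close> \<open>y \<in> carrier L\<close> \<open>z \<in> carrier L\<close> unfolding fraction_carrier by blast
    have den: "b \<otimes> d \<in> carrier R - {\<zero>}" "d \<otimes> f \<in> carrier R - {\<zero>}" "b \<otimes> f \<in> carrier R - {\<zero>}"
      "b \<otimes> d \<otimes> f \<in> carrier R - {\<zero>}" using v den_mult by auto
    have "x \<otimes>\<^bsub>L\<^esub> z \<oplus>\<^bsub>L\<^esub> y \<otimes>\<^bsub>L\<^esub> z = fraction R ((a \<otimes> e) \<otimes> (d \<otimes> f) \<oplus> (c \<otimes> e) \<otimes> (b \<otimes> f)) ((b \<otimes> f) \<otimes> (d \<otimes> f))"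
      using v den by (simp add: fraction_mult fraction_add)
    also have "\<dots> = fraction R (((a \<otimes> d) \<oplus> (c \<otimes> b)) \<otimes> e) ((b \<otimes> d) \<otimes> f)"
      using v den by (intro fraction_cancel[where e = f]) (auto simp: l_distr r_distr m_ac)
    also have "\<dots> = (x \<oplus>\<^bsub>L\<^esub> y) \<otimes>\<^bsub>L\<^esub> z" using v den by (simp add: fraction_mult fraction_add)
    finally show ?thesis by simp
  qed
  interpret L: cring L by (rule cringI[OF ag cm distr])
  show ?thesis
  proof (rule L.cring_fieldI2)
    show "\<zero>\<^bsub>L\<^esub> \<noteq> \<one>\<^bsub>L\<^esub>"
      using fraction_zero_iff[of \<one> \<one>] unfolding fraction_one by (metis DiffI one_closed singletonD zero_not_one)
    fix x assume x: "x \<in> carrier L" "x \<noteq> \<zero>\<^bsub>L\<^esub>"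
    then obtain a b where v: "a \<in> carrier R" "b \<in> carrier R - {\<zero>}" "x = fraction R a b"
      unfolding fraction_carrier by blast
    then have a: "a \<in> carrier R - {\<zero>}" using x fraction_zero_iff by auto
    have "x \<otimes>\<^bsub>L\<^esub> fraction R b a = \<one>\<^bsub>L\<^esub>"
      unfolding v(3) fraction_one using v a den_mult[of b a]
      by (simp add: fraction_mult) (subst fraction_eq_iff, auto simp: m_ac)
    then show "\<exists>b\<in>carrier L. x \<otimes>\<^bsub>L\<^esub> b = \<one>\<^bsub>L\<^esub>" using fraction_in_carrier[of b a] v a by blast
  qed
qed

end

section \<open>Coordinate rings\<close>

lemma coordinate_ring_carrier: "f \<in> poly_functions n \<Longrightarrow> restrict f V \<in> carrier (coordinate_ring n V)"
  by (simp add: coordinate_ring_def)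

lemma coordinate_ring_carrierE:
  assumes "a \<in> carrier (coordinate_ring n V)"
  obtains f where "f \<in> poly_functions n" "a = restrict f V"
  using assms by (auto simp: coordinate_ring_def)

lemma coordinate_ring_ops:
  "restrict f V \<oplus>\<^bsub>coordinate_ring n V\<^esub> restrict g V = restrict (\<lambda>X. f X + g X) V"
  "restrict f V \<otimes>\<^bsub>coordinate_ring n V\<^esub> restrict g V = restrict (\<lambda>X. f X * g X) V"
  "\<zero>\<^bsub>coordinate_ring n V\<^esub> = restrict (\<lambda>X. 0) V"
  "\<one>\<^bsub>coordinate_ring n V\<^esub> = restrict (\<lambda>X. 1) V"
  by (auto simp: coordinate_ring_def restrict_def fun_eq_iff)

lemma cring_coordinate_ring: "cring (coordinate_ring n V)"
proof (rule cringI)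
  show "abelian_group (coordinate_ring n V)"
  proof (rule abelian_groupI)
    fix x assume "x \<in> carrier (coordinate_ring n V)"
    then obtain f where f: "f \<in> poly_functions n" "x = restrict f V" by (rule coordinate_ring_carrierE)
    show "\<exists>y\<in>carrier (coordinate_ring n V). y \<oplus>\<^bsub>coordinate_ring n V\<^esub> x = \<zero>\<^bsub>coordinate_ring n V\<^esub>"
      unfolding f(2) by (rule bexI[OF _ coordinate_ring_carrier[OF poly_functions_uminus[OF f(1)]]])
        (simp add: coordinate_ring_ops)
  qed (auto elim!: coordinate_ring_carrierE simp: coordinate_ring_ops algebra_simps
      intro: coordinate_ring_carrier[OF poly_functions.const] coordinate_ring_carrier[OF poly_functions.add]
        coordinate_ring_carrier[OF poly_functions.mult])
  show "comm_monoid (coordinate_ring n V)"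
    by (rule comm_monoidI) (auto elim!: coordinate_ring_carrierE simp: coordinate_ring_ops algebra_simps
      intro: coordinate_ring_carrier[OF poly_functions.const] coordinate_ring_carrier[OF poly_functions.add]
        coordinate_ring_carrier[OF poly_functions.mult])
qed (auto elim!: coordinate_ring_carrierE simp: coordinate_ring_ops algebra_simps)

section \<open>Rational functions and invariants\<close>

text \<open>The properties that the cell and the cone share. The cell is dense in \<open>V\<close> in the sense that polynomial
functions on \<open>V\<close> are determined by their values on the cell.\<close>

locale invariant_variety = basic_roots n D
  for n :: nat and D :: "root set" +
  fixes V :: "'k::field_char_0 mat set"
  assumes n1: "1 \<le> n"
    and cell_subset: "basic_cell n D \<subseteq> V"
    and V_strict: "V \<subseteq> strictly_lower n"
    and V_closure: "\<And>f X. f \<in> poly_functions n \<Longrightarrow> (\<And>Y. Y \<in> basic_cell n D \<Longrightarrow> f Y = 0) \<Longrightarrow> X \<in> V \<Longrightarrow> f X = 0"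
    and V_invariant: "\<And>g X. g \<in> UT n \<Longrightarrow> X \<in> V \<Longrightarrow> coadjoint_act g X \<in> V"
begin

abbreviation "W \<equiv> basic_cell n D :: 'k mat set"
abbreviation "P \<equiv> poly_functions n :: ('k mat \<Rightarrow> 'k) set"
abbreviation "R \<equiv> coordinate_ring n V"
abbreviation "L \<equiv> rational_functions n V"

definition nz :: "('k mat \<Rightarrow> 'k) \<Rightarrow> bool" where "nz f \<longleftrightarrow> (\<exists>X\<in>W. f X \<noteq> 0)"

definition frac :: "('k mat \<Rightarrow> 'k) \<Rightarrow> ('k mat \<Rightarrow> 'k) \<Rightarrow> 'k ratfun" where
  "frac a b = fraction R (restrict a V) (restrict b V)"

lemma finite_D: "finite D"
  by (rule finite_subset[of _ "{..n} \<times> {..n}"]) (auto dest: D_bounds)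

lemma nz_mult: "f \<in> P \<Longrightarrow> h \<in> P \<Longrightarrow> nz f \<Longrightarrow> nz h \<Longrightarrow> nz (\<lambda>X. f X * h X)"
  unfolding nz_def using basic_cell_irreducible[OF finite_D] by fastforce

lemma nz_iff: "f \<in> P \<Longrightarrow> nz f \<longleftrightarrow> (\<exists>X\<in>V. f X \<noteq> 0)"
  unfolding nz_def using V_closure cell_subset by blast

lemma restrict_zero_iff: "f \<in> P \<Longrightarrow> restrict f V = \<zero>\<^bsub>R\<^esub> \<longleftrightarrow> \<not> nz f"
  unfolding coordinate_ring_ops nz_iff by (auto simp: restrict_def fun_eq_iff)

lemma nz_one: "nz (\<lambda>X. 1)"
  using solve_in_cell[OF n1, of "\<lambda>_. 1"] unfolding nz_def by auto

lemma domain_R: "domain R"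
proof (rule domainI[OF cring_coordinate_ring])
  show "\<one>\<^bsub>R\<^esub> \<noteq> \<zero>\<^bsub>R\<^esub>"
    using restrict_zero_iff[OF poly_functions_const, of 1] nz_one unfolding coordinate_ring_ops(4) by simp
  fix a b assume ab: "a \<otimes>\<^bsub>R\<^esub> b = \<zero>\<^bsub>R\<^esub>" "a \<in> carrier R" "b \<in> carrier R"
  obtain f h where f: "f \<in> P" "a = restrict f V" and h: "h \<in> P" "b = restrict h V"
    using ab coordinate_ring_carrierE by metis
  have "\<not> nz (\<lambda>X. f X * h X)"
    using ab(1) restrict_zero_iff[OF poly_functions.mult[OF f(1) h(1)]] unfolding f(2) h(2) coordinate_ring_ops(2) by simp
  then show "a = \<zero>\<^bsub>R\<^esub> \<or> b = \<zero>\<^bsub>R\<^esub>"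
    using nz_mult[OF f(1) h(1)] restrict_zero_iff f h by blast
qed

sublocale R: domain R by (rule domain_R)

lemma field_L: "field L" unfolding rational_functions_def by (rule R.field_fraction_field)

sublocale L: field L by (rule field_L)

lemma num: "a \<in> P \<Longrightarrow> restrict a V \<in> carrier R" by (rule coordinate_ring_carrier)

lemma den: "b \<in> P \<Longrightarrow> nz b \<Longrightarrow> restrict b V \<in> carrier R - {\<zero>\<^bsub>R\<^esub>}"
  using coordinate_ring_carrier restrict_zero_iff by auto

lemma frac_eq_iff:
  assumes "a \<in> P" "b \<in> P" "nz b" "c \<in> P" "d \<in> P" "nz d"
  shows "frac a b = frac c d \<longleftrightarrow> (\<forall>X\<in>V. a X * d X = c X * b X)"
  unfolding frac_def R.fraction_eq_iff[OF num[OF assms(1)] den[OF assms(2,3)] num[OF assms(4)] den[OF assms(5,6)]]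
  unfolding coordinate_ring_ops by (auto simp: restrict_def fun_eq_iff)

lemma frac_add:
  assumes "a \<in> P" "b \<in> P" "nz b" "c \<in> P" "d \<in> P" "nz d"
  shows "frac a b \<oplus>\<^bsub>L\<^esub> frac c d = frac (\<lambda>X. a X * d X + c X * b X) (\<lambda>X. b X * d X)"
  unfolding frac_def rational_functions_def
    R.fraction_add[OF num[OF assms(1)] den[OF assms(2,3)] num[OF assms(4)] den[OF assms(5,6)]]
  by (simp add: coordinate_ring_ops)

lemma frac_mult:
  assumes "a \<in> P" "b \<in> P" "nz b" "c \<in> P" "d \<in> P" "nz d"
  shows "frac a b \<otimes>\<^bsub>L\<^esub> frac c d = frac (\<lambda>X. a X * c X) (\<lambda>X. b X * d X)"
  unfolding frac_def rational_functions_def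
    R.fraction_mult[OF num[OF assms(1)] den[OF assms(2,3)] num[OF assms(4)] den[OF assms(5,6)]]
  by (simp add: coordinate_ring_ops)

lemma frac_zero: "\<zero>\<^bsub>L\<^esub> = frac (\<lambda>X. 0) (\<lambda>X. 1)" and frac_one: "\<one>\<^bsub>L\<^esub> = frac (\<lambda>X. 1) (\<lambda>X. 1)"
  unfolding frac_def rational_functions_def R.fraction_zero R.fraction_one coordinate_ring_ops by simp_all

lemma frac_carrier: "a \<in> P \<Longrightarrow> b \<in> P \<Longrightarrow> nz b \<Longrightarrow> frac a b \<in> carrier L"
  unfolding frac_def rational_functions_def by (intro R.fraction_in_carrier num den)

lemma frac_exists:
  assumes "A \<in> carrier L" obtains a b where "a \<in> P" "b \<in> P" "nz b" "A = frac a b"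
proof -
  obtain a b where ab: "a \<in> carrier R" "b \<in> carrier R" "b \<noteq> \<zero>\<^bsub>R\<^esub>" "A = fraction R a b"
    using assms unfolding rational_functions_def R.fraction_carrier by blast
  obtain f h where f: "f \<in> P" "a = restrict f V" and h: "h \<in> P" "b = restrict h V"
    using ab coordinate_ring_carrierE by metis
  show ?thesis using that[OF f(1) h(1)] ab f h restrict_zero_iff[OF h(1)] unfolding frac_def by auto
qed

lemma ratfun_of_frac: "ratfun_of n V f = frac f (\<lambda>X. 1)" unfolding ratfun_of_def frac_def ..

lemma ratfun_const_frac: "ratfun_const n V c = frac (\<lambda>X. c) (\<lambda>X. 1)" unfolding ratfun_const_def ratfun_of_frac ..

text \<open>Dense open subsets of the cell, and the sets containing one.\<close>

definition large :: "'k mat set \<Rightarrow> bool" where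
  "large Q \<longleftrightarrow> Q \<subseteq> W \<and> (\<exists>h\<in>P. nz h \<and> (\<forall>X\<in>W. h X \<noteq> 0 \<longrightarrow> X \<in> Q))"

lemma largeI: "h \<in> P \<Longrightarrow> nz h \<Longrightarrow> (\<And>X. X \<in> W \<Longrightarrow> h X \<noteq> 0 \<Longrightarrow> X \<in> Q) \<Longrightarrow> Q \<subseteq> W \<Longrightarrow> large Q"
  unfolding large_def by blast

lemma large_W: "large W" by (rule largeI[OF poly_functions_const nz_one]) auto

lemma large_open: "h \<in> P \<Longrightarrow> nz h \<Longrightarrow> large {X \<in> W. h X \<noteq> 0}" by (rule largeI) auto

lemma large_Int:
  assumes "large Q" "large Q'" shows "large (Q \<inter> Q')"
proof -
  obtain f where f: "f \<in> P" "nz f" "\<And>X. X \<in> W \<Longrightarrow> f X \<noteq> 0 \<Longrightarrow> X \<in> Q" using assms(1) unfolding large_def by blast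
  obtain h where h: "h \<in> P" "nz h" "\<And>X. X \<in> W \<Longrightarrow> h X \<noteq> 0 \<Longrightarrow> X \<in> Q'" using assms(2) unfolding large_def by blast
  show ?thesis
    by (rule largeI[OF poly_functions.mult[OF f(1) h(1)] nz_mult[OF f(1) h(1) f(2) h(2)]])
      (use f h assms in \<open>auto simp: large_def\<close>)
qed

lemma large_nonempty: "large Q \<Longrightarrow> Q \<noteq> {}" unfolding large_def nz_def by blast

lemma large_subset: "large Q \<Longrightarrow> Q \<subseteq> W" unfolding large_def by blast

lemma large_dense:
  assumes Q: "large Q" and f: "f \<in> P" and z: "\<And>X. X \<in> Q \<Longrightarrow> f X = 0" and X: "X \<in> V"
  shows "f X = 0"
proof (rule ccontr)
  assume "f X \<noteq> 0"
  then have "nz f" using nz_iff[OF f] X by blast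
  then show False using large_nonempty[OF large_Int[OF Q large_open[OF f]]] z by blast
qed

text \<open>The rational function \<open>A\<close> is regular at all points of \<open>Q\<close> and has the values \<open>\<phi>\<close> there. On a large
set this determines \<open>A\<close> and reduces the arithmetic of fractions to that of functions.\<close>

definition rep :: "'k mat set \<Rightarrow> 'k ratfun \<Rightarrow> ('k mat \<Rightarrow> 'k) \<Rightarrow> bool" where
  "rep Q A \<phi> \<longleftrightarrow> (\<exists>a\<in>P. \<exists>b\<in>P. nz b \<and> A = frac a b \<and> (\<forall>X\<in>Q. b X \<noteq> 0 \<and> \<phi> X = a X / b X))"

lemma repI: "a \<in> P \<Longrightarrow> b \<in> P \<Longrightarrow> nz b \<Longrightarrow> (\<And>X. X \<in> Q \<Longrightarrow> b X \<noteq> 0 \<and> \<phi> X = a X / b X) \<Longrightarrow> rep Q (frac a b) \<phi>"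
  unfolding rep_def by blast

lemma repE:
  assumes "rep Q A \<phi>"
  obtains a b where "a \<in> P" "b \<in> P" "nz b" "A = frac a b" "\<And>X. X \<in> Q \<Longrightarrow> b X \<noteq> 0 \<and> \<phi> X = a X / b X"
  using assms unfolding rep_def by blast

lemma rep_carrier: "rep Q A \<phi> \<Longrightarrow> A \<in> carrier L" by (elim repE) (simp add: frac_carrier)

lemma rep_mono: "rep Q A \<phi> \<Longrightarrow> Q' \<subseteq> Q \<Longrightarrow> rep Q' A \<phi>" unfolding rep_def by blast

lemma rep_cong: "rep Q A \<phi> \<Longrightarrow> (\<And>X. X \<in> Q \<Longrightarrow> \<phi> X = \<psi> X) \<Longrightarrow> rep Q A \<psi>" unfolding rep_def by auto

lemma rep_poly: "f \<in> P \<Longrightarrow> rep Q (ratfun_of n V f) f"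
  unfolding ratfun_of_frac by (rule repI[OF _ poly_functions_const nz_one]) auto

lemma rep_const: "rep Q (ratfun_const n V c) (\<lambda>X. c)"
  unfolding ratfun_const_def by (rule rep_poly[OF poly_functions_const])

lemma rep_zero: "rep Q \<zero>\<^bsub>L\<^esub> (\<lambda>X. 0)" and rep_one: "rep Q \<one>\<^bsub>L\<^esub> (\<lambda>X. 1)"
  using rep_const[of Q 0] rep_const[of Q 1] unfolding frac_zero frac_one ratfun_const_frac by auto

lemma rep_add: assumes "rep Q A \<phi>" "rep Q B \<psi>" shows "rep Q (A \<oplus>\<^bsub>L\<^esub> B) (\<lambda>X. \<phi> X + \<psi> X)"
proof -
  obtain a b where a: "a \<in> P" "b \<in> P" "nz b" "A = frac a b" "\<And>X. X \<in> Q \<Longrightarrow> b X \<noteq> 0 \<and> \<phi> X = a X / b X" using repE[OF assms(1)] by blast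
  obtain c d where c: "c \<in> P" "d \<in> P" "nz d" "B = frac c d" "\<And>X. X \<in> Q \<Longrightarrow> d X \<noteq> 0 \<and> \<psi> X = c X / d X" using repE[OF assms(2)] by blast
  show ?thesis unfolding a(4) c(4) frac_add[OF a(1-3) c(1-3)]
    by (intro repI poly_functions.add poly_functions.mult a c nz_mult) (use a(5) c(5) in \<open>auto simp: field_simps\<close>)
qed

lemma rep_mult: assumes "rep Q A \<phi>" "rep Q B \<psi>" shows "rep Q (A \<otimes>\<^bsub>L\<^esub> B) (\<lambda>X. \<phi> X * \<psi> X)"
proof -
  obtain a b where a: "a \<in> P" "b \<in> P" "nz b" "A = frac a b" "\<And>X. X \<in> Q \<Longrightarrow> b X \<noteq> 0 \<and> \<phi> X = a X / b X" using repE[OF assms(1)] by blast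
  obtain c d where c: "c \<in> P" "d \<in> P" "nz d" "B = frac c d" "\<And>X. X \<in> Q \<Longrightarrow> d X \<noteq> 0 \<and> \<psi> X = c X / d X" using repE[OF assms(2)] by blast
  show ?thesis unfolding a(4) c(4) frac_mult[OF a(1-3) c(1-3)]
    by (intro repI poly_functions.mult a c nz_mult) (use a(5) c(5) in \<open>auto simp: field_simps\<close>)
qed

lemma rep_value_unique:
  assumes "rep Q A \<phi>" "rep Q A \<psi>" "Q \<subseteq> W" "X \<in> Q" shows "\<phi> X = \<psi> X"
proof -
  obtain a b where a: "a \<in> P" "b \<in> P" "nz b" "A = frac a b" "\<And>X. X \<in> Q \<Longrightarrow> b X \<noteq> 0 \<and> \<phi> X = a X / b X" using repE[OF assms(1)] by blast
  obtain c d where c: "c \<in> P" "d \<in> P" "nz d" "A = frac c d" "\<And>X. X \<in> Q \<Longrightarrow> d X \<noteq> 0 \<and> \<psi> X = c X / d X" using repE[OF assms(2)] by blast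
  have "a X * d X = c X * b X" using frac_eq_iff[OF a(1-3) c(1-3)] a(4) c(4) assms cell_subset by auto
  then show ?thesis using a(5) c(5) assms(4) by (auto simp: field_simps)
qed

lemma rep_unique:
  assumes "rep Q A \<phi>" "rep Q B \<psi>" "large Q" "\<And>X. X \<in> Q \<Longrightarrow> \<phi> X = \<psi> X" shows "A = B"
proof -
  obtain a b where a: "a \<in> P" "b \<in> P" "nz b" "A = frac a b" "\<And>X. X \<in> Q \<Longrightarrow> b X \<noteq> 0 \<and> \<phi> X = a X / b X" using repE[OF assms(1)] by blast
  obtain c d where c: "c \<in> P" "d \<in> P" "nz d" "B = frac c d" "\<And>X. X \<in> Q \<Longrightarrow> d X \<noteq> 0 \<and> \<psi> X = c X / d X" using repE[OF assms(2)] by blast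
  have z: "a X * d X - c X * b X = 0" if "X \<in> Q" for X using a(5) c(5) assms(4) that by (auto simp: field_simps)
  have "(\<lambda>X. a X * d X - c X * b X) \<in> P"
    using poly_functions.add[OF poly_functions.mult[OF a(1) c(2)] poly_functions_uminus[OF poly_functions.mult[OF c(1) a(2)]]] by simp
  then have "\<forall>X\<in>V. a X * d X - c X * b X = 0" using large_dense[OF assms(3)] z by blast
  then show ?thesis unfolding a(4) c(4) frac_eq_iff[OF a(1-3) c(1-3)] by simp
qed

lemma rep_exists:
  assumes "A \<in> carrier L" obtains Q \<phi> where "large Q" "rep Q A \<phi>"
proof -
  obtain a b where ab: "a \<in> P" "b \<in> P" "nz b" "A = frac a b" by (rule frac_exists[OF assms])
  have "rep {X \<in> W. b X \<noteq> 0} A (\<lambda>X. a X / b X)" unfolding ab(4) by (rule repI[OF ab(1-3)]) auto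
  then show ?thesis using that large_open[OF ab(2,3)] by blast
qed

lemma rep_uminus: assumes "rep Q A \<phi>" shows "rep Q (\<ominus>\<^bsub>L\<^esub> A) (\<lambda>X. - \<phi> X)"
proof -
  obtain Q' \<psi> where "large Q'" by (rule rep_exists[OF L.zero_closed])
  obtain a b where a: "a \<in> P" "b \<in> P" "nz b" "A = frac a b" "\<And>X. X \<in> Q \<Longrightarrow> b X \<noteq> 0 \<and> \<phi> X = a X / b X" using repE[OF assms(1)] by blast
  have r: "rep S (frac (\<lambda>X. - a X) b) (\<lambda>X. - \<phi> X)" if "S \<subseteq> Q" for S
    using that a by (intro repI poly_functions_uminus) auto
  have "frac (\<lambda>X. - a X) b \<oplus>\<^bsub>L\<^esub> A = \<zero>\<^bsub>L\<^esub>"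
    unfolding a(4) frac_zero frac_add[OF poly_functions_uminus[OF a(1)] a(2,3) a(1-3)]
    by (subst frac_eq_iff) (auto intro!: poly_functions.add poly_functions.mult poly_functions_uminus a nz_mult nz_one poly_functions_const)
  moreover have "frac (\<lambda>X. - a X) b \<in> carrier L" "A \<in> carrier L"
    using a by (auto intro!: frac_carrier poly_functions_uminus)
  ultimately have "\<ominus>\<^bsub>L\<^esub> A = frac (\<lambda>X. - a X) b" using L.minus_equality by blast
  then show ?thesis using r by simp
qed

lemma rep_inverse:
  assumes A: "rep Q A \<phi>" and Q: "large Q" and nzero: "\<And>X. X \<in> Q \<Longrightarrow> \<phi> X \<noteq> 0"
  shows "A \<noteq> \<zero>\<^bsub>L\<^esub>" "rep Q (inv\<^bsub>L\<^esub> A) (\<lambda>X. inverse (\<phi> X))"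
proof -
  obtain a b where a: "a \<in> P" "b \<in> P" "nz b" "A = frac a b" "\<And>X. X \<in> Q \<Longrightarrow> b X \<noteq> 0 \<and> \<phi> X = a X / b X" using repE[OF assms(1)] by blast
  have a0: "a X \<noteq> 0" if "X \<in> Q" for X using a(5)[OF that] nzero[OF that] by auto
  then have na: "nz a" using large_nonempty[OF Q] large_subset[OF Q] unfolding nz_def by blast
  have "frac b a \<otimes>\<^bsub>L\<^esub> A = \<one>\<^bsub>L\<^esub>"
    unfolding a(4) frac_one frac_mult[OF a(2,1) na a(1-3)]
    by (subst frac_eq_iff) (auto intro!: poly_functions.mult a na nz_mult nz_one poly_functions_const)
  moreover have c: "frac b a \<in> carrier L" "A \<in> carrier L" using a na by (auto intro!: frac_carrier)
  ultimately have i: "inv\<^bsub>L\<^esub> A = frac b a" by (metis L.comm_inv_char L.m_comm)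
  show "A \<noteq> \<zero>\<^bsub>L\<^esub>" using \<open>frac b a \<otimes>\<^bsub>L\<^esub> A = \<one>\<^bsub>L\<^esub>\<close> c by auto
  show "rep Q (inv\<^bsub>L\<^esub> A) (\<lambda>X. inverse (\<phi> X))" unfolding i
    by (rule repI[OF a(2,1) na]) (use a(5) a0 in auto)
qed

text \<open>Provides a large set on which \<open>rep_inverse\<close> applies.\<close>

lemma rep_nonzero_shrink:
  assumes A: "rep Q A \<phi>" and Q: "large Q" and X: "X \<in> Q" "\<phi> X \<noteq> 0"
  shows "large {X \<in> Q. \<phi> X \<noteq> 0}"
proof -
  obtain a b where a: "a \<in> P" "b \<in> P" "nz b" "A = frac a b" "\<And>X. X \<in> Q \<Longrightarrow> b X \<noteq> 0 \<and> \<phi> X = a X / b X" using repE[OF assms(1)] by blast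
  have "nz a" using X a(5) large_subset[OF Q] unfolding nz_def by auto
  have "Q \<inter> {X \<in> W. a X \<noteq> 0} = {X \<in> Q. \<phi> X \<noteq> 0}" using a(5) large_subset[OF Q] by auto
  then show ?thesis using large_Int[OF Q large_open[OF a(1) \<open>nz a\<close>]] by simp
qed

lemma rep_nonzero:
  assumes A: "rep Q A \<phi>" and Q: "large Q" and nz: "A \<noteq> \<zero>\<^bsub>L\<^esub>"
  obtains X where "X \<in> Q" "\<phi> X \<noteq> 0"
  using rep_unique[OF A rep_zero Q] nz by blast

lemma ginv_act: "g \<in> UT n \<Longrightarrow> X \<in> V \<Longrightarrow> coadjoint_act (ginv g) (coadjoint_act g X) = X"
  using coadjoint_act_inverse V_strict by blast

lemma act_ginv: "g \<in> UT n \<Longrightarrow> X \<in> V \<Longrightarrow> coadjoint_act g (coadjoint_act (ginv g) X) = X"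
  using ginv_act[OF UT_ginv(1)] ginv_ginv by metis

text \<open>A polynomial function that agrees with \<open>f\<close> after the action of \<open>g\<close>. Since entries above the diagonal
vanish on \<open>V\<close> only, it is not the composition itself.\<close>

definition pulled_back :: "'k mat \<Rightarrow> ('k mat \<Rightarrow> 'k) \<Rightarrow> 'k mat \<Rightarrow> 'k" where
  "pulled_back g f = (SOME f'. f' \<in> P \<and> (\<forall>X\<in>V. f' X = f (coadjoint_act g X)))"

lemma pulled_back:
  assumes "f \<in> P" "g \<in> UT n"
  shows "pulled_back g f \<in> P" "X \<in> V \<Longrightarrow> pulled_back g f X = f (coadjoint_act g X)"
proof -
  have "\<exists>f'. f' \<in> P \<and> (\<forall>X\<in>V. f' X = f (coadjoint_act g X))"
    using poly_functions_pullback[OF assms] V_strict by blast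
  then have "pulled_back g f \<in> P \<and> (\<forall>X\<in>V. pulled_back g f X = f (coadjoint_act g X))"
    unfolding pulled_back_def by (rule someI_ex)
  then show "pulled_back g f \<in> P" "X \<in> V \<Longrightarrow> pulled_back g f X = f (coadjoint_act g X)" by auto
qed

lemma pullback_restrict: "g \<in> UT n \<Longrightarrow> (\<And>X. X \<in> V \<Longrightarrow> f' X = f (coadjoint_act g X)) \<Longrightarrow>
    pullback V g (restrict f V) = restrict f' V"
  unfolding pullback_def using V_invariant by (auto simp: restrict_def fun_eq_iff)

lemma nz_pullback:
  assumes "nz f" "g \<in> UT n" "\<And>X. X \<in> V \<Longrightarrow> f' X = f (coadjoint_act g X)" shows "nz f'"
proof -
  obtain X where X: "X \<in> W" "f X \<noteq> 0" using assms(1) unfolding nz_def by blast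
  have "coadjoint_act (ginv g) X \<in> W" by (rule basic_cell_invariant[OF UT_ginv(1)[OF assms(2)] X(1)])
  moreover have "f' (coadjoint_act (ginv g) X) = f X"
    using assms(3) act_ginv[OF assms(2)] X(1) calculation cell_subset by (metis subsetD)
  ultimately show ?thesis using X unfolding nz_def by metis
qed

text \<open>Substitution carries equivalent fractions to equivalent fractions, which gives one inclusion; the
substitution by the inverse group element gives the other.\<close>

lemma frac_pullback:
  assumes g: "g \<in> UT n" and a: "a \<in> P" "b \<in> P" "nz b"
    and a': "a' \<in> P" "\<And>X. X \<in> V \<Longrightarrow> a' X = a (coadjoint_act g X)"
    and b': "b' \<in> P" "\<And>X. X \<in> V \<Longrightarrow> b' X = b (coadjoint_act g X)"
  shows "map_prod (pullback V g) (pullback V g) ` frac a b = frac a' b'"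
proof -
  have nb': "nz b'" by (rule nz_pullback[where f = b and f' = b', OF a(3) g b'(2)])
  have sub: "map_prod (pullback V g) (pullback V g) ` frac a b \<subseteq> frac a' b'"
    if g: "g \<in> UT n" and a: "a \<in> P" "b \<in> P" "nz b"
    and a': "a' \<in> P" "\<And>X. X \<in> V \<Longrightarrow> a' X = a (coadjoint_act g X)"
    and b': "b' \<in> P" "\<And>X. X \<in> V \<Longrightarrow> b' X = b (coadjoint_act g X)" for g a b a' b'
  proof (rule image_subsetI)
    fix p assume p: "p \<in> frac a b"
    have nb': "nz b'" by (rule nz_pullback[where f = b and f' = b', OF a(3) g b'(2)])
    obtain c d where p': "p = (c, d)" by (cases p)
    have cd: "c \<in> carrier R" "d \<in> carrier R - {\<zero>\<^bsub>R\<^esub>}" "restrict a V \<otimes>\<^bsub>R\<^esub> d = c \<otimes>\<^bsub>R\<^esub> restrict b V"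
      using p R.fraction_mem[OF num[OF a(1)] den[OF a(2,3)]] unfolding frac_def p' by auto
    obtain u where u: "u \<in> P" "c = restrict u V" using cd coordinate_ring_carrierE by metis
    obtain v where v: "v \<in> P" "d = restrict v V" using cd coordinate_ring_carrierE by (metis DiffD1)
    have nv: "nz v" using cd(2) restrict_zero_iff[OF v(1)] v(2) by auto
    have eq: "a X * v X = u X * b X" if "X \<in> V" for X
      using fun_cong[OF cd(3), of X] that unfolding u(2) v(2) coordinate_ring_ops by simp
    define u' where "u' = pulled_back g u"
    have u': "u' \<in> P" "\<And>X. X \<in> V \<Longrightarrow> u' X = u (coadjoint_act g X)" unfolding u'_def by (rule pulled_back[OF u(1) g], assumption?)+
    define v' where "v' = pulled_back g v"
    have v': "v' \<in> P" "\<And>X. X \<in> V \<Longrightarrow> v' X = v (coadjoint_act g X)" unfolding v'_def by (rule pulled_back[OF v(1) g], assumption?)+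
    have nv': "nz v'" by (rule nz_pullback[where f = v and f' = v', OF nv g v'(2)])
    have "restrict a' V \<otimes>\<^bsub>R\<^esub> restrict v' V = restrict u' V \<otimes>\<^bsub>R\<^esub> restrict b' V"
      unfolding coordinate_ring_ops using eq V_invariant[OF g] a' b' u' v' by (auto simp: restrict_def fun_eq_iff)
    then show "map_prod (pullback V g) (pullback V g) p \<in> frac a' b'"
      unfolding p' frac_def u(2) v(2)
      using pullback_restrict[where f = u and f' = u', OF g u'(2)] pullback_restrict[where f = v and f' = v', OF g v'(2)]
        R.fraction_mem[OF num[OF a'(1)] den[OF b'(1) nb']] num[OF u'(1)] den[OF v'(1) nv'] by auto
  qed
  show ?thesis
  proof
    show "map_prod (pullback V g) (pullback V g) ` frac a b \<subseteq> frac a' b'" by (rule sub[OF g a a' b'])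
    have inverse_sub: "map_prod (pullback V (ginv g)) (pullback V (ginv g)) ` frac a' b' \<subseteq> frac a b"
      using act_ginv[OF g] a'(2) b'(2) V_invariant[OF UT_ginv(1)[OF g]]
      by (intro sub[OF UT_ginv(1)[OF g] a'(1) b'(1) nb']) (auto simp: a)
    have car: "c \<in> carrier R" "d \<in> carrier R" if "(c, d) \<in> frac a' b'" for c d
      using that R.fraction_mem[OF num[OF a'(1)] den[OF b'(1) nb']] unfolding frac_def by auto
    have inv: "pullback V g (pullback V (ginv g) c) = c" if c: "c \<in> carrier R" for c
    proof -
      obtain u where "u \<in> P" and u: "c = restrict u V" by (rule coordinate_ring_carrierE[OF c])
      show ?thesis unfolding u pullback_def using ginv_act[OF g] V_invariant[OF g] by (auto simp: restrict_def fun_eq_iff)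
    qed
    show "frac a' b' \<subseteq> map_prod (pullback V g) (pullback V g) ` frac a b"
    proof
      fix p assume p: "p \<in> frac a' b'"
      obtain c d where p': "p = (c, d)" by (cases p)
      have "map_prod (pullback V (ginv g)) (pullback V (ginv g)) p \<in> frac a b" using inverse_sub p by blast
      moreover have "p = map_prod (pullback V g) (pullback V g) (map_prod (pullback V (ginv g)) (pullback V (ginv g)) p)"
        using car[of c d] p inv unfolding p' by simp
      ultimately show "p \<in> map_prod (pullback V g) (pullback V g) ` frac a b" by (rule image_eqI[rotated])
    qed
  qed
qed

lemma frac_invariant_iff:
  assumes "a \<in> P" "b \<in> P" "nz b"
  shows "frac a b \<in> invariant_field n V \<longleftrightarrow>
    (\<forall>g\<in>UT n. \<forall>X\<in>V. a (coadjoint_act g X) * b X = a X * b (coadjoint_act g X))"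
proof -
  have "map_prod (pullback V g) (pullback V g) ` frac a b = frac a b \<longleftrightarrow>
    (\<forall>X\<in>V. a (coadjoint_act g X) * b X = a X * b (coadjoint_act g X))" if g: "g \<in> UT n" for g
  proof -
    define a' where "a' = pulled_back g a"
    have a': "a' \<in> P" "\<And>X. X \<in> V \<Longrightarrow> a' X = a (coadjoint_act g X)" unfolding a'_def by (rule pulled_back[OF assms(1) g], assumption?)+
    define b' where "b' = pulled_back g b"
    have b': "b' \<in> P" "\<And>X. X \<in> V \<Longrightarrow> b' X = b (coadjoint_act g X)" unfolding b'_def by (rule pulled_back[OF assms(2) g], assumption?)+
    have nb': "nz b'" by (rule nz_pullback[where f = b and f' = b', OF assms(3) g b'(2)])
    have 1: "map_prod (pullback V g) (pullback V g) ` frac a b = frac a' b'"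
      by (rule frac_pullback[OF g assms a' b'])
    have 2: "frac a' b' = frac a b \<longleftrightarrow> (\<forall>X\<in>V. a' X * b X = a X * b' X)"
      by (rule frac_eq_iff[OF a'(1) b'(1) nb' assms])
    show ?thesis unfolding 1 2 using a'(2) b'(2) by auto
  qed
  then show ?thesis unfolding invariant_field_def using frac_carrier[OF assms] by auto
qed

text \<open>Both directions compare \<open>a (g X) b X\<close> with \<open>a X b (g X)\<close>; an identity that holds where \<open>X\<close> and \<open>g X\<close> lie in \<open>Q\<close> holds
on \<open>V\<close> by density.\<close>

lemma rep_invariant_iff:
  assumes A: "rep Q A \<phi>" and Q: "large Q"
  shows "A \<in> invariant_field n V \<longleftrightarrow>
    (\<forall>g\<in>UT n. \<forall>X\<in>Q. coadjoint_act g X \<in> Q \<longrightarrow> \<phi> (coadjoint_act g X) = \<phi> X)"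
proof -
  obtain a b where a: "a \<in> P" "b \<in> P" "nz b" "A = frac a b" "\<And>X. X \<in> Q \<Longrightarrow> b X \<noteq> 0 \<and> \<phi> X = a X / b X" using repE[OF A] by blast
  have QV: "X \<in> V" if "X \<in> Q" for X using large_subset[OF Q] cell_subset that by blast
  have "(\<forall>X\<in>V. a (coadjoint_act g X) * b X = a X * b (coadjoint_act g X)) \<longleftrightarrow>
    (\<forall>X\<in>Q. coadjoint_act g X \<in> Q \<longrightarrow> \<phi> (coadjoint_act g X) = \<phi> X)" if g: "g \<in> UT n" for g
  proof
    assume *: "\<forall>X\<in>V. a (coadjoint_act g X) * b X = a X * b (coadjoint_act g X)"
    show "\<forall>X\<in>Q. coadjoint_act g X \<in> Q \<longrightarrow> \<phi> (coadjoint_act g X) = \<phi> X"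
    proof (intro ballI impI)
      fix X assume X: "X \<in> Q" "coadjoint_act g X \<in> Q"
      show "\<phi> (coadjoint_act g X) = \<phi> X"
        using a(5)[OF X(1)] a(5)[OF X(2)] bspec[OF * QV[OF X(1)]] by (simp add: field_simps)
    qed
  next
    assume *: "\<forall>X\<in>Q. coadjoint_act g X \<in> Q \<longrightarrow> \<phi> (coadjoint_act g X) = \<phi> X"
    define a' where "a' = pulled_back g a"
    have a': "a' \<in> P" "\<And>X. X \<in> V \<Longrightarrow> a' X = a (coadjoint_act g X)" unfolding a'_def by (rule pulled_back[OF a(1) g], assumption?)+
    define b' where "b' = pulled_back g b"
    have b': "b' \<in> P" "\<And>X. X \<in> V \<Longrightarrow> b' X = b (coadjoint_act g X)" unfolding b'_def by (rule pulled_back[OF a(2) g], assumption?)+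
    obtain h where h: "h \<in> P" "nz h" "\<And>X. X \<in> W \<Longrightarrow> h X \<noteq> 0 \<Longrightarrow> X \<in> Q" using Q unfolding large_def by blast
    define h' where "h' = pulled_back g h"
    have h': "h' \<in> P" "\<And>X. X \<in> V \<Longrightarrow> h' X = h (coadjoint_act g X)" unfolding h'_def by (rule pulled_back[OF h(1) g], assumption?)+
    have lh: "large (Q \<inter> {X \<in> W. h' X \<noteq> 0})"
      using large_Int[OF Q large_open[OF h'(1) nz_pullback[where f = h and f' = h', OF h(2) g h'(2)]]] .
    have P': "(\<lambda>X. a' X * b X - a X * b' X) \<in> P"
      using poly_functions.add[OF poly_functions.mult[OF a'(1) a(2)] poly_functions_uminus[OF poly_functions.mult[OF a(1) b'(1)]]] by simp
    have "a' X * b X - a X * b' X = 0" if "X \<in> Q \<inter> {X \<in> W. h' X \<noteq> 0}" for X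
    proof -
      have X: "X \<in> Q" "X \<in> W" "h' X \<noteq> 0" using that by auto
      have gX: "coadjoint_act g X \<in> Q" using h(3)[OF basic_cell_invariant[OF g X(2)]] h'(2)[OF QV[OF X(1)]] X(3) by simp
      then have "\<phi> (coadjoint_act g X) = \<phi> X" using * X by blast
      then show ?thesis using a(5)[OF X(1)] a(5)[OF gX] a'(2)[OF QV[OF X(1)]] b'(2)[OF QV[OF X(1)]] by (simp add: field_simps)
    qed
    then have "a' X * b X - a X * b' X = 0" if "X \<in> V" for X using large_dense[OF lh P'] that by blast
    then show "\<forall>X\<in>V. a (coadjoint_act g X) * b X = a X * b (coadjoint_act g X)" using a'(2) b'(2) by auto
  qed
  then show ?thesis unfolding a(4) frac_invariant_iff[OF a(1-3)] by blast
qed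

lemma invariant_carrier: "A \<in> invariant_field n V \<Longrightarrow> A \<in> carrier L" unfolding invariant_field_def by blast

lemma const_invariant: "ratfun_const n V c \<in> invariant_field n V"
  using rep_invariant_iff[OF rep_const large_W] by blast

lemma subfield_invariant: "subfield (invariant_field n V) L"
proof (rule L.subfieldI')
  have bin: "\<exists>Q \<phi> \<psi>. large Q \<and> rep Q A \<phi> \<and> rep Q B \<psi>" if "A \<in> carrier L" "B \<in> carrier L" for A B
  proof -
    obtain Q \<phi> where 1: "large Q" "rep Q A \<phi>" by (rule rep_exists[OF \<open>A \<in> carrier L\<close>])
    obtain Q' \<psi> where 2: "large Q'" "rep Q' B \<psi>" by (rule rep_exists[OF \<open>B \<in> carrier L\<close>])
    show ?thesis using large_Int[OF 1(1) 2(1)] rep_mono[OF 1(2)] rep_mono[OF 2(2)] by (metis inf_le1 inf_le2)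
  qed
  show "subring (invariant_field n V) L"
  proof (rule L.subringI)
    show "invariant_field n V \<subseteq> carrier L" using invariant_carrier by blast
    show "\<one>\<^bsub>L\<^esub> \<in> invariant_field n V" using rep_invariant_iff[OF rep_one large_W] by blast
    fix A assume A: "A \<in> invariant_field n V"
    obtain Q \<phi> where 1: "large Q" "rep Q A \<phi>" by (rule rep_exists[OF invariant_carrier[OF A]])
    show "\<ominus>\<^bsub>L\<^esub> A \<in> invariant_field n V"
      using A rep_invariant_iff[OF 1(2,1)] rep_invariant_iff[OF rep_uminus[OF 1(2)] 1(1)] by simp
  next
    fix A B assume A: "A \<in> invariant_field n V" and B: "B \<in> invariant_field n V"
    obtain Q \<phi> \<psi> where 1: "large Q" "rep Q A \<phi>" "rep Q B \<psi>" using bin[OF invariant_carrier[OF A] invariant_carrier[OF B]] by blast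
    show "A \<otimes>\<^bsub>L\<^esub> B \<in> invariant_field n V"
      using A B rep_invariant_iff[OF 1(2,1)] rep_invariant_iff[OF 1(3,1)] rep_invariant_iff[OF rep_mult[OF 1(2,3)] 1(1)] by simp
    show "A \<oplus>\<^bsub>L\<^esub> B \<in> invariant_field n V"
      using A B rep_invariant_iff[OF 1(2,1)] rep_invariant_iff[OF 1(3,1)] rep_invariant_iff[OF rep_add[OF 1(2,3)] 1(1)] by simp
  qed
  fix A assume "A \<in> invariant_field n V - {\<zero>\<^bsub>L\<^esub>}"
  then have A: "A \<in> invariant_field n V" "A \<noteq> \<zero>\<^bsub>L\<^esub>" by auto
  obtain Q \<phi> where 1: "large Q" "rep Q A \<phi>" by (rule rep_exists[OF invariant_carrier[OF A(1)]])
  obtain X where X: "X \<in> Q" "\<phi> X \<noteq> 0" by (rule rep_nonzero[OF 1(2,1) A(2)])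
  define Q' where "Q' = {X \<in> Q. \<phi> X \<noteq> 0}"
  have Q': "large Q'" unfolding Q'_def by (rule rep_nonzero_shrink[OF 1(2,1) X])
  have A': "rep Q' A \<phi>" by (rule rep_mono[OF 1(2)]) (simp add: Q'_def)
  have I: "rep Q' (inv\<^bsub>L\<^esub> A) (\<lambda>X. inverse (\<phi> X))" by (rule rep_inverse(2)[OF A' Q']) (simp add: Q'_def)
  show "inv\<^bsub>L\<^esub> A \<in> invariant_field n V"
    using A(1) rep_invariant_iff[OF A' Q'] rep_invariant_iff[OF I Q'] by simp
qed

end

section \<open>The pivots generate the invariants\<close>

context invariant_variety begin

abbreviation "C \<equiv> C_set n D"

definition pivot_value :: "root \<Rightarrow> 'k mat \<Rightarrow> 'k" where
  "pivot_value \<xi> X = elim (snd \<xi>) (ent X) (fst \<xi>) (snd \<xi>)"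

text \<open>Points at which the pivots before column \<open>j\<close> are defined and nonzero, so that the eliminated entries of
column \<open>j\<close> are regular.\<close>

definition pivotal :: "nat \<Rightarrow> 'k mat set" where
  "pivotal j = {X \<in> W. pivots_nonzero j (ent X)}"

abbreviation "U \<equiv> pivotal (Suc n)"

lemma rational_class_rep:
  assumes Q: "large Q" and K: "subfield K L" and c: "range (ratfun_const n V) \<subseteq> K"
  shows "rational_class (\<lambda>\<phi>. \<exists>A\<in>K. rep Q A \<phi>) Q"
proof
  note sr = subfieldE(1)[OF K]
  show "\<exists>A\<in>K. rep Q A (\<lambda>p. a)" for a using rep_const c by blast
  fix f g assume "\<exists>A\<in>K. rep Q A f" "\<exists>A\<in>K. rep Q A g"
  then obtain A B where AB: "A \<in> K" "rep Q A f" "B \<in> K" "rep Q B g" by blast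
  show "\<exists>A\<in>K. rep Q A (\<lambda>p. f p + g p)" using subringE(7)[OF sr] AB rep_add by blast
  show "\<exists>A\<in>K. rep Q A (\<lambda>p. f p * g p)" using subringE(6)[OF sr] AB rep_mult by blast
  assume "\<And>p. p \<in> Q \<Longrightarrow> g p \<noteq> 0"
  then have i: "B \<noteq> \<zero>\<^bsub>L\<^esub>" "rep Q (inv\<^bsub>L\<^esub> B) (\<lambda>p. inverse (g p))" using rep_inverse[OF AB(4) Q] by blast+
  have "inv\<^bsub>L\<^esub> B \<in> K" using L.subfield_m_inv(1)[OF K] AB(3) i(1) by blast
  then have "A \<otimes>\<^bsub>L\<^esub> inv\<^bsub>L\<^esub> B \<in> K" using subringE(6)[OF sr] AB by blast
  moreover have "rep Q (A \<otimes>\<^bsub>L\<^esub> inv\<^bsub>L\<^esub> B) (\<lambda>p. f p / g p)"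
    using rep_mult[OF AB(2) i(2)] by (simp add: divide_inverse)
  ultimately show "\<exists>A\<in>K. rep Q A (\<lambda>p. f p / g p)" by blast
qed

lemma rational_class_all: "large Q \<Longrightarrow> rational_class (\<lambda>\<phi>. \<exists>A\<in>carrier L. rep Q A \<phi>) Q"
  by (rule rational_class_rep[OF _ L.carrier_is_subfield]) (use rep_const rep_carrier in blast)+

lemma rep_ent:
  assumes "b \<in> {1..n}" "c \<in> {1..n}" "Q \<subseteq> W" shows "\<exists>A\<in>carrier L. rep Q A (\<lambda>X. ent X b c)"
proof -
  obtain f where f: "f \<in> P" "\<forall>X\<in>strictly_lower n. f X = ent X b c" using poly_function_ent[OF assms(1,2)] by blast
  have "rep Q (ratfun_of n V f) (\<lambda>X. ent X b c)"
    using f(2) assms(3) basic_cell_strict by (intro rep_cong[OF rep_poly[OF f(1)]]) blast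
  then show ?thesis using rep_carrier by blast
qed

lemma W_variety: "X \<in> W \<Longrightarrow> \<exists>\<phi>. X \<in> basic_variety n D \<phi> \<and> (\<forall>\<xi>\<in>D. \<phi> \<xi> \<noteq> 0)"
  unfolding basic_cell_def by blast

lemma pivot_rational:
  assumes Q: "large Q" "Q \<subseteq> pivotal j" and kj: "1 \<le> j" "j < k" "k \<le> n"
  shows "\<exists>A\<in>carrier L. rep Q A (\<lambda>X. elim j (ent X) k j)"
  by (rule elim_rational[OF rational_class_all[OF Q(1)]])
    (use Q kj large_subset[OF Q(1)] rep_ent in \<open>auto simp: pivotal_def\<close>)

lemma solve_pivotal:
  assumes "\<And>\<xi>. \<xi> \<in> C \<Longrightarrow> y \<xi> \<noteq> 0"
  shows "matrix_of (solve y) \<in> U" and "\<xi> \<in> C \<Longrightarrow> pivot_value \<xi> (matrix_of (solve y)) = y \<xi>"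
proof -
  have e: "ent (matrix_of (solve y)) b c = solve y b c" if "1 \<le> c" "c < b" "b \<le> n" for b c
    using that by (intro ent_matrix_of) auto
  show "matrix_of (solve y) \<in> U" unfolding pivotal_def
    using solve_in_cell[OF n1, of y] pivots_nonzero_cong[OF n1 e[symmetric] solve_pivots_nonzero[OF n1, of y]] assms by auto
  assume \<xi>: "\<xi> \<in> C"
  obtain k c where kc: "\<xi> = (k, c)" by (cases \<xi>)
  then have b: "1 \<le> c" "c < k" "k \<le> n" using C_bounds \<xi> by auto
  have "elim c (ent (matrix_of (solve y))) k c = elim c (solve y) k c" using e b by (intro elim_cong) auto
  then show "pivot_value \<xi> (matrix_of (solve y)) = y \<xi>" using solve_pivot[of k c y] \<xi> unfolding pivot_value_def kc by simp
qed

lemma large_nonvanishing: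
  assumes "finite A" and Q: "large Q"
    and r: "\<And>k. k \<in> A \<Longrightarrow> \<exists>B. rep Q B (\<phi> k)" and X: "\<And>k. k \<in> A \<Longrightarrow> \<exists>X\<in>Q. \<phi> k X \<noteq> 0"
  shows "large {X \<in> Q. \<forall>k\<in>A. \<phi> k X \<noteq> 0}"
  using assms(1) r X
proof (induction A)
  case empty then show ?case using Q by simp
next
  case (insert k A)
  have "large {X \<in> Q. \<phi> k X \<noteq> 0}" using insert.prems rep_nonzero_shrink[OF _ Q] by blast
  moreover have "large {X \<in> Q. \<forall>k\<in>A. \<phi> k X \<noteq> 0}" using insert by blast
  ultimately have "large ({X \<in> Q. \<phi> k X \<noteq> 0} \<inter> {X \<in> Q. \<forall>k\<in>A. \<phi> k X \<noteq> 0})" by (rule large_Int)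
  also have "{X \<in> Q. \<phi> k X \<noteq> 0} \<inter> {X \<in> Q. \<forall>k\<in>A. \<phi> k X \<noteq> 0} = {X \<in> Q. \<forall>k\<in>insert k A. \<phi> k X \<noteq> 0}" by auto
  finally show ?case .
qed

text \<open>The matrix on \<open>C(D)\<close> with all pivots equal to \<open>1\<close> shows that no pivot vanishes identically.\<close>

lemma large_pivotal:
  assumes "1 \<le> j" "j \<le> Suc n" shows "large (pivotal j)"
  using assms
proof (induction j rule: nat_induct_at_least)
  case base
  then show ?case using large_W by (simp add: pivotal_def pivots_nonzero_def)
next
  case (Suc j)
  have C: "(k, j) \<in> C" if "k \<in> rec_at j" for k using C_iff[OF n1] that Suc by auto
  have fin: "finite (rec_at j)" by (rule finite_subset[of _ "{..n}"]) (use C C_bounds in blast, simp)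
  define X0 where "X0 = matrix_of (solve (\<lambda>\<xi>. 1 :: 'k))"
  have X0: "X0 \<in> U" "\<And>\<xi>. \<xi> \<in> C \<Longrightarrow> pivot_value \<xi> X0 = 1" unfolding X0_def using solve_pivotal[of "\<lambda>\<xi>. 1"] by auto
  have X0j: "X0 \<in> pivotal j" using X0(1) pivots_nonzero_mono[of "Suc n" _ j] Suc.prems unfolding pivotal_def by auto
  have "large {X \<in> pivotal j. \<forall>k\<in>rec_at j. elim j (ent X) k j \<noteq> 0}"
  proof (rule large_nonvanishing[OF fin])
    show "large (pivotal j)" using Suc by simp
    fix k assume k: "k \<in> rec_at j"
    show "\<exists>B. rep (pivotal j) B (\<lambda>X. elim j (ent X) k j)"
      using pivot_rational[of "pivotal j" j k] Suc C[OF k] C_bounds by auto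
    show "\<exists>X\<in>pivotal j. elim j (ent X) k j \<noteq> 0"
      using X0j X0(2)[OF C[OF k]] unfolding pivot_value_def by (intro bexI[of _ X0]) auto
  qed
  also have "{X \<in> pivotal j. \<forall>k\<in>rec_at j. elim j (ent X) k j \<noteq> 0} = pivotal (Suc j)"
    using Suc.hyps unfolding pivotal_def pivots_nonzero_def by (auto simp: less_Suc_eq)
  finally show ?case .
qed

lemma large_U: "large U" by (rule large_pivotal) auto

definition pivot_ratfun :: "root \<Rightarrow> 'k ratfun" where "pivot_ratfun \<xi> = (SOME A. rep U A (pivot_value \<xi>))"

lemma rep_pivot_ratfun: assumes "\<xi> \<in> C" shows "rep U (pivot_ratfun \<xi>) (pivot_value \<xi>)"
proof -
  obtain k c where kc: "\<xi> = (k, c)" by (cases \<xi>)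
  have b: "1 \<le> c" "c < k" "k \<le> n" using C_bounds assms kc by auto
  have "U \<subseteq> pivotal c" using pivots_nonzero_mono[of "Suc n" _ c] b unfolding pivotal_def by auto
  then have "\<exists>A. rep U A (pivot_value \<xi>)" using pivot_rational[OF large_U _ b] unfolding pivot_value_def kc by auto
  then show ?thesis unfolding pivot_ratfun_def by (rule someI_ex)
qed

lemma pivot_nonzero: "X \<in> U \<Longrightarrow> \<xi> \<in> C \<Longrightarrow> pivot_value \<xi> X \<noteq> 0"
  using C_iff[OF n1, of "fst \<xi>" "snd \<xi>"] unfolding pivotal_def pivots_nonzero_def pivot_value_def by auto

lemma pivot_act:
  assumes X: "X \<in> U" and g: "g \<in> UT n"
  shows "coadjoint_act g X \<in> U" and "\<xi> \<in> C \<Longrightarrow> pivot_value \<xi> (coadjoint_act g X) = pivot_value \<xi> X"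
proof -
  have W: "X \<in> W" "pivots_nonzero (Suc n) (ent X)" using X unfolding pivotal_def by auto
  obtain \<phi> where \<phi>: "X \<in> basic_variety n D \<phi>" using W_variety[OF W(1)] by blast
  note rel = conj_rel_coadjoint[OF g basic_cell_strict[OF W(1)]]
  have ns: "pivots_nonzero (Suc n) (ent (coadjoint_act g X))" using pivots_nonzero_invariant[OF \<phi> rel _ _ W(2)] by simp
  then show "coadjoint_act g X \<in> U" using basic_cell_invariant[OF g W(1)] unfolding pivotal_def by simp
  assume \<xi>: "\<xi> \<in> C"
  obtain k c where kc: "\<xi> = (k, c)" by (cases \<xi>)
  then have b: "1 \<le> c" "c \<le> n" "k \<in> rec_at c" using C_iff[OF n1] \<xi> by auto
  show "pivot_value \<xi> (coadjoint_act g X) = pivot_value \<xi> X" unfolding pivot_value_def kc fst_conv snd_conv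
    by (rule pivot_invariant[OF \<phi> rel pivots_nonzero_mono[OF W(2)] pivots_nonzero_mono[OF ns] b]) (use b in auto)
qed

definition generic :: "'k mat set" where
  "generic = {X \<in> U. injective_on sign_places (bracket (ent X))}"

text \<open>The determinant of the bracket on the places with a sign is a polynomial function, nonzero at the matrix found in
\<open>sign_places_injective\<close>.\<close>

lemma large_generic: "large generic"
proof -
  have "\<forall>b c. \<exists>f. b \<in> {1..n} \<longrightarrow> c \<in> {1..n} \<longrightarrow> f \<in> P \<and> (\<forall>X\<in>strictly_lower n. f X = ent X b c)"
    using poly_function_ent[where 'a = 'k] by blast
  then obtain e where e: "\<And>b c. b \<in> {1..n} \<Longrightarrow> c \<in> {1..n} \<Longrightarrow>
      e b c \<in> P \<and> (\<forall>X\<in>strictly_lower n. e b c X = ent X b c)"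
    unfolding choice_iff by blast
  obtain q where q: "bij_betw q {0..<card sign_places} sign_places" using ex_bij_betw_nat_finite[OF finite_sign_places] by blast
  have qE: "fst (q i) \<in> {1..n}" "snd (q i) \<in> {1..n}" if "i < card sign_places" for i
  proof -
    have "q i \<in> pos_roots n" using bij_betw_apply[OF q, of i] that by (simp add: sign_places_def)
    then show "fst (q i) \<in> {1..n}" "snd (q i) \<in> {1..n}" by (auto simp: pos_roots_def)
  qed
  define f where "f = (\<lambda>i l X. (if snd (q l) = fst (q i) then e (fst (q l)) (snd (q i)) X else 0) +
    - (if fst (q l) = snd (q i) then e (fst (q i)) (snd (q l)) X else 0))"
  define h where "h = (\<lambda>X. det (mat (card sign_places) (card sign_places) (\<lambda>(i, l). f i l X)))"
  have fP: "f i l \<in> P" if "i < card sign_places" "l < card sign_places" for i l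
  proof -
    have 1: "(\<lambda>X. if snd (q l) = fst (q i) then e (fst (q l)) (snd (q i)) X else 0) \<in> P"
      using e[OF qE(1)[OF that(2)] qE(2)[OF that(1)]] poly_functions_const[of 0 n]
      by (cases "snd (q l) = fst (q i)") auto
    have 2: "(\<lambda>X. if fst (q l) = snd (q i) then e (fst (q i)) (snd (q l)) X else 0) \<in> P"
      using e[OF qE(1)[OF that(1)] qE(2)[OF that(2)]] poly_functions_const[of 0 n]
      by (cases "fst (q l) = snd (q i)") auto
    show ?thesis unfolding f_def by (rule poly_functions.add[OF 1 poly_functions_uminus[OF 2]])
  qed
  have hP: "h \<in> P" unfolding h_def by (rule poly_functions_det[OF fP])
  have hv: "h X \<noteq> 0 \<longleftrightarrow> injective_on sign_places (bracket (ent X))" if X: "X \<in> W" for X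
  proof -
    have Xs: "X \<in> strictly_lower n" by (rule basic_cell_strict[OF X])
    have "mat (card sign_places) (card sign_places) (\<lambda>(i, l). f i l X) = enum_mat (card sign_places) q (bracket (ent X))"
      unfolding enum_mat_def using e qE Xs by (intro cong_mat) (auto simp: f_def bracket_def)
    then show ?thesis unfolding h_def injective_on_iff_det[OF finite_sign_places q] by simp
  qed
  obtain t :: "nat \<Rightarrow> nat \<Rightarrow> 'k" where t: "\<And>b c. t b c \<noteq> 0 \<longleftrightarrow> (b, c) \<in> C" "injective_on sign_places (bracket t)"
    using sign_places_injective[OF n1] by metis
  have "matrix_of t \<in> basic_variety n D (\<lambda>(b, c). t b c)"
    using t(1) D_subset_C[OF n1] by (intro matrix_of_in_variety[OF n1]) auto
  moreover have "\<forall>\<xi>\<in>D. (\<lambda>(b, c). t b c) \<xi> \<noteq> 0" using t(1) D_subset_C[OF n1] by auto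
  ultimately have tW: "matrix_of t \<in> W" unfolding basic_cell_def by blast
  have "injective_on sign_places (bracket (ent (matrix_of t))) \<longleftrightarrow> injective_on sign_places (bracket t)"
  proof -
    have "bracket (ent (matrix_of t)) \<eta> \<beta> = bracket t \<eta> \<beta>" if "\<eta> \<in> sign_places" "\<beta> \<in> sign_places" for \<eta> \<beta>
      using that unfolding bracket_def sign_places_def pos_roots_def by (auto simp: ent_matrix_of)
    then show ?thesis unfolding injective_on_def by simp
  qed
  then have "nz h" using hv[OF tW] t(2) tW unfolding nz_def by blast
  then have "large (U \<inter> {X \<in> W. h X \<noteq> 0})" using large_Int[OF large_U large_open[OF hP]] by blast
  also have "U \<inter> {X \<in> W. h X \<noteq> 0} = generic" unfolding generic_def pivotal_def using hv by auto
  finally show ?thesis .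
qed

definition normal_form :: "'k mat \<Rightarrow> 'k mat" where
  "normal_form X = matrix_of (solve (\<lambda>\<xi>. pivot_value \<xi> X))"

lemma conjugate_normal_form:
  assumes "X \<in> generic" shows "\<exists>g\<in>UT n. coadjoint_act g X = normal_form X"
proof -
  have X: "X \<in> U" "X \<in> W" "pivots_nonzero (Suc n) (ent X)" "injective_on sign_places (bracket (ent X))"
    using assms unfolding generic_def pivotal_def by auto
  obtain \<phi> where \<phi>: "X \<in> basic_variety n D \<phi>" using W_variety[OF X(2)] by blast
  obtain g where g: "g \<in> UT n" "\<forall>b c. 1 \<le> c \<longrightarrow> c < b \<longrightarrow> b \<le> n \<longrightarrow> (b, c) \<notin> C \<longrightarrow> ent (coadjoint_act g X) b c = 0"
    using conjugate_to_pivots[OF n1 \<phi> X(3,4)] by blast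
  have "coadjoint_act g X = normal_form X" unfolding normal_form_def
  proof (rule strict_eqI)
    show "coadjoint_act g X \<in> strictly_lower n" by (rule basic_cell_strict[OF basic_cell_invariant[OF g(1) X(2)]])
    show "matrix_of (solve (\<lambda>\<xi>. pivot_value \<xi> X)) \<in> strictly_lower n" by (rule matrix_of_strict[OF solve_support])
    fix b c assume bc: "1 \<le> c" "c < b" "b \<le> n"
    have "ent (coadjoint_act g X) b c = solve (\<lambda>\<xi>. pivot_value \<xi> X) b c"
    proof (rule solve_unique[OF _ _ bc])
      fix k c assume "(k, c) \<in> C"
      then show "elim c (ent (coadjoint_act g X)) k c = pivot_value (k, c) X"
        using pivot_act(2)[OF X(1) g(1)] unfolding pivot_value_def by force
    qed (use g(2) in blast)
    then show "ent (coadjoint_act g X) b c = ent (matrix_of (solve (\<lambda>\<xi>. pivot_value \<xi> X))) b c"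
      using bc by (simp add: ent_matrix_of)
  qed
  then show ?thesis using g(1) by blast
qed

text \<open>For an invariant \<open>a / b\<close> the relation \<open>a X b (g X) = a (g X) b X\<close> with \<open>g X\<close> the normal form of \<open>X\<close>
expresses \<open>a / b\<close> by the values of \<open>a\<close> and \<open>b\<close> at the normal form, which are rational in the pivots.\<close>

theorem invariants_in_subfield:
  assumes K: "subfield K L" "range (ratfun_const n V) \<subseteq> K" and pv: "\<And>\<xi>. \<xi> \<in> C \<Longrightarrow> pivot_ratfun \<xi> \<in> K"
  shows "invariant_field n V \<subseteq> K"
proof
  fix A assume A: "A \<in> invariant_field n V"
  note sr = subfieldE(1)[OF K(1)]
  interpret F: rational_class "\<lambda>\<phi>. \<exists>A\<in>K. rep U A \<phi>" U by (rule rational_class_rep[OF large_U K])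
  have nf: "\<exists>B\<in>K. rep U B (\<lambda>X. f (normal_form X))" if "f \<in> P" for f
    using that
  proof induction
    case (coord i j)
    have "\<exists>B\<in>K. rep U B (\<lambda>X. solve (\<lambda>\<xi>. pivot_value \<xi> X) i j)"
      by (rule solve_rational[OF n1 F.rational_class_axioms]) (use pv rep_pivot_ratfun pivot_nonzero in blast)+
    moreover have "normal_form X $$ (i - 1, j - 1) = solve (\<lambda>\<xi>. pivot_value \<xi> X) i j" for X
      using coord by (auto simp: normal_form_def matrix_of_def pos_roots_def)
    ultimately show ?case by presburger
  qed (auto intro: F.const F.add F.mult)
  obtain a b where ab: "a \<in> P" "b \<in> P" "nz b" "A = frac a b" by (rule frac_exists[OF invariant_carrier[OF A]])
  obtain X0 where X0: "X0 \<in> generic" "X0 \<in> W" "b X0 \<noteq> 0"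
    using large_nonempty[OF large_Int[OF large_generic large_open[OF ab(2,3)]]] by blast
  obtain g where g: "g \<in> UT n" "coadjoint_act g X0 = normal_form X0" using conjugate_normal_form[OF X0(1)] by blast
  \<comment> \<open>\<open>b\<close> may vanish on all normal forms; a translate of \<open>a / b\<close> is the same fraction, with a denominator that is nonzero at the normal form of \<open>X0\<close>\<close>
  define a' where "a' = pulled_back (ginv g) a"
  define b' where "b' = pulled_back (ginv g) b"
  note gi = UT_ginv(1)[OF g(1)]
  have a': "a' \<in> P" "\<And>X. X \<in> V \<Longrightarrow> a' X = a (coadjoint_act (ginv g) X)"
    and b': "b' \<in> P" "\<And>X. X \<in> V \<Longrightarrow> b' X = b (coadjoint_act (ginv g) X)"
    unfolding a'_def b'_def using pulled_back ab gi by auto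
  have nb': "nz b'" by (rule nz_pullback[OF ab(3) gi b'(2)])
  have inv: "\<And>g X. g \<in> UT n \<Longrightarrow> X \<in> V \<Longrightarrow> a (coadjoint_act g X) * b X = a X * b (coadjoint_act g X)"
    using A frac_invariant_iff[OF ab(1-3)] ab(4) by blast
  have A': "A = frac a' b'" unfolding ab(4) frac_eq_iff[OF ab(1-3) a'(1) b'(1) nb']
    using inv[OF gi] a'(2) b'(2) by auto
  then have inv': "\<And>g X. g \<in> UT n \<Longrightarrow> X \<in> V \<Longrightarrow> a' (coadjoint_act g X) * b' X = a' X * b' (coadjoint_act g X)"
    using A frac_invariant_iff[OF a'(1) b'(1) nb'] by blast
  have X0V: "X0 \<in> V" using X0(2) cell_subset by blast
  have b0: "b' (normal_form X0) \<noteq> 0"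
    using b'(2)[OF V_invariant[OF g(1) X0V]] ginv_act[OF g(1) X0V] X0(3) unfolding g(2) by simp
  obtain B1 where B1: "B1 \<in> K" "rep U B1 (\<lambda>X. a' (normal_form X))" using nf[OF a'(1)] by blast
  obtain B2 where B2: "B2 \<in> K" "rep U B2 (\<lambda>X. b' (normal_form X))" using nf[OF b'(1)] by blast
  have "X0 \<in> U" using X0(1) unfolding generic_def by simp
  then have "large {X \<in> U. b' (normal_form X) \<noteq> 0}" using rep_nonzero_shrink[OF B2(2) large_U] b0 by blast
  define Q where "Q = {X \<in> U. b' (normal_form X) \<noteq> 0} \<inter> (generic \<inter> {X \<in> W. b' X \<noteq> 0})"
  have Q: "large Q" unfolding Q_def
    by (intro large_Int large_generic large_open b' nb' \<open>large {X \<in> U. b' (normal_form X) \<noteq> 0}\<close>)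
  have QU: "Q \<subseteq> U" unfolding Q_def by blast
  have i: "B2 \<noteq> \<zero>\<^bsub>L\<^esub>" "rep Q (inv\<^bsub>L\<^esub> B2) (\<lambda>X. inverse (b' (normal_form X)))"
    using rep_inverse[OF rep_mono[OF B2(2) QU] Q] unfolding Q_def by auto
  have "A = B1 \<otimes>\<^bsub>L\<^esub> inv\<^bsub>L\<^esub> B2"
  proof (rule rep_unique[OF _ rep_mult[OF rep_mono[OF B1(2) QU] i(2)] Q])
    show "rep Q A (\<lambda>X. a' X / b' X)" unfolding A' by (rule repI[OF a'(1) b'(1) nb']) (simp add: Q_def)
    fix X assume X: "X \<in> Q"
    then obtain h where h: "h \<in> UT n" "coadjoint_act h X = normal_form X"
      using conjugate_normal_form unfolding Q_def by blast
    have "X \<in> V" using X cell_subset unfolding Q_def by blast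
    then show "a' X / b' X = a' (normal_form X) * inverse (b' (normal_form X))"
      using inv'[OF h(1), of X] h(2) X unfolding Q_def by (simp add: field_simps)
  qed
  moreover have "inv\<^bsub>L\<^esub> B2 \<in> K" using L.subfield_m_inv(1)[OF K(1)] B2(1) i(1) by blast
  ultimately show "A \<in> K" using subringE(6)[OF sr] B1(1) by simp
qed

end

section \<open>The minors\<close>

context basic_roots begin

text \<open>Rows that \<open>D\<close> meets in an earlier column are already values of the permutation. Hence the greatest available row
is that of the root of \<open>D\<close> in column \<open>b\<close>; without such a root, every row below the diagonal is
either used or carries a bullet.\<close>

lemma w_perm_value:
  assumes "1 \<le> b" "b \<le> n"
  shows "(\<forall>r. (r, b) \<in> D \<longrightarrow> w_perm n D b = r) \<and> ((\<forall>r. (r, b) \<notin> D) \<longrightarrow> w_perm n D b \<le> b)"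
  using assms
proof (induction b rule: less_induct)
  case (less b)
  define A where "A = {i \<in> {1..n}. (i, b) \<notin> MD \<and> i \<notin> w_perm n D ` {1..<b}}"
  have w: "w_perm n D b = Max A" unfolding A_def by (rule w_perm.simps)
  have fin: "finite A" unfolding A_def by simp
  have above: "\<exists>b'\<ge>i. (b', b) \<in> D" if i: "i \<in> A" "b < i" for i
  proof -
    have "i \<le> n" "(i, b) \<notin> MD" using i unfolding A_def by auto
    then have "(\<exists>c'\<le>b. (i, c') \<in> D) \<or> (\<exists>b'\<ge>i. (b', b) \<in> D)" using M_roots_iff[of b i] i(2) less.prems by auto
    moreover have False if "(i, c') \<in> D" "c' < b" for c'
    proof -
      have "1 \<le> c'" "c' \<le> n" using D_bounds[OF that(1)] by auto
      then have "w_perm n D c' = i" using less.IH[of c'] that by auto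
      then show False using i(1) that(2) \<open>1 \<le> c'\<close> unfolding A_def by auto
    qed
    ultimately show ?thesis by (metis le_neq_implies_less order_refl)
  qed
  have D: "w_perm n D b = r" if r: "(r, b) \<in> D" for r
    unfolding w
  proof (rule Max_eqI[OF fin])
    have rb: "b < r" "r \<le> n" using D_bounds[OF r] by auto
    have "r \<notin> w_perm n D ` {1..<b}"
    proof
      assume "r \<in> w_perm n D ` {1..<b}"
      then obtain b' where b': "1 \<le> b'" "b' < b" "w_perm n D b' = r" by auto
      have IH: "(\<forall>r. (r, b') \<in> D \<longrightarrow> w_perm n D b' = r) \<and> ((\<forall>r. (r, b') \<notin> D) \<longrightarrow> w_perm n D b' \<le> b')"
        using less.IH[of b'] b' less.prems by auto
      show False
      proof (cases "\<exists>r'. (r', b') \<in> D")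
        case True
        then have "(r, b') \<in> D" using IH b'(3) by auto
        then show False using D_row_unique[OF r, of b'] b'(2) by simp
      next
        case False
        then show False using IH b' rb by auto
      qed
    qed
    moreover have "(r, b) \<notin> MD" using M_roots_iff[of b r] rb less.prems r by auto
    ultimately show "r \<in> A" unfolding A_def using rb by auto
    fix i assume i: "i \<in> A"
    show "i \<le> r"
    proof (rule ccontr)
      assume "\<not> i \<le> r"
      then obtain b' where "b' \<ge> i" "(b', b) \<in> D" using above[OF i] rb by auto
      then show False using D_col_unique[OF r, of b'] \<open>\<not> i \<le> r\<close> by auto
    qed
  qed
  have "w_perm n D b \<le> b" if no: "\<forall>r. (r, b) \<notin> D"
  proof -
    \<comment> \<open>the set under the maximum is nonempty, as \<open>b - 1\<close> values cannot exhaust \<open>{1..b}\<close>\<close>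
    have "card (w_perm n D ` {1..<b}) < card {1..b}"
      using card_image_le[of "{1..<b}" "w_perm n D"] less.prems by auto
    then have "\<not> {1..b} \<subseteq> w_perm n D ` {1..<b}" using card_mono[of "w_perm n D ` {1..<b}" "{1..b}"] by auto
    then obtain i where i: "i \<in> {1..b}" "i \<notin> w_perm n D ` {1..<b}" by blast
    then have "i \<in> A" unfolding A_def using less.prems M_roots_pos[of i b] by fastforce
    then have "Max A \<in> A" using fin by (intro Max_in) auto
    then show ?thesis using above[of "Max A"] no unfolding w by (meson not_le)
  qed
  then show ?case using D by blast
qed

lemma w_perm_D: "(r, b) \<in> D \<Longrightarrow> w_perm n D b = r"
  using w_perm_value[of b] D_bounds[of r b] by auto

definition south_west :: "root \<Rightarrow> root set" where
  "south_west \<xi> = {\<eta> \<in> D. fst \<xi> \<le> fst \<eta> \<and> snd \<eta> \<le> snd \<xi>}"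

text \<open>Only columns with a root of \<open>D\<close> can have values of the permutation below the diagonal, so that the rows and columns of
the minor are those of the roots of \<open>D\<close> to the south-west.\<close>

lemma P_minor_south_west:
  assumes "\<xi> \<in> D"
  shows "P_minor n D \<xi> X = minor (fst ` south_west \<xi>) (snd ` south_west \<xi>) X"
proof -
  obtain i j where \<xi>: "\<xi> = (i, j)" by (cases \<xi>)
  have D: "(i, j) \<in> D" using assms \<xi> by simp
  have ij: "1 \<le> j" "j < i" "i \<le> n" using D_bounds[OF D] by auto
  define J' where "J' = {b. 1 \<le> b \<and> b \<le> j - 1 \<and> w_perm n D b > i}"
  have J: "b \<in> J' \<longleftrightarrow> b < j \<and> (w_perm n D b, b) \<in> D \<and> i < w_perm n D b" for b
  proof
    assume "b \<in> J'"
    then have b: "1 \<le> b" "b < j" "i < w_perm n D b" unfolding J'_def using ij by auto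
    have "\<exists>r. (r, b) \<in> D"
    proof (rule ccontr)
      assume "\<nexists>r. (r, b) \<in> D"
      then have "w_perm n D b \<le> b" using w_perm_value[of b] b ij by auto
      then show False using b ij by auto
    qed
    then show "b < j \<and> (w_perm n D b, b) \<in> D \<and> i < w_perm n D b" using w_perm_D b by blast
  next
    assume "b < j \<and> (w_perm n D b, b) \<in> D \<and> i < w_perm n D b"
    then show "b \<in> J'" unfolding J'_def using D_bounds[of "w_perm n D b" b] by auto
  qed
  have sw: "\<eta> \<in> south_west \<xi> \<longleftrightarrow> \<eta> = (i, j) \<or> (\<exists>b\<in>J'. \<eta> = (w_perm n D b, b))" for \<eta>
  proof -
    obtain r c where \<eta>: "\<eta> = (r, c)" by (cases \<eta>)
    have "r = i \<longleftrightarrow> c = j" if "(r, c) \<in> D"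
      using D_row_unique[OF D, of c] D_col_unique[OF D, of r] that by auto
    then show ?thesis unfolding \<eta> \<xi> south_west_def using w_perm_D[of r c] J[of c] D by (auto simp: J)
  qed
  have "south_west \<xi> = insert (i, j) ((\<lambda>b. (w_perm n D b, b)) ` J')" using sw by blast
  then have "fst ` south_west \<xi> = w_perm n D ` J' \<union> {i}" "snd ` south_west \<xi> = J' \<union> {j}"
    by (simp_all add: image_image)
  then show ?thesis unfolding P_minor_def \<xi> Let_def fst_conv snd_conv J'_def[symmetric] by simp
qed

end

lemma pick_bij:
  assumes "finite S"
  shows "bij_betw (pick S) {0..<card S} S" and "a < b \<Longrightarrow> b < card S \<Longrightarrow> pick S a < pick S b"
proof -
  show mono: "a < b \<Longrightarrow> b < card S \<Longrightarrow> pick S a < pick S b" for a b by (rule pick_mono_le)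
  have inj: "inj_on (pick S) {0..<card S}"
    by (rule linorder_inj_onI) (use mono in \<open>auto simp: less_imp_neq\<close>)
  have sub: "pick S ` {0..<card S} \<subseteq> S" using pick_in_set_le by auto
  have "pick S ` {0..<card S} = S" by (rule card_subset_eq[OF assms sub]) (simp add: card_image[OF inj])
  then show "bij_betw (pick S) {0..<card S} S" using inj by (simp add: bij_betw_def)
qed

lemma minor_enumeration:
  fixes I J :: "nat set"
  assumes I: "I \<subseteq> {1..n}" and J: "J \<subseteq> {1..n}"
  shows "\<exists>\<rho> \<sigma>. bij_betw \<rho> {0..<card I} I \<and> bij_betw \<sigma> {0..<card J} J \<and>
    (\<forall>a b. a < b \<longrightarrow> b < card I \<longrightarrow> \<rho> a < \<rho> b) \<and> (\<forall>a b. a < b \<longrightarrow> b < card J \<longrightarrow> \<sigma> a < \<sigma> b) \<and>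
    (\<forall>X :: 'k::field mat \<in> carrier_mat n n. minor I J X = det (mat (card I) (card J) (\<lambda>(a, b). ent X (\<rho> a) (\<sigma> b))))"
proof -
  have shift: "bij_betw (\<lambda>i. i - 1) S ((\<lambda>i. i - 1) ` S)" "Suc ` (\<lambda>i. i - 1) ` S = S"
    "(\<lambda>i. i - 1) ` S \<subseteq> {..<n}" "card ((\<lambda>i. i - 1) ` S) = card S" if "S \<subseteq> {1..n}" for S :: "nat set"
  proof -
    have "inj_on (\<lambda>i. i - 1) S" using that by (intro inj_onI) (metis Suc_pred' atLeastAtMost_iff less_eq_Suc_le One_nat_def subset_iff)
    then show "bij_betw (\<lambda>i. i - 1) S ((\<lambda>i. i - 1) ` S)" "card ((\<lambda>i. i - 1) ` S) = card S"
      by (auto simp: bij_betw_def card_image)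
    show "Suc ` (\<lambda>i. i - 1) ` S = S" unfolding image_image using that by (force simp: image_iff subset_iff)
    show "(\<lambda>i. i - 1) ` S \<subseteq> {..<n}" using that by (force simp: subset_iff)
  qed
  have enum: "bij_betw (\<lambda>a. Suc (pick ((\<lambda>i. i - 1) ` S) a)) {0..<card S} S"
    "\<forall>a b. a < b \<longrightarrow> b < card S \<longrightarrow> Suc (pick ((\<lambda>i. i - 1) ` S) a) < Suc (pick ((\<lambda>i. i - 1) ` S) b)"
    if S: "S \<subseteq> {1..n}" for S :: "nat set"
  proof -
    let ?S = "(\<lambda>i. i - 1) ` S"
    have fin: "finite ?S" using finite_subset[OF shift(3)[OF S]] by simp
    have "bij_betw Suc ?S (Suc ` ?S)" by (simp add: bij_betw_def)
    then have "bij_betw Suc ?S S" unfolding shift(2)[OF S] .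
    from bij_betw_trans[OF pick_bij(1)[OF fin] this]
    show "bij_betw (\<lambda>a. Suc (pick ?S a)) {0..<card S} S" unfolding shift(4)[OF S] o_def .
    show "\<forall>a b. a < b \<longrightarrow> b < card S \<longrightarrow> Suc (pick ?S a) < Suc (pick ?S b)"
      using pick_bij(2)[OF fin] unfolding shift(4)[OF S] by simp
  qed
  have "minor I J X = det (mat (card I) (card J) (\<lambda>(a, b). ent X (Suc (pick ((\<lambda>i. i - 1) ` I) a)) (Suc (pick ((\<lambda>i. i - 1) ` J) b))))"
    if X: "X \<in> carrier_mat n n" for X :: "'k mat"
  proof -
    have c: "card {i. i < n \<and> i \<in> (\<lambda>i. i - 1) ` S} = card S" if "S \<subseteq> {1..n}" for S :: "nat set"
    proof -
      have "{i. i < n \<and> i \<in> (\<lambda>i. i - 1) ` S} = (\<lambda>i. i - 1) ` S" using shift(3)[OF that] by auto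
      then show ?thesis using shift(4)[OF that] by simp
    qed
    have dims: "dim_row X = n" "dim_col X = n" using X by auto
    show ?thesis unfolding minor_def submatrix_def dims c[OF I] c[OF J] ent_def by simp
  qed
  then show ?thesis using enum[OF I] enum[OF J] by blast
qed

lemma det_unitriangular:
  fixes A :: "'k::field mat"
  assumes A: "A \<in> carrier_mat m m" and u: "\<And>a b. b < a \<Longrightarrow> a < m \<Longrightarrow> A $$ (a, b) = 0"
  shows "det A = (\<Prod>a\<in>{0..<m}. A $$ (a, a))"
proof -
  have "upper_triangular A" using A u by (intro upper_triangularI) auto
  then have "det A = prod_list (diag_mat A)" by (rule det_upper_triangular[OF _ A])
  then show ?thesis using A by (simp add: prod_list_diag_prod)
qed

context basic_roots begin

lemma finite_south_west: "finite (south_west \<xi>)"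
  by (rule finite_subset[of _ "{..n} \<times> {..n}"]) (auto simp: south_west_def dest: D_bounds)

lemma south_west_inj: "inj_on fst (south_west \<xi>)" "inj_on snd (south_west \<xi>)"
  using D_row_unique D_col_unique unfolding south_west_def inj_on_def by auto

lemma south_west_images:
  "fst ` south_west \<xi> \<subseteq> {1..n}" "snd ` south_west \<xi> \<subseteq> {1..n}"
  "card (fst ` south_west \<xi>) = card (south_west \<xi>)" "card (snd ` south_west \<xi>) = card (south_west \<xi>)"
  using card_image[OF south_west_inj(1)] card_image[OF south_west_inj(2)]
  by (auto simp: south_west_def dest: D_bounds)

text \<open>The submatrix factors as \<open>G * (Pm * E) * H\<close>. Here \<open>G\<close> and \<open>H\<close> are submatrices of the
unitriangular factors on equal row and column sets, hence unitriangular; \<open>Pm\<close> is a permutation matrix and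
\<open>E\<close> the diagonal matrix of the values of \<open>\<phi>\<close>. No other roots of \<open>D\<close> contribute, since the
row operations only add lower rows and the column operations only add columns to the left. The constant is \<open>det Pm\<close>.\<close>

lemma P_minor_value:
  assumes "\<xi> \<in> D"
  shows "\<exists>\<kappa>. \<kappa> \<noteq> 0 \<and> (\<forall>\<phi>. \<forall>X\<in>basic_variety n D \<phi>. P_minor n D \<xi> X = \<kappa> * (\<Prod>\<eta>\<in>south_west \<xi>. \<phi> \<eta> :: 'k::field))"
proof -
  obtain i j where \<xi>: "\<xi> = (i, j)" by (cases \<xi>)
  have ij: "1 \<le> j" "j < i" "i \<le> n" using D_bounds assms \<xi> by auto
  let ?S = "south_west \<xi>"
  define m where "m = card ?S"
  obtain \<rho> \<sigma> where b\<rho>: "bij_betw \<rho> {0..<m} (fst ` ?S)" and b\<sigma>: "bij_betw \<sigma> {0..<m} (snd ` ?S)"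
    and m\<rho>: "\<And>a b. a < b \<Longrightarrow> b < m \<Longrightarrow> \<rho> a < \<rho> b" and m\<sigma>: "\<And>a b. a < b \<Longrightarrow> b < m \<Longrightarrow> \<sigma> a < \<sigma> b"
    and mi: "\<And>X :: 'k mat. X \<in> carrier_mat n n \<Longrightarrow>
      minor (fst ` ?S) (snd ` ?S) X = det (mat m m (\<lambda>(a, b). ent X (\<rho> a) (\<sigma> b)))"
    using minor_enumeration[OF south_west_images(1,2)[of \<xi>], where 'k = 'k] unfolding south_west_images m_def by metis
  have \<rho>S: "\<rho> a \<in> {1..n}" "i \<le> \<rho> a" "\<exists>t<m. (\<rho> a, \<sigma> t) \<in> D" if "a < m" for a
  proof -
    have "\<rho> a \<in> fst ` ?S" using bij_betw_apply[OF b\<rho>, of a] that by simp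
    then obtain c where c: "(\<rho> a, c) \<in> ?S" by force
    then show "\<rho> a \<in> {1..n}" "i \<le> \<rho> a" using \<xi> by (auto simp: south_west_def dest: D_bounds)
    have "c \<in> \<sigma> ` {0..<m}" using c b\<sigma> by (force simp: bij_betw_def)
    then show "\<exists>t<m. (\<rho> a, \<sigma> t) \<in> D" using c by (auto simp: south_west_def)
  qed
  have \<sigma>S: "\<sigma> a \<in> {1..n}" "\<sigma> a \<le> j" "\<exists>s<m. (\<rho> s, \<sigma> a) \<in> D" if "a < m" for a
  proof -
    have "\<sigma> a \<in> snd ` ?S" using bij_betw_apply[OF b\<sigma>, of a] that by simp
    then obtain c where c: "(c, \<sigma> a) \<in> ?S" by force
    then show "\<sigma> a \<in> {1..n}" "\<sigma> a \<le> j" using \<xi> by (auto simp: south_west_def dest: D_bounds)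
    have "c \<in> \<rho> ` {0..<m}" using c b\<rho> by (force simp: bij_betw_def)
    then show "\<exists>s<m. (\<rho> s, \<sigma> a) \<in> D" using c by (auto simp: south_west_def)
  qed
  have \<rho>inj: "\<rho> a = \<rho> b \<longleftrightarrow> a = b" if "a < m" "b < m" for a b
    using b\<rho> that unfolding bij_betw_def inj_on_def by auto
  have \<sigma>inj: "\<sigma> a = \<sigma> b \<longleftrightarrow> a = b" if "a < m" "b < m" for a b
    using b\<sigma> that unfolding bij_betw_def inj_on_def by auto
  define Pm :: "'k mat" where "Pm = mat m m (\<lambda>(s, t). if (\<rho> s, \<sigma> t) \<in> D then 1 else 0)"
  have Pc: "Pm \<in> carrier_mat m m" "transpose_mat Pm \<in> carrier_mat m m" by (simp_all add: Pm_def)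
  have "Pm * transpose_mat Pm = 1\<^sub>m m"
  proof (rule eq_matI)
    fix s s' assume "s < dim_row (1\<^sub>m m :: 'k mat)" "s' < dim_col (1\<^sub>m m :: 'k mat)"
    then have s: "s < m" "s' < m" by auto
    obtain t where t: "t < m" "(\<rho> s, \<sigma> t) \<in> D" using \<rho>S(3)[OF s(1)] by blast
    have "(Pm * transpose_mat Pm) $$ (s, s') = (\<Sum>u\<in>{0..<m}. Pm $$ (s, u) * Pm $$ (s', u))"
      using s by (simp add: Pm_def scalar_prod_def)
    also have "\<dots> = (\<Sum>u\<in>{0..<m}. if u = t then (if s = s' then 1 else 0) else 0)"
    proof (rule sum.cong[OF refl])
      fix u assume u: "u \<in> {0..<m}"
      show "Pm $$ (s, u) * Pm $$ (s', u) = (if u = t then (if s = s' then 1 else 0) else 0)"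
      proof (cases "u = t")
        case True
        then show ?thesis using s t D_col_unique[OF t(2), of "\<rho> s'"] \<rho>inj[OF s] by (auto simp: Pm_def)
      next
        case False
        then have "(\<rho> s, \<sigma> u) \<notin> D" using D_row_unique[OF t(2), of "\<sigma> u"] \<sigma>inj[of t u] t u by auto
        then show ?thesis using s u False by (simp add: Pm_def)
      qed
    qed
    also have "\<dots> = 1\<^sub>m m $$ (s, s')" using s t by simp
    finally show "(Pm * transpose_mat Pm) $$ (s, s') = 1\<^sub>m m $$ (s, s')" .
  qed (simp_all add: Pm_def)
  then have "det Pm * det (transpose_mat Pm) = 1" using det_mult[OF Pc] by simp
  then have nz: "det Pm \<noteq> 0" by auto
  have "P_minor n D \<xi> X = det Pm * (\<Prod>\<eta>\<in>?S. \<phi> \<eta>)" if X: "X \<in> basic_variety n D \<phi>" for X and \<phi> :: "root \<Rightarrow> 'k"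
  proof -
    obtain g k where gk: "g \<in> UT n" "k \<in> UT n" "X = left_right_act g k (X_mat n D \<phi>)"
      using X unfolding basic_variety_def by auto
    define h where "h = ginv k"
    have h: "h \<in> UT n" unfolding h_def by (rule UT_ginv(1)[OF gk(2)])
    note gc = UT_carrier[OF gk(1)] and hc = UT_carrier[OF h]
    have Z: "g * X_mat n D \<phi> * h \<in> carrier_mat n n"
      by (rule mult_carrier_mat[OF mult_carrier_mat[OF gc X_mat_carrier] hc])
    have Xl: "X = lower_part (g * X_mat n D \<phi> * h)" unfolding gk(3) left_right_act_def h_def ..
    have Xc: "X \<in> carrier_mat n n" unfolding Xl using Z by simp
    define r where "r = (\<lambda>c. SOME q. (q, c) \<in> D)"
    have r: "r c = q" if "(q, c) \<in> D" for q c
    proof -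
      have "(r c, c) \<in> D" unfolding r_def using that by (rule someI)
      then show ?thesis using D_col_unique[OF that] by blast
    qed
    define G where "G = mat m m (\<lambda>(a, s). ent g (\<rho> a) (\<rho> s))"
    define H where "H = mat m m (\<lambda>(t, b). ent h (\<sigma> t) (\<sigma> b))"
    define E where "E = mat m m (\<lambda>(t, u). if t = u then \<phi> (r (\<sigma> t), \<sigma> t) else 0)"
    have car: "G \<in> carrier_mat m m" "H \<in> carrier_mat m m" "E \<in> carrier_mat m m" by (simp_all add: G_def H_def E_def)
    have dG: "det G = 1"
    proof -
      have "det G = (\<Prod>a\<in>{0..<m}. G $$ (a, a))"
        by (rule det_unitriangular[OF car(1)]) (use m\<rho> \<rho>S(1) ent_UT[OF gk(1)] in \<open>auto simp: G_def less_imp_le \<rho>inj\<close>)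
      also have "\<dots> = 1" using ent_UT[OF gk(1)] \<rho>S(1) by (intro prod.neutral) (auto simp: G_def)
      finally show ?thesis .
    qed
    have dH: "det H = 1"
    proof -
      have "det H = (\<Prod>a\<in>{0..<m}. H $$ (a, a))"
        by (rule det_unitriangular[OF car(2)]) (use m\<sigma> \<sigma>S(1) ent_UT[OF h] in \<open>auto simp: H_def less_imp_le \<sigma>inj\<close>)
      also have "\<dots> = 1" using ent_UT[OF h] \<sigma>S(1) by (intro prod.neutral) (auto simp: H_def)
      finally show ?thesis .
    qed
    have dE: "det E = (\<Prod>\<eta>\<in>?S. \<phi> \<eta>)"
    proof -
      have "det E = (\<Prod>a\<in>{0..<m}. E $$ (a, a))" by (rule det_unitriangular[OF car(3)]) (auto simp: E_def)
      also have "\<dots> = (\<Prod>a\<in>{0..<m}. \<phi> (r (\<sigma> a), \<sigma> a))" by (intro prod.cong) (auto simp: E_def)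
      also have "\<dots> = (\<Prod>c\<in>snd ` ?S. \<phi> (r c, c))" by (rule prod.reindex_bij_betw[OF b\<sigma>])
      also have "\<dots> = (\<Prod>\<eta>\<in>?S. \<phi> (r (snd \<eta>), snd \<eta>))" by (simp add: prod.reindex[OF south_west_inj(2)])
      also have "\<dots> = (\<Prod>\<eta>\<in>?S. \<phi> \<eta>)" using r by (intro prod.cong) (auto simp: south_west_def)
      finally show ?thesis .
    qed
    have "mat m m (\<lambda>(a, b). ent X (\<rho> a) (\<sigma> b)) = G * (Pm * E) * H"
    proof (rule eq_matI)
      fix a b assume "a < dim_row (G * (Pm * E) * H)" "b < dim_col (G * (Pm * E) * H)"
      then have ab: "a < m" "b < m" using car by auto
      note \<rho>a = \<rho>S[OF ab(1)] and \<sigma>b = \<sigma>S[OF ab(2)]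
      have PE: "(Pm * E) $$ (s, t) = (if (\<rho> s, \<sigma> t) \<in> D then \<phi> (\<rho> s, \<sigma> t) else 0)" if st: "s < m" "t < m" for s t
      proof -
        have "(Pm * E) $$ (s, t) = (\<Sum>u\<in>{0..<m}. Pm $$ (s, u) * E $$ (u, t))"
          using st by (simp add: Pm_def E_def scalar_prod_def)
        also have "\<dots> = (\<Sum>u\<in>{0..<m}. if u = t then (if (\<rho> s, \<sigma> t) \<in> D then \<phi> (\<rho> s, \<sigma> t) else 0) else 0)"
          using st r by (intro sum.cong refl) (auto simp: Pm_def E_def)
        finally show ?thesis using st by simp
      qed
      have "ent X (\<rho> a) (\<sigma> b) = ent (g * X_mat n D \<phi> * h) (\<rho> a) (\<sigma> b)"
        unfolding Xl using ent_lower[OF Z \<rho>a(1) \<sigma>b(1)] \<rho>a(2) \<sigma>b(2) ij by simp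
      also have "\<dots> = (\<Sum>q\<in>{1..n}. (\<Sum>p\<in>{1..n}. ent g (\<rho> a) p * ent (X_mat n D \<phi>) p q) * ent h q (\<sigma> b))"
        using ent_mult[OF mult_carrier_mat[OF gc X_mat_carrier] hc \<rho>a(1) \<sigma>b(1)]
          ent_mult[OF gc X_mat_carrier \<rho>a(1)] by (simp add: mm_def)
      also have "\<dots> = (\<Sum>q\<in>{1..n}. \<Sum>p\<in>fst ` ?S. ent g (\<rho> a) p * ent (X_mat n D \<phi>) p q * ent h q (\<sigma> b))"
      proof (rule sum.cong[OF refl])
        fix q assume q: "q \<in> {1..n}"
        have "(\<Sum>p\<in>{1..n}. ent g (\<rho> a) p * ent (X_mat n D \<phi>) p q * ent h q (\<sigma> b)) =
          (\<Sum>p\<in>fst ` ?S. ent g (\<rho> a) p * ent (X_mat n D \<phi>) p q * ent h q (\<sigma> b))"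
        proof (rule sum.mono_neutral_right)
          show "\<forall>p\<in>{1..n} - fst ` ?S. ent g (\<rho> a) p * ent (X_mat n D \<phi>) p q * ent h q (\<sigma> b) = 0"
          proof
            fix p assume p: "p \<in> {1..n} - fst ` ?S"
            show "ent g (\<rho> a) p * ent (X_mat n D \<phi>) p q * ent h q (\<sigma> b) = 0"
            proof (cases "(p, q) \<in> D \<and> \<rho> a \<le> p \<and> q \<le> \<sigma> b")
              case True
              then have "(p, q) \<in> ?S" using \<rho>a(2) \<sigma>b(2) unfolding south_west_def \<xi> by auto
              then show ?thesis using p by force
            next
              case False
              then show ?thesis using p q ent_UT[OF gk(1) \<rho>a(1), of p] ent_UT[OF h q, of "\<sigma> b"] \<rho>a(1) \<sigma>b(1)
                by (auto simp: ent_def X_mat_def)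
            qed
          qed
        qed (use south_west_images in auto)
        then show "(\<Sum>p\<in>{1..n}. ent g (\<rho> a) p * ent (X_mat n D \<phi>) p q) * ent h q (\<sigma> b) =
          (\<Sum>p\<in>fst ` ?S. ent g (\<rho> a) p * ent (X_mat n D \<phi>) p q * ent h q (\<sigma> b))"
          by (simp add: sum_distrib_right)
      qed
      also have "\<dots> = (\<Sum>q\<in>snd ` ?S. \<Sum>p\<in>fst ` ?S. ent g (\<rho> a) p * ent (X_mat n D \<phi>) p q * ent h q (\<sigma> b))"
      proof (rule sum.mono_neutral_right)
        show "\<forall>q\<in>{1..n} - snd ` ?S. (\<Sum>p\<in>fst ` ?S. ent g (\<rho> a) p * ent (X_mat n D \<phi>) p q * ent h q (\<sigma> b)) = 0"
        proof (intro ballI sum.neutral)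
          fix q p assume q: "q \<in> {1..n} - snd ` ?S" and p: "p \<in> fst ` ?S"
          have pn: "p \<in> {1..n}" using p south_west_images(1) by blast
          show "ent g (\<rho> a) p * ent (X_mat n D \<phi>) p q * ent h q (\<sigma> b) = 0"
          proof (cases "(p, q) \<in> D \<and> \<rho> a \<le> p \<and> q \<le> \<sigma> b")
            case True
            then have "(p, q) \<in> ?S" using \<rho>a(2) \<sigma>b(2) unfolding south_west_def \<xi> by auto
            then show ?thesis using q by force
          next
            case False
            then show ?thesis using pn q ent_UT[OF gk(1) \<rho>a(1), of p] ent_UT[OF h, of q "\<sigma> b"] \<rho>a(1) \<sigma>b(1)
              by (auto simp: ent_def X_mat_def)
          qed
        qed
      qed (use south_west_images in auto)
      also have "\<dots> = (\<Sum>t\<in>{0..<m}. \<Sum>s\<in>{0..<m}. ent g (\<rho> a) (\<rho> s) * ent (X_mat n D \<phi>) (\<rho> s) (\<sigma> t) * ent h (\<sigma> t) (\<sigma> b))"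
        unfolding sum.reindex_bij_betw[OF b\<rho>, symmetric] sum.reindex_bij_betw[OF b\<sigma>, symmetric] ..
      also have "\<dots> = (\<Sum>t\<in>{0..<m}. (\<Sum>s\<in>{0..<m}. G $$ (a, s) * (Pm * E) $$ (s, t)) * H $$ (t, b))"
      proof (rule sum.cong[OF refl])
        fix t assume t: "t \<in> {0..<m}"
        have "ent g (\<rho> a) (\<rho> s) * ent (X_mat n D \<phi>) (\<rho> s) (\<sigma> t) * ent h (\<sigma> t) (\<sigma> b) =
          G $$ (a, s) * (Pm * E) $$ (s, t) * H $$ (t, b)" if s: "s \<in> {0..<m}" for s
        proof -
          have "ent (X_mat n D \<phi>) (\<rho> s) (\<sigma> t) = (Pm * E) $$ (s, t)"
            using \<rho>S(1)[of s] \<sigma>S(1)[of t] s t PE[of s t] by (auto simp: ent_def X_mat_def)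
          then show ?thesis using s t ab by (simp add: G_def H_def)
        qed
        then show "(\<Sum>s\<in>{0..<m}. ent g (\<rho> a) (\<rho> s) * ent (X_mat n D \<phi>) (\<rho> s) (\<sigma> t) * ent h (\<sigma> t) (\<sigma> b)) =
          (\<Sum>s\<in>{0..<m}. G $$ (a, s) * (Pm * E) $$ (s, t)) * H $$ (t, b)" by (simp add: sum_distrib_right)
      qed
      also have "\<dots> = (G * (Pm * E) * H) $$ (a, b)"
      proof -
        have "(G * (Pm * E)) $$ (a, t) = (\<Sum>s\<in>{0..<m}. G $$ (a, s) * (Pm * E) $$ (s, t))" if "t < m" for t
          using mat_mult_entry[OF car(1) mult_carrier_mat[OF Pc(1) car(3)] ab(1) that] by (simp only: atLeast0LessThan)
        then show ?thesis
          using mat_mult_entry[OF mult_carrier_mat[OF car(1) mult_carrier_mat[OF Pc(1) car(3)]] car(2) ab] by (simp add: atLeast0LessThan)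
      qed
      finally show "mat m m (\<lambda>(a, b). ent X (\<rho> a) (\<sigma> b)) $$ (a, b) = (G * (Pm * E) * H) $$ (a, b)"
        using ab by simp
    qed (simp_all add: G_def H_def)
    then have "P_minor n D \<xi> X = det (G * (Pm * E) * H)"
      using mi[OF Xc] P_minor_south_west[OF assms, of X] by simp
    also have "\<dots> = det G * (det Pm * det E) * det H"
      using det_mult[OF mult_carrier_mat[OF car(1) mult_carrier_mat[OF Pc(1) car(3)]] car(2)]
        det_mult[OF car(1) mult_carrier_mat[OF Pc(1) car(3)]] det_mult[OF Pc(1) car(3)] by simp
    finally show ?thesis unfolding dG dH dE by simp
  qed
  then show ?thesis using nz by blast
qed

lemma poly_function_P_minor:
  assumes "\<xi> \<in> D"
  shows "\<exists>f\<in>poly_functions n. \<forall>X\<in>strictly_lower n. f X = (P_minor n D \<xi> X :: 'k::field)"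
proof -
  let ?S = "south_west \<xi>"
  define m where "m = card ?S"
  obtain \<rho> \<sigma> where b\<rho>: "bij_betw \<rho> {0..<m} (fst ` ?S)" and b\<sigma>: "bij_betw \<sigma> {0..<m} (snd ` ?S)"
    and mi: "\<And>X :: 'k mat. X \<in> carrier_mat n n \<Longrightarrow>
      minor (fst ` ?S) (snd ` ?S) X = det (mat m m (\<lambda>(a, b). ent X (\<rho> a) (\<sigma> b)))"
    using minor_enumeration[OF south_west_images(1,2)[of \<xi>], where 'k = 'k] unfolding south_west_images m_def by metis
  have "\<forall>b c. \<exists>f :: 'k mat \<Rightarrow> 'k. b \<in> {1..n} \<longrightarrow> c \<in> {1..n} \<longrightarrow>
      f \<in> poly_functions n \<and> (\<forall>X\<in>strictly_lower n. f X = ent X b c)"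
    using poly_function_ent[where 'a = 'k] by blast
  then obtain e where e: "\<And>b c. b \<in> {1..n} \<Longrightarrow> c \<in> {1..n} \<Longrightarrow>
      e b c \<in> poly_functions n \<and> (\<forall>X\<in>strictly_lower n. e b c X = (ent X b c :: 'k))"
    unfolding choice_iff by blast
  have in_n: "\<rho> a \<in> {1..n}" "\<sigma> a \<in> {1..n}" if "a < m" for a
    using bij_betw_apply[OF b\<rho>, of a] bij_betw_apply[OF b\<sigma>, of a] south_west_images(1,2)[of \<xi>] that by auto
  show ?thesis
  proof (rule bexI)
    show "(\<lambda>X. det (mat m m (\<lambda>(a, b). e (\<rho> a) (\<sigma> b) X))) \<in> poly_functions n"
      using e in_n by (intro poly_functions_det) auto
    show "\<forall>X\<in>strictly_lower n. det (mat m m (\<lambda>(a, b). e (\<rho> a) (\<sigma> b) X)) = P_minor n D \<xi> X"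
    proof
      fix X :: "'k mat" assume X: "X \<in> strictly_lower n"
      have "mat m m (\<lambda>(a, b). e (\<rho> a) (\<sigma> b) X) = mat m m (\<lambda>(a, b). ent X (\<rho> a) (\<sigma> b))"
        using e in_n X by (intro cong_mat) auto
      then show "det (mat m m (\<lambda>(a, b). e (\<rho> a) (\<sigma> b) X)) = P_minor n D \<xi> X"
        using mi[OF strictly_lower_carrier[OF X]] P_minor_south_west[OF assms, of X] by simp
    qed
  qed
qed

end

section \<open>Algebraic independence\<close>

lemma digits_unique:
  fixes a b :: "nat \<Rightarrow> nat"
  assumes "(\<Sum>i<k. a i * N ^ i) = (\<Sum>i<k. b i * N ^ i)" "\<And>i. i < k \<Longrightarrow> a i < N" "\<And>i. i < k \<Longrightarrow> b i < N" "i < k"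
  shows "a i = b i"
  using assms
proof (induction k arbitrary: a b i)
  case (Suc k)
  have split: "(\<Sum>i<Suc k. c i * N ^ i) = c 0 + N * (\<Sum>i<k. c (Suc i) * N ^ i)" for c :: "nat \<Rightarrow> nat"
    by (subst sum.lessThan_Suc_shift) (simp add: sum_distrib_left algebra_simps)
  have lt: "a 0 < N" "b 0 < N" using Suc.prems by auto
  have eq: "a 0 + N * (\<Sum>i<k. a (Suc i) * N ^ i) = b 0 + N * (\<Sum>i<k. b (Suc i) * N ^ i)"
    using Suc.prems(1) unfolding split .
  have "(a 0 + N * (\<Sum>i<k. a (Suc i) * N ^ i)) mod N = (b 0 + N * (\<Sum>i<k. b (Suc i) * N ^ i)) mod N" using eq by simp
  then have 0: "a 0 = b 0" using lt by simp
  then have "(\<Sum>i<k. a (Suc i) * N ^ i) = (\<Sum>i<k. b (Suc i) * N ^ i)" using eq lt by simp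
  then have "a (Suc l) = b (Suc l)" if "l < k" for l
    using Suc.IH[of "\<lambda>i. a (Suc i)" "\<lambda>i. b (Suc i)" l] Suc.prems(2,3) that by simp
  then show ?case using 0 Suc.prems(4) by (cases i) auto
qed simp

text \<open>Kronecker substitution: for \<open>N\<close> exceeding all exponents, replacing the variable number \<open>l\<close> by \<open>\<tau> ^ (N ^ l)\<close> sends
different monomials to different powers of \<open>\<tau>\<close>, and leaves a polynomial in \<open>\<tau>\<close> that vanishes at all \<open>\<tau> \<noteq> 0\<close>.\<close>

lemma mpoly_zero_on_torus:
  fixes p :: "('i \<Rightarrow>\<^sub>0 nat) \<Rightarrow>\<^sub>0 'k::field_char_0"
  assumes S: "finite S" and keys: "\<And>m. m \<in> Poly_Mapping.keys p \<Longrightarrow> Poly_Mapping.keys m \<subseteq> S"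
    and zero: "\<And>y. (\<And>s. s \<in> S \<Longrightarrow> y s \<noteq> 0) \<Longrightarrow>
      (\<Sum>m\<in>Poly_Mapping.keys p. Poly_Mapping.lookup p m * (\<Prod>v\<in>Poly_Mapping.keys m. y v ^ Poly_Mapping.lookup m v)) = 0"
  shows "p = 0"
proof (rule ccontr)
  assume "p \<noteq> 0"
  then obtain m0 where m0: "m0 \<in> Poly_Mapping.keys p" by (metis keys_eq_empty all_not_in_conv)
  let ?K = "Poly_Mapping.keys p"
  obtain e where e: "bij_betw e {0..<card S} S" using ex_bij_betw_nat_finite[OF S] by blast
  define N where "N = Suc (\<Sum>m\<in>?K. \<Sum>v\<in>S. Poly_Mapping.lookup m v)"
  have N: "Poly_Mapping.lookup m v < N" if "m \<in> ?K" "v \<in> S" for m v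
  proof -
    have "Poly_Mapping.lookup m v \<le> (\<Sum>v\<in>S. Poly_Mapping.lookup m v)" using S that by (intro member_le_sum) auto
    also have "\<dots> \<le> (\<Sum>m\<in>?K. \<Sum>v\<in>S. Poly_Mapping.lookup m v)"
      using that by (intro member_le_sum[where f = "\<lambda>m. \<Sum>v\<in>S. Poly_Mapping.lookup m v"]) auto
    finally show ?thesis unfolding N_def by simp
  qed
  define w where "w = (\<lambda>m :: 'i \<Rightarrow>\<^sub>0 nat. \<Sum>i<card S. Poly_Mapping.lookup m (e i) * N ^ i)"
  have w_inj: "m = m'" if m: "m \<in> ?K" "m' \<in> ?K" and eq: "w m = w m'" for m m'
  proof (rule poly_mapping_eqI)
    fix v
    show "Poly_Mapping.lookup m v = Poly_Mapping.lookup m' v"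
    proof (cases "v \<in> S")
      case True
      then have "v \<in> e ` {0..<card S}" using e by (simp add: bij_betw_def)
      then obtain i where i: "i < card S" "v = e i" by auto
      have eS: "e i \<in> S" if "i < card S" for i using bij_betw_apply[OF e] that by auto
      show ?thesis unfolding i(2) by (rule digits_unique[OF eq[unfolded w_def] _ _ i(1)]) (use N m eS in auto)
    next
      case False
      then have "v \<notin> Poly_Mapping.keys m" "v \<notin> Poly_Mapping.keys m'" using keys m by auto
      then show ?thesis by (simp add: in_keys_iff)
    qed
  qed
  define i where "i = the_inv_into {0..<card S} e"
  have ie: "i (e l) = l" if "l < card S" for l
    using e that unfolding i_def bij_betw_def by (intro the_inv_into_f_f) auto
  define Q where "Q = (\<Sum>m\<in>?K. monom (Poly_Mapping.lookup p m) (w m))"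
  have "poly Q \<tau> = 0" if \<tau>: "\<tau> \<noteq> 0" for \<tau>
  proof -
    define y where "y = (\<lambda>s. \<tau> ^ (N ^ i s))"
    have "(\<Prod>v\<in>Poly_Mapping.keys m. y v ^ Poly_Mapping.lookup m v) = \<tau> ^ w m" if m: "m \<in> ?K" for m
    proof -
      have "(\<Prod>v\<in>Poly_Mapping.keys m. y v ^ Poly_Mapping.lookup m v) = (\<Prod>v\<in>S. y v ^ Poly_Mapping.lookup m v)"
        using S keys[OF m] by (intro prod.mono_neutral_left) (auto simp: in_keys_iff)
      also have "\<dots> = (\<Prod>l\<in>{0..<card S}. y (e l) ^ Poly_Mapping.lookup m (e l))"
        by (rule prod.reindex_bij_betw[OF e, symmetric])
      also have "\<dots> = (\<Prod>l<card S. \<tau> ^ (Poly_Mapping.lookup m (e l) * N ^ l))"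
        unfolding atLeast0LessThan by (intro prod.cong) (auto simp: y_def ie power_mult[symmetric] mult.commute)
      also have "\<dots> = \<tau> ^ w m" unfolding w_def by (rule power_sum[symmetric])
      finally show ?thesis .
    qed
    then have "poly Q \<tau> = (\<Sum>m\<in>?K. Poly_Mapping.lookup p m * (\<Prod>v\<in>Poly_Mapping.keys m. y v ^ Poly_Mapping.lookup m v))"
      unfolding Q_def by (simp add: poly_sum poly_monom)
    then show ?thesis using zero[of y] \<tau> unfolding y_def by simp
  qed
  then have "UNIV - {0} \<subseteq> {\<tau>. poly Q \<tau> = 0}" by blast
  moreover have "infinite (UNIV - {0 :: 'k})" using infinite_UNIV_char_0 by simp
  ultimately have "Q = 0" using poly_roots_finite[of Q] finite_subset by blast
  then have "0 = coeff Q (w m0)" by simp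
  also have "\<dots> = (\<Sum>m\<in>?K. if m = m0 then Poly_Mapping.lookup p m0 else 0)"
    unfolding Q_def coeff_sum using w_inj m0 by (intro sum.cong refl) (auto simp: coeff_monom)
  also have "\<dots> = Poly_Mapping.lookup p m0" using m0 by simp
  finally show False using m0 by (simp add: in_keys_iff)
qed

context invariant_variety begin

abbreviation "\<iota> \<equiv> ratfun_const n V"
abbreviation "E \<equiv> invariant_field n V"

lemma rep_finsum: "finite A \<Longrightarrow> (\<And>i. i \<in> A \<Longrightarrow> rep Q (G i) (\<phi> i)) \<Longrightarrow>
    rep Q (\<Oplus>\<^bsub>L\<^esub>i\<in>A. G i) (\<lambda>X. \<Sum>i\<in>A. \<phi> i X)"
proof (induction A rule: finite_induct)
  case empty then show ?case using rep_zero by simp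
next
  case (insert i A)
  have "G \<in> A \<rightarrow> carrier L" "G i \<in> carrier L" using insert.prems rep_carrier by auto
  then show ?case using insert rep_add by (simp add: L.finsum_insert)
qed

lemma rep_finprod: "finite A \<Longrightarrow> (\<And>i. i \<in> A \<Longrightarrow> rep Q (G i) (\<phi> i)) \<Longrightarrow>
    rep Q (\<Otimes>\<^bsub>L\<^esub>i\<in>A. G i) (\<lambda>X. \<Prod>i\<in>A. \<phi> i X)"
proof (induction A rule: finite_induct)
  case empty then show ?case using rep_one by simp
next
  case (insert i A)
  have "G \<in> A \<rightarrow> carrier L" "G i \<in> carrier L" using insert.prems rep_carrier by auto
  then show ?case using insert rep_mult by (simp add: L.finprod_insert)
qed

lemma rep_power: "rep Q A \<phi> \<Longrightarrow> rep Q (A [^]\<^bsub>L\<^esub> (k::nat)) (\<lambda>X. \<phi> X ^ k)"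
proof (induction k)
  case 0 then show ?case using rep_one by simp
next
  case (Suc k)
  then show ?case using rep_mult[OF Suc.IH[OF Suc.prems] Suc.prems] by (simp add: mult.commute)
qed

lemma rep_mpoly_eval:
  fixes p :: "('i \<Rightarrow>\<^sub>0 nat) \<Rightarrow>\<^sub>0 'k"
  assumes "\<And>m. m \<in> Poly_Mapping.keys p \<Longrightarrow> Poly_Mapping.keys m \<subseteq> S" "\<And>s. s \<in> S \<Longrightarrow> rep Q (F s) (f s)"
  shows "rep Q (mpoly_eval L \<iota> F p)
    (\<lambda>X. \<Sum>m\<in>Poly_Mapping.keys p. Poly_Mapping.lookup p m * (\<Prod>v\<in>Poly_Mapping.keys m. f v X ^ Poly_Mapping.lookup m v))"
  unfolding mpoly_eval_def
  by (intro rep_finsum rep_mult rep_const rep_finprod rep_power) (use assms in auto)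

text \<open>A relation between the functions would be a polynomial vanishing on the torus of their joint values.\<close>

lemma alg_independentI:
  fixes S :: "'i set"
  assumes S: "finite S" and Q: "Q \<subseteq> W" and r: "\<And>s. s \<in> S \<Longrightarrow> rep Q (F s) (f s)"
    and surj: "\<And>z. (\<And>s. s \<in> S \<Longrightarrow> z s \<noteq> 0) \<Longrightarrow> \<exists>X\<in>Q. \<forall>s\<in>S. f s X = z s"
  shows "alg_independent L \<iota> S F"
  unfolding alg_independent_def
proof (intro allI impI)
  fix p :: "('i \<Rightarrow>\<^sub>0 nat) \<Rightarrow>\<^sub>0 'k"
  assume keys: "\<forall>m\<in>Poly_Mapping.keys p. Poly_Mapping.keys m \<subseteq> S" and z: "mpoly_eval L \<iota> F p = \<zero>\<^bsub>L\<^esub>"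
  have keys': "Poly_Mapping.keys m \<subseteq> S" if "m \<in> Poly_Mapping.keys p" for m using keys that by blast
  show "p = 0"
  proof (rule mpoly_zero_on_torus[OF S keys'])
    fix y :: "'i \<Rightarrow> 'k" assume "\<And>s. s \<in> S \<Longrightarrow> y s \<noteq> 0"
    then obtain X where X: "X \<in> Q" "\<forall>s\<in>S. f s X = y s" using surj by blast
    have "rep Q (mpoly_eval L \<iota> F p) (\<lambda>X. \<Sum>m\<in>Poly_Mapping.keys p. Poly_Mapping.lookup p m *
        (\<Prod>v\<in>Poly_Mapping.keys m. f v X ^ Poly_Mapping.lookup m v))"
      by (rule rep_mpoly_eval[OF keys' r])
    then have "rep Q \<zero>\<^bsub>L\<^esub> (\<lambda>X. \<Sum>m\<in>Poly_Mapping.keys p. Poly_Mapping.lookup p m *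
        (\<Prod>v\<in>Poly_Mapping.keys m. f v X ^ Poly_Mapping.lookup m v))"
      unfolding z .
    from rep_value_unique[OF this rep_zero Q X(1)]
    have "(\<Sum>m\<in>Poly_Mapping.keys p. Poly_Mapping.lookup p m * (\<Prod>v\<in>Poly_Mapping.keys m. f v X ^ Poly_Mapping.lookup m v)) = 0" .
    moreover have "(\<Prod>v\<in>Poly_Mapping.keys m. f v X ^ Poly_Mapping.lookup m v) = (\<Prod>v\<in>Poly_Mapping.keys m. y v ^ Poly_Mapping.lookup m v)"
      if "m \<in> Poly_Mapping.keys p" for m
      using keys'[OF that] X(2) by (intro prod.cong refl) auto
    ultimately show "(\<Sum>m\<in>Poly_Mapping.keys p. Poly_Mapping.lookup p m * (\<Prod>v\<in>Poly_Mapping.keys m. y v ^ Poly_Mapping.lookup m v)) = 0"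
      by simp
  qed
qed

definition gen :: "root \<Rightarrow> 'k ratfun" where
  "gen \<xi> = (if \<xi> \<in> D then ratfun_of n V (P_minor n D \<xi>) else pivot_ratfun \<xi>)"

definition gen_value :: "root \<Rightarrow> 'k mat \<Rightarrow> 'k" where
  "gen_value \<xi> X = (if \<xi> \<in> D then P_minor n D \<xi> X else pivot_value \<xi> X)"

lemma DC: "D \<subseteq> C" by (rule D_subset_C[OF n1])

lemma finite_C: "finite C"
  by (rule finite_subset[of _ "{..n} \<times> {..n}"]) (auto dest: C_bounds)

lemma U_subset: "U \<subseteq> W" by (rule large_subset[OF large_U])

lemma rep_gen: assumes "\<xi> \<in> C" shows "rep U (gen \<xi>) (gen_value \<xi>)"
proof (cases "\<xi> \<in> D")
  case False
  have "gen \<xi> = pivot_ratfun \<xi>" "gen_value \<xi> = pivot_value \<xi>" using False by (auto simp: gen_def gen_value_def fun_eq_iff)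
  then show ?thesis using rep_pivot_ratfun[OF assms] by simp
next
  case True
  obtain f where f: "f \<in> P" "\<forall>X\<in>strictly_lower n. f X = P_minor n D \<xi> X" using poly_function_P_minor[OF True] by blast
  have "restrict (P_minor n D \<xi>) V = restrict f V" using f(2) V_strict by (auto simp: restrict_def fun_eq_iff)
  then have "gen \<xi> = ratfun_of n V f" using True by (simp add: gen_def ratfun_of_def)
  moreover have "rep U (ratfun_of n V f) (gen_value \<xi>)"
  proof (rule rep_cong[OF rep_poly[OF f(1)]])
    fix X assume "X \<in> U"
    then have "X \<in> strictly_lower n" using U_subset basic_cell_strict by blast
    then show "f X = gen_value \<xi> X" using f(2) True by (simp add: gen_value_def)
  qed
  ultimately show ?thesis by simp
qed

lemma pivot_D:
  assumes "X \<in> U" "X \<in> basic_variety n D \<phi>" "\<eta> \<in> D" shows "pivot_value \<eta> X = \<phi> \<eta>"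
proof -
  obtain k j where \<eta>: "\<eta> = (k, j)" by (cases \<eta>)
  have "j \<le> Suc n" using D_bounds[of k j] assms(3) \<eta> by auto
  then have "pivots_nonzero j (ent X)" using assms(1) pivots_nonzero_mono unfolding pivotal_def by blast
  then show ?thesis using cell_elim_D[OF assms(2), of j k] assms(3) unfolding \<eta> pivot_value_def by simp
qed

lemma south_west_subset: "south_west \<xi> \<subseteq> D" unfolding south_west_def by blast

lemma south_west_self: "\<xi> \<in> D \<Longrightarrow> \<xi> \<in> south_west \<xi>" unfolding south_west_def by simp

lemma south_west_less: "\<xi> \<in> D \<Longrightarrow> \<eta> \<in> south_west \<xi> - {\<xi>} \<Longrightarrow> snd \<eta> < snd \<xi>"
  using D_col_unique[of "fst \<xi>" "snd \<xi>" "fst \<eta>"] unfolding south_west_def by (cases \<xi>; cases \<eta>) (auto simp: le_less)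

lemma minor_pivots:
  obtains \<kappa> :: "root \<Rightarrow> 'k" where "\<And>\<xi>. \<xi> \<in> D \<Longrightarrow> \<kappa> \<xi> \<noteq> 0"
    "\<And>\<xi> X. \<xi> \<in> D \<Longrightarrow> X \<in> U \<Longrightarrow> P_minor n D \<xi> X = \<kappa> \<xi> * (\<Prod>\<eta>\<in>south_west \<xi>. pivot_value \<eta> X)"
proof -
  have "\<forall>\<xi>\<in>D. \<exists>\<kappa>. \<kappa> \<noteq> 0 \<and> (\<forall>\<phi>. \<forall>X\<in>basic_variety n D \<phi>. P_minor n D \<xi> X = \<kappa> * (\<Prod>\<eta>\<in>south_west \<xi>. \<phi> \<eta> :: 'k))"
    using P_minor_value[where 'k = 'k] by blast
  then obtain \<kappa> :: "root \<Rightarrow> 'k" where \<kappa>: "\<forall>\<xi>\<in>D. \<kappa> \<xi> \<noteq> 0 \<and> (\<forall>\<phi>. \<forall>X\<in>basic_variety n D \<phi>.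
      P_minor n D \<xi> X = \<kappa> \<xi> * (\<Prod>\<eta>\<in>south_west \<xi>. \<phi> \<eta>))"
    unfolding bchoice_iff by blast
  have "P_minor n D \<xi> X = \<kappa> \<xi> * (\<Prod>\<eta>\<in>south_west \<xi>. pivot_value \<eta> X)" if \<xi>: "\<xi> \<in> D" and X: "X \<in> U" for \<xi> X
  proof -
    obtain \<phi> where \<phi>: "X \<in> basic_variety n D \<phi>" using W_variety X U_subset by blast
    have "(\<Prod>\<eta>\<in>south_west \<xi>. pivot_value \<eta> X) = (\<Prod>\<eta>\<in>south_west \<xi>. \<phi> \<eta>)"
      using pivot_D[OF X \<phi>] south_west_subset by (intro prod.cong refl) blast
    then show ?thesis using \<kappa> \<xi> \<phi> by simp
  qed
  then show ?thesis using that \<kappa> by blast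
qed

text \<open>The values at \<open>D\<close> depend on the pivots by a monomial substitution that is triangular with respect to the columns, and can be
solved column by column.\<close>

lemma gen_values_surjective:
  assumes z: "\<And>\<xi>. \<xi> \<in> C \<Longrightarrow> z \<xi> \<noteq> 0" shows "\<exists>X\<in>U. \<forall>\<xi>\<in>C. gen_value \<xi> X = z \<xi>"
proof -
  obtain \<kappa> :: "root \<Rightarrow> 'k" where \<kappa>: "\<And>\<xi>. \<xi> \<in> D \<Longrightarrow> \<kappa> \<xi> \<noteq> 0"
    "\<And>\<xi> X. \<xi> \<in> D \<Longrightarrow> X \<in> U \<Longrightarrow> P_minor n D \<xi> X = \<kappa> \<xi> * (\<Prod>\<eta>\<in>south_west \<xi>. pivot_value \<eta> X)"
    using minor_pivots by metis
  have "\<exists>y. (\<forall>\<xi>\<in>C. y \<xi> \<noteq> 0) \<and> (\<forall>\<xi>\<in>C - D. y \<xi> = z \<xi>) \<and>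
      (\<forall>\<xi>\<in>D. snd \<xi> < j \<longrightarrow> \<kappa> \<xi> * (\<Prod>\<eta>\<in>south_west \<xi>. y \<eta>) = z \<xi>)" for j
  proof (induction j)
    case 0 then show ?case using z by (intro exI[of _ z]) auto
  next
    case (Suc j)
    then obtain y where y: "\<forall>\<xi>\<in>C. y \<xi> \<noteq> 0" "\<forall>\<xi>\<in>C - D. y \<xi> = z \<xi>"
      "\<forall>\<xi>\<in>D. snd \<xi> < j \<longrightarrow> \<kappa> \<xi> * (\<Prod>\<eta>\<in>south_west \<xi>. y \<eta>) = z \<xi>" by blast
    define y' where "y' = (\<lambda>\<xi>. if \<xi> \<in> D \<and> snd \<xi> = j then z \<xi> / (\<kappa> \<xi> * (\<Prod>\<eta>\<in>south_west \<xi> - {\<xi>}. y \<eta>)) else y \<xi>)"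
    have prod0: "(\<Prod>\<eta>\<in>south_west \<xi> - {\<xi>}. y \<eta>) \<noteq> 0" for \<xi>
      using y(1) DC south_west_subset[of \<xi>] finite_south_west[of \<xi>] by (subst prod_zero_iff) auto
    have same: "(\<Prod>\<eta>\<in>south_west \<xi> - {\<xi>}. y' \<eta>) = (\<Prod>\<eta>\<in>south_west \<xi> - {\<xi>}. y \<eta>)" if "\<xi> \<in> D" "snd \<xi> \<le> j" for \<xi>
      using south_west_less[OF that(1)] that(2) by (intro prod.cong refl) (fastforce simp: y'_def)
    have split: "(\<Prod>\<eta>\<in>south_west \<xi>. x \<eta>) = x \<xi> * (\<Prod>\<eta>\<in>south_west \<xi> - {\<xi>}. x \<eta>)" if "\<xi> \<in> D" for \<xi> and x :: "root \<Rightarrow> 'k"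
      by (rule prod.remove[OF finite_south_west south_west_self[OF that]])
    have "\<kappa> \<xi> * (\<Prod>\<eta>\<in>south_west \<xi>. y' \<eta>) = z \<xi>" if \<xi>: "\<xi> \<in> D" "snd \<xi> < Suc j" for \<xi>
    proof (cases "snd \<xi> = j")
      case True
      then show ?thesis unfolding split[OF \<xi>(1)] using same[OF \<xi>(1)] prod0[of \<xi>] \<kappa>(1)[OF \<xi>(1)] \<xi> by (simp add: y'_def)
    next
      case False
      then have "y' \<xi> = y \<xi>" by (simp add: y'_def)
      then have "(\<Prod>\<eta>\<in>south_west \<xi>. y' \<eta>) = (\<Prod>\<eta>\<in>south_west \<xi>. y \<eta>)" unfolding split[OF \<xi>(1)] using same[OF \<xi>(1)] \<xi>(2) by simp
      then show ?thesis using y(3) \<xi> False by auto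
    qed
    moreover have "\<forall>\<xi>\<in>C. y' \<xi> \<noteq> 0" using y(1) z prod0 \<kappa>(1) unfolding y'_def by auto
    moreover have "\<forall>\<xi>\<in>C - D. y' \<xi> = z \<xi>" using y(2) unfolding y'_def by auto
    ultimately show ?case by blast
  qed
  from this[of "Suc n"] obtain y where y: "\<forall>\<xi>\<in>C. y \<xi> \<noteq> 0" "\<forall>\<xi>\<in>C - D. y \<xi> = z \<xi>"
    "\<forall>\<xi>\<in>D. snd \<xi> < Suc n \<longrightarrow> \<kappa> \<xi> * (\<Prod>\<eta>\<in>south_west \<xi>. y \<eta>) = z \<xi>" by blast
  define X where "X = matrix_of (solve y)"
  have X: "X \<in> U" "\<And>\<xi>. \<xi> \<in> C \<Longrightarrow> pivot_value \<xi> X = y \<xi>" unfolding X_def using solve_pivotal[of y] y(1) by auto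
  have "gen_value \<xi> X = z \<xi>" if "\<xi> \<in> C" for \<xi>
  proof (cases "\<xi> \<in> D")
    case True
    have "(\<Prod>\<eta>\<in>south_west \<xi>. pivot_value \<eta> X) = (\<Prod>\<eta>\<in>south_west \<xi>. y \<eta>)"
      using X(2) DC south_west_subset by (intro prod.cong refl) blast
    then show ?thesis using y(3) \<kappa>(2)[OF True X(1)] True C_bounds[of "fst \<xi>" "snd \<xi>"] that by (simp add: gen_value_def)
  next
    case False
    then show ?thesis using y(2) X(2) that by (simp add: gen_value_def)
  qed
  then show ?thesis using X(1) by blast
qed

lemma gen_value_act: "g \<in> UT n \<Longrightarrow> X \<in> U \<Longrightarrow> \<xi> \<in> C \<Longrightarrow> gen_value \<xi> (coadjoint_act g X) = gen_value \<xi> X"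
proof -
  assume g: "g \<in> UT n" and X: "X \<in> U" and \<xi>: "\<xi> \<in> C"
  obtain \<kappa> :: "root \<Rightarrow> 'k" where \<kappa>: "\<And>\<xi>. \<xi> \<in> D \<Longrightarrow> \<kappa> \<xi> \<noteq> 0"
    "\<And>\<xi> X. \<xi> \<in> D \<Longrightarrow> X \<in> U \<Longrightarrow> P_minor n D \<xi> X = \<kappa> \<xi> * (\<Prod>\<eta>\<in>south_west \<xi>. pivot_value \<eta> X)"
    using minor_pivots by metis
  have "(\<Prod>\<eta>\<in>south_west \<xi>. pivot_value \<eta> (coadjoint_act g X)) = (\<Prod>\<eta>\<in>south_west \<xi>. pivot_value \<eta> X)"
    using pivot_act(2)[OF X g] DC south_west_subset by (intro prod.cong refl) blast
  then show ?thesis using \<kappa>(2)[OF _ X] \<kappa>(2)[OF _ pivot_act(1)[OF X g]] pivot_act(2)[OF X g \<xi>] by (simp add: gen_value_def)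
qed

lemma gen_invariant: "\<xi> \<in> C \<Longrightarrow> gen \<xi> \<in> E"
  using rep_invariant_iff[OF rep_gen large_U] gen_value_act by blast

lemma range_const: "range \<iota> \<subseteq> E" using const_invariant by blast

text \<open>A pivot at \<open>\<xi> \<in> D\<close> is recovered from the minor by dividing by the pivots in earlier columns.\<close>

lemma generated: "generate_field L (range \<iota> \<union> gen ` C) = E"
proof
  have sub: "range \<iota> \<union> gen ` C \<subseteq> E" using range_const gen_invariant by blast
  then have car: "range \<iota> \<union> gen ` C \<subseteq> carrier L" using invariant_carrier by blast
  show "generate_field L (range \<iota> \<union> gen ` C) \<subseteq> E"
    by (rule L.generate_field_min_subfield1[OF car subfield_invariant sub])
  define K where "K = generate_field L (range \<iota> \<union> gen ` C)"
  have K: "subfield K L" unfolding K_def by (rule L.generate_field_is_subfield[OF car])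
  have cK: "range \<iota> \<subseteq> K" and gK: "\<And>\<xi>. \<xi> \<in> C \<Longrightarrow> gen \<xi> \<in> K" 
  proof -
    have "range \<iota> \<union> gen ` C \<subseteq> K" unfolding K_def by (rule subsetI) (rule generate_field.incl)
    then show "range \<iota> \<subseteq> K" "\<And>\<xi>. \<xi> \<in> C \<Longrightarrow> gen \<xi> \<in> K" by auto
  qed
  interpret F: rational_class "\<lambda>\<phi>. \<exists>A\<in>K. rep U A \<phi>" U by (rule rational_class_rep[OF large_U K cK])
  obtain \<kappa> :: "root \<Rightarrow> 'k" where \<kappa>: "\<And>\<xi>. \<xi> \<in> D \<Longrightarrow> \<kappa> \<xi> \<noteq> 0"
    "\<And>\<xi> X. \<xi> \<in> D \<Longrightarrow> X \<in> U \<Longrightarrow> P_minor n D \<xi> X = \<kappa> \<xi> * (\<Prod>\<eta>\<in>south_west \<xi>. pivot_value \<eta> X)"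
    using minor_pivots by metis
  have "pivot_ratfun \<xi> \<in> K" if "\<xi> \<in> C" for \<xi>
    using that
  proof (induction "snd \<xi>" arbitrary: \<xi> rule: less_induct)
    case less
    show ?case
    proof (cases "\<xi> \<in> D")
      case False
      then show ?thesis using gK[OF less.prems] by (simp add: gen_def)
    next
      case True
      have q0: "(\<Prod>\<eta>\<in>south_west \<xi> - {\<xi>}. pivot_value \<eta> X) \<noteq> 0" if "X \<in> U" for X
        using pivot_nonzero[OF that] DC south_west_subset[of \<xi>] finite_south_west[of \<xi>] by (subst prod_zero_iff) auto
      have num: "\<exists>A\<in>K. rep U A (gen_value \<xi>)" using rep_gen[OF less.prems] gK[OF less.prems] by blast
      have den: "\<exists>A\<in>K. rep U A (\<lambda>X. \<kappa> \<xi> * (\<Prod>\<eta>\<in>south_west \<xi> - {\<xi>}. pivot_value \<eta> X))"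
      proof (intro F.mult F.const F.prod)
        fix \<eta> assume \<eta>: "\<eta> \<in> south_west \<xi> - {\<xi>}"
        then have "\<eta> \<in> C" using south_west_subset DC by blast
        then show "\<exists>A\<in>K. rep U A (pivot_value \<eta>)" using less.hyps[OF south_west_less[OF True \<eta>]] rep_pivot_ratfun by blast
      qed
      have "\<exists>A\<in>K. rep U A (\<lambda>X. gen_value \<xi> X / (\<kappa> \<xi> * (\<Prod>\<eta>\<in>south_west \<xi> - {\<xi>}. pivot_value \<eta> X)))"
        by (rule F.divide[OF num den]) (use q0 \<kappa>(1)[OF True] in simp)
      then obtain A where A: "A \<in> K" "rep U A (\<lambda>X. gen_value \<xi> X / (\<kappa> \<xi> * (\<Prod>\<eta>\<in>south_west \<xi> - {\<xi>}. pivot_value \<eta> X)))" by blast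
      have "pivot_ratfun \<xi> = A"
      proof (rule rep_unique[OF rep_pivot_ratfun[OF less.prems] A(2) large_U])
        fix X assume X: "X \<in> U"
        show "pivot_value \<xi> X = gen_value \<xi> X / (\<kappa> \<xi> * (\<Prod>\<eta>\<in>south_west \<xi> - {\<xi>}. pivot_value \<eta> X))"
          using \<kappa>(2)[OF True X] \<kappa>(1)[OF True] q0[OF X] True
            prod.remove[OF finite_south_west[of \<xi>] south_west_self[OF True], of "\<lambda>\<eta>. pivot_value \<eta> X"]
          by (simp add: gen_value_def)
      qed
      then show ?thesis using A(1) by simp
    qed
  qed
  then show "E \<subseteq> generate_field L (range \<iota> \<union> gen ` C)"
    unfolding K_def[symmetric] using invariants_in_subfield[OF K cK] by blast
qed

lemma inj_gen: "inj_on gen C"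
proof (rule inj_onI, rule ccontr)
  fix \<xi> \<eta> assume \<xi>: "\<xi> \<in> C" "\<eta> \<in> C" and eq: "gen \<xi> = gen \<eta>" and ne: "\<xi> \<noteq> \<eta>"
  have "\<exists>X\<in>U. \<forall>\<zeta>\<in>C. gen_value \<zeta> X = (if \<zeta> = \<xi> then 1 else 2)"
    by (rule gen_values_surjective) simp
  then obtain X where X: "X \<in> U" "\<forall>\<zeta>\<in>C. gen_value \<zeta> X = (if \<zeta> = \<xi> then 1 else 2)" by blast
  have "gen_value \<xi> X = gen_value \<eta> X"
    using rep_value_unique[OF rep_gen[OF \<xi>(1)] _ U_subset X(1)] rep_gen[OF \<xi>(2)] eq by simp
  then show False using X(2) \<xi> ne by simp
qed

theorem generators_independent: "independent_generators L \<iota> E C gen"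
  unfolding independent_generators_def
  using gen_invariant generated alg_independentI[OF finite_C U_subset rep_gen gen_values_surjective] by blast

theorem invariants_purely_transcendental: "purely_transcendental L \<iota> E (card C)"
proof -
  define h where "h = the_inv_into C gen"
  have h: "h (gen \<xi>) = \<xi>" if "\<xi> \<in> C" for \<xi> unfolding h_def by (rule the_inv_into_f_f[OF inj_gen that])
  have "alg_independent L \<iota> (gen ` C) (\<lambda>b. b)"
  proof (rule alg_independentI[OF finite_imageI[OF finite_C] U_subset])
    show "rep U b (gen_value (h b))" if "b \<in> gen ` C" for b using that rep_gen h by auto
    fix z :: "'k ratfun \<Rightarrow> 'k" assume "\<And>b. b \<in> gen ` C \<Longrightarrow> z b \<noteq> 0"
    then obtain X where "X \<in> U" "\<forall>\<xi>\<in>C. gen_value \<xi> X = z (gen \<xi>)"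
      using gen_values_surjective[of "\<lambda>\<xi>. z (gen \<xi>)"] by auto
    then show "\<exists>X\<in>U. \<forall>b\<in>gen ` C. gen_value (h b) X = z b" using h by auto
  qed
  then have "independent_generators L \<iota> E (gen ` C) (\<lambda>b. b)"
    unfolding independent_generators_def using generated gen_invariant by auto
  then show ?thesis unfolding purely_transcendental_def
    using subfield_invariant range_const finite_C card_image[OF inj_gen] by blast
qed

end

lemma invariant_variety_cell:
  assumes "n \<ge> 1" "basic n D"
  shows "invariant_variety n D (basic_cell n D :: 'k::field_char_0 mat set)"
proof -
  interpret basic_roots n D by standard (rule assms(2))
  show ?thesis by standard (use assms basic_cell_strict basic_cell_invariant in blast)+
qed

lemma invariant_variety_cone:
  assumes "n \<ge> 1" "basic n D"
  shows "invariant_variety n D (basic_cone n D :: 'k::field_char_0 mat set)"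
proof -
  interpret basic_roots n D by standard (rule assms(2))
  show ?thesis
  proof
    show "1 \<le> n" by (rule assms(1))
    show "basic_cell n D \<subseteq> basic_cone n D"
      unfolding basic_cone_def zariski_closure_def using basic_cell_strict by blast
    show strict: "basic_cone n D \<subseteq> strictly_lower n" unfolding basic_cone_def zariski_closure_def by blast
    show clos: "f X = 0" if "f \<in> poly_functions n" "\<And>Y. Y \<in> basic_cell n D \<Longrightarrow> f Y = 0" "X \<in> basic_cone n D" for f and X :: "'k mat"
      using that unfolding basic_cone_def zariski_closure_def by blast
    fix g X :: "'k mat" assume g: "g \<in> UT n" and X: "X \<in> basic_cone n D"
    have Xs: "X \<in> strictly_lower n" using strict X by blast
    have "f (coadjoint_act g X) = 0" if f: "f \<in> poly_functions n" "\<forall>Y\<in>basic_cell n D. f Y = 0" for f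
    proof -
      obtain f' where f': "f' \<in> poly_functions n" "\<forall>X\<in>strictly_lower n. f' X = f (coadjoint_act g X)"
        using poly_functions_pullback[OF f(1) g] by blast
      have "f' Y = 0" if "Y \<in> basic_cell n D" for Y
        using f'(2) f(2) basic_cell_strict[OF that] basic_cell_invariant[OF g that] by simp
      then have "f' X = 0" by (rule clos[OF f'(1) _ X])
      then show ?thesis using f'(2) Xs by simp
    qed
    moreover have "coadjoint_act g X \<in> strictly_lower n" by (rule coadjoint_act_strict[OF g strictly_lower_carrier[OF Xs]])
    ultimately show "coadjoint_act g X \<in> basic_cone n D" unfolding basic_cone_def zariski_closure_def by blast
  qed
qed

theorem theorem1p10:
  fixes n :: nat and D :: "root set" and V :: "'k::field_char_0 mat set"
  assumes "n \<ge> 1"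
    and "basic n D"
    and "V = basic_cell n D \<or> V = basic_cone n D"
  defines "L \<equiv> rational_functions n V"
    and "E \<equiv> invariant_field n V"
    and "\<iota> \<equiv> ratfun_const n V"
  shows "field L \<and>
    purely_transcendental L \<iota> E (card (C_set n D)) \<and>
    D \<subseteq> C_set n D \<and>
    (\<exists>F. independent_generators L \<iota> E (C_set n D) F \<and>
         (\<forall>\<xi>\<in>D. F \<xi> = ratfun_of n V (P_minor n D \<xi>)))"
proof -
  have "invariant_variety n D V"
    using assms(3) invariant_variety_cell[OF assms(1,2)] invariant_variety_cone[OF assms(1,2)] by blast
  then interpret invariant_variety n D V .
  have "\<forall>\<xi>\<in>D. gen \<xi> = ratfun_of n V (P_minor n D \<xi>)" by (simp add: gen_def)
  then show ?thesis unfolding L_def E_def \<iota>_def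
    using field_L invariants_purely_transcendental DC generators_independent by blast
qed

end
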